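(* Let $D$ be a connected locally-finite triangle-free digraph with more than one end. If $D$ is connected-homogeneous then: (i) $D$ is highly arc-transitive; (ii) the reachability relation $\mathcal{A}$ on $ED$ is not universal, and hence $\Delta(D)$ is bipartite; (iii) in particular $\Delta(D)$ (viewed as an undirected bipartite graph) is isomorphic to one of: a cycle $C_m$ with $m$ even, a complete bipartite graph $K_{m,n}$ ($m,n\in\mathbb{N}$), the complement of a perfect matching $CP_n$ ($n\in\mathbb{N}$), or an infinite semiregular tree $T_{a,b}$ ($a,b\in\mathbb{N}$); (iv) conversely, for every bipartite graph $B$ listed in (iii), the digraph $DL(B)$ is a connected triangle-free locally-finite connected-homogeneous digraph with $\Delta(DL(B))$ isomorphic to $B$. In addition, if $D$ has more than two ends then (v) for every vertex $u\in VD$ the subdigraphs induced by $\mathrm{desc}(u)$ and by $\mathrm{anc}(u)$ are trees.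
   Context: A digraph is a set $VD$ with an irreflexive antisymmetric binary relation $ED$ (arcs); write $x\to y$ for $(x,y)\in ED$. $D^+(v)=\{w:v\to w\}$, $D^-(v)=\{w:w\to v\}$; $D$ is locally-finite if all these are finite. Connectivity, ends, "triangle-free" (no three mutually adjacent vertices) and "tree" refer to the underlying undirected graph. The ends of a connected locally-finite graph are equivalence classes of rays (one-way infinite paths), two rays being equivalent if some third ray meets each of them infinitely often. A digraph is connected-homogeneous if every isomorphism between finite connected induced subdigraphs extends to an automorphism. A $k$-arc is a sequence $(x_0,\dots,x_k)$ with $x_i\to x_{i+1}$; $D$ is highly arc-transitive if for every $k$ its automorphism group is transitive on $k$-arcs. An alternating walk is a sequence $(x_1,\dots,x_n)$ whose consecutive arcs alternate in direction; arcs $e,e'$ are related by $\mathcal{A}$ if some alternating walk has first arc $e$ and last arc $e'$; $\mathcal{A}$ is an equivalence relation on $ED$. For arc-transitive $D$, $\Delta(D)$ denotes the (common up to isomorphism) subdigraph induced by an $\mathcal{A}$-class; it is called bipartite if its vertex set splits into $X\cup Y$ with all arcs from $X$ to $Y$. $CP_n$ is the bipartite graph with parts $X,Y$ of size $n$, a bijection $\eta:X\to Y$, and $x\sim y$ iff $y\ne\eta(x)$. $T_{a,b}$ is the infinite tree in which vertices of one part of the bipartition have degree $a$ and those of the other have degree $b$. $\mathrm{desc}(u)$ is the set of vertices reachable from $u$ by a directed path; $\mathrm{anc}(u)$ the set of vertices from which $u$ is reachable by a directed path. Construction $DL(\Delta)$: for an edge-transitive connected bipartite graph $\Delta$ with bipartition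 $X\cup Y$, let $T$ be a directed tree with every in-degree $|X|$ and every out-degree $|Y|$; for each $t\in VT$ fix bijections $\varphi_t:T^-(t)\to X$, $\psi_t:T^+(t)\to Y$; $DL(\Delta)$ has vertex set $ET$ and an arc $(a,b)\to(c,d)$ iff $b=c$ and $\{\psi_b(a),\varphi_b(d)\}$ is an edge of $\Delta$ (up to isomorphism independent of choices). Here the bipartition of $B$ in (iv) is the natural one.
   Formalization: In (iv), B is assumed connected, which excludes CP_1 and CP_2, for which DL(B) is undefined or disconnected; and the arc rule of DL is read as {φ_b(a), ψ_b(d)} being an edge, since ψ_b(a) and φ_b(d) are undefined as printed. *)

theory Defs
  imports Main
begin

section \<open>Digraphs\<close>

text \<open>A digraph: a vertex set with an arc relation. The underlying undirected
graph has x ~ y iff there is an arc in either direction.\<close>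

record 'a dg =
  verts :: "'a set"
  arcs  :: "('a \<times> 'a) set"

definition wf_digraph :: "'a dg \<Rightarrow> bool" where
  "wf_digraph D \<longleftrightarrow> arcs D \<subseteq> verts D \<times> verts D
     \<and> (\<forall>x. (x, x) \<notin> arcs D)
     \<and> (\<forall>x y. (x, y) \<in> arcs D \<longrightarrow> (y, x) \<notin> arcs D)"

definition uadj :: "'a dg \<Rightarrow> 'a \<Rightarrow> 'a \<Rightarrow> bool" where
  "uadj D x y \<longleftrightarrow> (x, y) \<in> arcs D \<or> (y, x) \<in> arcs D"

definition out_nbrs :: "'a dg \<Rightarrow> 'a \<Rightarrow> 'a set" where
  "out_nbrs D v = {w. (v, w) \<in> arcs D}"

definition in_nbrs :: "'a dg \<Rightarrow> 'a \<Rightarrow> 'a set" where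
  "in_nbrs D v = {w. (w, v) \<in> arcs D}"

definition locally_finite :: "'a dg \<Rightarrow> bool" where
  "locally_finite D \<longleftrightarrow> (\<forall>v\<in>verts D. finite (out_nbrs D v) \<and> finite (in_nbrs D v))"

text \<open>Connectivity of the underlying undirected graph (nonempty).\<close>
definition uconnected :: "'a dg \<Rightarrow> bool" where
  "uconnected D \<longleftrightarrow> verts D \<noteq> {} \<and>
     (\<forall>x\<in>verts D. \<forall>y\<in>verts D.
        (x, y) \<in> {(u, v). u \<in> verts D \<and> v \<in> verts D \<and> uadj D u v}\<^sup>*)"

text \<open>No cycle (of length at least 3) in the underlying undirected graph.\<close>
definition uacyclic :: "'a dg \<Rightarrow> bool" where
  "uacyclic D \<longleftrightarrow> \<not> (\<exists>xs. length xs \<ge> 3 \<and> distinct xs \<and> set xs \<subseteq> verts D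
       \<and> (\<forall>i. Suc i < length xs \<longrightarrow> uadj D (xs ! i) (xs ! Suc i))
       \<and> uadj D (last xs) (hd xs))"

definition is_tree :: "'a dg \<Rightarrow> bool" where
  "is_tree D \<longleftrightarrow> uconnected D \<and> uacyclic D"

definition triangle_free :: "'a dg \<Rightarrow> bool" where
  "triangle_free D \<longleftrightarrow> \<not> (\<exists>x\<in>verts D. \<exists>y\<in>verts D. \<exists>z\<in>verts D.
       uadj D x y \<and> uadj D y z \<and> uadj D x z)"

definition induced :: "'a dg \<Rightarrow> 'a set \<Rightarrow> 'a dg" where
  "induced D S = \<lparr>verts = S, arcs = arcs D \<inter> (S \<times> S)\<rparr>"

section \<open>Isomorphisms and automorphisms\<close>

definition dg_iso :: "('a \<Rightarrow> 'b) \<Rightarrow> 'a dg \<Rightarrow> 'b dg \<Rightarrow> bool" where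
  "dg_iso f D H \<longleftrightarrow> bij_betw f (verts D) (verts H) \<and>
     (\<forall>x\<in>verts D. \<forall>y\<in>verts D. (x, y) \<in> arcs D \<longleftrightarrow> (f x, f y) \<in> arcs H)"

definition automorphism :: "('a \<Rightarrow> 'a) \<Rightarrow> 'a dg \<Rightarrow> bool" where
  "automorphism g D \<longleftrightarrow> dg_iso g D D"

text \<open>Isomorphism of the underlying undirected graphs.\<close>
definition u_isomorphic :: "'a dg \<Rightarrow> 'b dg \<Rightarrow> bool" where
  "u_isomorphic D H \<longleftrightarrow> (\<exists>f. bij_betw f (verts D) (verts H) \<and>
     (\<forall>x\<in>verts D. \<forall>y\<in>verts D. uadj D x y \<longleftrightarrow> uadj H (f x) (f y)))"

definition connected_homogeneous :: "'a dg \<Rightarrow> bool" where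
  "connected_homogeneous D \<longleftrightarrow>
     (\<forall>A B f. A \<subseteq> verts D \<and> B \<subseteq> verts D \<and> finite A \<and> finite B
        \<and> uconnected (induced D A) \<and> uconnected (induced D B)
        \<and> dg_iso f (induced D A) (induced D B)
        \<longrightarrow> (\<exists>g. automorphism g D \<and> (\<forall>x\<in>A. g x = f x)))"

text \<open>A k-arc is a list (x_0,...,x_k) with x_i -> x_(i+1).\<close>
definition is_k_arc :: "'a dg \<Rightarrow> nat \<Rightarrow> 'a list \<Rightarrow> bool" where
  "is_k_arc D k xs \<longleftrightarrow> length xs = Suc k \<and> set xs \<subseteq> verts D \<and>
     (\<forall>i<k. (xs ! i, xs ! Suc i) \<in> arcs D)"

definition highly_arc_transitive :: "'a dg \<Rightarrow> bool" where
  "highly_arc_transitive D \<longleftrightarrow>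
     (\<forall>k xs ys. is_k_arc D k xs \<and> is_k_arc D k ys
        \<longrightarrow> (\<exists>g. automorphism g D \<and> map g xs = ys))"

section \<open>Alternating walks and the relation A\<close>

definition fwd_step :: "'a dg \<Rightarrow> 'a list \<Rightarrow> nat \<Rightarrow> bool" where
  "fwd_step D xs i \<longleftrightarrow> (xs ! i, xs ! Suc i) \<in> arcs D"

definition step_arc :: "'a dg \<Rightarrow> 'a list \<Rightarrow> nat \<Rightarrow> 'a \<times> 'a" where
  "step_arc D xs i = (if fwd_step D xs i then (xs ! i, xs ! Suc i) else (xs ! Suc i, xs ! i))"

definition alt_walk :: "'a dg \<Rightarrow> 'a list \<Rightarrow> bool" where
  "alt_walk D xs \<longleftrightarrow> length xs \<ge> 2 \<and>
     (\<forall>i. Suc i < length xs \<longrightarrow> uadj D (xs ! i) (xs ! Suc i)) \<and>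
     (\<forall>i. Suc (Suc i) < length xs \<longrightarrow> (fwd_step D xs i \<longleftrightarrow> \<not> fwd_step D xs (Suc i)))"

definition rel_A :: "'a dg \<Rightarrow> ('a \<times> 'a) \<Rightarrow> ('a \<times> 'a) \<Rightarrow> bool" where
  "rel_A D e e' \<longleftrightarrow> (\<exists>xs. alt_walk D xs \<and> step_arc D xs 0 = e
       \<and> step_arc D xs (length xs - 2) = e')"

definition A_class :: "'a dg \<Rightarrow> ('a \<times> 'a) \<Rightarrow> ('a \<times> 'a) set" where
  "A_class D e = {e'. rel_A D e e'}"

text \<open>The subdigraph spanned by a set of arcs C (vertices: the endpoints).\<close>
definition Delta_of :: "('a \<times> 'a) set \<Rightarrow> 'a dg" where
  "Delta_of C = \<lparr>verts = fst ` C \<union> snd ` C, arcs = C\<rparr>"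

definition bipartite_parts :: "'a dg \<Rightarrow> 'a set \<Rightarrow> 'a set \<Rightarrow> bool" where
  "bipartite_parts G X Y \<longleftrightarrow> X \<inter> Y = {} \<and> X \<union> Y = verts G \<and> arcs G \<subseteq> X \<times> Y"

definition bipartite_dg :: "'a dg \<Rightarrow> bool" where
  "bipartite_dg G \<longleftrightarrow> (\<exists>X Y. bipartite_parts G X Y)"

section \<open>Ends\<close>

definition is_ray :: "'a dg \<Rightarrow> (nat \<Rightarrow> 'a) \<Rightarrow> bool" where
  "is_ray D r \<longleftrightarrow> inj r \<and> range r \<subseteq> verts D \<and> (\<forall>i. uadj D (r i) (r (Suc i)))"

definition equiv_rays :: "'a dg \<Rightarrow> (nat \<Rightarrow> 'a) \<Rightarrow> (nat \<Rightarrow> 'a) \<Rightarrow> bool" where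
  "equiv_rays D r s \<longleftrightarrow> (\<exists>t. is_ray D t \<and> infinite (range t \<inter> range r)
       \<and> infinite (range t \<inter> range s))"

definition more_than_one_end :: "'a dg \<Rightarrow> bool" where
  "more_than_one_end D \<longleftrightarrow> (\<exists>r s. is_ray D r \<and> is_ray D s \<and> \<not> equiv_rays D r s)"

definition more_than_two_ends :: "'a dg \<Rightarrow> bool" where
  "more_than_two_ends D \<longleftrightarrow> (\<exists>r s t. is_ray D r \<and> is_ray D s \<and> is_ray D t
       \<and> \<not> equiv_rays D r s \<and> \<not> equiv_rays D r t \<and> \<not> equiv_rays D s t)"

section \<open>Descendants and ancestors\<close>

definition desc :: "'a dg \<Rightarrow> 'a \<Rightarrow> 'a set" where
  "desc D u = {v. (u, v) \<in> (arcs D)\<^sup>*}"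

definition anc :: "'a dg \<Rightarrow> 'a \<Rightarrow> 'a set" where
  "anc D u = {v. (v, u) \<in> (arcs D)\<^sup>*}"

section \<open>The bipartite graphs of the list\<close>

text \<open>Models (only the underlying undirected graphs matter).\<close>
definition cycle_graph :: "nat \<Rightarrow> nat dg" where
  "cycle_graph m = \<lparr>verts = {..<m}, arcs = {(i, Suc i mod m) | i. i < m}\<rparr>"

definition K_bip :: "nat \<Rightarrow> nat \<Rightarrow> (bool \<times> nat) dg" where
  "K_bip m n = \<lparr>verts = {(False, i) | i. i < m} \<union> {(True, j) | j. j < n},
     arcs = {((False, i), (True, j)) | i j. i < m \<and> j < n}\<rparr>"

definition CP_graph :: "nat \<Rightarrow> (bool \<times> nat) dg" where
  "CP_graph n = \<lparr>verts = {(False, i) | i. i < n} \<union> {(True, j) | j. j < n},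
     arcs = {((False, i), (True, j)) | i j. i < n \<and> j < n \<and> i \<noteq> j}\<rparr>"

text \<open>G (undirected) is the infinite semiregular tree T_{a,b}.\<close>
definition is_T_ab :: "'a dg \<Rightarrow> nat \<Rightarrow> nat \<Rightarrow> bool" where
  "is_T_ab G a b \<longleftrightarrow> is_tree G \<and> infinite (verts G) \<and>
     (\<exists>X Y. X \<inter> Y = {} \<and> X \<union> Y = verts G
        \<and> (\<forall>x\<in>verts G. \<forall>y\<in>verts G. uadj G x y \<longrightarrow> (x \<in> X \<longleftrightarrow> y \<in> Y))
        \<and> (\<forall>x\<in>X. finite {w. uadj G x w} \<and> card {w. uadj G x w} = a)
        \<and> (\<forall>y\<in>Y. finite {w. uadj G y w} \<and> card {w. uadj G y w} = b))"

definition listed_graph :: "'a dg \<Rightarrow> bool" where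
  "listed_graph G \<longleftrightarrow>
     (\<exists>m. even m \<and> m \<ge> 4 \<and> u_isomorphic G (cycle_graph m))
   \<or> (\<exists>m n. m \<ge> 1 \<and> n \<ge> 1 \<and> u_isomorphic G (K_bip m n))
   \<or> (\<exists>n. n \<ge> 1 \<and> u_isomorphic G (CP_graph n))
   \<or> (\<exists>a b. a \<ge> 1 \<and> b \<ge> 1 \<and> is_T_ab G a b)"

section \<open>The construction DL\<close>

text \<open>Admissible data for DL(B): T a directed tree, phi t : T^-(t) -> X and
psi t : T^+(t) -> Y bijections.\<close>
definition DL_data :: "'b set \<Rightarrow> 'b set \<Rightarrow> 't dg \<Rightarrow> ('t \<Rightarrow> 't \<Rightarrow> 'b) \<Rightarrow> ('t \<Rightarrow> 't \<Rightarrow> 'b) \<Rightarrow> bool" where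
  "DL_data X Y T \<phi> \<psi> \<longleftrightarrow> wf_digraph T \<and> is_tree T \<and>
     (\<forall>t\<in>verts T. bij_betw (\<phi> t) (in_nbrs T t) X \<and> bij_betw (\<psi> t) (out_nbrs T t) Y)"

text \<open>Vertex set ET; (a,b) -> (c,d) iff b = c and phi_b(a) -> psi_b(d) in B.\<close>
definition DL :: "'b dg \<Rightarrow> 't dg \<Rightarrow> ('t \<Rightarrow> 't \<Rightarrow> 'b) \<Rightarrow> ('t \<Rightarrow> 't \<Rightarrow> 'b) \<Rightarrow> ('t \<times> 't) dg" where
  "DL B T \<phi> \<psi> = \<lparr>verts = arcs T,
     arcs = {((a, b), (c, d)) | a b c d. (a, b) \<in> arcs T \<and> (c, d) \<in> arcs T \<and> b = c
               \<and> (\<phi> b a, \<psi> b d) \<in> arcs B}\<rparr>"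

end

theory Submission
  imports Defs
begin

text \<open>Among the finite edge cuts with two infinite sides, take those of minimum size and, among these,
  those that cross the fewest others: they form a nested family \<open>E\<close> invariant under automorphisms.
  Homogeneity makes the automorphism group transitive on 2-arcs and on pairs of arcs with a common
  source or sink, so the number of cuts in \<open>E\<close> separating such vertices is constant. Together with
  nestedness this shows that no cut in \<open>E\<close> separates the middle vertex of a 2-arc from both ends;
  hence a directed path crosses every cut at most once, and directed paths are induced, which gives (i).
  Counting the cuts shared by two arcs with a common source and by two arcs with a common sink leaves
  two possibilities: either every edge is a bridge and \<open>D\<close> is a tree, or all arcs of a reachability
  class pass through one point of the structure tree of \<open>E\<close>. In both cases no vertex is a source and a
  sink of the same class, which is (ii); in the second case a class is an induced subdigraph, inherits
  homogeneity and can be classified by its girth and codegrees, which is (iii). If two directed paths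
  with common ends exist, then the vertices lie on finite levels indexed by the integers and there are at
  most two ends, which is (v). In \<open>DL\<close> the copies of \<open>B\<close> are glued along cut vertices in a tree-like
  way, so partial isomorphisms between connected sets extend by one vertex at a time, and Zorn's lemma
  gives (iv).\<close>

section \<open>Connected sets and edge boundaries\<close>

definition connected_on :: "('a \<times> 'a) set \<Rightarrow> 'a set \<Rightarrow> bool" where
  "connected_on R S \<longleftrightarrow> (\<forall>x\<in>S. \<forall>y\<in>S. (x, y) \<in> (R \<inter> S \<times> S)\<^sup>*)"

definition component :: "('a \<times> 'a) set \<Rightarrow> 'a set \<Rightarrow> 'a \<Rightarrow> 'a set" where
  "component R S x = {y. (x, y) \<in> (R \<inter> S \<times> S)\<^sup>*}"

definition boundary :: "('a \<times> 'a) set \<Rightarrow> 'a set \<Rightarrow> ('a \<times> 'a) set" where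
  "boundary R C = {(x, y) \<in> R. x \<in> C \<and> y \<notin> C}"

lemma rtrancl_finite_subrelation:
  assumes "(x, y) \<in> R\<^sup>*"
  obtains F where "finite F" "F \<subseteq> R" "(x, y) \<in> F\<^sup>*"
proof -
  have "\<exists>F. finite F \<and> F \<subseteq> R \<and> (x, y) \<in> F\<^sup>*"
    using assms
  proof (induction rule: rtrancl_induct)
    case base
    show ?case by (rule exI[of _ "{}"]) simp
  next
    case (step y z)
    then obtain F where F: "finite F" "F \<subseteq> R" "(x, y) \<in> F\<^sup>*" by blast
    have "(x, z) \<in> (insert (y, z) F)\<^sup>*"
      using F(3) by (meson insertI1 rtrancl.rtrancl_into_rtrancl rtrancl_mono subsetD subset_insertI)
    with F step.hyps show ?case by (intro exI[of _ "insert (y, z) F"]) auto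
  qed
  then show ?thesis using that by blast
qed

lemma rtrancl_exits:
  assumes "(x, y) \<in> R\<^sup>*" "x \<in> C" "y \<notin> C"
  obtains u v where "(u, v) \<in> R" "u \<in> C" "v \<notin> C"
proof -
  have "\<exists>u v. (u, v) \<in> R \<and> u \<in> C \<and> v \<notin> C"
    using assms by (induction rule: rtrancl_induct) auto
  then show ?thesis using that by blast
qed

lemma rtrancl_closed:
  assumes "(x, y) \<in> R\<^sup>*" "x \<in> C" "\<And>u v. (u, v) \<in> R \<Longrightarrow> u \<in> C \<Longrightarrow> v \<in> C"
  shows "y \<in> C"
  using assms(1,2) by (induction rule: rtrancl_induct) (auto dest: assms(3))

lemma component_refl [simp]: "x \<in> component R S x"
  by (simp add: component_def)

lemma component_step:
  assumes "u \<in> component R S x" "(u, v) \<in> R" "u \<in> S" "v \<in> S"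
  shows "v \<in> component R S x"
  using assms unfolding component_def by (auto intro: rtrancl_into_rtrancl)

lemma component_subset: "x \<in> S \<Longrightarrow> component R S x \<subseteq> S"
  by (auto simp: component_def elim!: rtrancl_closed)

lemma boundary_component_subset:
  assumes "x \<in> S" shows "boundary R (component R S x) \<subseteq> boundary R S"
  using component_subset[OF assms, of R] by (auto simp: boundary_def intro: component_step)

lemma component_eq:
  assumes "sym R" "y \<in> component R S x" shows "component R S y = component R S x"
proof -
  have "sym (R \<inter> S \<times> S)" using assms(1) by (auto simp: sym_def)
  then have "(y, x) \<in> (R \<inter> S \<times> S)\<^sup>*"
    using assms(2) unfolding component_def by (metis mem_Collect_eq symD sym_rtrancl)
  with assms(2) show ?thesis by (auto simp: component_def intro: rtrancl_trans)
qed

lemma connected_on_component: "connected_on R S \<Longrightarrow> x \<in> S \<Longrightarrow> component R S x = S"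
  using component_subset by (fastforce simp: connected_on_def component_def)

lemma connected_on_from:
  assumes "sym R" "z \<in> S" "\<And>x. x \<in> S \<Longrightarrow> (z, x) \<in> (R \<inter> S \<times> S)\<^sup>*"
  shows "connected_on R S"
proof -
  have "component R S x = component R S z" if "x \<in> S" for x
    using assms(3)[OF that] by (intro component_eq[OF assms(1)]) (simp add: component_def)
  then show ?thesis
    using assms(3) unfolding connected_on_def component_def by blast
qed

lemma connected_on_rtrancl:
  assumes "connected_on R S" "x \<in> S" "y \<in> S" shows "(x, y) \<in> R\<^sup>*"
  using assms rtrancl_mono[of "R \<inter> S \<times> S" R] by (auto simp: connected_on_def)

lemma connected_on_Un_edge:
  assumes "sym R" "connected_on R A" "connected_on R B" "u \<in> A" "v \<in> B" "(u, v) \<in> R"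
  shows "connected_on R (A \<union> B)"
proof (rule connected_on_from[OF assms(1)])
  let ?S = "R \<inter> (A \<union> B) \<times> (A \<union> B)"
  have mono: "(R \<inter> A \<times> A)\<^sup>* \<subseteq> ?S\<^sup>*" "(R \<inter> B \<times> B)\<^sup>* \<subseteq> ?S\<^sup>*"
    by (auto intro!: rtrancl_mono)
  show "u \<in> A \<union> B" using assms(4) by simp
  fix z assume "z \<in> A \<union> B"
  then consider "z \<in> A" | "z \<in> B" by blast
  then show "(u, z) \<in> ?S\<^sup>*"
  proof cases
    case 1
    then show ?thesis using mono(1) assms(2,4) by (auto simp: connected_on_def)
  next
    case 2
    then have "(v, z) \<in> ?S\<^sup>*" using mono(2) assms(3,5) by (auto simp: connected_on_def)
    moreover have "(u, v) \<in> ?S" using assms(4-6) by blast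
    ultimately show ?thesis by (rule converse_rtrancl_into_rtrancl[rotated])
  qed
qed

lemma connected_on_singleton: "connected_on R {x}"
  by (simp add: connected_on_def)

lemma connected_on_insert:
  assumes "sym R" "connected_on R S" "\<exists>s\<in>S. (s, v) \<in> R"
  shows "connected_on R (insert v S)"
  using assms connected_on_Un_edge[OF assms(1,2) connected_on_singleton] by auto

lemma rtrancl_map:
  assumes "(x, y) \<in> R\<^sup>*" "\<And>x y. (x, y) \<in> R \<Longrightarrow> (f x, f y) \<in> Q"
  shows "(f x, f y) \<in> Q\<^sup>*"
  using assms(1) by (induction rule: rtrancl_induct) (auto intro: rtrancl_into_rtrancl assms(2))

lemma connected_on_image:
  assumes "connected_on R S" "\<And>x y. x \<in> S \<Longrightarrow> y \<in> S \<Longrightarrow> (x, y) \<in> R \<Longrightarrow> (f x, f y) \<in> Q"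
  shows "connected_on Q (f ` S)"
  unfolding connected_on_def
proof (intro ballI)
  fix y y' assume "y \<in> f ` S" "y' \<in> f ` S"
  then obtain x x' where x: "x \<in> S" "x' \<in> S" and y: "y = f x" "y' = f x'" by blast
  have "(x, x') \<in> (R \<inter> S \<times> S)\<^sup>*" using assms(1) x by (simp add: connected_on_def)
  then show "(y, y') \<in> (Q \<inter> f ` S \<times> f ` S)\<^sup>*"
    unfolding y by (rule rtrancl_map) (use assms(2) in blast)
qed

section \<open>Relation automorphisms\<close>

definition rel_aut :: "'a set \<Rightarrow> ('a \<times> 'a) set \<Rightarrow> ('a \<Rightarrow> 'a) \<Rightarrow> bool" where
  "rel_aut V R g \<longleftrightarrow> bij_betw g V V \<and> (\<forall>x\<in>V. \<forall>y\<in>V. (x, y) \<in> R \<longleftrightarrow> (g x, g y) \<in> R)"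

lemma rel_aut_inj: "rel_aut V R g \<Longrightarrow> inj_on g V"
  and rel_aut_image: "rel_aut V R g \<Longrightarrow> g ` V = V"
  by (auto simp: rel_aut_def bij_betw_def)

lemma rel_aut_mem_iff: "rel_aut V R g \<Longrightarrow> x \<in> V \<Longrightarrow> C \<subseteq> V \<Longrightarrow> g x \<in> g ` C \<longleftrightarrow> x \<in> C"
  by (rule inj_on_image_mem_iff[OF rel_aut_inj])

lemma rel_aut_inv_into:
  assumes "rel_aut V R g" shows "rel_aut V R (inv_into V g)"
proof -
  have bij: "bij_betw g V V" using assms by (simp add: rel_aut_def)
  then have "inv_into V g x \<in> V" "g (inv_into V g x) = x" if "x \<in> V" for x
    using that by (auto simp: bij_betw_def f_inv_into_f inv_into_into)
  then show ?thesis using assms bij_betw_inv_into[OF bij] by (auto simp: rel_aut_def)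
qed

lemma rel_aut_image_inverse:
  assumes "rel_aut V R g" "C \<subseteq> V"
  shows "inv_into V g ` g ` C = C" "g ` inv_into V g ` C = C"
  using assms rel_aut_inj[OF assms(1)] rel_aut_image[OF assms(1)]
  by (simp_all add: inv_into_image_cancel image_inv_into_cancel)

lemma rel_aut_Image:
  assumes g: "rel_aut V R g" and R: "R \<subseteq> V \<times> V" and x: "x \<in> V"
  shows "g ` (R `` {x}) = R `` {g x}"
proof (intro set_eqI iffI)
  fix w assume "w \<in> g ` (R `` {x})"
  then show "w \<in> R `` {g x}" using g R x by (auto simp: rel_aut_def)
next
  fix w assume w: "w \<in> R `` {g x}"
  then obtain v where "v \<in> V" "w = g v" using R rel_aut_image[OF g] by blast
  then show "w \<in> g ` (R `` {x})" using w g x by (auto simp: rel_aut_def)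
qed

lemma rel_aut_boundary:
  assumes g: "rel_aut V R g" and R: "R \<subseteq> V \<times> V" and C: "C \<subseteq> V"
  shows "boundary R (g ` C) = map_prod g g ` boundary R C"
proof (intro set_eqI iffI)
  fix e assume "e \<in> boundary R (g ` C)"
  then obtain x b where e: "e = (g x, b)" "(g x, b) \<in> R" "x \<in> C" "b \<notin> g ` C"
    by (auto simp: boundary_def)
  then have "b \<in> g ` V" using R rel_aut_image[OF g] by blast
  then obtain y where "y \<in> V" "b = g y" by blast
  then show "e \<in> map_prod g g ` boundary R C"
    using e g C by (intro image_eqI[of _ _ "(x, y)"]) (auto simp: boundary_def rel_aut_def)
next
  fix e assume "e \<in> map_prod g g ` boundary R C"
  then obtain x y where e: "e = (g x, g y)" "(x, y) \<in> R" "x \<in> C" "y \<notin> C"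
    by (auto simp: boundary_def)
  then show "e \<in> boundary R (g ` C)"
    using R C g rel_aut_mem_iff[OF g _ C, of y] by (auto simp: boundary_def rel_aut_def)
qed

section \<open>Finitely many tight cuts through an edge\<close>

definition tight_cuts :: "('a \<times> 'a) set \<Rightarrow> 'a set \<Rightarrow> 'a \<Rightarrow> 'a \<Rightarrow> nat \<Rightarrow> 'a set set" where
  "tight_cuts R V x y k = {C. C \<subseteq> V \<and> x \<in> C \<and> y \<notin> C \<and> connected_on R C \<and> connected_on R (V - C)
     \<and> finite (boundary R C) \<and> card (boundary R C) = k}"

lemma restrict_delete_cut_edge:
  assumes "x \<in> C" "y \<notin> C"
  shows "(R - {(x, y), (y, x)}) \<inter> C \<times> C = R \<inter> C \<times> C"
    "(R - {(x, y), (y, x)}) \<inter> (V - C) \<times> (V - C) = R \<inter> (V - C) \<times> (V - C)"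
    "boundary (R - {(x, y), (y, x)}) C = boundary R C - {(x, y)}"
  using assms by (auto simp: boundary_def)

lemma tight_cuts_delete_edge:
  assumes C: "C \<in> tight_cuts R V x y (Suc k)" and "(x, y) \<in> R" "u \<in> C" "v \<notin> C"
  shows "C \<in> tight_cuts (R - {(x, y), (y, x)}) V u v k"
proof -
  have xy: "x \<in> C" "y \<notin> C" using C by (auto simp: tight_cuts_def)
  moreover have "(x, y) \<in> boundary R C" using xy assms(2) by (simp add: boundary_def)
  ultimately show ?thesis
    using C assms(3,4) restrict_delete_cut_edge[OF xy, of R]
    by (simp add: tight_cuts_def connected_on_def)
qed

lemma tight_cuts_bridge:
  assumes R: "sym R" "R \<subseteq> V \<times> V" and C: "C \<in> tight_cuts R V x y k"
    and bridge: "\<not> connected_on (R - {(x, y), (y, x)}) V"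
  shows "C = component (R - {(x, y), (y, x)}) V x"
proof -
  let ?R = "R - {(x, y), (y, x)}"
  have sub: "C \<subseteq> V" and xy: "x \<in> C" "y \<notin> C" using C by (auto simp: tight_cuts_def)
  have conn: "connected_on ?R C" "connected_on ?R (V - C)"
    using C restrict_delete_cut_edge[OF xy, of R] by (auto simp: tight_cuts_def connected_on_def)
  have "sym ?R" using R(1) by (auto simp: sym_def)
  have closed: "v \<in> C" if "(u, v) \<in> ?R" "u \<in> C" for u v
  proof (rule ccontr)
    assume "v \<notin> C"
    then have "connected_on ?R (C \<union> (V - C))"
      using R(2) that by (intro connected_on_Un_edge[OF \<open>sym ?R\<close> conn that(2) _ that(1)]) blast
    then show False using bridge sub by (simp add: Un_absorb1)
  qed
  have "C = component ?R C x" using connected_on_component[OF conn(1) xy(1)] by simp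
  also have "\<dots> \<subseteq> component ?R V x"
    unfolding component_def using sub by (intro Collect_mono impI) (rule subsetD[OF rtrancl_mono], auto)
  finally have "C \<subseteq> component ?R V x" .
  moreover have "component ?R V x \<subseteq> C"
    using xy(1) closed by (auto simp: component_def elim!: rtrancl_closed)
  ultimately show ?thesis by (rule subset_antisym)
qed

lemma finite_tight_cuts:
  assumes "sym R" "R \<subseteq> V \<times> V" "connected_on R V" "(x, y) \<in> R"
  shows "finite (tight_cuts R V x y k)"
  using assms
proof (induction k arbitrary: R x y)
  case 0
  then have "tight_cuts R V x y 0 = {}" by (auto simp: tight_cuts_def boundary_def)
  then show ?case by (simp only: finite.emptyI)
next
  case (Suc k)
  define R' where "R' = R - {(x, y), (y, x)}"
  show ?case
  proof (cases "connected_on R' V")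
    case True
    then have "(x, y) \<in> R'\<^sup>*"
      by (rule connected_on_rtrancl) (use Suc.prems(2,4) in blast)+
    then obtain F where F: "finite F" "F \<subseteq> R'" "(x, y) \<in> F\<^sup>*" by (rule rtrancl_finite_subrelation)
    have "tight_cuts R V x y (Suc k) \<subseteq> (\<Union>(u, v)\<in>F. tight_cuts R' V u v k)"
    proof
      fix C assume C: "C \<in> tight_cuts R V x y (Suc k)"
      then obtain u v where "(u, v) \<in> F" "u \<in> C" "v \<notin> C"
        by (auto simp: tight_cuts_def intro: rtrancl_exits[OF F(3), of C])
      with C Suc.prems(4) show "C \<in> (\<Union>(u, v)\<in>F. tight_cuts R' V u v k)"
        unfolding R'_def by (intro UN_I[of "(u, v)"]) (auto intro: tight_cuts_delete_edge)
    qed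
    moreover have "sym R'" "R' \<subseteq> V \<times> V"
      using Suc.prems(1,2) by (auto simp: R'_def sym_def)
    then have "finite (\<Union>(u, v)\<in>F. tight_cuts R' V u v k)"
      using F Suc.IH[OF _ _ True] by auto
    ultimately show ?thesis by (rule finite_subset)
  next
    case False
    then have "tight_cuts R V x y (Suc k) \<subseteq> {component R' V x}"
      using tight_cuts_bridge[OF Suc.prems(1,2)] unfolding R'_def by blast
    then show ?thesis by (rule finite_subset) simp
  qed
qed

section \<open>Minimum cuts with infinite sides\<close>

locale connected_graph =
  fixes V :: "'a set" and R :: "('a \<times> 'a) set"
  assumes R_sym: "sym R" and R_sub: "R \<subseteq> V \<times> V" and R_conn: "connected_on R V"
begin

definition is_cut :: "'a set \<Rightarrow> bool" where
  "is_cut C \<longleftrightarrow> C \<subseteq> V \<and> infinite C \<and> infinite (V - C) \<and> finite (boundary R C)"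

definition min_cuts :: "'a set set" where
  "min_cuts = {C. is_cut C \<and> (\<forall>D. is_cut D \<longrightarrow> card (boundary R C) \<le> card (boundary R D))}"

lemma boundary_compl: "C \<subseteq> V \<Longrightarrow> boundary R (V - C) = (boundary R C)\<inverse>"
  using R_sym R_sub by (auto simp: boundary_def sym_def)

lemma is_cut_compl: "is_cut C \<Longrightarrow> is_cut (V - C)"
  by (auto simp: is_cut_def boundary_compl double_diff)

lemma card_boundary_compl: "C \<subseteq> V \<Longrightarrow> card (boundary R (V - C)) = card (boundary R C)"
  by (simp add: boundary_compl card_inverse)

lemma min_cuts_is_cut: "C \<in> min_cuts \<Longrightarrow> is_cut C"
  and min_cuts_subset: "C \<in> min_cuts \<Longrightarrow> C \<subseteq> V"
  by (simp_all add: min_cuts_def is_cut_def)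

lemma min_cuts_le: "C \<in> min_cuts \<Longrightarrow> is_cut D \<Longrightarrow> card (boundary R C) \<le> card (boundary R D)"
  by (simp add: min_cuts_def)

lemma min_cuts_card_eq: "C \<in> min_cuts \<Longrightarrow> D \<in> min_cuts \<Longrightarrow> card (boundary R C) = card (boundary R D)"
  by (auto simp: min_cuts_def intro: antisym)

lemma min_cuts_if_card_eq:
  "C \<in> min_cuts \<Longrightarrow> is_cut D \<Longrightarrow> card (boundary R D) = card (boundary R C) \<Longrightarrow> D \<in> min_cuts"
  by (simp add: min_cuts_def)

lemma min_cuts_compl: "C \<in> min_cuts \<Longrightarrow> V - C \<in> min_cuts"
  by (rule min_cuts_if_card_eq) (simp_all add: is_cut_compl card_boundary_compl min_cuts_is_cut min_cuts_subset)

lemma min_cuts_exist: "is_cut C \<Longrightarrow> \<exists>C. C \<in> min_cuts"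
  using ex_has_least_nat[of is_cut C "\<lambda>C. card (boundary R C)"]
  by (auto simp: min_cuts_def)

lemma boundary_component_nonempty:
  assumes "C \<subset> V" "x \<in> C"
  obtains e where "e \<in> boundary R (component R C x)"
proof -
  obtain y where y: "y \<in> V" "y \<notin> C" using assms(1) by blast
  have "(x, y) \<in> R\<^sup>*" using connected_on_rtrancl[OF R_conn] assms y by blast
  moreover have "y \<notin> component R C x" using component_subset[OF assms(2)] y by blast
  ultimately obtain u v where "(u, v) \<in> R" "u \<in> component R C x" "v \<notin> component R C x"
    using rtrancl_exits[OF _ component_refl] by metis
  then show ?thesis using that[of "(u, v)"] by (simp add: boundary_def)
qed

lemma fst_boundary_component:
  "e \<in> boundary R (component R C x) \<Longrightarrow> component R C (fst e) = component R C x"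
  by (rule component_eq[OF R_sym]) (auto simp: boundary_def)

lemma is_cut_psubset: "is_cut C \<Longrightarrow> C \<subset> V"
  by (auto simp: is_cut_def)

lemma cut_has_infinite_component:
  assumes cut: "is_cut C"
  obtains x where "x \<in> C" "infinite (component R C x)"
proof -
  have "C \<subseteq> (\<Union>e\<in>boundary R C. component R C (fst e))"
  proof
    fix x assume x: "x \<in> C"
    then obtain e where e: "e \<in> boundary R (component R C x)"
      using boundary_component_nonempty[OF is_cut_psubset[OF cut]] by blast
    then have "e \<in> boundary R C" using boundary_component_subset[OF x] by blast
    moreover have "x \<in> component R C (fst e)" using fst_boundary_component[OF e] by simp
    ultimately show "x \<in> (\<Union>e\<in>boundary R C. component R C (fst e))" by blast
  qed
  moreover have "infinite C" "finite (boundary R C)" using cut by (auto simp: is_cut_def)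
  ultimately obtain e where "e \<in> boundary R C" "infinite (component R C (fst e))"
    by (meson finite_UN_I finite_subset)
  then show ?thesis using that[of "fst e"] by (auto simp: boundary_def)
qed

lemma min_cut_connected:
  assumes C: "C \<in> min_cuts" shows "connected_on R C"
proof -
  have cut: "is_cut C" by (rule min_cuts_is_cut[OF C])
  then obtain x where x: "x \<in> C" "infinite (component R C x)" by (rule cut_has_infinite_component)
  let ?K = "component R C x"
  have sub: "boundary R ?K \<subseteq> boundary R C" "?K \<subseteq> C"
    using boundary_component_subset component_subset x(1) by metis+
  then have "is_cut ?K"
    using cut x(2) unfolding is_cut_def by (meson Diff_mono finite_subset order_refl order_trans)
  then have eq: "boundary R ?K = boundary R C"
    using card_seteq[OF _ sub(1)] min_cuts_le[OF C] cut by (simp add: is_cut_def)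
  have "C \<subseteq> ?K"
  proof
    fix z assume z: "z \<in> C"
    then obtain e where e: "e \<in> boundary R (component R C z)"
      using boundary_component_nonempty[OF is_cut_psubset[OF cut]] by blast
    then have "e \<in> boundary R ?K" using boundary_component_subset[OF z] eq by blast
    then have "component R C z = ?K" using fst_boundary_component e by metis
    then show "z \<in> ?K" using component_refl by metis
  qed
  then show ?thesis
    using x(1) by (intro connected_on_from[OF R_sym, of x]) (auto simp: component_def)
qed

lemma finite_min_cuts_separating:
  assumes "x \<in> V" "y \<in> V"
  shows "finite {C \<in> min_cuts. x \<in> C \<and> y \<notin> C}"
proof (cases "min_cuts = {}")
  case False
  then obtain C\<^sub>0 where C\<^sub>0: "C\<^sub>0 \<in> min_cuts" by blast
  define k where "k = card (boundary R C\<^sub>0)"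
  have "(x, y) \<in> R\<^sup>*" by (rule connected_on_rtrancl[OF R_conn assms])
  then obtain F where F: "finite F" "F \<subseteq> R" "(x, y) \<in> F\<^sup>*" by (rule rtrancl_finite_subrelation)
  have "{C \<in> min_cuts. x \<in> C \<and> y \<notin> C} \<subseteq> (\<Union>(u, v)\<in>F. tight_cuts R V u v k)"
  proof
    fix C assume "C \<in> {C \<in> min_cuts. x \<in> C \<and> y \<notin> C}"
    then have C: "C \<in> min_cuts" "x \<in> C" "y \<notin> C" by auto
    obtain u v where uv: "(u, v) \<in> F" "u \<in> C" "v \<notin> C"
      by (rule rtrancl_exits[OF F(3) C(2,3)])
    have "C \<subseteq> V" "finite (boundary R C)"
      using min_cuts_is_cut[OF C(1)] by (simp_all add: is_cut_def)
    then have "C \<in> tight_cuts R V u v k"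
      using uv C(1) min_cuts_card_eq[OF C(1) C\<^sub>0] min_cut_connected min_cuts_compl
      by (simp add: tight_cuts_def k_def)
    with uv(1) show "C \<in> (\<Union>(u, v)\<in>F. tight_cuts R V u v k)" by blast
  qed
  moreover have "finite (\<Union>(u, v)\<in>F. tight_cuts R V u v k)"
    using F finite_tight_cuts[OF R_sym R_sub R_conn] by auto
  ultimately show ?thesis by (rule finite_subset)
qed simp

lemma rel_aut_min_cuts:
  assumes g: "rel_aut V R g" and C: "C \<in> min_cuts" shows "g ` C \<in> min_cuts"
proof -
  note inj = rel_aut_inj[OF g] and im = rel_aut_image[OF g]
  have cut: "is_cut C" by (rule min_cuts_is_cut[OF C])
  have sub: "C \<subseteq> V" by (rule min_cuts_subset[OF C])
  have "V - g ` C = g ` (V - C)"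
    using inj_on_image_set_diff[OF inj, of V C] sub im by auto
  then have "infinite (V - g ` C)" "infinite (g ` C)"
    using cut inj sub by (auto simp: is_cut_def finite_image_iff inj_on_subset)
  moreover have boundary: "boundary R (g ` C) = map_prod g g ` boundary R C"
    by (rule rel_aut_boundary[OF g R_sub sub])
  ultimately have "is_cut (g ` C)" using cut image_mono[OF sub, of g] im by (auto simp: is_cut_def)
  moreover have "inj_on (map_prod g g) (boundary R C)"
    using R_sub by (intro inj_on_subset[OF map_prod_inj_on[OF inj inj]]) (auto simp: boundary_def)
  then have "card (boundary R (g ` C)) = card (boundary R C)"
    by (simp add: boundary card_image)
  ultimately show ?thesis by (rule min_cuts_if_card_eq[OF C])
qed

section \<open>Minimum cuts crossing as few others as possible\<close>

definition crosses :: "'a set \<Rightarrow> 'a set \<Rightarrow> bool" where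
  "crosses C D \<longleftrightarrow> C \<inter> D \<noteq> {} \<and> C - D \<noteq> {} \<and> D - C \<noteq> {} \<and> V - (C \<union> D) \<noteq> {}"

definition crossing_cuts :: "'a set \<Rightarrow> 'a set set" where
  "crossing_cuts C = {D \<in> min_cuts. crosses C D}"

definition optimal_cuts :: "'a set set" where
  "optimal_cuts =
     {C \<in> min_cuts. \<forall>D\<in>min_cuts. card (crossing_cuts C) \<le> card (crossing_cuts D)}"

lemma crosses_compl: "C \<subseteq> V \<Longrightarrow> D \<subseteq> V \<Longrightarrow> crosses C (V - D) \<longleftrightarrow> crosses C D"
  by (auto simp: crosses_def)

lemma crosses_commute: "crosses C D \<longleftrightarrow> crosses D C"
  by (auto simp: crosses_def Un_commute)

lemma crossing_cuts_compl: "C \<in> min_cuts \<Longrightarrow> crossing_cuts (V - C) = crossing_cuts C"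
  unfolding crossing_cuts_def using crosses_compl crosses_commute min_cuts_subset by metis

lemma optimal_cuts_min_cuts: "C \<in> optimal_cuts \<Longrightarrow> C \<in> min_cuts"
  and optimal_cuts_le:
    "C \<in> optimal_cuts \<Longrightarrow> D \<in> min_cuts \<Longrightarrow> card (crossing_cuts C) \<le> card (crossing_cuts D)"
  by (simp_all add: optimal_cuts_def)

lemma optimal_cuts_compl: "C \<in> optimal_cuts \<Longrightarrow> V - C \<in> optimal_cuts"
  by (auto simp: optimal_cuts_def min_cuts_compl crossing_cuts_compl)

lemma optimal_cuts_exist:
  assumes "is_cut C" shows "optimal_cuts \<noteq> {}"
proof -
  obtain C' where "C' \<in> min_cuts" using min_cuts_exist[OF assms] by blast
  from ex_has_least_nat[of "\<lambda>C. C \<in> min_cuts", OF this, of "\<lambda>C. card (crossing_cuts C)"]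
  show ?thesis unfolding optimal_cuts_def by blast
qed

lemma min_cut_meets_boundary:
  assumes "D \<in> min_cuts" "C \<inter> D \<noteq> {}" "D - C \<noteq> {}"
  shows "D \<inter> Field (boundary R C) \<noteq> {}"
proof -
  obtain x y where xy: "x \<in> D" "x \<in> C" "y \<in> D" "y \<notin> C" using assms(2,3) by blast
  then have "(x, y) \<in> (R \<inter> D \<times> D)\<^sup>*"
    using min_cut_connected[OF assms(1)] by (simp add: connected_on_def)
  then obtain u v where "(u, v) \<in> R \<inter> D \<times> D" "u \<in> C" "v \<notin> C"
    using xy(2,4) by (rule rtrancl_exits)
  then show ?thesis by (auto simp: boundary_def Field_def)
qed

lemma finite_crossing_cuts:
  assumes C: "C \<in> min_cuts"
  shows "finite (crossing_cuts C)"
proof -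
  let ?U = "Field (boundary R C)"
  have "crossing_cuts C \<subseteq> (\<Union>(u, v)\<in>?U \<times> ?U. {D \<in> min_cuts. u \<in> D \<and> v \<notin> D})"
  proof
    fix D assume "D \<in> crossing_cuts C"
    then have D: "D \<in> min_cuts" "crosses C D" by (auto simp: crossing_cuts_def)
    have "C \<inter> (V - D) \<noteq> {}" "V - D - C \<noteq> {}"
      using D min_cuts_subset[OF C] by (auto simp: crosses_def)
    then obtain v where "v \<in> ?U" "v \<in> V - D"
      using min_cut_meets_boundary min_cuts_compl[OF D(1)] by blast
    moreover obtain u where "u \<in> ?U" "u \<in> D"
      using min_cut_meets_boundary[OF D(1), of C] D(2) by (auto simp: crosses_def)
    ultimately show "D \<in> (\<Union>(u, v)\<in>?U \<times> ?U. {D \<in> min_cuts. u \<in> D \<and> v \<notin> D})" using D(1) by auto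
  qed
  moreover have "finite ?U"
    using min_cuts_is_cut[OF C] by (simp add: is_cut_def finite_Field)
  moreover have "?U \<subseteq> V" using R_sub by (auto simp: Field_def boundary_def)
  ultimately show ?thesis
    using finite_min_cuts_separating by (elim finite_subset) auto
qed

lemma card_add_mono_Un_Int:
  assumes fin: "finite A" "finite B" and sub: "P \<union> Q \<subseteq> A \<union> B" "P \<inter> Q \<subseteq> A \<inter> B"
  shows "card P + card Q \<le> card A + card B"
    and "P \<union> Q \<noteq> A \<union> B \<Longrightarrow> card P + card Q < card A + card B"
proof -
  have "finite P" "finite Q" using fin sub(1) by (meson finite_Un finite_subset)+
  then have eq: "card P + card Q = card (P \<union> Q) + card (P \<inter> Q)" by (rule card_Un_Int)
  note eq' = card_Un_Int[OF fin]
  have "card (P \<inter> Q) \<le> card (A \<inter> B)" using fin sub(2) by (intro card_mono) auto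
  moreover have "card (P \<union> Q) \<le> card (A \<union> B)" using fin sub(1) by (intro card_mono) auto
  ultimately show "card P + card Q \<le> card A + card B" using eq eq' by linarith
  assume "P \<union> Q \<noteq> A \<union> B"
  then have "card (P \<union> Q) < card (A \<union> B)" using fin sub(1) by (intro psubset_card_mono) auto
  with \<open>card (P \<inter> Q) \<le> card (A \<inter> B)\<close> show "card P + card Q < card A + card B"
    using eq eq' by linarith
qed

lemma min_cuts_corners:
  assumes C: "C \<in> min_cuts" and D: "D \<in> min_cuts"
    and inf: "infinite (C \<inter> D)" "infinite (V - (C \<union> D))"
  shows "C \<inter> D \<in> min_cuts" "C \<union> D \<in> min_cuts"
proof -
  let ?b = "\<lambda>C. card (boundary R C)"
  have cuts: "is_cut C" "is_cut D" using min_cuts_is_cut C D by auto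
  then have fin: "finite (boundary R C)" "finite (boundary R D)" by (auto simp: is_cut_def)
  have sub: "boundary R (C \<inter> D) \<union> boundary R (C \<union> D) \<subseteq> boundary R C \<union> boundary R D"
    "boundary R (C \<inter> D) \<inter> boundary R (C \<union> D) \<subseteq> boundary R C \<inter> boundary R D"
    by (auto simp: boundary_def)
  then have "finite (boundary R (C \<inter> D))" "finite (boundary R (C \<union> D))"
    using fin by (meson finite_Un finite_subset)+
  moreover have "infinite (V - C \<inter> D)"
    using cuts(1) by (metis Diff_mono Int_lower1 finite_subset is_cut_def order_refl)
  ultimately have corners: "is_cut (C \<inter> D)" "is_cut (C \<union> D)"
    using cuts inf by (auto simp: is_cut_def)
  have "?b (C \<inter> D) + ?b (C \<union> D) \<le> ?b C + ?b D" by (rule card_add_mono_Un_Int(1)[OF fin sub])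
  moreover have "?b D = ?b C" by (rule min_cuts_card_eq[OF D C])
  ultimately have "?b (C \<inter> D) = ?b C" "?b (C \<union> D) = ?b C"
    using corners[THEN min_cuts_le[OF C]] by auto
  then show "C \<inter> D \<in> min_cuts" "C \<union> D \<in> min_cuts" using min_cuts_if_card_eq[OF C] corners by auto
qed

lemma crosses_some_corner:
  assumes "C \<subseteq> V" "D \<subseteq> V" "F \<subseteq> V" "crosses C D"
    and "crosses (C \<inter> D) F \<or> crosses (C \<union> D) F"
  shows "crosses C F \<or> crosses D F"
proof (rule ccontr)
  assume "\<not> ?thesis"
  then have F: "F \<subseteq> C \<or> C \<subseteq> F \<or> F \<inter> C = {} \<or> F \<union> C = V" "F \<subseteq> D \<or> D \<subseteq> F \<or> F \<inter> D = {} \<or> F \<union> D = V"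
    using assms(1-3) unfolding crosses_def by blast+
  have corners: "\<not> C \<subseteq> D" "\<not> D \<subseteq> C" "C \<inter> D \<noteq> {}" "C \<union> D \<noteq> V"
    using assms(4) by (auto simp: crosses_def)
  from F have "\<not> crosses (C \<inter> D) F \<and> \<not> crosses (C \<union> D) F"
    unfolding crosses_def by (elim disjE) (insert corners assms(1-3), blast+)
  then show False using assms(5) by blast
qed

lemma crosses_both_corners:
  assumes "C \<subseteq> V" "D \<subseteq> V" "crosses (C \<inter> D) F" "crosses (C \<union> D) F"
  shows "crosses C F \<and> crosses D F"
  using assms unfolding crosses_def by blast

text \<open>Replacing two crossing cuts by opposite corners strictly lowers the total number of crossings.\<close>

lemma optimal_cuts_infinite_corners_not_crossing:
  assumes C: "C \<in> optimal_cuts" and D: "D \<in> optimal_cuts"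
    and inf: "infinite (C \<inter> D)" "infinite (V - (C \<union> D))"
  shows "\<not> crosses C D"
proof
  assume cross: "crosses C D"
  note min = optimal_cuts_min_cuts[OF C] optimal_cuts_min_cuts[OF D]
  note corners = min_cuts_corners[OF min inf]
  note V = min_cuts_subset[OF min(1)] min_cuts_subset[OF min(2)]
  let ?X = crossing_cuts
  have Un: "?X (C \<inter> D) \<union> ?X (C \<union> D) \<subseteq> ?X C \<union> ?X D"
  proof
    fix F assume F: "F \<in> ?X (C \<inter> D) \<union> ?X (C \<union> D)"
    then have "F \<in> min_cuts" by (auto simp: crossing_cuts_def)
    moreover have "crosses C F \<or> crosses D F"
      using F by (intro crosses_some_corner[OF V min_cuts_subset[OF \<open>F \<in> min_cuts\<close>] cross])
        (auto simp: crossing_cuts_def)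
    ultimately show "F \<in> ?X C \<union> ?X D" by (simp add: crossing_cuts_def)
  qed
  have Int: "?X (C \<inter> D) \<inter> ?X (C \<union> D) \<subseteq> ?X C \<inter> ?X D"
    using crosses_both_corners[OF V] by (simp add: crossing_cuts_def subset_iff)
  have "C \<in> ?X D" using min cross crosses_commute[of C D] by (simp add: crossing_cuts_def)
  moreover have "C \<notin> ?X (C \<inter> D)" "C \<notin> ?X (C \<union> D)" by (auto simp: crossing_cuts_def crosses_def)
  ultimately have "?X (C \<inter> D) \<union> ?X (C \<union> D) \<noteq> ?X C \<union> ?X D" by blast
  then have "card (?X (C \<inter> D)) + card (?X (C \<union> D)) < card (?X C) + card (?X D)"
    by (rule card_add_mono_Un_Int(2)[OF min[THEN finite_crossing_cuts] Un Int])
  moreover have "card (?X C) \<le> card (?X (C \<inter> D))" "card (?X D) \<le> card (?X (C \<union> D))"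
    by (rule optimal_cuts_le[OF C corners(1)], rule optimal_cuts_le[OF D corners(2)])
  ultimately show False by linarith
qed

lemma optimal_cuts_not_crossing:
  assumes C: "C \<in> optimal_cuts" and D: "D \<in> optimal_cuts"
  shows "\<not> crosses C D"
proof (cases "infinite (C \<inter> D) \<and> infinite (V - (C \<union> D))")
  case True
  then show ?thesis using optimal_cuts_infinite_corners_not_crossing[OF C D] by blast
next
  case False
  have sub: "C \<subseteq> V" "D \<subseteq> V" and inf: "infinite C" "infinite D" "infinite (V - C)" "infinite (V - D)"
    using C D by (auto dest!: optimal_cuts_min_cuts min_cuts_is_cut simp: is_cut_def)
  have "infinite (C - D) \<and> infinite (D - C)"
  proof (cases "finite (C \<inter> D)")
    case True
    moreover have "C - D = C - C \<inter> D" "D - C = D - C \<inter> D" by auto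
    ultimately show ?thesis using inf by (metis Diff_infinite_finite)
  next
    case False
    with \<open>\<not> (infinite (C \<inter> D) \<and> infinite (V - (C \<union> D)))\<close> have "finite (V - (C \<union> D))" by blast
    moreover have "C - D = (V - D) - (V - (C \<union> D))" "D - C = (V - C) - (V - (C \<union> D))"
      using sub by auto
    ultimately show ?thesis using inf by (metis Diff_infinite_finite)
  qed
  moreover have "C \<inter> (V - D) = C - D" "V - (C \<union> (V - D)) = D - C" using sub by auto
  ultimately show ?thesis
    using optimal_cuts_infinite_corners_not_crossing[OF C optimal_cuts_compl[OF D]]
      crosses_compl[OF sub] by simp
qed

lemma rel_aut_crosses:
  assumes g: "rel_aut V R g" and sub: "C \<subseteq> V" "D \<subseteq> V" and cross: "crosses C D"
  shows "crosses (g ` C) (g ` D)"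
proof -
  note inj = rel_aut_inj[OF g]
  have "g ` C \<inter> g ` D = g ` (C \<inter> D)" "g ` C - g ` D = g ` (C - D)" "g ` D - g ` C = g ` (D - C)"
    "V - (g ` C \<union> g ` D) = g ` (V - (C \<union> D))"
    using sub rel_aut_image[OF g]
    by (simp_all add: inj_on_image_Int[OF inj] inj_on_image_set_diff[OF inj] image_Un
        Diff_subset_conv le_supI2)
  then show ?thesis using cross by (simp add: crosses_def)
qed

lemma rel_aut_card_crossing_cuts_le:
  assumes g: "rel_aut V R g" and C: "C \<in> min_cuts"
  shows "card (crossing_cuts C) \<le> card (crossing_cuts (g ` C))"
proof (rule card_inj_on_le)
  show "inj_on (image g) (crossing_cuts C)"
    using rel_aut_inj[OF g] unfolding crossing_cuts_def
    by (intro inj_onI) (metis (no_types, lifting) inj_on_image_eq_iff min_cuts_subset mem_Collect_eq)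
  show "image g ` crossing_cuts C \<subseteq> crossing_cuts (g ` C)"
    using rel_aut_crosses[OF g] rel_aut_min_cuts[OF g] C min_cuts_subset
    by (auto simp: crossing_cuts_def)
  show "finite (crossing_cuts (g ` C))"
    by (intro finite_crossing_cuts rel_aut_min_cuts g C)
qed

lemma rel_aut_optimal_cuts:
  assumes g: "rel_aut V R g" and C: "C \<in> optimal_cuts" shows "g ` C \<in> optimal_cuts"
proof -
  have min: "C \<in> min_cuts" by (rule optimal_cuts_min_cuts[OF C])
  have gmin: "g ` C \<in> min_cuts" by (rule rel_aut_min_cuts[OF g min])
  have "card (crossing_cuts (g ` C)) \<le> card (crossing_cuts C)"
    using rel_aut_card_crossing_cuts_le[OF rel_aut_inv_into[OF g] gmin]
      rel_aut_image_inverse(1)[OF g min_cuts_subset[OF min]] by simp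
  then show ?thesis using C gmin by (auto simp: optimal_cuts_def intro: order_trans)
qed

end

section \<open>Digraphs, paths and automorphisms\<close>

definition ugraph :: "'a dg \<Rightarrow> ('a \<times> 'a) set" where
  "ugraph D = {(x, y). uadj D x y}"

definition path_between :: "('a \<times> 'a) set \<Rightarrow> 'a \<Rightarrow> 'a \<Rightarrow> 'a list \<Rightarrow> bool" where
  "path_between R x y xs \<longleftrightarrow> xs \<noteq> [] \<and> distinct xs \<and> hd xs = x \<and> last xs = y
     \<and> successively (\<lambda>u v. (u, v) \<in> R) xs"

lemma rtrancl_path_between:
  assumes "(x, y) \<in> R\<^sup>*" obtains xs where "path_between R x y xs"
proof -
  have "\<exists>xs. path_between R x y xs"
    using assms
  proof (induction rule: converse_rtrancl_induct)
    case base
    show ?case by (rule exI[of _ "[y]"]) (simp add: path_between_def)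
  next
    case (step x x')
    then obtain xs where xs: "path_between R x' y xs" by blast
    show ?case
    proof (cases "x \<in> set xs")
      case False
      then have "path_between R x y (x # xs)"
        using xs step.hyps(1) by (cases xs) (auto simp: path_between_def)
      then show ?thesis by blast
    next
      case True
      then obtain ys zs where "xs = ys @ x # zs" by (meson split_list)
      then have "path_between R x y (x # zs)"
        using xs by (auto simp: path_between_def successively_append_iff)
      then show ?thesis by blast
    qed
  qed
  then show ?thesis using that by blast
qed

lemma successively_restrict:
  assumes "successively (\<lambda>u v. (u, v) \<in> R \<inter> S \<times> S) xs" "xs \<noteq> []" "hd xs \<in> S"
  shows "set xs \<subseteq> S \<and> successively (\<lambda>u v. (u, v) \<in> R) xs"
  using assms by (induction xs rule: induct_list012) auto

lemma component_path:
  assumes "y \<in> component R S x" "x \<in> S"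
  obtains xs where "path_between R x y xs" "set xs \<subseteq> S"
proof -
  have "(x, y) \<in> (R \<inter> S \<times> S)\<^sup>*" using assms(1) by (simp add: component_def)
  then obtain xs where "path_between (R \<inter> S \<times> S) x y xs" by (rule rtrancl_path_between)
  then show ?thesis using successively_restrict[of R S xs] assms(2) that
    by (auto simp: path_between_def)
qed

lemma connected_on_path:
  assumes "connected_on R S" "x \<in> S" "y \<in> S"
  obtains xs where "path_between R x y xs" "set xs \<subseteq> S"
  using component_path connected_on_component assms by metis

lemma sym_ugraph: "sym (ugraph D)"
  by (auto simp: ugraph_def sym_def uadj_def)

lemma uadj_commute: "uadj D x y \<longleftrightarrow> uadj D y x"
  by (auto simp: uadj_def)

lemma ugraph_sub: "wf_digraph D \<Longrightarrow> ugraph D \<subseteq> verts D \<times> verts D"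
  by (auto simp: ugraph_def uadj_def wf_digraph_def)

lemma uadj_in_verts: "wf_digraph D \<Longrightarrow> uadj D x y \<Longrightarrow> x \<in> verts D \<and> y \<in> verts D"
  by (auto simp: uadj_def wf_digraph_def)

lemma arcs_in_verts: "wf_digraph D \<Longrightarrow> (x, y) \<in> arcs D \<Longrightarrow> x \<in> verts D \<and> y \<in> verts D"
  by (auto simp: wf_digraph_def)

lemma finite_ugraph_nbrs:
  assumes "wf_digraph D" "locally_finite D" shows "finite {w. uadj D v w}"
proof -
  have "{w. uadj D v w} = out_nbrs D v \<union> in_nbrs D v" by (auto simp: uadj_def out_nbrs_def in_nbrs_def)
  moreover have "{w. uadj D v w} = {}" if "v \<notin> verts D"
    using assms(1) that by (auto simp: uadj_def wf_digraph_def)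
  ultimately show ?thesis using assms(2) by (cases "v \<in> verts D") (auto simp: locally_finite_def)
qed

lemma uconnected_iff: "uconnected D \<longleftrightarrow> verts D \<noteq> {} \<and> connected_on (ugraph D) (verts D)"
proof -
  have "{(u, v). u \<in> verts D \<and> v \<in> verts D \<and> uadj D u v} = ugraph D \<inter> verts D \<times> verts D"
    by (auto simp: ugraph_def)
  then show ?thesis by (simp add: uconnected_def connected_on_def)
qed

lemma connected_graph_ugraph:
  "wf_digraph D \<Longrightarrow> uconnected D \<Longrightarrow> connected_graph (verts D) (ugraph D)"
  by (simp add: connected_graph_def sym_ugraph ugraph_sub uconnected_iff)

lemma verts_induced [simp]: "verts (induced D S) = S"
  and arcs_induced: "arcs (induced D S) = arcs D \<inter> S \<times> S"
  by (auto simp: induced_def)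

lemma uadj_induced: "uadj (induced D S) x y \<longleftrightarrow> uadj D x y \<and> x \<in> S \<and> y \<in> S"
  by (auto simp: uadj_def arcs_induced)

lemma uconnected_induced_iff:
  "uconnected (induced D S) \<longleftrightarrow> S \<noteq> {} \<and> connected_on (ugraph D) S"
proof -
  have "ugraph (induced D S) \<inter> S \<times> S = ugraph D \<inter> S \<times> S"
    by (auto simp: ugraph_def uadj_induced)
  then show ?thesis by (simp add: uconnected_iff connected_on_def)
qed

lemma connected_on_list:
  assumes "sym R" "\<And>i. 0 < i \<Longrightarrow> i < length xs \<Longrightarrow> \<exists>j<i. (xs ! j, xs ! i) \<in> R"
  shows "connected_on R (set xs)"
proof (cases "xs = []")
  case False
  have "(xs ! 0, xs ! i) \<in> (R \<inter> set xs \<times> set xs)\<^sup>*" if "i < length xs" for i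
    using that
  proof (induction i rule: less_induct)
    case (less i)
    show ?case
    proof (cases "i = 0")
      case False
      then obtain j where j: "j < i" "(xs ! j, xs ! i) \<in> R" using assms(2) less.prems by blast
      then have "(xs ! 0, xs ! j) \<in> (R \<inter> set xs \<times> set xs)\<^sup>*" using less by simp
      then show ?thesis by (rule rtrancl_into_rtrancl) (use j less.prems in simp)
    qed simp
  qed
  then show ?thesis using assms(1) False
    by (intro connected_on_from[of R "xs ! 0"]) (auto simp: in_set_conv_nth)
qed (simp add: connected_on_def)

lemma automorphism_iff_rel_aut: "automorphism g D \<longleftrightarrow> rel_aut (verts D) (arcs D) g"
  by (simp add: automorphism_def dg_iso_def rel_aut_def)

lemma automorphism_bij: "automorphism g D \<Longrightarrow> bij_betw g (verts D) (verts D)"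
  by (simp add: automorphism_def dg_iso_def)

lemma automorphism_arcs:
  "automorphism g D \<Longrightarrow> x \<in> verts D \<Longrightarrow> y \<in> verts D \<Longrightarrow> (g x, g y) \<in> arcs D \<longleftrightarrow> (x, y) \<in> arcs D"
  by (simp add: automorphism_def dg_iso_def)

lemma automorphism_uadj:
  "automorphism g D \<Longrightarrow> x \<in> verts D \<Longrightarrow> y \<in> verts D \<Longrightarrow> uadj D (g x) (g y) \<longleftrightarrow> uadj D x y"
  by (simp add: uadj_def automorphism_arcs)

lemma automorphism_rel_aut_ugraph: "automorphism g D \<Longrightarrow> rel_aut (verts D) (ugraph D) g"
  by (simp add: rel_aut_def automorphism_bij automorphism_uadj ugraph_def)

lemma automorphism_inv: "automorphism g D \<Longrightarrow> automorphism (inv_into (verts D) g) D"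
  by (simp add: automorphism_iff_rel_aut rel_aut_inv_into)

lemma automorphism_out_nbrs:
  assumes "wf_digraph D" "automorphism g D" "x \<in> verts D"
  shows "g ` out_nbrs D x = out_nbrs D (g x)"
  using rel_aut_Image[of "verts D" "arcs D" g x] assms
  by (simp add: automorphism_iff_rel_aut wf_digraph_def out_nbrs_def Image_singleton)

lemma distinct_map_exists:
  assumes "distinct xs" "length ys = length xs" obtains f where "map f xs = ys"
proof
  show "map (\<lambda>z. the (map_of (zip xs ys) z)) xs = ys"
    using assms by (intro nth_equalityI) (simp_all add: map_of_zip_nth)
qed

lemma homogeneous_list:
  assumes hom: "connected_homogeneous D"
    and xs: "distinct xs" "set xs \<subseteq> verts D" "xs \<noteq> []"
    and ys: "distinct ys" "set ys \<subseteq> verts D" "length ys = length xs"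
    and conn: "\<And>i. 0 < i \<Longrightarrow> i < length xs \<Longrightarrow> \<exists>j<i. uadj D (xs ! j) (xs ! i)"
    and iso: "\<And>i j. i < length xs \<Longrightarrow> j < length xs \<Longrightarrow>
               (xs ! i, xs ! j) \<in> arcs D \<longleftrightarrow> (ys ! i, ys ! j) \<in> arcs D"
  shows "\<exists>g. automorphism g D \<and> map g xs = ys"
proof -
  obtain f where "map f xs = ys" using distinct_map_exists xs(1) ys(3) by metis
  then have f: "f (xs ! i) = ys ! i" if "i < length xs" for i using that by (metis nth_map)
  have conn': "\<And>i. 0 < i \<Longrightarrow> i < length ys \<Longrightarrow> \<exists>j<i. uadj D (ys ! j) (ys ! i)"
    using conn iso ys(3) unfolding uadj_def by (metis less_trans)
  have bij: "bij_betw f (set xs) (set ys)"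
  proof (rule bij_betw_imageI)
    show "inj_on f (set xs)"
      using f ys by (auto intro!: inj_onI simp: in_set_conv_nth nth_eq_iff_index_eq)
    show "f ` set xs = set ys"
      using f ys(3) by (force simp: in_set_conv_nth image_iff)
  qed
  have arcs: "(x, y) \<in> arcs D \<longleftrightarrow> (f x, f y) \<in> arcs D" if "x \<in> set xs" "y \<in> set xs" for x y
    using that f iso by (auto simp: in_set_conv_nth)
  have "dg_iso f (induced D (set xs)) (induced D (set ys))"
    using bij arcs bij_betwE[OF bij] by (auto simp: dg_iso_def arcs_induced)
  moreover have "connected_on (ugraph D) (set xs)" "connected_on (ugraph D) (set ys)"
    using conn conn' by (intro connected_on_list sym_ugraph; simp add: ugraph_def)+
  ultimately obtain g where g: "automorphism g D" "\<forall>x\<in>set xs. g x = f x"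
    using hom xs ys unfolding connected_homogeneous_def uconnected_induced_iff
    by (metis finite_set length_0_conv set_empty)
  have "map g xs = ys" using g f ys by (intro nth_equalityI) auto
  then show ?thesis using g by blast
qed

section \<open>Cycles and non-backtracking walks\<close>

definition is_cycle :: "'a dg \<Rightarrow> 'a list \<Rightarrow> bool" where
  "is_cycle D xs \<longleftrightarrow> length xs \<ge> 3 \<and> distinct xs \<and> successively (uadj D) xs \<and> uadj D (last xs) (hd xs)"

lemma is_cycle_next_adj:
  assumes "is_cycle D xs" "i < length xs"
  shows "uadj D (xs ! i) (xs ! (Suc i mod length xs))"
proof (cases "Suc i < length xs")
  case True
  then show ?thesis using assms(1) by (simp add: is_cycle_def successively_conv_nth)
next
  case False
  then have "i = length xs - 1" "xs \<noteq> []" "Suc i = length xs" using assms by auto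
  then show ?thesis using assms(1) by (simp add: is_cycle_def last_conv_nth hd_conv_nth)
qed

lemma is_cycle_snoc_iff:
  "is_cycle D (xs @ [v]) \<longleftrightarrow> 2 \<le> length xs \<and> distinct xs \<and> v \<notin> set xs \<and> successively (uadj D) xs
     \<and> uadj D (last xs) v \<and> uadj D v (hd xs)"
  unfolding is_cycle_def successively_append_iff by (cases "xs = []") auto

lemma is_cycle_rotate: "is_cycle D (x # xs) \<Longrightarrow> is_cycle D (xs @ [x])"
  unfolding is_cycle_snoc_iff by (cases xs) (auto simp: is_cycle_def)

lemma cycle_index_pred:
  assumes "3 \<le> n" "k < n" obtains i where "i < n" "Suc i mod n = k" "i \<noteq> Suc k mod n"
proof
  show "(if k = 0 then n - 1 else k - 1) < n" "Suc (if k = 0 then n - 1 else k - 1) mod n = k"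
    "(if k = 0 then n - 1 else k - 1) \<noteq> Suc k mod n"
    using assms by (auto simp: mod_Suc)
qed

lemma is_cycle_two_nbrs:
  assumes "is_cycle D xs" "v \<in> set xs"
  obtains a b where "a \<in> set xs" "b \<in> set xs" "a \<noteq> b" "uadj D v a" "uadj D v b"
proof -
  let ?n = "length xs"
  have n: "?n \<ge> 3" and d: "distinct xs" using assms(1) by (auto simp: is_cycle_def)
  obtain k where k: "k < ?n" "v = xs ! k" using assms(2) by (auto simp: in_set_conv_nth)
  obtain i where i: "i < ?n" "Suc i mod ?n = k" "i \<noteq> Suc k mod ?n" by (rule cycle_index_pred[OF n k(1)])
  have lt: "Suc k mod ?n < ?n" using n by (intro mod_less_divisor) linarith
  have "xs ! i \<noteq> xs ! (Suc k mod ?n)" using i lt d by (simp add: nth_eq_iff_index_eq)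
  moreover have "uadj D v (xs ! (Suc k mod ?n))" using is_cycle_next_adj[OF assms(1) k(1)] k(2) by simp
  moreover have "uadj D v (xs ! i)"
    using is_cycle_next_adj[OF assms(1) i(1)] i(2) k(2) by (simp add: uadj_commute)
  ultimately show ?thesis using that i(1) lt by (meson nth_mem)
qed

lemma is_cycle_in_verts:
  assumes "ugraph D \<subseteq> verts D \<times> verts D" "is_cycle D xs" shows "set xs \<subseteq> verts D"
proof
  fix v assume "v \<in> set xs"
  then obtain a where "uadj D v a" by (rule is_cycle_two_nbrs[OF assms(2)])
  then show "v \<in> verts D" using assms(1) by (auto simp: ugraph_def)
qed

lemma uacyclic_iff:
  assumes "ugraph D \<subseteq> verts D \<times> verts D" shows "uacyclic D \<longleftrightarrow> (\<nexists>xs. is_cycle D xs)"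
  using is_cycle_in_verts[OF assms]
  unfolding uacyclic_def is_cycle_def successively_conv_nth by blast

lemma is_cycle_through:
  assumes "(s, u) \<in> (ugraph D \<inter> W \<times> W)\<^sup>*" "s \<in> W" "s \<noteq> u" "v \<notin> W" "uadj D s v" "uadj D u v"
  obtains xs where "is_cycle D (xs @ [v])" "set xs \<subseteq> W" "s \<in> set xs" "u \<in> set xs"
proof -
  obtain xs where path: "path_between (ugraph D) s u xs" "set xs \<subseteq> W"
    using component_path assms(1,2) unfolding component_def by (metis mem_Collect_eq)
  then have xs: "xs \<noteq> []" "distinct xs" "hd xs = s" "last xs = u" "successively (uadj D) xs"
    by (auto simp: path_between_def ugraph_def)
  have "xs \<noteq> [s]" using xs(4) assms(3) by auto
  then have "2 \<le> length xs" using xs(1,3) by (cases xs; cases "tl xs") auto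
  then have "is_cycle D (xs @ [v])"
    using xs path(2) assms(4-6) by (auto simp: is_cycle_snoc_iff uadj_commute[of D v])
  then show ?thesis using that path(2) xs(3,4) hd_in_set[OF xs(1)] last_in_set[OF xs(1)] by auto
qed

fun non_backtracking :: "'a list \<Rightarrow> bool" where
  "non_backtracking (x # y # z # zs) \<longleftrightarrow> x \<noteq> z \<and> non_backtracking (y # z # zs)"
| "non_backtracking _ \<longleftrightarrow> True"

lemma non_backtracking_distinct: "distinct xs \<Longrightarrow> non_backtracking xs"
  by (induction xs rule: non_backtracking.induct) auto

lemma non_backtracking_snoc:
  "non_backtracking (xs @ [y]) \<Longrightarrow> (xs \<noteq> [] \<Longrightarrow> last xs \<noteq> z) \<Longrightarrow> non_backtracking (xs @ [y, z])"
  by (induction xs rule: non_backtracking.induct) auto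

lemma non_backtracking_closed_cycle:
  assumes "is_cycle D (x # xs)" shows "non_backtracking (x # xs @ [x])"
proof -
  obtain y ys z where xs: "xs = y # ys @ [z]"
    using assms unfolding is_cycle_def
    by (cases xs; cases "tl xs" rule: rev_cases) auto
  have "non_backtracking ((x # y # ys) @ [z])"
    using assms xs by (intro non_backtracking_distinct) (simp add: is_cycle_def)
  then have "non_backtracking ((x # y # ys) @ [z, x])"
    by (rule non_backtracking_snoc) (use assms xs in \<open>auto simp: is_cycle_def split: if_splits\<close>)
  then show ?thesis using xs by simp
qed

section \<open>The reachability relation as a closure\<close>

definition share_end :: "'a dg \<Rightarrow> (('a \<times> 'a) \<times> ('a \<times> 'a)) set" where
  "share_end D = {(e, e'). e \<in> arcs D \<and> e' \<in> arcs D \<and> (fst e = fst e' \<or> snd e = snd e')}"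

lemma sym_share_end: "sym (share_end D)"
  by (auto simp: share_end_def sym_def)

lemma share_end_rtrancl_arcs: "(e, e') \<in> (share_end D)\<^sup>* \<Longrightarrow> e \<in> arcs D \<Longrightarrow> e' \<in> arcs D"
  by (induction rule: rtrancl_induct) (auto simp: share_end_def)

lemma step_arc_in_arcs:
  assumes "alt_walk D xs" "Suc i < length xs" shows "step_arc D xs i \<in> arcs D"
  using assms by (auto simp: alt_walk_def step_arc_def fwd_step_def uadj_def)

lemma alt_walk_share_end:
  assumes "alt_walk D xs" "Suc i < length xs"
  shows "(step_arc D xs 0, step_arc D xs i) \<in> (share_end D)\<^sup>*"
  using assms(2)
proof (induction i)
  case (Suc i)
  have "(step_arc D xs i, step_arc D xs (Suc i)) \<in> share_end D"
    using step_arc_in_arcs[OF assms(1), of i] step_arc_in_arcs[OF assms(1), of "Suc i"] Suc.prems assms(1)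
    by (auto simp: share_end_def step_arc_def alt_walk_def)
  then show ?case using Suc by (meson Suc_lessD rtrancl.rtrancl_into_rtrancl)
qed simp

definition alt_reaches :: "'a dg \<Rightarrow> 'a \<times> 'a \<Rightarrow> bool \<Rightarrow> 'a \<times> 'a \<Rightarrow> bool" where
  "alt_reaches D e forward e' \<longleftrightarrow> (\<exists>xs n. alt_walk D xs \<and> length xs = Suc (Suc n)
     \<and> step_arc D xs 0 = e \<and> step_arc D xs n = e' \<and> (fwd_step D xs n \<longleftrightarrow> forward))"

lemma alt_walk_snoc:
  assumes xs: "alt_walk D xs" and n: "length xs = Suc (Suc n)"
    and z: "uadj D (xs ! Suc n) z" "(xs ! Suc n, z) \<in> arcs D \<longleftrightarrow> \<not> fwd_step D xs n"
  shows "alt_walk D (xs @ [z])"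
  unfolding alt_walk_def
proof (intro conjI allI impI)
  show "length (xs @ [z]) \<ge> 2" using n by simp
  fix i
  have prefix: "fwd_step D (xs @ [z]) j = fwd_step D xs j" if "j \<le> n" for j
    using that n by (simp add: fwd_step_def nth_append)
  {
    assume "Suc i < length (xs @ [z])"
    then show "uadj D ((xs @ [z]) ! i) ((xs @ [z]) ! Suc i)"
      using xs z(1) n by (cases "i = Suc n") (auto simp: alt_walk_def nth_append)
  next
    assume i: "Suc (Suc i) < length (xs @ [z])"
    show "fwd_step D (xs @ [z]) i \<longleftrightarrow> \<not> fwd_step D (xs @ [z]) (Suc i)"
    proof (cases "i = n")
      case True
      moreover have "fwd_step D (xs @ [z]) (Suc n) \<longleftrightarrow> (xs ! Suc n, z) \<in> arcs D"
        using n by (simp add: fwd_step_def nth_append)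
      ultimately show ?thesis using z(2) prefix[of n] by simp
    next
      case False
      then have "Suc (Suc i) < length xs" using i n by simp
      then show ?thesis using xs prefix[of i] prefix[of "Suc i"] n by (simp add: alt_walk_def)
    qed
  }
qed

lemma alt_reaches_snoc:
  assumes wf: "wf_digraph D" and f: "alt_reaches D e forward f"
    and f': "f' \<in> arcs D" "if forward then snd f' = snd f else fst f' = fst f"
  shows "alt_reaches D e (\<not> forward) f'"
proof -
  obtain xs n where xs: "alt_walk D xs" "length xs = Suc (Suc n)" "step_arc D xs 0 = e"
    "step_arc D xs n = f" "fwd_step D xs n \<longleftrightarrow> forward"
    using f by (auto simp: alt_reaches_def)
  define z where "z = (if forward then fst f' else snd f')"
  have asym: "(snd f', fst f') \<notin> arcs D" using f'(1) wf by (auto simp: wf_digraph_def)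
  have turn: "xs ! Suc n = (if forward then snd f' else fst f')"
    using xs(4,5) f'(2) by (auto simp: step_arc_def split: if_splits)
  then have "uadj D (xs ! Suc n) z" "(xs ! Suc n, z) \<in> arcs D \<longleftrightarrow> \<not> fwd_step D xs n"
    using f'(1) asym xs(5) by (auto simp: z_def uadj_def)
  then have "alt_walk D (xs @ [z])" by (rule alt_walk_snoc[OF xs(1,2)])
  moreover have "fwd_step D (xs @ [z]) 0 = fwd_step D xs 0"
    using xs(2) by (simp add: fwd_step_def nth_append)
  then have "step_arc D (xs @ [z]) 0 = e"
    unfolding xs(3)[symmetric] using xs(2) by (simp add: step_arc_def nth_append)
  moreover have "(xs @ [z]) ! Suc n = xs ! Suc n" "(xs @ [z]) ! Suc (Suc n) = z"
    using xs(2) by (simp_all add: nth_append)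
  then have "fwd_step D (xs @ [z]) (Suc n) \<longleftrightarrow> \<not> forward" "step_arc D (xs @ [z]) (Suc n) = f'"
    using turn f'(1) asym by (simp_all add: step_arc_def fwd_step_def z_def)
  ultimately show ?thesis
    unfolding alt_reaches_def using xs(2) by (intro exI[of _ "xs @ [z]"] exI[of _ "Suc n"]) simp
qed

lemma alt_reaches_refl:
  assumes "wf_digraph D" "e \<in> arcs D" shows "alt_reaches D e forward e"
proof -
  obtain x y where e: "e = (x, y)" by (cases e)
  moreover have "(y, x) \<notin> arcs D" using assms e by (auto simp: wf_digraph_def)
  ultimately show ?thesis unfolding alt_reaches_def using assms(2)
    by (intro exI[of _ "if forward then [x, y] else [y, x]"] exI[of _ 0])
      (auto simp: alt_walk_def step_arc_def fwd_step_def uadj_def)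
qed

lemma share_end_alt_reaches:
  assumes "wf_digraph D" "e \<in> arcs D" "(e, e') \<in> (share_end D)\<^sup>*"
  shows "alt_reaches D e forward e'"
  using assms(3)
proof (induction arbitrary: forward rule: rtrancl_induct)
  case base
  show ?case by (rule alt_reaches_refl[OF assms(1,2)])
next
  case (step f f')
  have arc: "f' \<in> arcs D" and "fst f' = fst f \<or> snd f' = snd f"
    using step.hyps(2) by (auto simp: share_end_def)
  then obtain b where b: "alt_reaches D e b f'"
    using alt_reaches_snoc[OF assms(1) step.IH[of True] arc]
      alt_reaches_snoc[OF assms(1) step.IH[of False] arc] by auto
  then have "alt_reaches D e (\<not> b) f'" using alt_reaches_snoc[OF assms(1) b arc] by simp
  with b show ?case by (cases "forward = b") auto
qed

lemma rel_A_iff: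
  assumes wf: "wf_digraph D"
  shows "rel_A D e e' \<longleftrightarrow> e \<in> arcs D \<and> (e, e') \<in> (share_end D)\<^sup>*"
proof
  assume "rel_A D e e'"
  then obtain xs where xs: "alt_walk D xs" "step_arc D xs 0 = e" "step_arc D xs (length xs - 2) = e'"
    by (auto simp: rel_A_def)
  then have "length xs \<ge> 2" by (simp add: alt_walk_def)
  then show "e \<in> arcs D \<and> (e, e') \<in> (share_end D)\<^sup>*"
    using step_arc_in_arcs[OF xs(1), of 0] alt_walk_share_end[OF xs(1), of "length xs - 2"] xs by auto
next
  assume "e \<in> arcs D \<and> (e, e') \<in> (share_end D)\<^sup>*"
  then have "alt_reaches D e True e'" using share_end_alt_reaches[OF wf] by blast
  then obtain xs n where "alt_walk D xs" "length xs = Suc (Suc n)" "step_arc D xs 0 = e"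
    "step_arc D xs n = e'" by (auto simp: alt_reaches_def)
  then show "rel_A D e e'" unfolding rel_A_def by (intro exI[of _ xs]) simp
qed

lemma A_class_iff:
  "wf_digraph D \<Longrightarrow> e \<in> arcs D \<Longrightarrow> e' \<in> A_class D e \<longleftrightarrow> (e, e') \<in> (share_end D)\<^sup>*"
  by (simp add: A_class_def rel_A_iff)

section \<open>Reversal\<close>

definition rev_dg :: "'a dg \<Rightarrow> 'a dg" where
  "rev_dg D = \<lparr>verts = verts D, arcs = (arcs D)\<inverse>\<rparr>"

lemma verts_rev [simp]: "verts (rev_dg D) = verts D"
  and arcs_rev [simp]: "arcs (rev_dg D) = (arcs D)\<inverse>"
  by (auto simp: rev_dg_def)

lemma uadj_rev [simp]: "uadj (rev_dg D) = uadj D"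
  by (auto simp: uadj_def fun_eq_iff)

lemma ugraph_rev [simp]: "ugraph (rev_dg D) = ugraph D"
  by (simp add: ugraph_def)

lemma induced_rev: "induced (rev_dg D) S = rev_dg (induced D S)"
  by (auto simp: induced_def rev_dg_def)

lemma wf_rev: "wf_digraph D \<Longrightarrow> wf_digraph (rev_dg D)"
  by (auto simp: wf_digraph_def)

lemma uconnected_rev: "uconnected (rev_dg D) \<longleftrightarrow> uconnected D"
  by (simp add: uconnected_def)

lemma locally_finite_rev: "locally_finite (rev_dg D) \<longleftrightarrow> locally_finite D"
  by (auto simp: locally_finite_def out_nbrs_def in_nbrs_def)

lemma triangle_free_rev: "triangle_free (rev_dg D) \<longleftrightarrow> triangle_free D"
  by (simp add: triangle_free_def)

lemma is_ray_rev: "is_ray (rev_dg D) r \<longleftrightarrow> is_ray D r"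
  by (simp add: is_ray_def)

lemma equiv_rays_rev: "equiv_rays (rev_dg D) r s \<longleftrightarrow> equiv_rays D r s"
  by (simp add: equiv_rays_def is_ray_rev)

lemma dg_iso_rev: "dg_iso f (rev_dg D) (rev_dg H) \<longleftrightarrow> dg_iso f D H"
  by (auto simp: dg_iso_def)

lemma automorphism_rev: "automorphism g (rev_dg D) \<longleftrightarrow> automorphism g D"
  by (simp add: automorphism_def dg_iso_rev)

lemma connected_homogeneous_rev: "connected_homogeneous (rev_dg D) \<longleftrightarrow> connected_homogeneous D"
  by (simp add: connected_homogeneous_def automorphism_rev induced_rev dg_iso_rev uconnected_rev)

lemma is_tree_rev: "is_tree (rev_dg D) \<longleftrightarrow> is_tree D"
  by (simp add: is_tree_def uconnected_rev uacyclic_def)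

lemma desc_rev: "desc (rev_dg D) u = anc D u"
  by (simp add: desc_def anc_def rtrancl_converse)

section \<open>Inequivalent rays are separated by a finite cut\<close>

definition separable :: "'a dg \<Rightarrow> (nat \<Rightarrow> 'a) \<Rightarrow> (nat \<Rightarrow> 'a) \<Rightarrow> bool" where
  "separable D r s \<longleftrightarrow> (\<exists>C. C \<subseteq> verts D \<and> finite (boundary (ugraph D) C)
     \<and> (\<exists>n. \<forall>i\<ge>n. r i \<in> C) \<and> (\<exists>n. \<forall>i\<ge>n. s i \<notin> C))"

lemma separable_commute:
  assumes wf: "wf_digraph D" and rays: "is_ray D r" "is_ray D s" and sep: "separable D s r"
  shows "separable D r s"
proof -
  from sep obtain C m n where C: "C \<subseteq> verts D" "finite (boundary (ugraph D) C)"
    "\<forall>i\<ge>n. s i \<in> C" "\<forall>i\<ge>m. r i \<notin> C" by (auto simp: separable_def)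
  have "boundary (ugraph D) (verts D - C) = (boundary (ugraph D) C)\<inverse>"
    using ugraph_sub[OF wf] C(1) by (auto simp: boundary_def ugraph_def uadj_commute)
  then have "finite (boundary (ugraph D) (verts D - C))" using C(2) by simp
  moreover have "\<forall>i\<ge>m. r i \<in> verts D - C" using C(4) rays by (auto simp: is_ray_def)
  moreover have "\<forall>i\<ge>n. s i \<notin> verts D - C" using C(3) by auto
  ultimately show ?thesis unfolding separable_def by (intro exI[of _ "verts D - C"]) blast
qed

lemma ray_avoids_finite:
  assumes "is_ray D s" "finite F" shows "\<exists>N. \<forall>k\<ge>N. s k \<notin> F"
proof -
  have "finite {k. s k \<in> F}"
    using assms by (auto simp: is_ray_def intro!: finite_imageD[of s "{k. s k \<in> F}"]
        intro: finite_subset[of _ F] inj_on_subset)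
  then obtain N where "\<forall>k\<in>{k. s k \<in> F}. k < N" using finite_nat_set_iff_bounded by auto
  then show ?thesis by (intro exI[of _ N]) (auto simp: not_le[symmetric])
qed

lemma finite_boundary_cofinite:
  assumes "wf_digraph D" "locally_finite D" "finite F"
  shows "finite (boundary (ugraph D) (verts D - F))"
proof (rule finite_subset)
  show "boundary (ugraph D) (verts D - F) \<subseteq> (\<Union>v\<in>F. {w. uadj D v w} \<times> {v})"
    using ugraph_sub[OF assms(1)] by (auto simp: boundary_def ugraph_def uadj_commute)
  show "finite (\<Union>v\<in>F. {w. uadj D v w} \<times> {v})"
    using assms(3) finite_ugraph_nbrs[OF assms(1,2)] by simp
qed

lemma ray_tail_component:
  assumes r: "is_ray D r" and tail: "\<forall>k\<ge>i. r k \<in> S" and k: "k \<ge> i"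
  shows "r k \<in> component (ugraph D) S (r i)"
  using k
proof (induction k rule: dec_induct)
  case (step k)
  then show ?case
    using r tail by (intro component_step[OF step.IH]) (auto simp: is_ray_def ugraph_def)
qed simp

lemma unseparated_ray_enters_component:
  assumes wf: "wf_digraph D" and lf: "locally_finite D"
    and r: "is_ray D r" and nsep: "\<not> separable D r s"
    and F: "finite F" and tail: "\<forall>k\<ge>i. r k \<notin> F"
  obtains k where "k \<ge> n" "s k \<in> component (ugraph D) (verts D - F) (r i)"
proof -
  let ?K = "component (ugraph D) (verts D - F) (r i)"
  have tail': "\<forall>k\<ge>i. r k \<in> verts D - F" using r tail by (auto simp: is_ray_def)
  then have "finite (boundary (ugraph D) ?K)"
    using finite_subset[OF boundary_component_subset finite_boundary_cofinite[OF wf lf F]] by blast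
  moreover have "?K \<subseteq> verts D" using component_subset[of "r i" "verts D - F"] tail' by blast
  ultimately show ?thesis
    using nsep ray_tail_component[OF r tail'] that unfolding separable_def by meson
qed

lemma path_upto_last_ray_vertex:
  assumes s: "is_ray D s" and P: "path_between R a (s k) P"
  obtains Q j where "path_between R a (s j) Q" "set Q \<subseteq> set P" "j \<ge> k" "\<forall>m>j. s m \<notin> set P"
proof -
  obtain M where M: "\<forall>m\<ge>M. s m \<notin> set P" using ray_avoids_finite[OF s, of "set P"] by auto
  define J where "J = {m. s m \<in> set P}"
  have "finite J" using M by (intro finite_subset[of J "{..<M}"]) (auto simp: J_def not_le[symmetric])
  moreover have "k \<in> J" using P last_in_set[of P] by (auto simp: J_def path_between_def)
  moreover define j where "j = Max J"
  ultimately have "j \<in> J" "k \<le> j" "\<forall>m\<in>J. m \<le> j" by (auto intro: Max_in)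
  then have j: "s j \<in> set P" "k \<le> j" "\<forall>m>j. s m \<notin> set P" by (auto simp: J_def not_le[symmetric])
  then obtain Q Q' where Q: "P = Q @ s j # Q'" by (meson split_list)
  have "path_between R a (s j) (Q @ [s j])"
    using P Q by (cases Q) (auto simp: path_between_def successively_append_iff successively_Cons
        hd_append split: if_splits)
  moreover have "set (Q @ [s j]) \<subseteq> set P" using Q by auto
  ultimately show ?thesis using that j by blast
qed

definition path_ending_on_ray :: "'a dg \<Rightarrow> (nat \<Rightarrow> 'a) \<Rightarrow> 'a list \<Rightarrow> nat \<Rightarrow> bool" where
  "path_ending_on_ray D r p i \<longleftrightarrow> p \<noteq> [] \<and> distinct p \<and> set p \<subseteq> verts D \<and> successively (uadj D) p
     \<and> last p = r i \<and> (\<forall>k>i. r k \<notin> set p)"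

lemma path_extends_to_unseparated_ray:
  assumes wf: "wf_digraph D" and lf: "locally_finite D"
    and r: "is_ray D r" and s: "is_ray D s" and nsep: "\<not> separable D r s"
    and p: "path_ending_on_ray D r p i"
  obtains Q j where "Q \<noteq> []" "path_ending_on_ray D s (p @ Q) j"
proof -
  let ?S = "verts D - set p"
  obtain n where n: "\<forall>k\<ge>n. s k \<notin> set p" using ray_avoids_finite[OF s, of "set p"] by auto
  have tail: "\<forall>k\<ge>Suc i. r k \<notin> set p" using p by (auto simp: path_ending_on_ray_def)
  obtain k where k: "k \<ge> n" "s k \<in> component (ugraph D) ?S (r (Suc i))"
    using unseparated_ray_enters_component[OF wf lf r nsep _ tail] by blast
  moreover have "r (Suc i) \<in> ?S" using r tail by (auto simp: is_ray_def)
  ultimately obtain P where P: "path_between (ugraph D) (r (Suc i)) (s k) P" "set P \<subseteq> ?S"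
    using component_path by metis
  obtain Q j where Q: "path_between (ugraph D) (r (Suc i)) (s j) Q" "set Q \<subseteq> set P" "j \<ge> k"
    "\<forall>m>j. s m \<notin> set P"
    by (rule path_upto_last_ray_vertex[OF s P(1)])
  have "uadj D (r i) (r (Suc i))" using r by (simp add: is_ray_def)
  moreover have "\<forall>m>j. s m \<notin> set p" using n k(1) Q(3) by simp
  ultimately have "path_ending_on_ray D s (p @ Q) j"
    using p Q P(2)
    by (auto simp: path_ending_on_ray_def path_between_def successively_append_iff ugraph_def)
  moreover have "Q \<noteq> []" using Q(1) by (simp add: path_between_def)
  ultimately show ?thesis using that by blast
qed

definition extending :: "(nat \<Rightarrow> 'a list) \<Rightarrow> bool" where
  "extending p \<longleftrightarrow> (\<forall>n. \<exists>Q. Q \<noteq> [] \<and> p (Suc n) = p n @ Q)"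

lemma extending_prefix:
  assumes "extending p" "m \<le> n"
  obtains Q where "p n = p m @ Q"
proof -
  have "\<exists>Q. p n = p m @ Q"
    using assms(2)
  proof (induction n rule: dec_induct)
    case (step n)
    then show ?case using assms(1) unfolding extending_def by (metis append_assoc)
  qed simp
  then show ?thesis using that by blast
qed

lemma extending_length:
  assumes "extending p" shows "n \<le> length (p n)"
proof (induction n)
  case (Suc n)
  obtain Q where "Q \<noteq> []" "p (Suc n) = p n @ Q" using assms unfolding extending_def by blast
  with Suc show ?case by (cases Q) auto
qed simp

lemma extending_limit:
  assumes "extending p" obtains t where "\<And>k n. k < length (p n) \<Longrightarrow> t k = p n ! k"
proof
  show "p (Suc k) ! k = p n ! k" if "k < length (p n)" for k n
  proof (cases "Suc k \<le> n")
    case True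
    then obtain Q where "p n = p (Suc k) @ Q" by (rule extending_prefix[OF assms])
    then show ?thesis using extending_length[OF assms, of "Suc k"] by (simp add: nth_append)
  next
    case False
    then have "n \<le> Suc k" by simp
    then obtain Q where "p (Suc k) = p n @ Q" by (rule extending_prefix[OF assms])
    then show ?thesis using that by (simp add: nth_append)
  qed
qed

lemma ray_through_extending_paths:
  assumes path: "\<And>n. distinct (p n)" "\<And>n. set (p n) \<subseteq> verts D" "\<And>n. successively (uadj D) (p n)"
    and ext: "extending p"
  obtains t where "is_ray D t" "\<And>n. set (p n) \<subseteq> range t"
proof -
  obtain t where t: "\<And>k n. k < length (p n) \<Longrightarrow> t k = p n ! k" by (rule extending_limit[OF ext]) blast
  have len: "k < length (p n)" if "k < n" for k n using extending_length[OF ext, of n] that by simp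
  have "is_ray D t"
    unfolding is_ray_def
  proof (intro conjI allI)
    show "inj t"
    proof (rule injI)
      fix x y assume eq: "t x = t y"
      have lt: "x < length (p (Suc (max x y)))" "y < length (p (Suc (max x y)))" using len by simp_all
      show "x = y" using eq path(1) unfolding t[OF lt(1)] t[OF lt(2)] by (simp add: nth_eq_iff_index_eq lt)
    qed
    show "range t \<subseteq> verts D"
    proof
      fix v assume "v \<in> range t"
      then obtain k where "v = p (Suc k) ! k" using t len[OF lessI] by blast
      then show "v \<in> verts D" using path(2)[of "Suc k"] len[of k "Suc k"] by auto
    qed
    fix k
    have lt: "k < length (p (Suc (Suc k)))" "Suc k < length (p (Suc (Suc k)))" using len by simp_all
    show "uadj D (t k) (t (Suc k))"
      using path(3) lt unfolding t[OF lt(1)] t[OF lt(2)] by (simp add: successively_conv_nth)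
  qed
  moreover have "set (p n) \<subseteq> range t" for n
  proof
    fix v assume "v \<in> set (p n)"
    then obtain k where "k < length (p n)" "v = p n ! k" by (auto simp: in_set_conv_nth)
    then show "v \<in> range t" using t[of k n] by (intro range_eqI[of _ _ k]) simp
  qed
  ultimately show ?thesis using that by blast
qed

lemma extending_last_inj:
  assumes "\<And>n. p n \<noteq> []" "\<And>n. distinct (p n)" and ext: "extending p"
  shows "inj (\<lambda>n. last (p n))"
proof -
  have "last (p m) \<noteq> last (p n)" if mn: "m < n" for m n
  proof -
    obtain k where k: "n = Suc k" "m \<le> k" using mn by (cases n) auto
    obtain Q where Q: "Q \<noteq> []" "p n = p k @ Q" using ext k(1) unfolding extending_def by blast
    obtain Q' where "p k = p m @ Q'" by (rule extending_prefix[OF ext k(2)])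
    then have "last (p m) \<in> set (p k)" using assms(1)[of m] by simp
    moreover have "last (p n) \<in> set Q" using Q by simp
    ultimately show ?thesis using assms(2)[of n] Q(2) by auto
  qed
  then show ?thesis by (metis injI nat_neq_iff)
qed

lemma unseparated_rays_extending_paths:
  assumes wf: "wf_digraph D" and lf: "locally_finite D"
    and r: "is_ray D r" and s: "is_ray D s" and nsep: "\<not> separable D r s"
  obtains p where "\<And>n. \<exists>i. path_ending_on_ray D (if even n then r else s) (p n) i"
    "extending p"
proof -
  have nsep': "\<not> separable D s r" using separable_commute[OF wf r s] nsep by blast
  have "\<exists>p. \<forall>n. (\<exists>i. path_ending_on_ray D (if even n then r else s) (p n) i)
      \<and> (\<exists>Q. Q \<noteq> [] \<and> p (Suc n) = p n @ Q)"
  proof (rule dependent_nat_choice)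
    have "path_ending_on_ray D r [r 0] 0"
      using r by (auto simp: path_ending_on_ray_def is_ray_def inj_eq)
    then show "\<exists>p i. path_ending_on_ray D (if even (0::nat) then r else s) p i" by auto
  next
    fix p and n :: nat assume "\<exists>i. path_ending_on_ray D (if even n then r else s) p i"
    then show "\<exists>p'. (\<exists>i. path_ending_on_ray D (if even (Suc n) then r else s) p' i)
        \<and> (\<exists>Q. Q \<noteq> [] \<and> p' = p @ Q)"
      using path_extends_to_unseparated_ray[OF wf lf r s nsep]
        path_extends_to_unseparated_ray[OF wf lf s r nsep'] by (cases "even n") (auto, metis+)
  qed
  then show ?thesis using that unfolding extending_def by blast
qed

theorem inequivalent_rays_separable:
  assumes wf: "wf_digraph D" and lf: "locally_finite D"
    and r: "is_ray D r" and s: "is_ray D s" and neq: "\<not> equiv_rays D r s"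
  shows "separable D r s"
proof (rule ccontr)
  assume "\<not> separable D r s"
  then obtain p where
    p: "\<And>n. \<exists>i. path_ending_on_ray D (if even n then r else s) (p n) i" and
    ext: "extending p"
    using unseparated_rays_extending_paths[OF wf lf r s] by blast
  have path: "p n \<noteq> []" "distinct (p n)" "set (p n) \<subseteq> verts D" "successively (uadj D) (p n)" for n
    using p[of n] by (auto simp: path_ending_on_ray_def)
  obtain t where t: "is_ray D t" "\<And>n. set (p n) \<subseteq> range t"
    using ray_through_extending_paths[OF path(2-4) ext] by blast
  have infinite: "infinite (range t \<inter> range f)"
    if f: "\<And>n. last (p (h n)) \<in> range f" and h: "inj h" for f and h :: "nat \<Rightarrow> nat"
  proof
    assume "finite (range t \<inter> range f)"
    moreover have "range (\<lambda>n. last (p (h n))) \<subseteq> range t \<inter> range f"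
      using f t(2) path(1) last_in_set by blast
    ultimately have "finite (range (\<lambda>n. last (p (h n))))" by (rule finite_subset[rotated])
    moreover have "inj (\<lambda>n. last (p (h n)))"
      using inj_compose[OF extending_last_inj[OF path(1,2) ext] h] by (simp add: comp_def)
    ultimately show False by (meson finite_imageD infinite_UNIV_nat)
  qed
  have "last (p (2 * n)) \<in> range r" "last (p (Suc (2 * n))) \<in> range s" for n
    using p[of "2 * n"] p[of "Suc (2 * n)"] by (auto simp: path_ending_on_ray_def)
  then have "infinite (range t \<inter> range r)" "infinite (range t \<inter> range s)"
    by (intro infinite[of "\<lambda>n. 2 * n"] infinite[of "\<lambda>n. Suc (2 * n)"] injI; simp)+
  with t(1) neq show False by (auto simp: equiv_rays_def)
qed

lemma separable_is_cut:
  assumes wf: "wf_digraph D" "uconnected D" and r: "is_ray D r" and s: "is_ray D s"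
    and sep: "separable D r s"
  shows "\<exists>C. connected_graph.is_cut (verts D) (ugraph D) C"
proof -
  interpret connected_graph "verts D" "ugraph D" using connected_graph_ugraph[OF wf] .
  from sep obtain C m n where C: "C \<subseteq> verts D" "finite (boundary (ugraph D) C)"
    "\<forall>i\<ge>n. r i \<in> C" "\<forall>i\<ge>m. s i \<notin> C" by (auto simp: separable_def)
  have "infinite (r ` {n..})" "infinite (s ` {m..})"
    using r s by (auto simp: is_ray_def finite_image_iff inj_on_subset infinite_Ici)
  moreover have "r ` {n..} \<subseteq> C" "s ` {m..} \<subseteq> verts D - C"
    using C s by (auto simp: is_ray_def)
  ultimately have "is_cut C" using C unfolding is_cut_def by (meson infinite_super)
  then show ?thesis by blast
qed

section \<open>Invariant nested cuts in connected-homogeneous digraphs\<close>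

locale cut_homogeneous =
  fixes D :: "'a dg" and E :: "'a set set"
  assumes wf: "wf_digraph D" and uconn: "uconnected D" and lf: "locally_finite D"
    and tf: "triangle_free D" and hom: "connected_homogeneous D"
    and E_ne: "E \<noteq> {}"
    and E_sub: "C \<in> E \<Longrightarrow> C \<subseteq> verts D"
    and E_inf: "C \<in> E \<Longrightarrow> infinite C"
    and E_conn: "C \<in> E \<Longrightarrow> connected_on (ugraph D) C"
    and E_fin: "C \<in> E \<Longrightarrow> finite (boundary (ugraph D) C)"
    and E_compl: "C \<in> E \<Longrightarrow> verts D - C \<in> E"
    and E_nested: "C \<in> E \<Longrightarrow> C' \<in> E \<Longrightarrow> C \<subseteq> C' \<or> C' \<subseteq> C \<or> C \<inter> C' = {} \<or> C \<union> C' = verts D"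
    and E_aut: "automorphism g D \<Longrightarrow> C \<in> E \<Longrightarrow> g ` C \<in> E"
    and E_sep_fin: "x \<in> verts D \<Longrightarrow> y \<in> verts D \<Longrightarrow> finite {C \<in> E. x \<in> C \<and> y \<notin> C}"

lemma cut_homogeneous_exists:
  assumes wf: "wf_digraph D" and uc: "uconnected D" and lf: "locally_finite D"
    and tf: "triangle_free D" and hom: "connected_homogeneous D" and ends: "more_than_one_end D"
  shows "\<exists>E. cut_homogeneous D E"
proof -
  interpret connected_graph "verts D" "ugraph D" using connected_graph_ugraph[OF wf uc] .
  obtain r s where rs: "is_ray D r" "is_ray D s" "\<not> equiv_rays D r s"
    using ends by (auto simp: more_than_one_end_def)
  obtain C where "is_cut C"
    using separable_is_cut[OF wf uc rs(1,2) inequivalent_rays_separable[OF wf lf rs]] by blast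
  then have ne: "optimal_cuts \<noteq> {}" by (rule optimal_cuts_exist)
  have M: "C \<in> min_cuts" if "C \<in> optimal_cuts" for C using that by (simp add: optimal_cuts_def)
  have "cut_homogeneous D optimal_cuts"
  proof
    fix C assume C: "C \<in> optimal_cuts"
    show "C \<subseteq> verts D" "infinite C" "finite (boundary (ugraph D) C)"
      using M[OF C] by (auto simp: min_cuts_def is_cut_def)
    show "connected_on (ugraph D) C" by (rule min_cut_connected[OF M[OF C]])
    show "verts D - C \<in> optimal_cuts" by (rule optimal_cuts_compl[OF C])
    fix g assume "automorphism g D"
    then show "g ` C \<in> optimal_cuts"
      using rel_aut_optimal_cuts automorphism_rel_aut_ugraph C by blast
  next
    fix C C' assume C: "C \<in> optimal_cuts" "C' \<in> optimal_cuts"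
    then have "C \<subseteq> verts D" "C' \<subseteq> verts D" using M by (auto simp: min_cuts_def is_cut_def)
    then show "C \<subseteq> C' \<or> C' \<subseteq> C \<or> C \<inter> C' = {} \<or> C \<union> C' = verts D"
      using optimal_cuts_not_crossing[OF C] by (auto simp: crosses_def)
  next
    fix x y assume "x \<in> verts D" "y \<in> verts D"
    then show "finite {C \<in> optimal_cuts. x \<in> C \<and> y \<notin> C}"
      by (rule finite_subset[rotated, OF finite_min_cuts_separating]) (auto dest: M)
  qed (use assms ne in auto)
  then show ?thesis by (rule exI)
qed

lemma card_exchange:
  assumes "finite A" "finite B" "card A = card B" "a \<in> A" "a \<notin> B"
  shows "\<exists>b\<in>B. b \<notin> A"
proof (rule ccontr)
  assume "\<not> ?thesis"
  then have "B \<subset> A" using assms by blast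
  then have "card B < card A" by (rule psubset_card_mono[OF assms(1)])
  then show False using assms by simp
qed

context cut_homogeneous
begin

lemma rev_cut_homogeneous: "cut_homogeneous (rev_dg D) E"
  by unfold_locales
    (use wf uconn lf tf hom E_ne E_sub E_inf E_conn E_fin E_compl E_nested E_aut E_sep_fin in
      \<open>simp_all add: wf_rev uconnected_rev locally_finite_rev triangle_free_rev connected_homogeneous_rev
         automorphism_rev\<close>)

lemma no_four_corners:
  assumes "C \<in> E" "C' \<in> E" "a \<in> C" "a \<in> C'" "b \<in> C" "b \<notin> C'" "c \<notin> C" "c \<in> C'"
    "d \<in> verts D" "d \<notin> C" "d \<notin> C'"
  shows False
  using E_nested[OF assms(1,2)] assms(3-) by blast

lemma arc_verts: "(x, y) \<in> arcs D \<Longrightarrow> x \<in> verts D" "(x, y) \<in> arcs D \<Longrightarrow> y \<in> verts D"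
  using wf by (auto simp: wf_digraph_def)

lemma arc_antisym: "(x, y) \<in> arcs D \<Longrightarrow> (y, x) \<notin> arcs D"
  using wf by (auto simp: wf_digraph_def)

lemma arc_irrefl: "(x, x) \<notin> arcs D"
  using wf by (auto simp: wf_digraph_def)

lemma out_nbrs_verts: "out_nbrs D x \<subseteq> verts D" and in_nbrs_verts: "in_nbrs D x \<subseteq> verts D"
  using arc_verts by (auto simp: out_nbrs_def in_nbrs_def)

lemma desc_verts: "(x, y) \<in> (arcs D)\<^sup>* \<Longrightarrow> x \<in> verts D \<Longrightarrow> y \<in> verts D"
  by (induction rule: rtrancl_induct) (auto dest: arc_verts)

lemma anc_verts: "(x, y) \<in> (arcs D)\<^sup>* \<Longrightarrow> y \<in> verts D \<Longrightarrow> x \<in> verts D"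
  by (induction rule: converse_rtrancl_induct) (auto dest: arc_verts)

lemma rtrancl_ugraph: "x \<in> verts D \<Longrightarrow> y \<in> verts D \<Longrightarrow> (x, y) \<in> (ugraph D)\<^sup>*"
  using uconn connected_on_rtrancl by (fastforce simp: uconnected_iff)

lemma no_triangle: "uadj D x y \<Longrightarrow> uadj D y z \<Longrightarrow> \<not> uadj D x z"
  using tf uadj_in_verts[OF wf] unfolding triangle_free_def by blast

lemma vertex_transitive:
  assumes "x \<in> verts D" "y \<in> verts D" shows "\<exists>g. automorphism g D \<and> g x = y"
  using homogeneous_list[OF hom, of "[x]" "[y]"] assms arc_irrefl by auto

lemma arc_transitive:
  assumes "(x, y) \<in> arcs D" "(x', y') \<in> arcs D"
  shows "\<exists>g. automorphism g D \<and> g x = x' \<and> g y = y'"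
proof -
  have "\<exists>g. automorphism g D \<and> map g [x, y] = [x', y']"
    using assms arc_verts arc_irrefl arc_antisym
    by (intro homogeneous_list[OF hom]) (auto simp: less_Suc_eq uadj_def)
  then show ?thesis by auto
qed

lemma homogeneous_3:
  assumes "uadj D b a" "uadj D b c" "a \<noteq> c" "uadj D b' a'" "uadj D b' c'" "a' \<noteq> c'"
    and "(b, a) \<in> arcs D \<longleftrightarrow> (b', a') \<in> arcs D" "(b, c) \<in> arcs D \<longleftrightarrow> (b', c') \<in> arcs D"
  shows "\<exists>g. automorphism g D \<and> g a = a' \<and> g b = b' \<and> g c = c'"
proof -
  have n: "(a, c) \<notin> arcs D" "(c, a) \<notin> arcs D" "(a', c') \<notin> arcs D" "(c', a') \<notin> arcs D"
    using no_triangle[of a b c] no_triangle[of a' b' c'] assms by (auto simp: uadj_def)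
  have e: "(a, b) \<in> arcs D \<longleftrightarrow> (b, a) \<notin> arcs D" "(c, b) \<in> arcs D \<longleftrightarrow> (b, c) \<notin> arcs D"
      "(a', b') \<in> arcs D \<longleftrightarrow> (b', a') \<notin> arcs D" "(c', b') \<in> arcs D \<longleftrightarrow> (b', c') \<notin> arcs D"
    using assms arc_antisym by (auto simp: uadj_def)
  have d: "b \<noteq> a" "b \<noteq> c" "b' \<noteq> a'" "b' \<noteq> c'" using e by auto
  have v: "{a, b, c, a', b', c'} \<subseteq> verts D" using assms uadj_in_verts[OF wf] by blast
  have "\<exists>g. automorphism g D \<and> map g [b, a, c] = [b', a', c']"
  proof (rule homogeneous_list[OF hom])
    fix i assume "0 < i" "i < length [b, a, c]"
    then show "\<exists>j<i. uadj D ([b, a, c] ! j) ([b, a, c] ! i)"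
      using assms by (intro exI[of _ 0]) (auto simp: less_Suc_eq numeral_2_eq_2)
  next
    fix i j assume "i < length [b, a, c]" "j < length [b, a, c]"
    then show "([b, a, c] ! i, [b, a, c] ! j) \<in> arcs D \<longleftrightarrow> ([b', a', c'] ! i, [b', a', c'] ! j) \<in> arcs D"
      using assms n e arc_irrefl by (auto simp: less_Suc_eq numeral_2_eq_2)
  qed (use d v assms in auto)
  then show ?thesis by auto
qed

definition cutset :: "'a set \<Rightarrow> 'a set \<Rightarrow> 'a set set" where
  "cutset A B = {C \<in> E. A \<subseteq> C \<and> B \<inter> C = {}}"

definition sep :: "'a \<Rightarrow> 'a \<Rightarrow> 'a set set" where
  "sep x y = cutset {y} {x}"

lemma sep_iff: "C \<in> sep x y \<longleftrightarrow> C \<in> E \<and> x \<notin> C \<and> y \<in> C"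
  by (auto simp: sep_def cutset_def)

lemma cutset_compl:
  "C \<subseteq> verts D \<Longrightarrow> A \<subseteq> verts D \<Longrightarrow> B \<subseteq> verts D \<Longrightarrow> verts D - C \<in> cutset A B \<longleftrightarrow> C \<in> cutset B A"
  using E_compl[of C] E_compl[of "verts D - C"] by (auto simp: cutset_def double_diff)

lemma finite_cutset:
  assumes "A \<noteq> {}" "B \<noteq> {}" "A \<subseteq> verts D" "B \<subseteq> verts D"
  shows "finite (cutset A B)"
proof -
  obtain x y where xy: "x \<in> A" "y \<in> B" using assms(1,2) by blast
  then have "finite {C \<in> E. x \<in> C \<and> y \<notin> C}" using assms(3,4) E_sep_fin by blast
  then show ?thesis by (rule finite_subset[rotated]) (use xy in \<open>auto simp: cutset_def\<close>)
qed

lemma finite_sep: "x \<in> verts D \<Longrightarrow> y \<in> verts D \<Longrightarrow> finite (sep x y)"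
  by (simp add: sep_def finite_cutset)

lemma cutset_aut:
  assumes g: "automorphism g D" and AB: "A \<subseteq> verts D" "B \<subseteq> verts D"
  shows "cutset (g ` A) (g ` B) = image g ` cutset A B"
proof -
  note aut = g[unfolded automorphism_iff_rel_aut]
  note inj = rel_aut_inj[OF aut]
  let ?h = "inv_into (verts D) g"
  have image_iff: "g ` C \<in> cutset (g ` A) (g ` B) \<longleftrightarrow> C \<in> cutset A B" if "C \<in> E" for C
  proof -
    have C: "C \<subseteq> verts D" by (rule E_sub[OF that])
    have "g ` A \<subseteq> g ` C \<longleftrightarrow> A \<subseteq> C" using inj_on_image_mem_iff[OF inj _ C] AB(1) by blast
    then show ?thesis
      using that E_aut[OF g] inj_on_image_Int[OF inj AB(2) C] by (auto simp: cutset_def)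
  qed
  show ?thesis
  proof (intro set_eqI iffI)
    fix C assume C: "C \<in> cutset (g ` A) (g ` B)"
    then have "C \<in> E" by (simp add: cutset_def)
    then have eq: "C = g ` ?h ` C" and "?h ` C \<in> E"
      using rel_aut_image_inverse(2)[OF aut E_sub] E_aut[OF automorphism_inv[OF g]] by auto
    then have "?h ` C \<in> cutset A B" using image_iff C by metis
    then show "C \<in> image g ` cutset A B" using eq by blast
  next
    fix C assume "C \<in> image g ` cutset A B"
    then obtain C' where C': "C' \<in> cutset A B" "C = g ` C'" by blast
    then have "C' \<in> E" by (simp add: cutset_def)
    then show "C \<in> cutset (g ` A) (g ` B)" using image_iff C' by blast
  qed
qed

lemma card_cutset_aut:
  assumes g: "automorphism g D" and "A \<subseteq> verts D" "B \<subseteq> verts D"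
  shows "card (cutset (g ` A) (g ` B)) = card (cutset A B)"
proof -
  have "inj_on g (verts D)" using g rel_aut_inj by (simp add: automorphism_iff_rel_aut)
  then have "inj_on (image g) (cutset A B)"
    by (rule inj_on_subset[OF inj_on_image_Pow]) (auto simp: cutset_def dest: E_sub)
  then show ?thesis by (simp add: cutset_aut[OF assms] card_image)
qed

lemma some_arc_separated:
  obtains a b C where "(a, b) \<in> arcs D" "C \<in> sep a b"
proof -
  obtain C where C: "C \<in> E" using E_ne by blast
  obtain u v where uv: "u \<in> C" "v \<in> verts D - C"
    using E_inf[OF C] E_inf[OF E_compl[OF C]] by (metis ex_in_conv finite.emptyI)
  then have "(u, v) \<in> (ugraph D)\<^sup>*" using rtrancl_ugraph E_sub[OF C] by blast
  then obtain x y where "uadj D x y" "x \<in> C" "y \<notin> C"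
    using rtrancl_exits[of u v "ugraph D" C] uv by (auto simp: ugraph_def)
  then consider "(x, y) \<in> arcs D" "verts D - C \<in> sep x y" | "(y, x) \<in> arcs D" "C \<in> sep y x"
    using C E_compl arc_verts by (auto simp: uadj_def sep_iff)
  then show ?thesis using that by metis
qed

lemma arc_separated:
  assumes "(x, y) \<in> arcs D" obtains C where "C \<in> sep x y"
proof -
  obtain a b C where ab: "(a, b) \<in> arcs D" "C \<in> sep a b" by (rule some_arc_separated)
  obtain g where g: "automorphism g D" "g a = x" "g b = y" using arc_transitive[OF ab(1) assms] by blast
  then have "cutset {y} {x} = image g ` cutset {b} {a}"
    using cutset_aut[OF g(1), of "{b}" "{a}"] arc_verts[OF ab(1)] by simp
  then show ?thesis using ab(2) that unfolding sep_def by blast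
qed

lemma has_out_nbr:
  assumes "x \<in> verts D" obtains y where "(x, y) \<in> arcs D"
proof -
  obtain a b where ab: "(a, b) \<in> arcs D" by (rule some_arc_separated)
  then obtain g where "automorphism g D" "g a = x" using vertex_transitive assms arc_verts by blast
  then show ?thesis using automorphism_arcs ab arc_verts that by metis
qed

lemma cut_has_nbr:
  assumes "C \<in> E" "y \<in> C" obtains w where "w \<in> C" "uadj D y w"
proof -
  have "infinite (C - {y})" using E_inf assms by simp
  then obtain v where v: "v \<in> C" "v \<noteq> y" by (metis DiffE ex_in_conv finite.emptyI insertI1)
  then have "(y, v) \<in> (ugraph D \<inter> C \<times> C)\<^sup>*" using E_conn assms by (simp add: connected_on_def)
  then show ?thesis using v that by (cases rule: converse_rtranclE) (auto simp: ugraph_def)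
qed

text \<open>The number of cuts in \<open>E\<close> separating the middle vertex of a 2-arc from both ends does not
  depend on the 2-arc; a cut counted here would, by connectedness of its sides, force a crossing.\<close>

lemma cut_middle_of_two_arc_if_out_nbr:
  assumes xyz: "(x, y) \<in> arcs D" "(y, z) \<in> arcs D" and C: "C \<in> E" "y \<in> C" "x \<notin> C"
    and w: "(y, w) \<in> arcs D" "w \<in> C"
  shows "z \<in> C"
proof (rule ccontr)
  assume z: "z \<notin> C"
  have ne: "x \<noteq> z" "x \<noteq> w" using xyz w arc_antisym by auto
  obtain g where g: "automorphism g D" "g x = x" "g y = y" "g z = w"
    using homogeneous_3[of y x z y x w] xyz w ne by (auto simp: uadj_def)
  have V: "{y} \<subseteq> verts D" "{x, z} \<subseteq> verts D" "{x, w} \<subseteq> verts D" using xyz w arc_verts by blast+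
  have "card (cutset {y} {x, z}) = card (cutset {y} {x, w})"
    using card_cutset_aut[OF g(1) V(1,2)] g by simp
  moreover have "C \<in> cutset {y} {x, z}" "C \<notin> cutset {y} {x, w}"
    using C w z by (auto simp: cutset_def)
  ultimately obtain C' where C': "C' \<in> cutset {y} {x, w}" "C' \<notin> cutset {y} {x, z}"
    using card_exchange[OF finite_cutset finite_cutset] V by (metis insert_not_empty)
  then have "C' \<in> E" "y \<in> C'" "x \<notin> C'" "w \<notin> C'" "z \<in> C'" by (auto simp: cutset_def)
  then show False using no_four_corners[OF C(1), of C' y w z x] C w z V by auto
qed

end

context cut_homogeneous
begin

interpretation reversed: cut_homogeneous "rev_dg D" E by (rule rev_cut_homogeneous)

lemma cut_middle_of_two_arc:
  assumes xyz: "(x, y) \<in> arcs D" "(y, z) \<in> arcs D" and C: "C \<in> E" "y \<in> C"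
  shows "x \<in> C \<or> z \<in> C"
proof -
  obtain w where w: "w \<in> C" "uadj D y w" by (rule cut_has_nbr[OF C])
  then consider "(y, w) \<in> arcs D" | "(w, y) \<in> arcs D" by (auto simp: uadj_def)
  then show ?thesis
  proof cases
    case 1
    then show ?thesis using cut_middle_of_two_arc_if_out_nbr[OF xyz C] w by blast
  next
    case 2
    then show ?thesis
      using reversed.cut_middle_of_two_arc_if_out_nbr[of z y x C w] xyz C w by auto
  qed
qed

lemma cut_middle_of_two_arc_compl:
  assumes xyz: "(x, y) \<in> arcs D" "(y, z) \<in> arcs D" and C: "C \<in> E" "y \<notin> C"
  shows "x \<notin> C \<or> z \<notin> C"
  using cut_middle_of_two_arc[OF xyz E_compl[OF C(1)]] C xyz arc_verts by blast

lemma has_in_nbr: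
  assumes "x \<in> verts D" obtains y where "(y, x) \<in> arcs D"
  using reversed.has_out_nbr[of x] assms by auto

lemma cut_contains_descendants:
  assumes "(y, w) \<in> (arcs D)\<^sup>*" "(x, y) \<in> arcs D" "C \<in> E" "x \<notin> C" "y \<in> C"
  shows "w \<in> C"
  using assms
proof (induction arbitrary: x C rule: converse_rtrancl_induct)
  case (step y z)
  have z: "z \<in> C"
    using cut_middle_of_two_arc[OF step.prems(1) step.hyps(1) step.prems(2)] step.prems by simp
  obtain C' where "C' \<in> sep y z" by (rule arc_separated[OF step.hyps(1)])
  then have C': "C' \<in> E" "y \<notin> C'" "z \<in> C'" by (auto simp: sep_iff)
  have "x \<notin> C'"
    using cut_middle_of_two_arc_compl[OF step.prems(1) step.hyps(1) C'(1,2)] C'(3) by simp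
  moreover have "w \<in> C'" by (rule step.IH[OF step.hyps(1) C'])
  moreover have "x \<in> verts D" using arc_verts step.prems by blast
  ultimately show ?case
    using no_four_corners[OF step.prems(2) C'(1) z C'(3) step.prems(4) C'(2), of w x] step.prems(3)
    by blast
qed

lemma arcs_acyclic: "(x, y) \<in> arcs D \<Longrightarrow> (y, x) \<notin> (arcs D)\<^sup>*"
  using arc_separated cut_contains_descendants by (metis sep_iff)

definition cut_dist :: nat where
  "cut_dist = card (sep (fst (SOME e. e \<in> arcs D)) (snd (SOME e. e \<in> arcs D)))"

lemma card_sep_arc:
  assumes "(x, y) \<in> arcs D" shows "card (sep x y) = cut_dist"
proof -
  let ?e = "SOME e. e \<in> arcs D"
  have "?e \<in> arcs D" using assms by (rule someI)
  then have e: "(fst ?e, snd ?e) \<in> arcs D" by simp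
  then obtain g where g: "automorphism g D" "g (fst ?e) = x" "g (snd ?e) = y"
    using arc_transitive assms by blast
  then show ?thesis using card_cutset_aut[OF g(1), of "{snd ?e}" "{fst ?e}"] arc_verts[OF e]
    by (simp add: sep_def cut_dist_def)
qed

lemma cut_dist_pos: "cut_dist > 0"
proof -
  obtain a b C where ab: "(a, b) \<in> arcs D" "C \<in> sep a b" by (rule some_arc_separated)
  then show ?thesis
    using finite_sep[OF arc_verts[OF ab(1)]] card_sep_arc[OF ab(1)] by (metis card_gt_0_iff ex_in_conv)
qed

lemma sep_split:
  assumes xy: "(x, y) \<in> arcs D" and yz: "(y, z) \<in> (arcs D)\<^sup>*"
  shows "sep x z = sep x y \<union> sep y z" "sep x y \<inter> sep y z = {}"
proof -
  show "sep x y \<inter> sep y z = {}" by (auto simp: sep_iff)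
  have "x \<notin> C" if "C \<in> sep y z" for C
  proof
    assume "x \<in> C"
    have C: "C \<in> E" "y \<notin> C" "z \<in> C" using that by (auto simp: sep_iff)
    have "z \<in> verts D - C"
      by (rule cut_contains_descendants[OF yz xy E_compl[OF C(1)]])
        (use \<open>x \<in> C\<close> C arc_verts[OF xy] in auto)
    then show False using C by simp
  qed
  then show "sep x z = sep x y \<union> sep y z"
    using cut_contains_descendants[OF yz xy] by (auto simp: sep_iff)
qed

lemma card_sep_relpow:
  assumes "(x, z) \<in> arcs D ^^ n" "x \<in> verts D" shows "card (sep x z) = n * cut_dist"
  using assms
proof (induction n arbitrary: x)
  case 0
  then show ?case by (auto simp: sep_def cutset_def)
next
  case (Suc n)
  then obtain y where y: "(x, y) \<in> arcs D" "(y, z) \<in> arcs D ^^ n" by (metis relpow_Suc_D2)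
  have yz: "(y, z) \<in> (arcs D)\<^sup>*" by (rule relpow_imp_rtrancl[OF y(2)])
  have V: "y \<in> verts D" "z \<in> verts D" using arc_verts y desc_verts[OF yz] by auto
  show ?case
    using sep_split[OF y(1) yz] card_sep_arc[OF y(1)] Suc.IH[OF y(2) V(1)]
    by (simp add: card_Un_disjoint finite_sep V Suc.prems)
qed

lemma no_chord:
  assumes "(x, y) \<in> arcs D" "(y, z) \<in> arcs D" "(z, w) \<in> (arcs D)\<^sup>*" shows "(x, w) \<notin> arcs D"
proof
  assume xw: "(x, w) \<in> arcs D"
  obtain n where n: "(z, w) \<in> arcs D ^^ n" using assms(3) rtrancl_imp_relpow by metis
  have "(x, w) \<in> arcs D ^^ (Suc (Suc n))" using assms n by (metis relpow_Suc_I2)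
  then have "card (sep x w) = Suc (Suc n) * cut_dist" using card_sep_relpow arc_verts(1)[OF xw] by blast
  then show False using card_sep_arc[OF xw] cut_dist_pos by simp
qed

lemma k_arc_reach:
  assumes "is_k_arc D k xs" "i \<le> j" "j \<le> k" shows "(xs ! i, xs ! j) \<in> (arcs D)\<^sup>*"
  using assms(2,3)
proof (induction j rule: dec_induct)
  case (step n)
  then have "(xs ! n, xs ! Suc n) \<in> arcs D" using assms(1) by (simp add: is_k_arc_def)
  with step show ?case by (meson Suc_leD rtrancl.rtrancl_into_rtrancl)
qed simp

lemma k_arc_induced:
  assumes xs: "is_k_arc D k xs" and ij: "i \<le> k" "j \<le> k"
  shows "(xs ! i, xs ! j) \<in> arcs D \<longleftrightarrow> j = Suc i" "xs ! i = xs ! j \<longleftrightarrow> i = j"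
proof -
  have arc: "(xs ! i, xs ! Suc i) \<in> arcs D" if "i < k" for i using xs that by (simp add: is_k_arc_def)
  have "xs ! i \<noteq> xs ! j" if "i < j" "j \<le> k" for i j
    using arcs_acyclic[OF arc[of i]] k_arc_reach[OF xs, of "Suc i" j] that by auto
  then show "xs ! i = xs ! j \<longleftrightarrow> i = j" using ij by (metis nat_neq_iff)
  have "(xs ! i, xs ! j) \<notin> arcs D" if "j \<le> i"
    using k_arc_reach[OF xs that] ij arcs_acyclic by blast
  moreover have "(xs ! i, xs ! j) \<notin> arcs D" if "Suc (Suc i) \<le> j"
    using no_chord[OF arc[of i] arc[of "Suc i"] k_arc_reach[OF xs that]] ij that by simp
  ultimately show "(xs ! i, xs ! j) \<in> arcs D \<longleftrightarrow> j = Suc i"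
    using arc[of i] ij by (metis Suc_le_eq le_less_Suc_eq not_less_eq_eq not_less)
qed

theorem cut_highly_arc_transitive: "highly_arc_transitive D"
  unfolding highly_arc_transitive_def
proof (intro allI impI)
  fix k xs ys assume "is_k_arc D k xs \<and> is_k_arc D k ys"
  then have xs: "is_k_arc D k xs" and ys: "is_k_arc D k ys" by auto
  have len: "length xs = Suc k" "length ys = Suc k" using xs ys by (auto simp: is_k_arc_def)
  show "\<exists>g. automorphism g D \<and> map g xs = ys"
  proof (rule homogeneous_list[OF hom])
    show "distinct xs" "distinct ys"
      using k_arc_induced(2)[OF xs] k_arc_induced(2)[OF ys] len
      by (auto simp: distinct_conv_nth less_Suc_eq_le)
    show "set xs \<subseteq> verts D" "set ys \<subseteq> verts D" using xs ys by (auto simp: is_k_arc_def)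
    show "xs \<noteq> []" "length ys = length xs" using len by auto
    fix i assume i: "0 < i" "i < length xs"
    then have "(xs ! (i - 1), xs ! i) \<in> arcs D" using k_arc_induced(1)[OF xs, of "i - 1" i] len by simp
    then show "\<exists>j<i. uadj D (xs ! j) (xs ! i)" using i by (intro exI[of _ "i - 1"]) (simp add: uadj_def)
  next
    fix i j assume "i < length xs" "j < length xs"
    then show "(xs ! i, xs ! j) \<in> arcs D \<longleftrightarrow> (ys ! i, ys ! j) \<in> arcs D"
      using k_arc_induced(1)[OF xs] k_arc_induced(1)[OF ys] len by (simp add: less_Suc_eq_le)
  qed
qed

end

section \<open>Reachability classes are bipartite\<close>

context cut_homogeneous
begin

definition out_cuts :: "'a \<Rightarrow> 'a set set" where
  "out_cuts x = cutset (out_nbrs D x) {x}"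

definition in_cuts :: "'a \<Rightarrow> 'a set set" where
  "in_cuts y = cutset {y} (in_nbrs D y)"

lemma out_cuts_sep: "(x, y) \<in> arcs D \<Longrightarrow> out_cuts x \<subseteq> sep x y"
  by (auto simp: out_cuts_def cutset_def sep_iff out_nbrs_def)

lemma in_cuts_sep: "(x, y) \<in> arcs D \<Longrightarrow> in_cuts y \<subseteq> sep x y"
  by (auto simp: in_cuts_def cutset_def sep_iff in_nbrs_def)

lemma out_cuts_target: "C \<in> out_cuts x \<Longrightarrow> (x, y) \<in> arcs D \<Longrightarrow> C \<in> E \<and> x \<notin> C \<and> y \<in> C"
  using out_cuts_sep sep_iff by blast

lemma out_cuts_common:
  assumes y: "(x, y) \<in> arcs D" "(x, y') \<in> arcs D" "y \<noteq> y'" and C: "C \<in> E" "x \<notin> C" "y \<in> C" "y' \<in> C"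
  shows "C \<in> out_cuts x"
proof (rule ccontr)
  assume "C \<notin> out_cuts x"
  then obtain z where z: "(x, z) \<in> arcs D" "z \<notin> C" using C by (auto simp: out_cuts_def cutset_def out_nbrs_def)
  then have "z \<noteq> y" using C by auto
  obtain g where g: "automorphism g D" "g y = y" "g x = x" "g y' = z"
    using homogeneous_3[of x y y' x y z] y z \<open>z \<noteq> y\<close> by (auto simp: uadj_def)
  have V: "{y, y'} \<subseteq> verts D" "{y, z} \<subseteq> verts D" "{x} \<subseteq> verts D" using y z arc_verts by blast+
  have "card (cutset {y, y'} {x}) = card (cutset {y, z} {x})"
    using card_cutset_aut[OF g(1) V(1,3)] g by simp
  moreover have "C \<in> cutset {y, y'} {x}" "C \<notin> cutset {y, z} {x}" using C z by (auto simp: cutset_def)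
  ultimately obtain C' where C': "C' \<in> cutset {y, z} {x}" "C' \<notin> cutset {y, y'} {x}"
    using card_exchange[OF finite_cutset finite_cutset] V by (metis insert_not_empty)
  then have "C' \<in> E" "y \<in> C'" "x \<notin> C'" "z \<in> C'" "y' \<notin> C'" by (auto simp: cutset_def)
  then show False using no_four_corners[OF C(1), of C' y y' z x] C z V by auto
qed

lemma card_out_cuts:
  assumes "x \<in> verts D" "x' \<in> verts D" shows "card (out_cuts x) = card (out_cuts x')"
proof -
  obtain g where g: "automorphism g D" "g x = x'" using vertex_transitive assms by blast
  then show ?thesis
    using card_cutset_aut[OF g(1) out_nbrs_verts, of "{x}" x] automorphism_out_nbrs[OF wf g(1) assms(1)] assms
    by (simp add: out_cuts_def)
qed

definition centred :: bool where
  "centred \<longleftrightarrow> (\<forall>x y. (x, y) \<in> arcs D \<longrightarrow> sep x y \<subseteq> out_cuts x \<union> in_cuts y)"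

text \<open>In a structure tree for \<open>E\<close>, all arcs of a reachability class pass through a common point
  when \<open>centred\<close> holds; \<open>centre x\<close> is the orientation of \<open>E\<close> towards that point for arcs starting
  at \<open>x\<close>.\<close>

definition centre :: "'a \<Rightarrow> 'a set set" where
  "centre x = {C \<in> E. x \<in> C \<and> verts D - C \<notin> out_cuts x} \<union> out_cuts x"

lemma centred_out_cuts_shared:
  assumes centred and xy: "(x, y) \<in> arcs D" "(x', y) \<in> arcs D"
    and C: "C \<in> in_cuts y" "C \<in> out_cuts x"
  shows "C \<in> out_cuts x'"
proof (rule ccontr)
  assume not: "C \<notin> out_cuts x'"
  have V: "x \<in> verts D" "x' \<in> verts D" "y \<in> verts D" using xy arc_verts by auto
  have diff: "in_cuts y - out_cuts x = sep x y - out_cuts x" if "(x, y) \<in> arcs D" for x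
    using in_cuts_sep[OF that] \<open>centred\<close> that by (auto simp: centred_def)
  have card: "card (in_cuts y - out_cuts x) = cut_dist - card (out_cuts x)" if "(x, y) \<in> arcs D" for x
    using diff[OF that] out_cuts_sep[OF that] card_sep_arc[OF that] finite_sep arc_verts[OF that]
    by (simp add: card_Diff_subset finite_subset)
  have fin: "finite (in_cuts y - out_cuts x)" if "(x, y) \<in> arcs D" for x
    using diff[OF that] finite_sep arc_verts[OF that] by simp
  have "C \<in> in_cuts y - out_cuts x'" "C \<notin> in_cuts y - out_cuts x" using C not by auto
  then obtain C' where C': "C' \<in> in_cuts y" "C' \<notin> out_cuts x" "C' \<in> out_cuts x'"
    using card_exchange[OF fin[OF xy(2)] fin[OF xy(1)]] card[OF xy(1)] card[OF xy(2)]
      card_out_cuts[OF V(1,2)] by auto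
  have E: "C \<in> E" "C' \<in> E" using C C' by (auto simp: in_cuts_def cutset_def)
  have y: "y \<in> C" "y \<in> C'" "x \<notin> C" "x \<notin> C'" "x' \<notin> C" "x' \<notin> C'"
    using C C' xy by (auto simp: in_cuts_def cutset_def in_nbrs_def)
  obtain a where a: "(x', a) \<in> arcs D" "a \<notin> C" "a \<in> C'"
    using not C'(3) E y by (auto simp: out_cuts_def cutset_def out_nbrs_def)
  obtain b where b: "(x, b) \<in> arcs D" "b \<notin> C'" "b \<in> C"
    using C(2) C'(2) E y by (auto simp: out_cuts_def cutset_def out_nbrs_def)
  show False using no_four_corners[OF E y(1,2) b(3,2) a(2,3), of x] y V by blast
qed

lemma centre_mono_common_target:
  assumes centred and xy: "(x, y) \<in> arcs D" "(x', y) \<in> arcs D" and C: "C \<in> centre x"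
  shows "C \<in> centre x'"
proof (rule ccontr)
  assume not: "C \<notin> centre x'"
  have E: "C \<in> E" using C by (auto simp: centre_def out_cuts_def cutset_def)
  have V: "x \<in> verts D" "x' \<in> verts D" "y \<in> verts D" using xy arc_verts by auto
  show False
  proof (cases "y \<in> C")
    case True
    then have "verts D - C \<notin> out_cuts x'" using out_cuts_target[OF _ xy(2)] by blast
    then have x': "x' \<notin> C" "C \<notin> out_cuts x'" using not E by (auto simp: centre_def)
    have "sep x' y \<subseteq> out_cuts x' \<union> in_cuts y" using \<open>centred\<close> xy(2) unfolding centred_def by blast
    moreover have "C \<in> sep x' y" using E x' True by (simp add: sep_iff)
    ultimately have in_cut: "C \<in> in_cuts y" using x' by blast
    then have "x \<notin> C" using xy(1) by (auto simp: in_cuts_def cutset_def in_nbrs_def)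
    then have "C \<in> out_cuts x" using C by (auto simp: centre_def)
    then show False using centred_out_cuts_shared[OF \<open>centred\<close> xy in_cut] x' by blast
  next
    case False
    then have "C \<notin> out_cuts x" using out_cuts_target[OF _ xy(1)] by blast
    then have x: "x \<in> C" "verts D - C \<notin> out_cuts x" using C by (auto simp: centre_def)
    then have "verts D - C \<in> sep x y" using False E V E_compl by (auto simp: sep_iff)
    then have in_cut: "verts D - C \<in> in_cuts y" using \<open>centred\<close> xy(1) x by (auto simp: centred_def)
    then have "x' \<in> C" using xy(2) V by (auto simp: in_cuts_def cutset_def in_nbrs_def)
    then have "verts D - C \<in> out_cuts x'" using not E by (auto simp: centre_def)
    then show False using centred_out_cuts_shared[OF \<open>centred\<close> xy(2,1) in_cut] x by blast
  qed
qed

lemma centre_class: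
  assumes centred "(e, e') \<in> (share_end D)\<^sup>*" shows "centre (fst e) = centre (fst e')"
  using assms(2)
proof (induction rule: rtrancl_induct)
  case (step f f')
  have "centre (fst f) = centre (fst f')"
  proof (cases "fst f = fst f'")
    case False
    then have "(fst f, snd f) \<in> arcs D" "(fst f', snd f) \<in> arcs D"
      using step.hyps(2) by (auto simp: share_end_def) (metis prod.collapse)+
    then show ?thesis using centre_mono_common_target[OF \<open>centred\<close>] by blast
  qed simp
  then show ?case using step by simp
qed simp

lemma centred_class_no_two_arc:
  assumes centred and xyz: "(x, y) \<in> arcs D" "(y, z) \<in> arcs D"
  shows "((x, y), (y, z)) \<notin> (share_end D)\<^sup>*"
proof
  assume "((x, y), (y, z)) \<in> (share_end D)\<^sup>*"
  from centre_class[OF \<open>centred\<close> this] have eq: "centre x = centre y" by simp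
  have "sep x y \<subseteq> out_cuts x"
  proof
    fix C assume "C \<in> sep x y"
    then have C: "C \<in> E" "x \<notin> C" "y \<in> C" by (auto simp: sep_iff)
    then have "z \<in> C" using cut_middle_of_two_arc[OF xyz] by blast
    then have "verts D - C \<notin> out_cuts y" using out_cuts_target[OF _ xyz(2)] by blast
    then have "C \<in> centre y" using C by (simp add: centre_def)
    then show "C \<in> out_cuts x" using eq C by (auto simp: centre_def)
  qed
  then have "card (out_cuts x) = cut_dist"
    using out_cuts_sep[OF xyz(1)] card_sep_arc[OF xyz(1)] by (metis subset_antisym)
  then have "card (out_cuts y) = cut_dist" using card_out_cuts arc_verts[OF xyz(1)] by metis
  then have "out_cuts y \<noteq> {}" using cut_dist_pos by auto
  then obtain C where C: "C \<in> out_cuts y" by blast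
  then have C': "C \<in> E" "y \<notin> C" "z \<in> C" using out_cuts_target[OF C xyz(2)] by auto
  then have "x \<notin> C" using cut_middle_of_two_arc_compl[OF xyz] by blast
  moreover have "C \<in> centre x" using C eq by (simp add: centre_def)
  ultimately have "C \<in> out_cuts x" by (auto simp: centre_def)
  then show False using out_cuts_target[OF _ xyz(1)] C' by blast
qed

lemma sep_sources_subset:
  assumes "centre x = centre x'"
  shows "sep x x' \<subseteq> out_cuts x \<union> (\<lambda>C. verts D - C) ` out_cuts x'"
proof
  fix C assume "C \<in> sep x x'"
  then have C: "C \<in> E" "x \<notin> C" "x' \<in> C" by (auto simp: sep_iff)
  show "C \<in> out_cuts x \<union> (\<lambda>C. verts D - C) ` out_cuts x'"
  proof (cases "C \<in> centre x")
    case True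
    then show ?thesis using C by (auto simp: centre_def)
  next
    case False
    then have "verts D - C \<in> out_cuts x'" using assms C by (auto simp: centre_def)
    moreover have "C = verts D - (verts D - C)" using E_sub[OF C(1)] by blast
    ultimately show ?thesis by blast
  qed
qed

lemma sep_targets_empty:
  assumes eq: "centre x = centre x'" and xy: "(x, y) \<in> arcs D" "(x', y') \<in> arcs D"
    and full: "out_cuts x = sep x y" "out_cuts x' = sep x' y'"
  shows "sep y y' = {}"
proof (rule ccontr)
  assume "sep y y' \<noteq> {}"
  then obtain C where C: "C \<in> E" "y \<notin> C" "y' \<in> C" by (auto simp: sep_iff)
  have V: "x \<in> verts D" "y \<in> verts D" using arc_verts[OF xy(1)] by auto
  show False
  proof (cases "C \<in> centre x")
    case True
    moreover have "C \<notin> out_cuts x" using out_cuts_target[OF _ xy(1)] C by blast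
    ultimately have "x \<in> C" "verts D - C \<notin> out_cuts x" by (auto simp: centre_def)
    then show False using full(1) C V E_compl by (auto simp: sep_iff)
  next
    case False
    then have not: "C \<notin> centre x'" using eq by simp
    have "verts D - C \<notin> out_cuts x'" using out_cuts_target[OF _ xy(2)] C by blast
    then have "x' \<notin> C" using not C by (auto simp: centre_def)
    then show False using not full(2) C by (auto simp: sep_iff centre_def)
  qed
qed

lemma card_sep_two_arc:
  assumes "(u, v) \<in> arcs D" "(v, w) \<in> arcs D" shows "card (sep u w) = 2 * cut_dist"
  using card_sep_relpow[of u w 2] assms arc_verts(1)[OF assms(1)] by (auto simp: numeral_2_eq_2)

lemma centred_class_induced:
  assumes centred and s: "((x, y), (x', y')) \<in> (share_end D)\<^sup>*" and xy: "(x, y) \<in> arcs D"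
  shows "(y, x') \<notin> arcs D"
proof
  assume yx': "(y, x') \<in> arcs D"
  have x'y': "(x', y') \<in> arcs D" using share_end_rtrancl_arcs[OF s] xy by simp
  have V: "x \<in> verts D" "y \<in> verts D" "x' \<in> verts D" "y' \<in> verts D" using xy x'y' arc_verts by auto
  from centre_class[OF \<open>centred\<close> s] have eq: "centre x = centre x'" by simp
  have fin: "finite (out_cuts x)" "finite (out_cuts x')"
    using out_cuts_sep[OF xy] out_cuts_sep[OF x'y'] finite_sep V by (meson finite_subset)+
  have "2 * cut_dist \<le> card (out_cuts x \<union> (\<lambda>C. verts D - C) ` out_cuts x')"
    unfolding card_sep_two_arc[OF xy yx', symmetric]
    using fin by (intro card_mono sep_sources_subset[OF eq]) simp
  also have "\<dots> \<le> card (out_cuts x) + card (out_cuts x')"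
    using fin by (meson card_Un_le card_image_le le_trans add_left_mono)
  finally have "cut_dist \<le> card (out_cuts x)" "cut_dist \<le> card (out_cuts x')"
    using card_out_cuts[OF V(1,3)] by auto
  then have "out_cuts x = sep x y" "out_cuts x' = sep x' y'"
    using card_seteq[OF finite_sep out_cuts_sep[OF xy]] card_seteq[OF finite_sep out_cuts_sep[OF x'y']]
      card_sep_arc xy x'y' V by auto
  then have "sep y y' = {}" by (rule sep_targets_empty[OF eq xy x'y'])
  then show False using card_sep_two_arc[OF yx' x'y'] cut_dist_pos by simp
qed

definition isolates :: "'a \<Rightarrow> 'a \<Rightarrow> 'a set \<Rightarrow> bool" where
  "isolates x y C \<longleftrightarrow> C \<in> E \<and> x \<notin> C \<and> y \<in> C \<and> (\<forall>w. uadj D x w \<and> w \<noteq> y \<longrightarrow> w \<notin> C)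
     \<and> (\<forall>w. uadj D y w \<and> w \<noteq> x \<longrightarrow> w \<in> C)"

lemma isolates_compl:
  assumes "isolates x y C" "uadj D x y" shows "isolates y x (verts D - C)"
  using assms E_compl uadj_in_verts[OF wf] unfolding isolates_def by blast

lemma isolates_aut:
  assumes g: "automorphism g D" and C: "isolates x y C" and V: "x \<in> verts D" "y \<in> verts D"
  shows "isolates (g x) (g y) (g ` C)"
proof -
  note aut = automorphism_rel_aut_ugraph[OF g]
  have mem: "g w \<in> g ` C \<longleftrightarrow> w \<in> C" if "w \<in> verts D" for w
    using rel_aut_mem_iff[OF aut that] C E_sub by (simp add: isolates_def)
  have nbr: "\<exists>v. w = g v \<and> v \<in> verts D \<and> uadj D u v" if "uadj D (g u) w" "u \<in> verts D" for u w
  proof -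
    have "w \<in> g ` (ugraph D `` {u})"
      using that unfolding rel_aut_Image[OF aut ugraph_sub[OF wf] that(2)] by (simp add: ugraph_def)
    then show ?thesis using uadj_in_verts[OF wf] by (auto simp: ugraph_def)
  qed
  show ?thesis
    unfolding isolates_def
  proof (intro conjI allI impI)
    show "g ` C \<in> E" using E_aut[OF g] C by (simp add: isolates_def)
    show "g x \<notin> g ` C" "g y \<in> g ` C" using mem V C by (auto simp: isolates_def)
  next
    fix w assume w: "uadj D (g x) w \<and> w \<noteq> g y"
    then obtain v where "w = g v" "v \<in> verts D" "uadj D x v" using nbr V by blast
    then show "w \<notin> g ` C" using mem w C by (auto simp: isolates_def)
  next
    fix w assume w: "uadj D (g y) w \<and> w \<noteq> g x"
    then obtain v where "w = g v" "v \<in> verts D" "uadj D y v" using nbr V by blast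
    then show "w \<in> g ` C" using mem w C by (auto simp: isolates_def)
  qed
qed

end

context cut_homogeneous
begin

interpretation reversed: cut_homogeneous "rev_dg D" E by (rule rev_cut_homogeneous)

lemma in_cuts_common:
  assumes x: "(x, y) \<in> arcs D" "(x', y) \<in> arcs D" "x \<noteq> x'" and C: "C \<in> E" "x \<notin> C" "x' \<notin> C" "y \<in> C"
  shows "C \<in> in_cuts y"
proof -
  have V: "x \<in> verts D" "x' \<in> verts D" "y \<in> verts D" using x arc_verts by auto
  have "verts D - C \<in> reversed.out_cuts y"
    by (rule reversed.out_cuts_common[of y x x']) (use x C V E_compl in auto)
  then have "verts D - C \<in> cutset (in_nbrs D y) {y}"
    by (auto simp: reversed.out_cuts_def reversed.cutset_def cutset_def out_nbrs_def in_nbrs_def)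
  then show ?thesis using cutset_compl[of C] E_sub[OF C(1)] in_nbrs_verts V by (auto simp: in_cuts_def)
qed

lemma some_arc_isolated:
  assumes "\<not> centred" obtains x y C where "(x, y) \<in> arcs D" "isolates x y C"
proof -
  obtain x y C where C: "(x, y) \<in> arcs D" "C \<in> sep x y" "C \<notin> out_cuts x" "C \<notin> in_cuts y"
    using assms by (auto simp: centred_def)
  then have C': "C \<in> E" "x \<notin> C" "y \<in> C" by (auto simp: sep_iff)
  have "w \<notin> C" if "uadj D x w" "w \<noteq> y" for w
    using that(1) unfolding uadj_def
  proof
    assume "(x, w) \<in> arcs D"
    then show ?thesis using out_cuts_common[OF C(1) _ _ C'] C(3) that(2) by blast
  next
    assume "(w, x) \<in> arcs D"
    then show ?thesis using cut_middle_of_two_arc_compl[OF _ C(1) C'(1,2)] C' by blast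
  qed
  moreover have "w \<in> C" if "uadj D y w" "w \<noteq> x" for w
    using that(1) unfolding uadj_def
  proof
    assume "(y, w) \<in> arcs D"
    then show ?thesis using cut_middle_of_two_arc[OF C(1) _ C'(1,3)] C' by blast
  next
    assume "(w, y) \<in> arcs D"
    then show ?thesis using in_cuts_common[OF C(1), of w C] C(4) C' that(2) by blast
  qed
  ultimately have "isolates x y C" using C' by (simp add: isolates_def)
  then show ?thesis using C(1) that by blast
qed

lemma edge_isolated:
  assumes "\<not> centred" "uadj D u v" obtains C where "isolates u v C"
proof -
  obtain x y C where C: "(x, y) \<in> arcs D" "isolates x y C" by (rule some_arc_isolated[OF assms(1)])
  have "\<exists>C. isolates a b C" if ab: "(a, b) \<in> arcs D" for a b
  proof -
    obtain g where "automorphism g D" "g x = a" "g y = b" using arc_transitive[OF C(1) ab] by blast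
    then show ?thesis using isolates_aut[OF _ C(2)] arc_verts[OF C(1)] by blast
  qed
  then show ?thesis using assms(2) isolates_compl[of v u] that unfolding uadj_def by blast
qed

lemma non_backtracking_walk_stays_in_cut:
  assumes "\<not> centred"
  shows "successively (uadj D) (u # v # ws) \<Longrightarrow> non_backtracking (u # v # ws) \<Longrightarrow> isolates u v C
    \<Longrightarrow> last (v # ws) \<in> C"
proof (induction ws arbitrary: u v C)
  case Nil
  then show ?case by (simp add: isolates_def)
next
  case (Cons w ws)
  have adj: "uadj D u v" "uadj D v w" and "u \<noteq> w" using Cons.prems by auto
  obtain C' where C': "isolates v w C'" by (rule edge_isolated[OF assms adj(2)])
  have "last (w # ws) \<in> C'"
    using Cons.prems by (intro Cons.IH[OF _ _ C']) auto
  moreover have "w \<in> C" "u \<notin> C'" "v \<in> C" "u \<notin> C" "C \<in> E"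
    using Cons.prems(3) C' adj \<open>u \<noteq> w\<close> by (auto simp: isolates_def uadj_commute)
  moreover have "C' \<in> E" "w \<in> C'" "v \<notin> C'" using C' by (auto simp: isolates_def)
  moreover have "u \<in> verts D" using uadj_in_verts[OF wf adj(1)] by simp
  ultimately show ?case
    using no_four_corners[of C C' w v "last (w # ws)" u] by (metis last_ConsR list.distinct(1))
qed

lemma uacyclic_if_not_centred:
  assumes "\<not> centred" shows "uacyclic D"
proof (rule ccontr)
  assume "\<not> uacyclic D"
  then obtain xs where cyc: "is_cycle D xs" using uacyclic_iff[OF ugraph_sub[OF wf]] by blast
  then have "3 \<le> length xs" by (simp add: is_cycle_def)
  then obtain u v ws where xs: "xs = u # v # ws" by (metis Suc_le_length_iff numeral_3_eq_3)
  have walk: "successively (uadj D) (xs @ [u])"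
    unfolding successively_append_iff using cyc xs by (simp add: is_cycle_def)
  then have "uadj D u v" using xs by simp
  then obtain C where C: "isolates u v C" by (rule edge_isolated[OF assms])
  moreover have "non_backtracking (u # v # ws @ [u])"
    using non_backtracking_closed_cycle[of D u "v # ws"] cyc xs by simp
  ultimately have "last (v # (ws @ [u])) \<in> C"
    using walk xs by (intro non_backtracking_walk_stays_in_cut[OF assms]) auto
  then show False using C by (simp add: isolates_def)
qed

lemma isolates_bridge:
  assumes "\<not> centred" and C: "isolates x y C" and xy: "uadj D x y"
    and uv: "uadj D u v" "u \<notin> C" "v \<in> C"
  shows "u = x \<and> v = y"
proof (cases "v = y")
  case True
  then show ?thesis using C uv by (auto simp: isolates_def uadj_commute)
next
  case False
  have CE: "C \<in> E" and xyC: "x \<notin> C" "y \<in> C" using C by (auto simp: isolates_def)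
  obtain ps where ps: "path_between (ugraph D) y v ps" "set ps \<subseteq> C"
    by (rule connected_on_path[OF E_conn[OF CE] xyC(2) uv(3)])
  then obtain ws where ws: "ps = y # ws @ [v]" using False
    by (cases ps rule: rev_cases; cases "butlast ps") (auto simp: path_between_def)
  have "non_backtracking ((x # y # ws) @ [v])"
    using ps ws xyC by (intro non_backtracking_distinct) (auto simp: path_between_def)
  then have "non_backtracking ((x # y # ws) @ [v, u])"
    by (rule non_backtracking_snoc) (use ps(2) ws uv(2) xyC in \<open>auto dest: last_in_set split: if_splits\<close>)
  moreover have "successively (uadj D) (ps @ [u])"
    using ps(1) uv(1) unfolding successively_append_iff
    by (simp add: path_between_def ugraph_def uadj_commute)
  ultimately have "last (y # (ws @ [v, u])) \<in> C"
    using ws xy by (intro non_backtracking_walk_stays_in_cut[OF assms(1) _ _ C]) simp_all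
  then show ?thesis using uv(2) by simp
qed

definition in_branch :: "'a \<Rightarrow> 'a \<times> 'a \<Rightarrow> bool" where
  "in_branch y e \<longleftrightarrow> snd e = y
     \<or> (\<exists>x C. (x, y) \<in> arcs D \<and> isolates y x C \<and> fst e \<in> C \<and> snd e \<in> C)"

lemma in_branch_meets_cut:
  assumes "\<not> centred" and x: "(x, y) \<in> arcs D" "isolates y x C"
    and ab: "(a, b) \<in> arcs D" "a \<in> C \<or> b \<in> C"
  shows "in_branch y (a, b)"
proof (cases "b = y")
  case False
  have "uadj D y x" "uadj D a b" using x ab by (auto simp: uadj_def)
  then have "a \<in> C \<and> b \<in> C \<or> (a = y \<and> b = x) \<or> (b = y \<and> a = x)"
    using isolates_bridge[OF assms(1) x(2)] ab(2) uadj_commute by metis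
  moreover have "\<not> (a = y \<and> b = x)" using ab(1) x(1) arc_antisym by blast
  ultimately show ?thesis using False x unfolding in_branch_def by auto
qed (simp add: in_branch_def)

lemma in_branch_share_end:
  assumes "\<not> centred" and e: "in_branch y e" and "(e, e') \<in> share_end D"
  shows "in_branch y e'"
proof -
  obtain a b a' b' where ab: "e = (a, b)" "e' = (a', b')" by (cases e, cases e')
  have arcs: "(a, b) \<in> arcs D" "(a', b') \<in> arcs D" and eq: "a = a' \<or> b = b'"
    using assms(3) ab by (auto simp: share_end_def)
  show ?thesis
  proof (cases "b = y")
    case True
    show ?thesis
    proof (cases "b' = y")
      case False
      then have "a = a'" using eq True by simp
      have "uadj D y a" using arcs(1) True by (simp add: uadj_def)
      then obtain C where C: "isolates y a C" by (rule edge_isolated[OF assms(1)])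
      then have "a' \<in> C" using \<open>a = a'\<close> by (simp add: isolates_def)
      then show ?thesis using in_branch_meets_cut[OF assms(1) _ C arcs(2)] arcs(1) True ab by blast
    qed (simp add: in_branch_def ab)
  next
    case False
    then obtain x C where x: "(x, y) \<in> arcs D" "isolates y x C" "a \<in> C" "b \<in> C"
      using e ab by (auto simp: in_branch_def)
    then show ?thesis using in_branch_meets_cut[OF assms(1) x(1,2) arcs(2)] eq ab by blast
  qed
qed

lemma not_centred_class_no_two_arc:
  assumes "\<not> centred" and xyz: "(x, y) \<in> arcs D" "(y, z) \<in> arcs D"
  shows "((x, y), (y, z)) \<notin> (share_end D)\<^sup>*"
proof
  assume "((x, y), (y, z)) \<in> (share_end D)\<^sup>*"
  then have "in_branch y (y, z)"
    by (induction rule: rtrancl_induct)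
      (auto simp: in_branch_def[of y "(x, y)"] intro: in_branch_share_end[OF assms(1)])
  then show False using xyz arc_irrefl by (auto simp: in_branch_def isolates_def)
qed

theorem class_no_two_arc:
  assumes "(x, y) \<in> arcs D" "(y, z) \<in> arcs D" shows "((x, y), (y, z)) \<notin> (share_end D)\<^sup>*"
  using centred_class_no_two_arc not_centred_class_no_two_arc assms by blast

lemma class_arcs: "e \<in> arcs D \<Longrightarrow> f \<in> A_class D e \<Longrightarrow> f \<in> arcs D"
  using A_class_iff[OF wf] share_end_rtrancl_arcs by blast

lemma class_related:
  assumes "e \<in> arcs D" "f \<in> A_class D e" "f' \<in> A_class D e"
  shows "(f, f') \<in> (share_end D)\<^sup>*"
proof -
  have "(e, f) \<in> (share_end D)\<^sup>*" "(e, f') \<in> (share_end D)\<^sup>*"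
    using assms A_class_iff[OF wf] by auto
  moreover from this(1) have "(f, e) \<in> (share_end D)\<^sup>*"
    using sym_rtrancl[OF sym_share_end] by (meson symD)
  ultimately show ?thesis by (meson rtrancl_trans)
qed

lemma class_parts_disjoint:
  assumes "e \<in> arcs D" shows "fst ` A_class D e \<inter> snd ` A_class D e = {}"
proof (rule ccontr)
  assume "\<not> ?thesis"
  then obtain u v w where uv: "(u, v) \<in> A_class D e" and vw: "(v, w) \<in> A_class D e" by auto
  show False
    using class_no_two_arc[OF class_arcs[OF assms uv] class_arcs[OF assms vw]]
      class_related[OF assms uv vw] by contradiction
qed

theorem cut_reachability_not_universal: "\<exists>e\<in>arcs D. \<exists>e'\<in>arcs D. \<not> rel_A D e e'"
proof -
  obtain x y where y: "(x, y) \<in> arcs D" by (rule some_arc_separated)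
  obtain z where z: "(y, z) \<in> arcs D" using has_out_nbr arc_verts[OF y] by blast
  show ?thesis using class_no_two_arc[OF y z] rel_A_iff[OF wf] y z by blast
qed

theorem cut_class_bipartite_parts:
  assumes "e \<in> arcs D"
  shows "bipartite_parts (Delta_of (A_class D e)) (fst ` A_class D e) (snd ` A_class D e)"
  using class_parts_disjoint[OF assms]
  by (auto simp: bipartite_parts_def Delta_of_def intro: rev_image_eqI)

end

section \<open>Generations of descendants and ancestors\<close>

lemma relpow_converse:
  fixes R :: "('a \<times> 'a) set"
  shows "(R\<inverse>) ^^ n = (R ^^ n)\<inverse>"
proof (induction n)
  case (Suc n)
  have "(R\<inverse>) ^^ Suc n = R\<inverse> O (R\<inverse>) ^^ n" by (simp add: relpow_commute)
  then show ?case using Suc by (simp add: converse_relcomp)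
qed auto

context cut_homogeneous
begin

lemma cut_contains_later_descendants:
  assumes "(u, z) \<in> (arcs D)\<^sup>*" "(z, w) \<in> (arcs D)\<^sup>*" "C \<in> E" "u \<notin> C" "z \<in> C"
  shows "w \<in> C"
  using assms
proof (induction rule: converse_rtrancl_induct)
  case (step u u')
  show ?case
  proof (cases "u' \<in> C")
    case True
    have "(u', w) \<in> (arcs D)\<^sup>*" using step.hyps(2) step.prems(1) by (rule rtrancl_trans)
    then show ?thesis using cut_contains_descendants step True by blast
  next
    case False
    then show ?thesis using step by blast
  qed
qed simp

definition inseparable :: "'a \<Rightarrow> 'a \<Rightarrow> bool" where
  "inseparable x y \<longleftrightarrow> (\<forall>C\<in>E. x \<in> C \<longleftrightarrow> y \<in> C)"

lemma inseparable_refl: "inseparable x x"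
  and inseparable_sym: "inseparable x y \<Longrightarrow> inseparable y x"
  and inseparable_trans: "inseparable x y \<Longrightarrow> inseparable y z \<Longrightarrow> inseparable x z"
  by (auto simp: inseparable_def)

lemma same_generation_same_side:
  assumes u: "u \<in> verts D" and z: "(u, z) \<in> arcs D ^^ j" "(z, w) \<in> (arcs D)\<^sup>*"
    and z': "(u, z') \<in> arcs D ^^ j" "(z', w) \<in> (arcs D)\<^sup>*"
    and C: "C \<in> E" "u \<notin> C" "z \<in> C"
  shows "z' \<in> C"
proof (rule ccontr)
  assume "z' \<notin> C"
  have uz: "(u, z) \<in> (arcs D)\<^sup>*" "(u, z') \<in> (arcs D)\<^sup>*" using z z' relpow_imp_rtrancl by metis+
  then have V: "z \<in> verts D" "z' \<in> verts D" using u desc_verts by auto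
  have "card (sep u z) = card (sep u z')" using card_sep_relpow z z' u by simp
  moreover have "C \<in> sep u z" "C \<notin> sep u z'" using C \<open>z' \<notin> C\<close> by (auto simp: sep_iff)
  ultimately obtain C' where "C' \<in> sep u z'" "C' \<notin> sep u z"
    using card_exchange[OF finite_sep[OF u V(1)] finite_sep[OF u V(2)]] by blast
  then have C': "C' \<in> E" "u \<notin> C'" "z' \<in> C'" "z \<notin> C'" by (auto simp: sep_iff)
  have "w \<in> C" by (rule cut_contains_later_descendants[OF uz(1) z(2) C])
  moreover have "w \<in> C'" by (rule cut_contains_later_descendants[OF uz(2) z'(2) C'(1,2,3)])
  ultimately show False using no_four_corners[OF C(1) C'(1), of w z z' u] C C' u \<open>z' \<notin> C\<close> by blast
qed

lemma same_generation_inseparable: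
  assumes u: "u \<in> verts D" and z: "(u, z) \<in> arcs D ^^ j" "(z, w) \<in> (arcs D)\<^sup>*"
    and z': "(u, z') \<in> arcs D ^^ j" "(z', w) \<in> (arcs D)\<^sup>*"
  shows "inseparable z z'"
  unfolding inseparable_def
proof
  fix C assume C: "C \<in> E"
  have V: "z \<in> verts D" "z' \<in> verts D"
    using u desc_verts relpow_imp_rtrancl z(1) z'(1) by metis+
  show "z \<in> C \<longleftrightarrow> z' \<in> C"
    using same_generation_same_side[OF u z z' C] same_generation_same_side[OF u z' z C]
      same_generation_same_side[OF u z z' E_compl[OF C]]
      same_generation_same_side[OF u z' z E_compl[OF C]] u V by blast
qed

definition siblings_rejoin :: "nat \<Rightarrow> bool" where
  "siblings_rejoin n \<longleftrightarrow> (\<exists>x s s' w. (x, s) \<in> arcs D \<and> (x, s') \<in> arcs D \<and> s \<noteq> s'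
     \<and> (s, w) \<in> arcs D ^^ n \<and> (s', w) \<in> arcs D ^^ n)"

lemma relpow_aut:
  assumes "automorphism g D" "(a, b) \<in> arcs D ^^ n" "a \<in> verts D"
  shows "(g a, g b) \<in> arcs D ^^ n"
  using assms(2,3)
proof (induction n arbitrary: a)
  case (Suc n)
  then obtain c where c: "(a, c) \<in> arcs D" "(c, b) \<in> arcs D ^^ n" by (metis relpow_Suc_D2)
  then have "(g a, g c) \<in> arcs D" using automorphism_arcs[OF assms(1)] arc_verts by blast
  then show ?case using Suc.IH[OF c(2)] c arc_verts by (metis relpow_Suc_I2)
qed simp

lemma all_siblings_rejoin:
  assumes "siblings_rejoin n" "(x, y) \<in> arcs D" "(x, y') \<in> arcs D" "y \<noteq> y'"
  obtains w where "(y, w) \<in> arcs D ^^ n" "(y', w) \<in> arcs D ^^ n"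
proof -
  obtain a s s' w where s: "(a, s) \<in> arcs D" "(a, s') \<in> arcs D" "s \<noteq> s'"
      "(s, w) \<in> arcs D ^^ n" "(s', w) \<in> arcs D ^^ n" using assms by (auto simp: siblings_rejoin_def)
  obtain g where "automorphism g D" "g s = y" "g a = x" "g s' = y'"
    using homogeneous_3[of a s s' x y y'] s assms by (auto simp: uadj_def)
  then show ?thesis using relpow_aut s arc_verts that by blast
qed

lemma out_generation_exists:
  assumes "x \<in> verts D" obtains y where "(x, y) \<in> arcs D ^^ n"
proof -
  have "\<exists>y. (x, y) \<in> arcs D ^^ n"
  proof (induction n)
    case (Suc n)
    then obtain y where y: "(x, y) \<in> arcs D ^^ n" by blast
    then have "y \<in> verts D" using assms desc_verts relpow_imp_rtrancl by metis
    then obtain z where "(y, z) \<in> arcs D" by (rule has_out_nbr)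
    then show ?case using y by (meson relpow_Suc_I)
  qed auto
  then show ?thesis using that by blast
qed

lemma siblings_inseparable_generation:
  assumes rejoin: "siblings_rejoin n" and y: "(x, y) \<in> arcs D" "(x, y') \<in> arcs D"
  obtains a a' where "(y, a) \<in> arcs D ^^ j" "(y', a') \<in> arcs D ^^ j" "inseparable a a'"
proof (cases "y = y'")
  case True
  obtain a where "(y, a) \<in> arcs D ^^ j" using out_generation_exists arc_verts y(1) by metis
  then show ?thesis using that True inseparable_refl by blast
next
  case False
  then obtain w where w: "(y, w) \<in> arcs D ^^ n" "(y', w) \<in> arcs D ^^ n"
    by (rule all_siblings_rejoin[OF rejoin y])
  have V: "x \<in> verts D" "y \<in> verts D" using y arc_verts by auto
  show ?thesis
  proof (cases "n \<le> j")
    case True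
    have "w \<in> verts D" using w V desc_verts relpow_imp_rtrancl by metis
    then obtain a where "(w, a) \<in> arcs D ^^ (j - n)" by (rule out_generation_exists)
    then have "(y, a) \<in> arcs D ^^ j" "(y', a) \<in> arcs D ^^ j"
      using w[THEN relpow_trans, of a "j - n"] True by simp_all
    then show ?thesis using that inseparable_refl by blast
  next
    case False
    then have "n = j + (n - j)" by simp
    then obtain a a' where a: "(y, a) \<in> arcs D ^^ j" "(a, w) \<in> arcs D ^^ (n - j)"
        "(y', a') \<in> arcs D ^^ j" "(a', w) \<in> arcs D ^^ (n - j)"
      using w by (metis relcomp.cases prod.inject relpow_add)
    have "inseparable a a'"
    proof (rule same_generation_inseparable[OF V(1)])
      show "(x, a) \<in> arcs D ^^ Suc j" "(x, a') \<in> arcs D ^^ Suc j" using y a by (metis relpow_Suc_I2)+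
      show "(a, w) \<in> (arcs D)\<^sup>*" "(a', w) \<in> (arcs D)\<^sup>*" using a relpow_imp_rtrancl by metis+
    qed
    then show ?thesis using that a(1,3) by blast
  qed
qed

lemma out_generation_inseparable:
  assumes "siblings_rejoin n"
    and "x \<in> verts D" "(x, v) \<in> arcs D ^^ j" "(x, v') \<in> arcs D ^^ j"
  shows "inseparable v v'"
  using assms(2-)
proof (induction j arbitrary: x v v')
  case 0
  then show ?case by (simp add: inseparable_refl)
next
  case (Suc j)
  obtain y y' where y: "(x, y) \<in> arcs D" "(y, v) \<in> arcs D ^^ j" "(x, y') \<in> arcs D" "(y', v') \<in> arcs D ^^ j"
    using Suc.prems by (metis relpow_Suc_D2)
  obtain a a' where a: "(y, a) \<in> arcs D ^^ j" "(y', a') \<in> arcs D ^^ j" "inseparable a a'"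
    by (rule siblings_inseparable_generation[OF assms(1) y(1,3)])
  have "inseparable v a" "inseparable v' a'"
    using Suc.IH[OF _ y(2) a(1)] Suc.IH[OF _ y(4) a(2)] arc_verts y by auto
  then show ?case using a(3) by (simp add: inseparable_def)
qed

end

context cut_homogeneous
begin

interpretation reversed: cut_homogeneous "rev_dg D" E by (rule rev_cut_homogeneous)

lemma siblings_rejoin_if_two_paths:
  assumes "(u, z) \<in> arcs D ^^ n" "(u, z') \<in> arcs D ^^ n" "z \<noteq> z'" "(z, w) \<in> arcs D" "(z', w) \<in> arcs D"
  obtains m where "siblings_rejoin m"
proof -
  have "\<exists>m. siblings_rejoin m"
    using assms(1,2)
  proof (induction n arbitrary: u)
    case 0
    then show ?case using assms by auto
  next
    case (Suc n)
    obtain y y' where y: "(u, y) \<in> arcs D" "(y, z) \<in> arcs D ^^ n" "(u, y') \<in> arcs D" "(y', z') \<in> arcs D ^^ n"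
      using Suc.prems by (metis relpow_Suc_D2)
    show ?case
    proof (cases "y = y'")
      case True
      then show ?thesis using Suc.IH y by blast
    next
      case False
      moreover have "(y, w) \<in> arcs D ^^ Suc n" "(y', w) \<in> arcs D ^^ Suc n"
        using y assms by (meson relpow_Suc_I)+
      ultimately show ?thesis using y unfolding siblings_rejoin_def by blast
    qed
  qed
  then show ?thesis using that by blast
qed

lemma in_generation_inseparable:
  assumes "reversed.siblings_rejoin n" "x \<in> verts D" "(v, x) \<in> arcs D ^^ j" "(v', x) \<in> arcs D ^^ j"
  shows "inseparable v v'"
  using reversed.out_generation_inseparable[of n x v j v'] assms by (simp add: relpow_converse)

lemma in_generation_exists:
  assumes "x \<in> verts D" obtains y where "(y, x) \<in> arcs D ^^ n"
  using reversed.out_generation_exists[of x n] assms by (auto simp: relpow_converse)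

definition generation :: "int \<Rightarrow> 'a \<Rightarrow> 'a \<Rightarrow> bool" where
  "generation i x y \<longleftrightarrow> (if i \<ge> 0 then (x, y) \<in> arcs D ^^ nat i else (y, x) \<in> arcs D ^^ nat (- i))"

lemma generation_nonneg: "i \<ge> 0 \<Longrightarrow> generation i x y \<longleftrightarrow> (x, y) \<in> arcs D ^^ nat i"
  and generation_nonpos: "i \<le> 0 \<Longrightarrow> generation i x y \<longleftrightarrow> (y, x) \<in> arcs D ^^ nat (- i)"
  by (auto simp: generation_def)

lemma generation_0 [simp]: "generation 0 x y \<longleftrightarrow> x = y"
  by (simp add: generation_def)

lemma generation_exists: "x \<in> verts D \<Longrightarrow> \<exists>y. generation i x y"
  unfolding generation_def by (cases "i \<ge> 0") (auto elim: out_generation_exists in_generation_exists)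

lemma generation_arc:
  assumes p: "p \<in> verts D" and ik: "i < k"
  obtains b b' where "generation i p b" "generation k p b'" "(b, b') \<in> arcs D ^^ nat (k - i)"
proof -
  consider "0 \<le> i" | "k \<le> 0" | "i < 0" "0 < k" by linarith
  then show ?thesis
  proof cases
    case 1
    obtain b where b: "(p, b) \<in> arcs D ^^ nat i" by (rule out_generation_exists[OF p])
    then have "b \<in> verts D" using p desc_verts relpow_imp_rtrancl by metis
    then obtain b' where b': "(b, b') \<in> arcs D ^^ nat (k - i)" by (rule out_generation_exists)
    have "nat k = nat i + nat (k - i)" using 1 ik by simp
    then have "(p, b') \<in> arcs D ^^ nat k" using relpow_trans[OF b b'] by simp
    then show ?thesis using that b b' 1 ik by (simp add: generation_nonneg)
  next
    case 2
    obtain b' where b': "(b', p) \<in> arcs D ^^ nat (- k)" by (rule in_generation_exists[OF p])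
    then have "b' \<in> verts D" using p anc_verts relpow_imp_rtrancl by metis
    then obtain b where b: "(b, b') \<in> arcs D ^^ nat (k - i)" by (rule in_generation_exists)
    have "nat (- i) = nat (k - i) + nat (- k)" using 2 ik by simp
    then have "(b, p) \<in> arcs D ^^ nat (- i)" using relpow_trans[OF b b'] by simp
    then show ?thesis using that b b' 2 ik by (simp add: generation_nonpos)
  next
    case 3
    obtain b where b: "(b, p) \<in> arcs D ^^ nat (- i)" by (rule in_generation_exists[OF p])
    obtain b' where b': "(p, b') \<in> arcs D ^^ nat k" by (rule out_generation_exists[OF p])
    have "nat (k - i) = nat (- i) + nat k" using 3 by simp
    then have "(b, b') \<in> arcs D ^^ nat (k - i)" using relpow_trans[OF b b'] by simp
    then show ?thesis using that b b' 3 by (simp add: generation_nonpos generation_nonneg)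
  qed
qed

lemma inseparable_generations_eq:
  assumes "x \<in> verts D" "(x, y) \<in> arcs D ^^ n" "inseparable x y" shows "n = 0"
proof -
  have "sep x y = {}" using assms(3) unfolding inseparable_def sep_def cutset_def by blast
  then have "n * cut_dist = 0" using card_sep_relpow[OF assms(2,1)] by simp
  then show ?thesis using cut_dist_pos by simp
qed

end

section \<open>Inseparable generations bound the number of ends\<close>

lemma ray_attains_height:
  fixes h :: "'a \<Rightarrow> int"
  assumes ray: "is_ray D r" and step: "\<And>x y. uadj D x y \<Longrightarrow> \<bar>h x - h y\<bar> \<le> 1"
    and up: "\<exists>i. n \<le> h (r i)" and below: "\<forall>i\<le>k. h (r i) < n"
  obtains i where "i \<ge> k" "h (r i) = n"
proof -
  obtain i where i: "n \<le> h (r i)" using up by blast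
  then have "k \<le> i" using below by (metis linorder_not_le nle_le)
  moreover have "\<forall>j. k \<le> j \<and> j < i \<longrightarrow> \<bar>h (r (Suc j)) - h (r j)\<bar> \<le> 1"
    using ray step by (metis abs_minus_commute is_ray_def)
  ultimately show ?thesis
    using nat_intermed_int_val[of k i "\<lambda>j. h (r j)" n] i below that by (auto simp: less_imp_le)
qed

lemma ascending_rays_not_separable:
  fixes h :: "'a \<Rightarrow> int"
  assumes ray: "is_ray D r" "is_ray D s"
    and step: "\<And>x y. uadj D x y \<Longrightarrow> \<bar>h x - h y\<bar> \<le> 1"
    and band: "\<And>x y. x \<in> verts D \<Longrightarrow> y \<in> verts D \<Longrightarrow> h x = h y \<Longrightarrow>
        (x, y) \<in> (ugraph D \<inter> {v. h x - M \<le> h v} \<times> {v. h x - M \<le> h v})\<^sup>*"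
    and up: "\<forall>n. \<exists>i. n \<le> h (r i)" "\<forall>n. \<exists>i. n \<le> h (s i)"
  shows "\<not> separable D r s"
proof
  assume "separable D r s"
  then obtain C i\<^sub>0 j\<^sub>0 where C: "finite (boundary (ugraph D) C)" "\<forall>i\<ge>i\<^sub>0. r i \<in> C" "\<forall>i\<ge>j\<^sub>0. s i \<notin> C"
    by (auto simp: separable_def)
  define B where "B = h ` fst ` boundary (ugraph D) C \<union> h ` r ` {..i\<^sub>0} \<union> h ` s ` {..j\<^sub>0}"
  have "finite B" using C by (simp add: B_def)
  then obtain b where b: "\<forall>x\<in>B. x < b"
    by (metis Max_ge add.commute less_add_one order_le_less_trans)
  define n where "n = b + \<bar>M\<bar>"
  have "x < n" if "x \<in> B" for x using b that by (fastforce simp: n_def)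
  then have below: "\<forall>i\<le>i\<^sub>0. h (r i) < n" "\<forall>i\<le>j\<^sub>0. h (s i) < n" by (auto simp: B_def)
  obtain i where i: "i \<ge> i\<^sub>0" "h (r i) = n"
    by (rule ray_attains_height[OF ray(1) step up(1)[rule_format] below(1)])
  obtain j where j: "j \<ge> j\<^sub>0" "h (s j) = n"
    by (rule ray_attains_height[OF ray(2) step up(2)[rule_format] below(2)])
  have "r i \<in> verts D" "s j \<in> verts D" using ray by (auto simp: is_ray_def)
  then have "(r i, s j) \<in> (ugraph D \<inter> {v. n - M \<le> h v} \<times> {v. n - M \<le> h v})\<^sup>*"
    using band[of "r i" "s j"] i j by simp
  then obtain u v where uv: "(u, v) \<in> ugraph D \<inter> {v. n - M \<le> h v} \<times> {v. n - M \<le> h v}" "u \<in> C" "v \<notin> C"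
    by (rule rtrancl_exits[where C = C]) (use C(2,3) i j in auto)
  then have "n - M \<le> h u" by simp
  from uv have "h u \<in> B" by (force simp: B_def boundary_def)
  then show False using b \<open>n - M \<le> h u\<close> by (auto simp: n_def)
qed

locale inseparable_generations = cut_homogeneous +
  fixes p :: 'a
  assumes p: "p \<in> verts D"
    and out_generation:
      "x \<in> verts D \<Longrightarrow> (x, v) \<in> arcs D ^^ j \<Longrightarrow> (x, v') \<in> arcs D ^^ j \<Longrightarrow> inseparable v v'"
    and in_generation:
      "x \<in> verts D \<Longrightarrow> (v, x) \<in> arcs D ^^ j \<Longrightarrow> (v', x) \<in> arcs D ^^ j \<Longrightarrow> inseparable v v'"
begin

lemma rev_inseparable_generations: "inseparable_generations (rev_dg D) E p"
proof -
  interpret reversed: cut_homogeneous "rev_dg D" E by (rule rev_cut_homogeneous)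
  show ?thesis
    by unfold_locales (use p out_generation in_generation in \<open>simp_all add: relpow_converse\<close>)
qed

definition at_level :: "'a \<Rightarrow> int \<Rightarrow> bool" where
  "at_level v i \<longleftrightarrow> (\<forall>j a b. generation j v a \<longrightarrow> generation (i + j) p b \<longrightarrow> inseparable a b)"

lemma at_level_base: "at_level p 0"
  unfolding at_level_def
proof (intro allI impI)
  fix j a b assume "generation j p a" "generation (0 + j) p b"
  then show "inseparable a b"
    using out_generation[OF p] in_generation[OF p]
    by (cases "j \<ge> 0") (auto simp: generation_def)
qed

lemma generation_shift_arc:
  assumes vw: "(v, w) \<in> arcs D" and a: "generation j w a"
  obtains a' where "generation (j + 1) v a'" "inseparable a a'"
proof (cases "j \<ge> 0")
  case True
  then have "(v, a) \<in> arcs D ^^ Suc (nat j)" using a vw generation_nonneg by (metis relpow_Suc_I2)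
  moreover have "nat (j + 1) = Suc (nat j)" using True by simp
  ultimately have "generation (j + 1) v a" using True by (simp add: generation_nonneg del: relpow.simps)
  then show ?thesis using that inseparable_refl by blast
next
  case False
  obtain a' where a': "generation (j + 1) v a'" using generation_exists arc_verts vw by blast
  then have "(a', v) \<in> arcs D ^^ nat (- (j + 1))" using False by (simp add: generation_nonpos)
  then have "(a', w) \<in> arcs D ^^ Suc (nat (- (j + 1)))" using vw by (meson relpow_Suc_I)
  moreover have "nat (- j) = Suc (nat (- (j + 1)))" using False by simp
  ultimately have "(a', w) \<in> arcs D ^^ nat (- j)" by simp
  moreover have "(a, w) \<in> arcs D ^^ nat (- j)" using a False by (simp add: generation_nonpos)
  ultimately show ?thesis using that[OF a'] in_generation arc_verts vw by blast
qed

lemma at_level_up: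
  assumes level: "at_level v i" and vw: "(v, w) \<in> arcs D"
  shows "at_level w (i + 1)"
  unfolding at_level_def
proof (intro allI impI)
  fix j a b assume a: "generation j w a" and b: "generation (i + 1 + j) p b"
  obtain a' where a': "generation (j + 1) v a'" "inseparable a a'"
    by (rule generation_shift_arc[OF vw a])
  have "i + (j + 1) = i + 1 + j" by simp
  then have "inseparable a' b" using level a'(1) b unfolding at_level_def by metis
  then show "inseparable a b" using a'(2) inseparable_trans by blast
qed

lemma at_level_unique:
  assumes v: "at_level v i" "at_level v k"
  shows "i = k"
proof -
  have "\<not> i < k" if v: "at_level v i" "at_level v k" for i k
  proof
    assume ik: "i < k"
    obtain b b' where b: "generation i p b" "generation k p b'" "(b, b') \<in> arcs D ^^ nat (k - i)"
      by (rule generation_arc[OF p ik])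
    have "inseparable v b" "inseparable v b'"
      using v b(1,2) unfolding at_level_def by (metis add.right_neutral generation_0)+
    then have "inseparable b b'" using inseparable_sym inseparable_trans by blast
    moreover have "b \<in> verts D"
      using b(1) p desc_verts anc_verts relpow_imp_rtrancl unfolding generation_def by metis
    ultimately have "nat (k - i) = 0" using inseparable_generations_eq b(3) by blast
    then show False using ik by simp
  qed
  from this[of i k] this[of k i] v show ?thesis by force
qed

end

context inseparable_generations
begin

interpretation reversed: inseparable_generations "rev_dg D" E p by (rule rev_inseparable_generations)

lemma reversed_generation: "reversed.generation i x y \<longleftrightarrow> generation (- i) x y"
  by (cases i "0::int" rule: linorder_cases)
    (auto simp: reversed.generation_def generation_def relpow_converse)

lemma reversed_at_level: "reversed.at_level v i \<longleftrightarrow> at_level v (- i)"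
proof
  assume level: "reversed.at_level v i"
  show "at_level v (- i)"
    unfolding at_level_def
  proof (intro allI impI)
    fix j a b assume "generation j v a" "generation (- i + j) p b"
    then have "reversed.generation (- j) v a" "reversed.generation (i + - j) p b"
      by (simp_all add: reversed_generation)
    then show "inseparable a b" using level unfolding reversed.at_level_def by blast
  qed
next
  assume level: "at_level v (- i)"
  show "reversed.at_level v i"
    unfolding reversed.at_level_def
  proof (intro allI impI)
    fix j a b assume "reversed.generation j v a" "reversed.generation (i + j) p b"
    then have "generation (- j) v a" "generation (- i + - j) p b"
      by (simp_all add: reversed_generation)
    then show "inseparable a b" using level unfolding at_level_def by blast
  qed
qed

lemma at_level_down:
  assumes "at_level v i" "(w, v) \<in> arcs D" shows "at_level w (i - 1)"
  using reversed.at_level_up[of v "- i" w] assms by (simp add: reversed_at_level)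

definition level :: "'a \<Rightarrow> int" where
  "level v = (THE i. at_level v i)"

lemma level_eq: "at_level v i \<Longrightarrow> level v = i"
  unfolding level_def using at_level_unique by blast

lemma at_level_level:
  assumes "v \<in> verts D" shows "at_level v (level v)"
proof -
  have "\<exists>i. at_level v i"
    using rtrancl_ugraph[OF p assms]
  proof (induction rule: rtrancl_induct)
    case base
    then show ?case using at_level_base by blast
  next
    case (step v w)
    then obtain i where i: "at_level v i" by blast
    have "(v, w) \<in> arcs D \<or> (w, v) \<in> arcs D" using step.hyps(2) by (simp add: ugraph_def uadj_def)
    then show ?case using at_level_up[OF i] at_level_down[OF i] by blast
  qed
  then show ?thesis using level_eq by blast
qed

lemma level_base: "level p = 0"
  by (rule level_eq[OF at_level_base])

lemma level_arc: "(v, w) \<in> arcs D \<Longrightarrow> level w = level v + 1"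
  using level_eq[OF at_level_up[OF at_level_level]] arc_verts by blast

lemma level_uadj: "uadj D x y \<Longrightarrow> \<bar>level x - level y\<bar> \<le> 1"
  using level_arc by (auto simp: uadj_def)

lemma level_eq_inseparable:
  assumes "v \<in> verts D" "v' \<in> verts D" "level v = level v'" shows "inseparable v v'"
proof -
  obtain b where b: "generation (level v) p b" using generation_exists p by blast
  have "inseparable v b" "inseparable v' b"
    using at_level_level[OF assms(1)] at_level_level[OF assms(2)] b assms(3)
    unfolding at_level_def by (metis add.right_neutral generation_0)+
  then show ?thesis using inseparable_sym inseparable_trans by blast
qed

lemma finite_level: "finite {v \<in> verts D. level v = n}"
proof (cases "{v \<in> verts D. level v = n} = {}")
  case False
  then obtain a where a: "a \<in> verts D" "level a = n" by blast
  obtain b where ab: "(a, b) \<in> arcs D" by (rule has_out_nbr[OF a(1)])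
  obtain C where C: "C \<in> sep a b" by (rule arc_separated[OF ab])
  have "{v \<in> verts D. level v = n} \<subseteq> snd ` boundary (ugraph D) C"
  proof
    fix v assume "v \<in> {v \<in> verts D. level v = n}"
    then have v: "v \<in> verts D" "level v = n" by auto
    obtain w where vw: "(v, w) \<in> arcs D" by (rule has_out_nbr[OF v(1)])
    have "inseparable v a" "inseparable w b"
      using level_eq_inseparable v a level_arc ab vw arc_verts by metis+
    then have "(w, v) \<in> boundary (ugraph D) C"
      using C vw by (auto simp: sep_iff inseparable_def boundary_def ugraph_def uadj_def)
    then show "v \<in> snd ` boundary (ugraph D) C" by force
  qed
  then show ?thesis using E_fin C by (meson finite_imageI finite_subset sep_iff)
next
  case True
  then show ?thesis by (simp only: finite.emptyI)
qed

lemma level_aut: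
  assumes g: "automorphism g D" and v: "v \<in> verts D"
  shows "level (g v) = level v + level (g p)"
  using rtrancl_ugraph[OF p v]
proof (induction rule: rtrancl_induct)
  case base
  then show ?case by (simp add: level_base)
next
  case (step u v)
  have V: "u \<in> verts D" "v \<in> verts D"
    using step.hyps(2) uadj_in_verts[OF wf] by (auto simp: ugraph_def)
  from step.hyps(2) consider "(u, v) \<in> arcs D" | "(v, u) \<in> arcs D" by (auto simp: ugraph_def uadj_def)
  then show ?case
    using level_arc automorphism_arcs[OF g] V step.IH by cases fastforce+
qed

definition band :: "int \<Rightarrow> int \<Rightarrow> ('a \<times> 'a) set" where
  "band i m = ugraph D \<inter> {v. \<bar>level v - i\<bar> \<le> m} \<times> {v. \<bar>level v - i\<bar> \<le> m}"

lemma level_zero_connected_in_band: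
  obtains m where "\<And>y. y \<in> verts D \<Longrightarrow> level y = 0 \<Longrightarrow> (p, y) \<in> (band 0 m)\<^sup>*"
proof -
  let ?L = "{y \<in> verts D. level y = 0}"
  have "\<exists>F. finite F \<and> F \<subseteq> ugraph D \<and> (p, y) \<in> F\<^sup>*" if "y \<in> ?L" for y
    using that rtrancl_ugraph[OF p] rtrancl_finite_subrelation by (metis (lifting) mem_Collect_eq)
  then obtain F where F: "\<And>y. y \<in> ?L \<Longrightarrow> finite (F y) \<and> F y \<subseteq> ugraph D \<and> (p, y) \<in> (F y)\<^sup>*" by metis
  define m where "m = Max ((\<lambda>v. \<bar>level v\<bar>) ` Field (\<Union>y\<in>?L. F y))"
  have "finite (Field (\<Union>y\<in>?L. F y))" using F finite_level by (intro finite_Field) blast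
  then have bound: "\<bar>level v\<bar> \<le> m" if "v \<in> Field (\<Union>y\<in>?L. F y)" for v
    unfolding m_def using that by (intro Max_ge) auto
  have "F y \<subseteq> band 0 m" if y: "y \<in> ?L" for y
  proof (intro subrelI)
    fix u v assume uv: "(u, v) \<in> F y"
    then have "u \<in> Field (\<Union>y\<in>?L. F y)" "v \<in> Field (\<Union>y\<in>?L. F y)" using y unfolding Field_def by blast+
    then have "\<bar>level u\<bar> \<le> m" "\<bar>level v\<bar> \<le> m" using bound by blast+
    then show "(u, v) \<in> band 0 m" using F[OF y] uv by (auto simp: band_def)
  qed
  then have "(p, y) \<in> (band 0 m)\<^sup>*" if "y \<in> ?L" for y
    using F[OF that] rtrancl_mono[of "F y" "band 0 m"] that by blast
  then show ?thesis using that by blast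
qed

lemma same_level_connected_in_band:
  obtains m where "\<And>x y. x \<in> verts D \<Longrightarrow> y \<in> verts D \<Longrightarrow> level x = level y \<Longrightarrow> (x, y) \<in> (band (level x) m)\<^sup>*"
proof -
  obtain m where m: "\<And>y. y \<in> verts D \<Longrightarrow> level y = 0 \<Longrightarrow> (p, y) \<in> (band 0 m)\<^sup>*"
    by (rule level_zero_connected_in_band) blast
  have "(x, y) \<in> (band (level x) m)\<^sup>*"
    if xy: "x \<in> verts D" "y \<in> verts D" "level x = level y" for x y
  proof -
    obtain g where g: "automorphism g D" "g p = x" using vertex_transitive p xy by blast
    have shift: "level (g v) = level v + level x" if "v \<in> verts D" for v
      using level_aut[OF g(1) that] g(2) by simp
    obtain y' where y': "y' \<in> verts D" "g y' = y"
      using automorphism_bij[OF g(1)] xy(2) unfolding bij_betw_def by (metis imageE)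
    then have "level y' = 0" using shift[OF y'(1)] xy(3) by simp
    then have "(p, y') \<in> (band 0 m)\<^sup>*" by (rule m[OF y'(1)])
    then have "(g p, g y') \<in> (band (level x) m)\<^sup>*"
    proof (induction rule: rtrancl_induct)
      case (step u v)
      then have "u \<in> verts D" "v \<in> verts D" using ugraph_sub[OF wf] by (auto simp: band_def)
      then have "(g u, g v) \<in> band (level x) m"
        using step.hyps(2) shift automorphism_uadj[OF g(1)] by (simp add: band_def ugraph_def)
      then show ?case using step.IH by (rule rtrancl_into_rtrancl[rotated])
    qed simp
    then show ?thesis using g y' by simp
  qed
  then show ?thesis using that by blast
qed

lemma ascending_rays_equiv:
  assumes rays: "is_ray D r" "is_ray D s"
  shows "\<forall>n. \<exists>i. n \<le> level (r i) \<Longrightarrow> \<forall>n. \<exists>i. n \<le> level (s i) \<Longrightarrow> equiv_rays D r s"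
    and "\<forall>n. \<exists>i. n \<le> - level (r i) \<Longrightarrow> \<forall>n. \<exists>i. n \<le> - level (s i) \<Longrightarrow> equiv_rays D r s"
proof -
  obtain m where m: "\<And>x y. x \<in> verts D \<Longrightarrow> y \<in> verts D \<Longrightarrow> level x = level y \<Longrightarrow>
      (x, y) \<in> (band (level x) m)\<^sup>*" by (rule same_level_connected_in_band) blast
  have equiv: "equiv_rays D r s" if "\<not> separable D r s"
    using that inequivalent_rays_separable[OF wf lf rays] by blast
  {
    assume up: "\<forall>n. \<exists>i. n \<le> level (r i)" "\<forall>n. \<exists>i. n \<le> level (s i)"
    show "equiv_rays D r s"
    proof (rule equiv[OF ascending_rays_not_separable[OF rays level_uadj _ up]])
      fix x y assume "x \<in> verts D" "y \<in> verts D" "level x = level y"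
      from m[OF this] show
        "(x, y) \<in> (ugraph D \<inter> {v. level x - m \<le> level v} \<times> {v. level x - m \<le> level v})\<^sup>*"
        by (rule subsetD[OF rtrancl_mono, rotated]) (auto simp: band_def)
    qed
  next
    assume down: "\<forall>n. \<exists>i. n \<le> - level (r i)" "\<forall>n. \<exists>i. n \<le> - level (s i)"
    show "equiv_rays D r s"
    proof (rule equiv[OF ascending_rays_not_separable[OF rays _ _ down]])
      show "\<bar>- level x - - level y\<bar> \<le> 1" if "uadj D x y" for x y using level_uadj[OF that] by linarith
      fix x y assume "x \<in> verts D" "y \<in> verts D" "- level x = - level y"
      then have "(x, y) \<in> (band (level x) m)\<^sup>*" using m by simp
      then show "(x, y) \<in> (ugraph D \<inter> {v. - level x - m \<le> - level v} \<times> {v. - level x - m \<le> - level v})\<^sup>*"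
        by (rule subsetD[OF rtrancl_mono, rotated]) (auto simp: band_def)
    qed
  }
qed

lemma ray_ascends_or_descends:
  assumes r: "is_ray D r"
  shows "(\<forall>n. \<exists>i. n \<le> level (r i)) \<or> (\<forall>n. \<exists>i. n \<le> - level (r i))"
proof (rule ccontr)
  assume "\<not> ?thesis"
  then obtain m n where mn: "\<forall>i. level (r i) < n" "\<forall>i. - level (r i) < m" by (auto simp: not_le)
  have "range r \<subseteq> (\<Union>k\<in>{-m..n}. {v \<in> verts D. level v = k})"
  proof
    fix v assume "v \<in> range r"
    then obtain i where i: "v = r i" by blast
    then have "v \<in> verts D" using r by (auto simp: is_ray_def)
    moreover have "level v \<in> {-m..n}" using mn i by (auto simp: less_imp_le minus_less_iff)
    ultimately show "v \<in> (\<Union>k\<in>{-m..n}. {v \<in> verts D. level v = k})" by blast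
  qed
  then have "finite (range r)" by (rule finite_subset) (use finite_level in auto)
  then show False using r by (auto simp: is_ray_def dest: finite_imageD)
qed

theorem not_more_than_two_ends: "\<not> more_than_two_ends D"
proof
  assume "more_than_two_ends D"
  then obtain r s t where rays: "is_ray D r" "is_ray D s" "is_ray D t"
    and "\<not> equiv_rays D r s" "\<not> equiv_rays D r t" "\<not> equiv_rays D s t"
    by (auto simp: more_than_two_ends_def)
  then show False
    using rays[THEN ray_ascends_or_descends] ascending_rays_equiv[OF rays(1,2)]
      ascending_rays_equiv[OF rays(1,3)] ascending_rays_equiv[OF rays(2,3)] by argo
qed

end

section \<open>Descendant and ancestor trees\<close>

lemma uconnected_induced_desc: "uconnected (induced D (desc D u))"
proof -
  let ?S = "desc D u"
  have "connected_on (ugraph D) ?S"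
  proof (rule connected_on_from[OF sym_ugraph])
    show "u \<in> ?S" by (simp add: desc_def)
    fix x assume "x \<in> ?S"
    then have "(u, x) \<in> (arcs D)\<^sup>*" by (simp add: desc_def)
    then show "(u, x) \<in> (ugraph D \<inter> ?S \<times> ?S)\<^sup>*"
    proof (induction rule: rtrancl_induct)
      case (step y z)
      have "(u, z) \<in> (arcs D)\<^sup>*" using step.hyps by (rule rtrancl_into_rtrancl)
      then have "(y, z) \<in> ugraph D \<inter> ?S \<times> ?S" using step.hyps by (simp add: desc_def ugraph_def uadj_def)
      then show ?case using step.IH by (rule rtrancl_into_rtrancl[rotated])
    qed simp
  qed
  then show ?thesis by (auto simp: uconnected_induced_iff desc_def)
qed

context cut_homogeneous
begin

interpretation reversed: cut_homogeneous "rev_dg D" E by (rule rev_cut_homogeneous)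

lemma no_common_out_nbr_in_generation:
  assumes "more_than_two_ends D" "u \<in> verts D"
    and z: "(u, z) \<in> arcs D ^^ n" "(u, z') \<in> arcs D ^^ n" "(z, w) \<in> arcs D" "(z', w) \<in> arcs D"
  shows "z = z'"
proof (rule ccontr)
  assume ne: "z \<noteq> z'"
  obtain m where m: "siblings_rejoin m" by (rule siblings_rejoin_if_two_paths[OF z(1,2) ne z(3,4)])
  have rev: "reversed.siblings_rejoin n"
    using z ne by (auto simp: reversed.siblings_rejoin_def relpow_converse)
  interpret inseparable_generations D E u
    by unfold_locales
      (use assms(2) out_generation_inseparable[OF m] in_generation_inseparable[OF rev] in blast)+
  show False using not_more_than_two_ends assms(1) by contradiction
qed

lemma relpow_length_unique:
  assumes "u \<in> verts D" "(u, v) \<in> arcs D ^^ m" "(u, v) \<in> arcs D ^^ n" shows "m = n"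
  using card_sep_relpow[OF assms(2,1)] card_sep_relpow[OF assms(3,1)] cut_dist_pos by simp

lemma is_cycle_desc_two_in_nbrs:
  assumes u: "u \<in> verts D" and xs: "is_cycle D xs" "set xs \<subseteq> desc D u"
  obtains v a b n where "a \<noteq> b" "(a, v) \<in> arcs D" "(b, v) \<in> arcs D"
    "(u, a) \<in> arcs D ^^ n" "(u, b) \<in> arcs D ^^ n"
proof -
  define depth where "depth v = card (sep u v)" for v
  have depth: "depth v = n * cut_dist" if "(u, v) \<in> arcs D ^^ n" for v n
    using card_sep_relpow[OF that u] by (simp add: depth_def)
  have reach: "\<exists>n. (u, v) \<in> arcs D ^^ n" if "v \<in> set xs" for v
    using that xs(2) rtrancl_imp_relpow by (fastforce simp: desc_def)
  have "xs \<noteq> []" using xs(1) by (auto simp: is_cycle_def)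
  then have "Max (depth ` set xs) \<in> depth ` set xs" by (intro Max_in) auto
  then obtain v where "v \<in> set xs" "depth v = Max (depth ` set xs)" by auto
  then have v: "v \<in> set xs" "\<forall>w\<in>set xs. depth w \<le> depth v" by simp_all
  have in_nbr: "(w, v) \<in> arcs D" if w: "w \<in> set xs" "uadj D v w" for w
  proof -
    have "(v, w) \<notin> arcs D"
    proof
      assume vw: "(v, w) \<in> arcs D"
      obtain n where n: "(u, v) \<in> arcs D ^^ n" using reach v by blast
      then have "(u, w) \<in> arcs D ^^ Suc n" using vw by (meson relpow_Suc_I)
      from depth[OF n] depth[OF this] have "depth v < depth w" using cut_dist_pos by simp
      then show False using v(2) w(1) by force
    qed
    then show ?thesis using w by (simp add: uadj_def)
  qed
  obtain a b where ab: "a \<in> set xs" "b \<in> set xs" "a \<noteq> b" "uadj D v a" "uadj D v b"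
    by (rule is_cycle_two_nbrs[OF xs(1) v(1)])
  obtain m n where mn: "(u, a) \<in> arcs D ^^ m" "(u, b) \<in> arcs D ^^ n" using reach ab by blast
  have arcs: "(a, v) \<in> arcs D" "(b, v) \<in> arcs D" using in_nbr ab by blast+
  then have "(u, v) \<in> arcs D ^^ Suc m" "(u, v) \<in> arcs D ^^ Suc n" using mn by (meson relpow_Suc_I)+
  then have "m = n" using relpow_length_unique[OF u] by blast
  then show ?thesis using that ab(3) arcs mn by blast
qed

theorem desc_tree:
  assumes "more_than_two_ends D" "u \<in> verts D" shows "is_tree (induced D (desc D u))"
proof -
  let ?H = "induced D (desc D u)"
  have "\<not> is_cycle ?H xs" for xs
  proof
    assume xs: "is_cycle ?H xs"
    have sub: "set xs \<subseteq> desc D u"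
      using is_cycle_in_verts[OF _ xs] by (auto simp: ugraph_def uadj_induced)
    have "is_cycle D xs"
      using xs by (auto simp: is_cycle_def uadj_induced elim: successively_mono)
    then show False
      using is_cycle_desc_two_in_nbrs[OF assms(2) _ sub] no_common_out_nbr_in_generation[OF assms] by metis
  qed
  then have "uacyclic ?H"
    using uacyclic_iff[of ?H] by (auto simp: ugraph_def uadj_induced)
  then show ?thesis using uconnected_induced_desc by (simp add: is_tree_def)
qed

end

context cut_homogeneous
begin

interpretation reversed: cut_homogeneous "rev_dg D" E by (rule rev_cut_homogeneous)

theorem anc_tree:
  assumes "more_than_two_ends D" "u \<in> verts D" shows "is_tree (induced D (anc D u))"
proof -
  have "more_than_two_ends (rev_dg D)"
    using assms by (simp add: more_than_two_ends_def is_ray_rev equiv_rays_rev)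
  then have "is_tree (induced (rev_dg D) (desc (rev_dg D) u))" using reversed.desc_tree assms by simp
  then show ?thesis by (simp add: desc_rev induced_rev is_tree_rev)
qed

end

section \<open>Biregular bipartite graphs\<close>

lemma bij_betw_Pair_Un:
  assumes "bij_betw h X A" "bij_betw k Y B" "X \<inter> Y = {}"
  shows "bij_betw (\<lambda>z. if z \<in> X then (False, h z) else (True, k z)) (X \<union> Y) ({False} \<times> A \<union> {True} \<times> B)"
proof (rule bij_betw_combine)
  show "bij_betw (\<lambda>z. if z \<in> X then (False, h z) else (True, k z)) X ({False} \<times> A)"
    using assms(1) by (auto simp: bij_betw_def inj_on_def)
  show "bij_betw (\<lambda>z. if z \<in> X then (False, h z) else (True, k z)) Y ({True} \<times> B)"
    using assms(2,3) by (auto simp: bij_betw_def inj_on_def)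
qed auto

lemma cycle_graph_uadj:
  "i < n \<Longrightarrow> j < n \<Longrightarrow> uadj (cycle_graph n) i j \<longleftrightarrow> j = Suc i mod n \<or> i = Suc j mod n"
  by (auto simp: uadj_def cycle_graph_def)

locale biregular_bipartite =
  fixes G :: "'a dg" and col :: "'a \<Rightarrow> bool" and deg :: "bool \<Rightarrow> nat"
  assumes adj_verts: "uadj G x y \<Longrightarrow> x \<in> verts G"
    and adj_col: "uadj G x y \<Longrightarrow> col x \<noteq> col y"
    and conn: "uconnected G"
    and finite_nbrs: "x \<in> verts G \<Longrightarrow> finite {y. uadj G x y}"
    and card_nbrs: "x \<in> verts G \<Longrightarrow> card {y. uadj G x y} = deg (col x)"
    and deg_pos: "deg c \<ge> 1"
begin

abbreviation V :: "'a set" where "V \<equiv> verts G"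

abbreviation adj :: "'a \<Rightarrow> 'a \<Rightarrow> bool" where "adj \<equiv> uadj G"

definition N :: "'a \<Rightarrow> 'a set" where "N x = {y. adj x y}"

lemma adj_sym: "adj x y \<Longrightarrow> adj y x"
  by (simp add: uadj_commute)

lemma in_N [simp]: "y \<in> N x \<longleftrightarrow> adj x y"
  by (simp add: N_def)

lemma adj_irrefl: "\<not> adj x x"
  using adj_col by blast

lemma adj_verts2: "adj x y \<Longrightarrow> y \<in> V"
  using adj_verts adj_sym by blast

lemma N_subset: "N x \<subseteq> V"
  using adj_verts2 by auto

lemma ugraph_verts: "ugraph G \<subseteq> V \<times> V"
  using adj_verts adj_verts2 by (auto simp: ugraph_def)

lemma N_Image: "N x = ugraph G `` {x}"
  by (auto simp: ugraph_def)

lemma finite_N: "x \<in> V \<Longrightarrow> finite (N x)" and card_N: "x \<in> V \<Longrightarrow> card (N x) = deg (col x)"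
  using finite_nbrs card_nbrs by (simp_all add: N_def)

lemma same_col_if_common_nbr: "adj x y \<Longrightarrow> adj x' y \<Longrightarrow> col x = col x'"
  using adj_col by metis

lemma graph_induct:
  assumes "x \<in> V" "P x" "\<And>u v. P u \<Longrightarrow> adj u v \<Longrightarrow> P v" "y \<in> V" shows "P y"
proof -
  have "(x, y) \<in> (ugraph G)\<^sup>*"
    using conn connected_on_rtrancl assms(1,4) by (fastforce simp: uconnected_iff)
  then show ?thesis
    by (induction rule: rtrancl_induct) (use assms in \<open>auto simp: ugraph_def\<close>)
qed

lemma nbr_avoiding:
  assumes "x \<in> V" "length ps < deg (col x)" obtains y where "adj x y" "y \<notin> set ps"
proof -
  have "\<not> N x \<subseteq> set ps"
  proof
    assume "N x \<subseteq> set ps"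
    then have "card (N x) \<le> card (set ps)" by (rule card_mono[rotated]) simp
    then have "card (N x) \<le> length ps" using card_length[of ps] by simp
    then show False using card_N assms by simp
  qed
  then obtain y where "y \<in> N x" "y \<notin> set ps" by blast
  then show ?thesis using that[of y] by simp
qed

lemma has_nbr:
  assumes "x \<in> V" obtains y where "adj x y"
  using nbr_avoiding[OF assms, of "[]"] deg_pos[of "col x"] by fastforce

lemma colour_vertex: obtains x where "x \<in> V" "col x = c"
proof -
  obtain x where x: "x \<in> V" using conn by (auto simp: uconnected_def)
  obtain y where "adj x y" by (rule has_nbr[OF x])
  then show ?thesis using that x adj_col adj_verts2 by metis
qed

lemma listed_if_complete:
  assumes fin: "finite V" and adj: "\<And>z w. z \<in> V \<Longrightarrow> w \<in> V \<Longrightarrow> adj z w \<longleftrightarrow> col z \<noteq> col w"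
  shows "listed_graph G"
proof -
  define X where "X = {z \<in> V. col z}"
  define Y where "Y = {z \<in> V. \<not> col z}"
  have V: "V = X \<union> Y" "X \<inter> Y = {}" by (auto simp: X_def Y_def)
  then have fin': "finite X" "finite Y" using fin by auto
  obtain h where h: "bij_betw h X {0..<card X}" using ex_bij_betw_finite_nat[OF fin'(1)] by blast
  obtain k where k: "bij_betw k Y {0..<card Y}" using ex_bij_betw_finite_nat[OF fin'(2)] by blast
  let ?K = "K_bip (card X) (card Y)"
  define f where "f = (\<lambda>z. if z \<in> X then (False, h z) else (True, k z))"
  have "verts ?K = {False} \<times> {0..<card X} \<union> {True} \<times> {0..<card Y}" by (auto simp: K_bip_def)
  then have "bij_betw f V (verts ?K)" using bij_betw_Pair_Un[OF h k V(2)] V(1) by (simp add: f_def)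
  moreover have "uadj ?K (f x) (f y) \<longleftrightarrow> col x \<noteq> col y" if "x \<in> V" "y \<in> V" for x y
    using bij_betwE[OF h] bij_betwE[OF k] that by (auto simp: f_def uadj_def K_bip_def X_def Y_def)
  ultimately have "u_isomorphic G ?K" unfolding u_isomorphic_def using adj by (intro exI[of _ f]) simp
  moreover have "X \<noteq> {}" "Y \<noteq> {}" using colour_vertex by (auto simp: X_def Y_def)
  then have "card X \<ge> 1" "card Y \<ge> 1" using fin' by (simp_all add: Suc_le_eq card_gt_0_iff)
  ultimately show ?thesis unfolding listed_graph_def by blast
qed

lemma twins_adj_iff:
  assumes twins: "\<And>x x' y. adj x y \<Longrightarrow> adj x' y \<Longrightarrow> col x = c \<Longrightarrow> N x = N x'"
    and V: "z \<in> V" "w \<in> V"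
  shows "adj z w \<longleftrightarrow> col z \<noteq> col w"
proof
  obtain x where x: "x \<in> V" "col x = c" by (rule colour_vertex)
  have all: "(col v = c \<longrightarrow> N v = N x) \<and> (col v \<noteq> c \<longrightarrow> adj x v)" if "v \<in> V" for v
  proof (rule graph_induct[OF x(1) _ _ that])
    show "(col x = c \<longrightarrow> N x = N x) \<and> (col x \<noteq> c \<longrightarrow> adj x x)" using x(2) by simp
    fix u v assume u: "(col u = c \<longrightarrow> N u = N x) \<and> (col u \<noteq> c \<longrightarrow> adj x u)" and uv: "adj u v"
    show "(col v = c \<longrightarrow> N v = N x) \<and> (col v \<noteq> c \<longrightarrow> adj x v)"
    proof (cases "col u = c")
      case True
      then show ?thesis using u uv in_N adj_col[OF uv] by blast
    next
      case False
      then show ?thesis using u twins[OF _ adj_sym[OF uv]] x(2) adj_col[OF uv] by blast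
    qed
  qed
  assume "col z \<noteq> col w"
  then consider "col z = c" "col w \<noteq> c" | "col z \<noteq> c" "col w = c" by blast
  then show "adj z w"
  proof cases
    case 1
    then show ?thesis using all[OF V(1)] all[OF V(2)] in_N by blast
  next
    case 2
    then show ?thesis using all[OF V(1)] all[OF V(2)] in_N adj_sym by blast
  qed
qed (rule adj_col)

lemma listed_if_twins:
  assumes twins: "\<And>x x' y. adj x y \<Longrightarrow> adj x' y \<Longrightarrow> col x = c \<Longrightarrow> N x = N x'"
  shows "listed_graph G"
proof (rule listed_if_complete)
  obtain x where x: "x \<in> V" "col x = True" by (rule colour_vertex)
  obtain y where y: "y \<in> V" "col y = False" by (rule colour_vertex)
  have "V \<subseteq> N x \<union> N y" using twins_adj_iff[OF twins x(1)] twins_adj_iff[OF twins y(1)] x(2) y(2) by auto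
  then show "finite V" using finite_N x(1) y(1) by (meson finite_UnI finite_subset)
qed (rule twins_adj_iff[OF twins])

lemma listed_if_deg_1:
  assumes c: "deg c = 1" shows "listed_graph G"
proof (rule listed_if_twins)
  fix x x' y assume xy: "adj x y" "adj x' y" "col x = c"
  have "N z = {y}" if "adj z y" "col z = c" for z
  proof -
    have "card (N z) = 1" using card_N[OF adj_verts[OF that(1)]] that c by simp
    then obtain w where "N z = {w}" by (metis card_1_singletonE)
    then show ?thesis using that by (metis in_N singletonD)
  qed
  then show "N x = N x'" using xy same_col_if_common_nbr[OF xy(1,2)] by simp
qed

lemma listed_if_complete_minus_matching:
  assumes fin: "finite V" and \<eta>: "bij_betw \<eta> {z \<in> V. col z = c} {z \<in> V. col z \<noteq> c}"
    and adj: "\<And>z w. z \<in> V \<Longrightarrow> w \<in> V \<Longrightarrow> col z = c \<Longrightarrow> col w \<noteq> c \<Longrightarrow> adj z w \<longleftrightarrow> w \<noteq> \<eta> z"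
  shows "listed_graph G"
proof -
  define X where "X = {z \<in> V. col z = c}"
  define Y where "Y = {z \<in> V. col z \<noteq> c}"
  have V: "V = X \<union> Y" "X \<inter> Y = {}" by (auto simp: X_def Y_def)
  have "finite X" using fin by (simp add: X_def)
  then obtain h where h: "bij_betw h X {0..<card X}" using ex_bij_betw_finite_nat by blast
  have \<eta>': "bij_betw \<eta> X Y" using \<eta> by (simp add: X_def Y_def)
  define k where "k = h \<circ> inv_into X \<eta>"
  have k: "bij_betw k Y {0..<card X}"
    unfolding k_def by (rule bij_betw_trans[OF bij_betw_inv_into[OF \<eta>'] h])
  have k\<eta>: "k y = h x \<longleftrightarrow> y = \<eta> x" if "x \<in> X" "y \<in> Y" for x y
    using that \<eta>' bij_betw_inv_into_left[OF \<eta>'] bij_betw_inv_into_right[OF \<eta>']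
      inj_onD[OF bij_betw_imp_inj_on[OF h]] bij_betwE[OF bij_betw_inv_into[OF \<eta>']]
    unfolding k_def comp_def by metis
  let ?C = "CP_graph (card X)"
  define f where "f = (\<lambda>z. if z \<in> X then (False, h z) else (True, k z))"
  have "verts ?C = {False} \<times> {0..<card X} \<union> {True} \<times> {0..<card X}" by (auto simp: CP_graph_def)
  then have "bij_betw f V (verts ?C)" using bij_betw_Pair_Un[OF h k V(2)] V(1) by (simp add: f_def)
  moreover have "adj x y \<longleftrightarrow> uadj ?C (f x) (f y)" if xy: "x \<in> V" "y \<in> V" for x y
  proof -
    have across: "adj x y \<longleftrightarrow> uadj ?C (f x) (f y)" if "x \<in> X" "y \<in> Y" for x y
    proof -
      have "adj x y \<longleftrightarrow> h x \<noteq> k y" using adj k\<eta>[OF that] that by (auto simp: X_def Y_def)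
      then show ?thesis
        using that V(2) bij_betwE[OF h] bij_betwE[OF k] by (auto simp: f_def uadj_def CP_graph_def)
    qed
    have "\<not> adj x y" "\<not> uadj ?C (f x) (f y)" if "(x \<in> X) = (y \<in> X)"
      using that xy adj_col[of x y] by (auto simp: f_def uadj_def CP_graph_def X_def)
    then show ?thesis using across[of x y] across[of y x] V(1) xy
      uadj_commute[of G x y] uadj_commute[of ?C "f x" "f y"] by blast
  qed
  ultimately have "u_isomorphic G ?C" unfolding u_isomorphic_def by blast
  moreover have "X \<noteq> {}" using colour_vertex[of c] by (auto simp: X_def)
  then have "card X \<ge> 1" using \<open>finite X\<close> by (simp add: Suc_le_eq card_gt_0_iff)
  ultimately show ?thesis unfolding listed_graph_def by blast
qed

lemma successively_verts: "successively adj xs \<Longrightarrow> length xs \<ge> 2 \<Longrightarrow> set xs \<subseteq> V"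
proof (induction xs rule: induct_list012)
  case (3 x y zs)
  then show ?case using adj_verts adj_verts2 by (cases zs) auto
qed auto

lemma acyclic_path_extends:
  assumes ac: "uacyclic G" and deg: "\<And>c. deg c \<ge> 2"
    and path: "distinct (v # w # ws)" "successively adj (v # w # ws)"
  obtains u where "adj u v" "u \<notin> set (v # w # ws)"
proof -
  have "length [w] < deg (col v)" using deg[of "col v"] by simp
  then obtain u where u: "adj v u" "u \<noteq> w" using nbr_avoiding[of v "[w]"] path(2) adj_verts by auto
  have "u \<notin> set (v # w # ws)"
  proof
    assume "u \<in> set (v # w # ws)"
    then have "u \<in> set ws" using u adj_irrefl by auto
    then obtain as bs where "ws = as @ u # bs" by (meson split_list)
    then have "is_cycle G ((v # w # as) @ [u])"
      unfolding is_cycle_snoc_iff using path u adj_sym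
      by (auto simp: successively_Cons successively_append_iff hd_append split: if_splits)
    then show False using ac uacyclic_iff[OF ugraph_verts] by blast
  qed
  then show ?thesis using that u(1) adj_sym by blast
qed

lemma acyclic_infinite:
  assumes ac: "uacyclic G" and deg: "\<And>c. deg c \<ge> 2" shows "infinite V"
proof
  assume fin: "finite V"
  have walk: "\<exists>v w ws. distinct (v # w # ws) \<and> successively adj (v # w # ws) \<and> length ws = n" for n
  proof (induction n)
    case 0
    obtain v where v: "v \<in> V" using colour_vertex by blast
    obtain w where "adj v w" by (rule has_nbr[OF v])
    then show ?case using adj_irrefl by (intro exI[of _ v] exI[of _ w] exI[of _ "[]"]) auto
  next
    case (Suc n)
    then obtain v w ws where ws: "distinct (v # w # ws)" "successively adj (v # w # ws)" "length ws = n"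
      by blast
    obtain u where "adj u v" "u \<notin> set (v # w # ws)" by (rule acyclic_path_extends[OF ac deg ws(1,2)])
    then show ?case using ws by (intro exI[of _ u] exI[of _ v] exI[of _ "w # ws"]) auto
  qed
  obtain v w ws where ws: "distinct (v # w # ws)" "successively adj (v # w # ws)" "length ws = card V"
    using walk by blast
  have "card (set (v # w # ws)) \<le> card V"
    using successively_verts[OF ws(2)] fin by (intro card_mono) auto
  then show False using distinct_card[OF ws(1)] ws(3) by simp
qed

lemma listed_if_acyclic:
  assumes ac: "uacyclic G" shows "listed_graph G"
proof (cases "\<exists>c. deg c = 1")
  case True
  then show ?thesis using listed_if_deg_1 by blast
next
  case False
  then have "deg c \<ge> 2" for c using deg_pos[of c] by (metis Suc_1 Suc_leI le_neq_implies_less)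
  then have inf: "infinite V" by (rule acyclic_infinite[OF ac])
  let ?X = "{x \<in> V. col x}" and ?Y = "{x \<in> V. \<not> col x}"
  have "?X \<inter> ?Y = {} \<and> ?X \<union> ?Y = V \<and> (\<forall>x\<in>V. \<forall>y\<in>V. adj x y \<longrightarrow> (x \<in> ?X \<longleftrightarrow> y \<in> ?Y))
      \<and> (\<forall>x\<in>?X. finite {w. adj x w} \<and> card {w. adj x w} = deg True)
      \<and> (\<forall>y\<in>?Y. finite {w. adj y w} \<and> card {w. adj y w} = deg False)"
    using finite_nbrs card_nbrs adj_col by auto
  then have "is_T_ab G (deg True) (deg False)"
    unfolding is_T_ab_def is_tree_def using ac conn inf by blast
  then have "\<exists>a b. a \<ge> 1 \<and> b \<ge> 1 \<and> is_T_ab G a b" using deg_pos by metis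
  then show ?thesis unfolding listed_graph_def by (intro disjI2)
qed

lemma path_colours:
  assumes "successively adj xs" "i < length xs" shows "col (xs ! i) \<longleftrightarrow> (col (xs ! 0) \<longleftrightarrow> even i)"
  using assms(2)
proof (induction i)
  case (Suc i)
  then have "adj (xs ! i) (xs ! Suc i)" using assms(1) by (simp add: successively_conv_nth)
  then show ?case using adj_col Suc by auto
qed simp

lemma cycle_even_length:
  assumes "is_cycle G xs" shows "even (length xs)" "length xs \<ge> 4"
proof -
  have xs: "length xs \<ge> 3" "successively adj xs" "adj (last xs) (hd xs)"
    using assms by (auto simp: is_cycle_def)
  have ne: "xs \<noteq> []" using xs(1) by auto
  have "col (xs ! (length xs - 1)) \<longleftrightarrow> (col (xs ! 0) \<longleftrightarrow> even (length xs - 1))"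
    by (rule path_colours[OF xs(2)]) (use ne in simp)
  moreover have "col (xs ! (length xs - 1)) \<noteq> col (xs ! 0)"
    using adj_col[OF xs(3)] ne by (simp add: last_conv_nth hd_conv_nth)
  ultimately have "odd (length xs - 1)" by blast
  then show "even (length xs)" using ne by simp
  then show "length xs \<ge> 4" using xs(1) by (cases "length xs = 3") auto
qed

lemma cycle_starting_with_colour:
  assumes "is_cycle G xs"
  obtains ys where "is_cycle G ys" "length ys = length xs" "col (hd ys) = c"
proof (cases "col (hd xs) = c")
  case True
  then show ?thesis using that assms by blast
next
  case False
  have "xs \<noteq> []" "tl xs \<noteq> []" using assms by (auto simp: is_cycle_def dest: arg_cong[where f = length])
  then obtain a b ys where ys: "xs = a # b # ys" by (metis list.collapse)
  then have "adj a b" using assms by (simp add: is_cycle_def)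
  then have "col b = c" using adj_col False ys by auto
  moreover have "is_cycle G ((b # ys) @ [a])" using is_cycle_rotate[of G a "b # ys"] assms ys by simp
  ultimately show ?thesis using that ys by simp
qed

lemma cycle_nbr_index:
  assumes xs: "is_cycle G xs" and deg: "\<And>c. deg c = 2" and k: "k < length xs" and v: "adj (xs ! k) v"
  obtains j where "j < length xs" "v = xs ! j" "j = Suc k mod length xs \<or> k = Suc j mod length xs"
proof -
  let ?n = "length xs"
  have n: "?n \<ge> 3" and d: "distinct xs" using xs by (auto simp: is_cycle_def)
  obtain i where i: "i < ?n" "Suc i mod ?n = k" "i \<noteq> Suc k mod ?n" by (rule cycle_index_pred[OF n k])
  have lt: "Suc k mod ?n < ?n" using n by (intro mod_less_divisor) linarith
  have nbrs: "adj (xs ! k) (xs ! (Suc k mod ?n))" "adj (xs ! k) (xs ! i)"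
    using is_cycle_next_adj[OF xs k] is_cycle_next_adj[OF xs i(1)] i(2) adj_sym by auto
  have V: "xs ! k \<in> V" using nbrs adj_verts by blast
  have "xs ! (Suc k mod ?n) \<noteq> xs ! i" using i lt d by (simp add: nth_eq_iff_index_eq)
  then have "{xs ! (Suc k mod ?n), xs ! i} = N (xs ! k)"
    using nbrs card_N[OF V] deg by (intro card_seteq finite_N[OF V]) auto
  then have "v \<in> {xs ! (Suc k mod ?n), xs ! i}" using v by simp
  then show ?thesis using that lt i(1,2) by blast
qed

lemma listed_if_cycle:
  assumes xs: "is_cycle G xs" and deg: "\<And>c. deg c = 2"
  shows "listed_graph G"
proof -
  let ?n = "length xs"
  have n: "?n \<ge> 3" and d: "distinct xs" using xs by (auto simp: is_cycle_def)
  have sub: "set xs \<subseteq> V" by (rule is_cycle_in_verts[OF ugraph_verts xs])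
  have hd: "hd xs \<in> set xs" using n by (intro hd_in_set) auto
  have "y \<in> set xs" if "y \<in> V" for y
  proof (rule graph_induct[where P = "\<lambda>v. v \<in> set xs", OF _ hd _ that])
    show "hd xs \<in> V" using hd sub by blast
    fix u v assume "u \<in> set xs" "adj u v"
    then obtain i where i: "i < ?n" "adj (xs ! i) v" by (auto simp: in_set_conv_nth)
    obtain j where "j < ?n" "v = xs ! j" by (rule cycle_nbr_index[OF xs deg i])
    then show "v \<in> set xs" by simp
  qed
  then have V: "V = set xs" using sub by blast
  have bij: "bij_betw (\<lambda>i. xs ! i) {..<?n} V" unfolding V using bij_betw_nth[OF d refl refl] by simp
  define f where "f = the_inv_into {..<?n} (\<lambda>i. xs ! i)"
  have f: "bij_betw f V {..<?n}" unfolding f_def by (rule bij_betw_the_inv_into[OF bij])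
  have f_nth: "f (xs ! i) = i" if "i < ?n" for i
    unfolding f_def using the_inv_into_f_f[OF bij_betw_imp_inj_on[OF bij]] that by simp
  have "adj x y \<longleftrightarrow> uadj (cycle_graph ?n) (f x) (f y)" if xy: "x \<in> V" "y \<in> V" for x y
  proof -
    obtain i j where ij: "i < ?n" "x = xs ! i" "j < ?n" "y = xs ! j"
      using xy V by (auto simp: in_set_conv_nth)
    have "adj x y \<longleftrightarrow> j = Suc i mod ?n \<or> i = Suc j mod ?n"
    proof
      assume "adj x y"
      then have "adj (xs ! i) y" using ij(2) by simp
      then obtain j' where "j' < ?n" "y = xs ! j'" "j' = Suc i mod ?n \<or> i = Suc j' mod ?n"
        by (rule cycle_nbr_index[OF xs deg ij(1)])
      then show "j = Suc i mod ?n \<or> i = Suc j mod ?n" using ij(3,4) d by (simp add: nth_eq_iff_index_eq)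
    next
      assume "j = Suc i mod ?n \<or> i = Suc j mod ?n"
      then show "adj x y"
        using is_cycle_next_adj[OF xs ij(1)] is_cycle_next_adj[OF xs ij(3)] adj_sym ij(2,4) by auto
    qed
    then show ?thesis using cycle_graph_uadj f_nth ij by simp
  qed
  moreover have "verts (cycle_graph ?n) = {..<?n}" by (simp add: cycle_graph_def)
  ultimately have "u_isomorphic G (cycle_graph ?n)" unfolding u_isomorphic_def using f by (intro exI[of _ f]) simp
  then show ?thesis using cycle_even_length[OF xs] unfolding listed_graph_def by blast
qed

end

section \<open>Homogeneous bipartite graphs: girth\<close>

locale homogeneous_bipartite = biregular_bipartite +
  assumes hom: "\<lbrakk>finite A; A \<noteq> {}; A \<subseteq> verts G; connected_on (ugraph G) A; inj_on f A; f ` A \<subseteq> verts G;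
      \<And>x. x \<in> A \<Longrightarrow> col (f x) = col x;
      \<And>x y. x \<in> A \<Longrightarrow> y \<in> A \<Longrightarrow> uadj G (f x) (f y) \<longleftrightarrow> uadj G x y\<rbrakk>
    \<Longrightarrow> \<exists>g. rel_aut (verts G) (ugraph G) g \<and> (\<forall>x\<in>A. g x = f x)"
begin

abbreviation aut :: "('a \<Rightarrow> 'a) \<Rightarrow> bool" where "aut \<equiv> rel_aut V (ugraph G)"

lemma aut_adj: "aut g \<Longrightarrow> adj x y \<Longrightarrow> adj (g x) (g y)"
  using adj_verts adj_verts2 unfolding rel_aut_def ugraph_def by fast

lemma aut_eq_iff: "aut g \<Longrightarrow> x \<in> V \<Longrightarrow> y \<in> V \<Longrightarrow> g x = g y \<longleftrightarrow> x = y"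
  using inj_on_eq_iff[OF rel_aut_inj] by metis

lemma aut_N: "aut g \<Longrightarrow> x \<in> V \<Longrightarrow> g ` N x = N (g x)"
  unfolding N_Image by (rule rel_aut_Image[OF _ ugraph_verts])

lemma aut_Int: "aut g \<Longrightarrow> A \<subseteq> V \<Longrightarrow> B \<subseteq> V \<Longrightarrow> g ` (A \<inter> B) = g ` A \<inter> g ` B"
  by (rule inj_on_image_Int[OF rel_aut_inj])

lemma aut_card: "aut g \<Longrightarrow> A \<subseteq> V \<Longrightarrow> card (g ` A) = card A"
  by (rule card_image[OF inj_on_subset[OF rel_aut_inj]])

lemma aut_fixing_swap:
  assumes Z: "finite Z" "Z \<subseteq> V" "connected_on (ugraph G) Z"
    and u: "u \<in> V" "u' \<in> V" "u \<notin> Z" "u' \<notin> Z" "col u = col u'"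
    and adj: "\<And>z. z \<in> Z \<Longrightarrow> adj z u \<longleftrightarrow> adj z u'" and nbr: "\<exists>z\<in>Z. adj z u"
  obtains g where "aut g" "\<And>z. z \<in> Z \<Longrightarrow> g z = z" "g u = u'"
proof -
  let ?f = "id(u := u')"
  have "\<exists>g. aut g \<and> (\<forall>x\<in>insert u Z. g x = ?f x)"
  proof (rule hom)
    show "connected_on (ugraph G) (insert u Z)"
      using nbr by (intro connected_on_insert[OF sym_ugraph Z(3)]) (auto simp: ugraph_def)
    show "inj_on ?f (insert u Z)" using u by (auto simp: inj_on_def)
    fix x y assume "x \<in> insert u Z" "y \<in> insert u Z"
    then show "adj (?f x) (?f y) \<longleftrightarrow> adj x y"
      using adj u(3) adj_irrefl by (auto simp: uadj_commute[of G u] uadj_commute[of G u'])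
  qed (use Z u in auto)
  then show ?thesis using that u(3) by fastforce
qed

lemma aut_permuting_nbrs:
  assumes x: "x \<in> V" and S: "S \<subseteq> N x" "inj_on h S" "h ` S \<subseteq> N x"
  obtains g where "aut g" "g x = x" "\<And>s. s \<in> S \<Longrightarrow> g s = h s"
proof -
  let ?f = "h(x := x)"
  have indep: "\<not> adj u v" if "u \<in> N x" "v \<in> N x" for u v
    using that adj_col by (metis in_N)
  have x': "x \<notin> S" "x \<notin> h ` S" using S adj_irrefl by auto
  have "\<exists>g. aut g \<and> (\<forall>y\<in>insert x S. g y = ?f y)"
  proof (rule hom)
    show "finite (insert x S)" using finite_subset[OF S(1) finite_N[OF x]] by simp
    show "connected_on (ugraph G) (insert x S)"
      using S(1) by (intro connected_on_from[OF sym_ugraph, of x])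
        (auto simp: ugraph_def subset_iff intro: r_into_rtrancl)
    show "inj_on ?f (insert x S)" using S(2) x' by (auto simp: inj_on_def)
    fix y assume y: "y \<in> insert x S"
    have hN: "h s \<in> N x" "s \<in> N x" if "s \<in> S" for s using that S by blast+
    show "col (?f y) = col y"
    proof (cases "y = x")
      case False
      then have "adj (h y) x" "adj y x" using hN[of y] y adj_sym by auto
      from same_col_if_common_nbr[OF this] show ?thesis using False by simp
    qed simp
    fix z assume z: "z \<in> insert x S"
    from y z consider "y = x" "z = x" | "y = x" "z \<in> S" | "y \<in> S" "z = x" | "y \<in> S" "z \<in> S" by blast
    then show "adj (?f y) (?f z) \<longleftrightarrow> adj y z"
    proof cases
      case 2
      then show ?thesis using hN[of z] x'(1) by auto
    next
      case 3
      then show ?thesis using hN[of y] x'(1) adj_sym by auto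
    next
      case 4
      then show ?thesis using indep[OF hN(1) hN(1)] indep[OF hN(2) hN(2)] x'(1) by auto
    qed simp
  qed (use x S N_subset[of x] in auto)
  then show ?thesis using that x'(1) by fastforce
qed

lemma aut_of_induced_paths:
  assumes xs: "distinct xs" "successively adj xs" "length xs \<ge> 2"
    and ys: "distinct ys" "successively adj ys" "length ys = length xs" "col (xs ! 0) = col (ys ! 0)"
    and iso: "\<And>i j. i < length xs \<Longrightarrow> j < length xs \<Longrightarrow> adj (xs ! i) (xs ! j) \<longleftrightarrow> adj (ys ! i) (ys ! j)"
  obtains g where "aut g" "map g xs = ys"
proof -
  obtain f where f: "map f xs = ys" using distinct_map_exists xs(1) ys(3) by metis
  have f_nth: "f (xs ! i) = ys ! i" if "i < length xs" for i using f that by (metis nth_map)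
  have V: "set xs \<subseteq> V" "set ys \<subseteq> V" using successively_verts xs ys by auto
  have "\<exists>g. aut g \<and> (\<forall>x\<in>set xs. g x = f x)"
  proof (rule hom)
    show "connected_on (ugraph G) (set xs)"
    proof (rule connected_on_list[OF sym_ugraph])
      fix i assume i: "0 < i" "i < length xs"
      then have "adj (xs ! (i - 1)) (xs ! i)" using xs(2) by (metis Suc_pred' successively_conv_nth)
      then show "\<exists>j<i. (xs ! j, xs ! i) \<in> ugraph G"
        using i(1) by (intro exI[of _ "i - 1"]) (simp add: ugraph_def)
    qed
    show "f ` set xs \<subseteq> V" using V(2) f by auto
    show "inj_on f (set xs)" using ys(1) f by (auto simp: distinct_map)
    show "set xs \<noteq> {}" using xs(3) by auto
    fix x assume "x \<in> set xs"
    then obtain i where i: "i < length xs" "x = xs ! i" by (auto simp: in_set_conv_nth)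
    then show "col (f x) = col x"
      using path_colours[OF xs(2)] path_colours[OF ys(2)] ys(3,4) f_nth by simp
    fix y assume "y \<in> set xs"
    then show "adj (f x) (f y) \<longleftrightarrow> adj x y" using i iso f_nth by (auto simp: in_set_conv_nth)
  qed (use V in auto)
  then obtain g where g: "aut g" "\<forall>x\<in>set xs. g x = f x" by blast
  then have "map g xs = ys" using f by (metis map_cong)
  then show ?thesis using that g(1) by blast
qed

definition girth :: nat where
  "girth = (LEAST n. \<exists>xs. is_cycle G xs \<and> length xs = n)"

lemma girth_le: "is_cycle G xs \<Longrightarrow> girth \<le> length xs"
  unfolding girth_def by (rule Least_le) blast

lemma girth_cycle: "is_cycle G xs \<Longrightarrow> \<exists>xs. is_cycle G xs \<and> length xs = girth"
  unfolding girth_def by (rule LeastI_ex) blast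

lemma short_path_induced:
  assumes xs: "distinct xs" "successively adj xs" "length xs < girth"
    and ij: "i < j" "j < length xs" "adj (xs ! i) (xs ! j)"
  shows "j = Suc i"
proof (rule ccontr)
  assume "j \<noteq> Suc i"
  then have j: "j \<ge> Suc (Suc i)" using ij by simp
  define ys where "ys = take (Suc (j - i)) (drop i xs)"
  have len: "length ys = Suc (j - i)" using ij by (simp add: ys_def)
  have nth: "ys ! k = xs ! (i + k)" if "k < length ys" for k using that len ij by (simp add: ys_def)
  have "successively adj ys" unfolding successively_conv_nth
    using nth len xs(2) ij by (auto simp: successively_conv_nth)
  moreover have "distinct ys" using xs(1) by (simp add: ys_def)
  moreover have "last ys = xs ! j" "hd ys = xs ! i"
    using nth[of 0] nth[of "j - i"] len ij
    by (auto simp: last_conv_nth hd_conv_nth simp flip: length_greater_0_conv)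
  ultimately have "is_cycle G ys" using len j ij(3) adj_sym by (auto simp: is_cycle_def)
  then show False using girth_le[of ys] len xs(3) ij by simp
qed

lemma short_path_adj_iff:
  assumes xs: "distinct xs" "successively adj xs" "length xs < girth"
    and ij: "i < length xs" "j < length xs"
  shows "adj (xs ! i) (xs ! j) \<longleftrightarrow> j = Suc i \<or> i = Suc j"
proof
  assume adj: "adj (xs ! i) (xs ! j)"
  then have "i \<noteq> j" using adj_irrefl by blast
  then show "j = Suc i \<or> i = Suc j"
    using short_path_induced[OF xs, of i j] short_path_induced[OF xs, of j i] ij adj adj_sym
    by (metis linorder_neqE_nat)
next
  have "adj (xs ! i) (xs ! Suc i)" if "Suc i < length xs" for i
    using xs(2) that by (simp add: successively_conv_nth)
  then show "j = Suc i \<or> i = Suc j \<Longrightarrow> adj (xs ! i) (xs ! j)" using ij adj_sym by blast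
qed

lemma aut_of_short_paths:
  assumes xs: "distinct xs" "successively adj xs" "length xs < girth" "length xs \<ge> 2"
    and ys: "distinct ys" "successively adj ys" "length ys = length xs" "col (xs ! 0) = col (ys ! 0)"
  obtains g where "aut g" "map g xs = ys"
proof (rule aut_of_induced_paths[OF xs(1,2,4) ys])
  fix i j assume "i < length xs" "j < length xs"
  then show "adj (xs ! i) (xs ! j) \<longleftrightarrow> adj (ys ! i) (ys ! j)"
    using short_path_adj_iff[OF xs(1-3)] short_path_adj_iff[OF ys(1,2)] xs(3) ys(3) by simp
qed (rule that)

lemma girth_path_closes:
  assumes cyc: "is_cycle G zs" "length zs = girth"
    and xs: "distinct xs" "successively adj xs" "Suc (length xs) = girth"
  obtains w where "adj w (hd xs)" "adj w (last xs)" "w \<notin> set xs"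
proof -
  obtain ys where ys: "is_cycle G ys" "length ys = length zs" "col (hd ys) = col (hd xs)"
    by (rule cycle_starting_with_colour[OF cyc(1)])
  have "ys \<noteq> []" using ys(1) by (auto simp: is_cycle_def)
  then obtain bs v where bs: "ys = bs @ [v]" by (meson rev_exhaust)
  then have c: "2 \<le> length bs" "distinct bs" "v \<notin> set bs" "successively adj bs" "adj (last bs) v" "adj v (hd bs)"
    using ys(1) unfolding bs is_cycle_snoc_iff by auto
  have len: "length xs = length bs" using ys(2) cyc(2) xs(3) bs by simp
  then have ne: "bs \<noteq> []" "xs \<noteq> []" using c(1) by auto
  then have "hd ys = hd bs" using bs by simp
  then have "col (bs ! 0) = col (xs ! 0)" using ys(3) ne by (simp add: hd_conv_nth)
  moreover have "length bs < girth" using xs(3) len by simp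
  ultimately obtain g where g: "aut g" "map g bs = xs"
    using aut_of_short_paths[OF c(2,4) _ c(1) xs(1,2) len] by blast
  have ends: "hd xs = g (hd bs)" "last xs = g (last bs)"
    using ne unfolding g(2)[symmetric] by (simp_all add: hd_map last_map)
  have V: "set bs \<subseteq> V" "v \<in> V" using successively_verts[OF c(4,1)] adj_verts[OF c(6)] by auto
  have "g v \<notin> set xs"
  proof
    assume "g v \<in> set xs"
    then obtain u where "u \<in> set bs" "g u = g v" using g(2) by (metis imageE list.set_map)
    then show False using aut_eq_iff[OF g(1)] V c(3) by (metis subsetD)
  qed
  then show ?thesis using that ends aut_adj[OF g(1)] adj_sym c(5,6) by metis
qed

lemma unique_common_nbr:
  assumes "girth > 4" "adj a p" "adj b p" "adj a q" "adj b q" "a \<noteq> b" shows "p = q"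
proof (rule ccontr)
  assume "p \<noteq> q"
  then have "is_cycle G [a, p, b, q]" using assms adj_irrefl adj_sym by (auto simp: is_cycle_def)
  then show False using girth_le assms(1) by fastforce
qed

lemma short_path_snoc:
  assumes xs: "distinct (xs @ [u, v])" "successively adj (xs @ [u, v])" "length (xs @ [u, v]) < girth"
    and w: "adj v w" "w \<noteq> u"
  shows "w \<notin> set (xs @ [u, v])"
proof
  let ?ys = "xs @ [u, v]"
  assume "w \<in> set ?ys"
  then obtain i where i: "i < length ?ys" "w = ?ys ! i" by (metis in_set_conv_nth)
  have v: "?ys ! Suc (length xs) = v" and u: "?ys ! length xs = u" by (simp_all add: nth_append)
  have "adj (?ys ! Suc (length xs)) (?ys ! i)" using v w(1) i(2) by simp
  then have "i = length xs" using short_path_adj_iff[OF xs, of "Suc (length xs)" i] i(1) by simp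
  then show False using u i(2) w(2) by simp
qed

lemma girth_cycle_minus_vertex:
  assumes cyc: "is_cycle G zs" "length zs = girth" and girth: "girth \<ge> 6"
  obtains q u v l where "length q = girth - 4" "q \<noteq> []" "col v = c"
    "distinct (q @ [u, v, l])" "successively adj (q @ [u, v, l])"
proof -
  obtain ys where ys: "is_cycle G ys" "length ys = girth" "col (hd ys) = (\<not> c)"
    using cycle_starting_with_colour[OF cyc(1)] cyc(2) by metis
  define q where "q = take (girth - 4) ys"
  have "length (drop (girth - 4) ys) = Suc (Suc (Suc (Suc 0)))" using ys(2) girth by simp
  then obtain u v l m where "drop (girth - 4) ys = [u, v, l, m]"
    unfolding length_Suc_conv length_0_conv by blast
  then have ys_eq: "ys = q @ [u, v, l, m]" unfolding q_def by (metis append_take_drop_id)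
  have q: "length q = girth - 4" "q \<noteq> []" using ys(2) girth by (auto simp: q_def)
  have "even girth" using cycle_even_length cyc by metis
  then have "even (length q)" "ys ! Suc (length q) = v" "ys ! 0 = hd ys"
    using ys_eq q girth by (simp_all add: nth_append hd_conv_nth)
  moreover have "col (ys ! Suc (length q)) \<longleftrightarrow> (col (ys ! 0) \<longleftrightarrow> even (Suc (length q)))"
    by (rule path_colours) (use ys(1) ys_eq in \<open>auto simp: is_cycle_def\<close>)
  ultimately have "col v = c" using ys(3) by auto
  moreover have "distinct (q @ [u, v, l])" "successively adj (q @ [u, v, l])"
    using ys(1) unfolding ys_eq is_cycle_def successively_append_iff by auto
  ultimately show ?thesis using that q by blast
qed

lemma girth_at_most_6:
  assumes cyc: "is_cycle G zs" "length zs = girth" and c: "deg c \<ge> 3" and girth: "girth > 4"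
  shows "girth = 6"
proof -
  have even: "even girth" using cycle_even_length cyc by metis
  then have girth_ge_6: "girth \<ge> 6" using girth by presburger
  obtain q u v l where q: "length q = girth - 4" "q \<noteq> []" and "col v = c"
    and dist: "distinct (q @ [u, v, l])" and succ: "successively adj (q @ [u, v, l])"
    by (rule girth_cycle_minus_vertex[OF cyc girth_ge_6])
  moreover have vl: "adj v l" and "adj u v" using succ unfolding successively_append_iff by auto
  ultimately obtain v' where v': "adj v v'" "v' \<notin> set [u, l]"
    using nbr_avoiding[of v "[u, l]"] c adj_verts by auto
  have sub: "distinct (q @ [u, v])" "successively adj (q @ [u, v])"
    using dist succ unfolding successively_append_iff by auto
  then have "v' \<notin> set (q @ [u, v])" by (rule short_path_snoc) (use q(1) girth v' in auto)
  then have dist': "distinct (q @ [u, v, v'])" and succ': "successively adj (q @ [u, v, v'])"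
    using sub v'(1) unfolding successively_append_iff by auto
  define a where "a = hd q"
  have a: "a \<in> set q" using q(2) by (simp add: a_def)
  have len: "Suc (length (q @ [u, v, z])) = girth" and ends: "hd (q @ [u, v, z]) = a" "last (q @ [u, v, z]) = z" for z
    using q girth by (simp_all add: a_def)
  obtain w where w: "adj w a" "adj w l" "w \<notin> set (q @ [u, v, l])"
    using girth_path_closes[OF cyc dist succ len] unfolding ends by blast
  obtain w' where w': "adj w' a" "adj w' v'" "w' \<notin> set (q @ [u, v, v'])"
    using girth_path_closes[OF cyc dist' succ' len] unfolding ends by blast
  have "w \<noteq> w'"
    using unique_common_nbr[OF girth vl w(2) v'(1)] w'(2) w(3) v'(2) by auto
  moreover have "col w \<noteq> col v'" "col w' \<noteq> col l"
    using adj_col[OF w(2)] adj_col[OF w'(2)] adj_col[OF vl] adj_col[OF v'(1)] by auto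
  then have "w \<noteq> v'" "w' \<noteq> l" by auto
  ultimately have "is_cycle G [w, a, w', v', v, l]"
    using w w' a v' vl dist dist' adj_sym by (auto simp: is_cycle_def)
  then show ?thesis using girth_le[of "[w, a, w', v', v, l]"] girth_ge_6 by simp
qed

context
  fixes zs assumes cyc: "is_cycle G zs" "length zs = girth" and girth6: "girth = 6"
begin

lemma girth6_path_closes:
  assumes "adj p a" "adj a b" "adj b d" "adj d q" "p \<noteq> b" "p \<noteq> q" "b \<noteq> q" "a \<noteq> d"
  obtains y where "adj p y" "adj y q"
proof -
  have "col p \<noteq> col a" "col a \<noteq> col b" "col b \<noteq> col d" "col d \<noteq> col q" using assms adj_col by auto
  then have "distinct [p, a, b, d, q]" using assms by auto
  then show ?thesis
    using girth_path_closes[OF cyc, of "[p, a, b, d, q]"] assms girth6 that adj_sym by auto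
qed

lemma girth6_common_nbr:
  assumes pq: "p \<in> V" "q \<in> V" "col p = col q" "p \<noteq> q"
  obtains y where "adj p y" "adj y q"
proof -
  define near where "near r \<longleftrightarrow> r = p \<or> (\<exists>y. adj p y \<and> adj y r)" for r
  have near_step: "near v" if r: "adj u r" "near r" and uv: "adj u v" for u v r
  proof (cases "v = p \<or> v = r \<or> r = p")
    case True
    then show ?thesis using r adj_sym[OF r(1)] uv by (auto simp: near_def)
  next
    case False
    then obtain y where y: "adj p y" "adj y r" using r by (auto simp: near_def)
    show ?thesis
    proof (cases "y = u")
      case True
      then show ?thesis using y uv by (auto simp: near_def)
    next
      case False
      obtain y' where "adj p y'" "adj y' v"
        by (rule girth6_path_closes[OF y adj_sym[OF r(1)] uv]) (use False \<open>\<not> (v = p \<or> v = r \<or> r = p)\<close> in auto)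
      then show ?thesis by (auto simp: near_def)
    qed
  qed
  let ?P = "\<lambda>v. (col v = col p \<longrightarrow> near v) \<and> (col v \<noteq> col p \<longrightarrow> (\<exists>r. adj v r \<and> near r \<and> col r = col p))"
  have "?P q"
  proof (rule graph_induct[OF pq(1) _ _ pq(2)])
    show "?P p" by (simp add: near_def)
    fix u v assume u: "?P u" and uv: "adj u v"
    show "?P v"
    proof (cases "col u = col p")
      case True
      then show ?thesis using u adj_sym[OF uv] adj_col[OF uv] by auto
    next
      case False
      then obtain r where "adj u r" "near r" using u by blast
      then have "near v" using near_step uv by blast
      then show ?thesis using False adj_col[OF uv] by blast
    qed
  qed
  then show ?thesis using pq that by (auto simp: near_def)
qed

lemma girth6_unique_common_nbr: "adj a p \<Longrightarrow> adj b p \<Longrightarrow> adj a q \<Longrightarrow> adj b q \<Longrightarrow> a \<noteq> b \<Longrightarrow> p = q"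
  by (rule unique_common_nbr) (simp add: girth6)

lemma girth6_deg_le:
  assumes xy: "x \<in> V" "y \<in> V" "col x \<noteq> col y" "\<not> adj x y"
  shows "deg (col x) \<le> deg (col y)"
proof -
  have "\<exists>z. adj y' z \<and> adj z y" if "y' \<in> N x" for y'
    using girth6_common_nbr[of y' y] that xy adj_verts2[of x y'] adj_col[of x y'] by auto
  then obtain f where f: "\<And>y'. y' \<in> N x \<Longrightarrow> adj y' (f y') \<and> adj (f y') y" by metis
  have "inj_on f (N x)"
  proof (rule inj_onI)
    fix y\<^sub>1 y\<^sub>2 assume y: "y\<^sub>1 \<in> N x" "y\<^sub>2 \<in> N x" "f y\<^sub>1 = f y\<^sub>2"
    have "x \<noteq> f y\<^sub>1" using f[OF y(1)] xy(4) by auto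
    then show "y\<^sub>1 = y\<^sub>2"
      using girth6_unique_common_nbr[of x y\<^sub>1 "f y\<^sub>1" y\<^sub>2] f[OF y(1)] f[OF y(2)] y adj_sym by simp
  qed
  moreover have "f ` N x \<subseteq> N y" using f adj_sym by auto
  ultimately have "card (N x) \<le> card (N y)" by (rule card_inj_on_le) (rule finite_N[OF xy(2)])
  then show ?thesis using card_N xy by simp
qed

lemma girth6_deg_eq:
  assumes deg: "\<And>c. deg c \<ge> 2" shows "deg c = deg c'"
proof -
  have deg': "length [z] < deg c" for z :: 'a and c using deg[of c] by simp
  obtain x where x: "x \<in> V" "col x = c" by (rule colour_vertex)
  obtain y where y: "adj x y" by (rule has_nbr[OF x(1)])
  obtain x' where x': "adj y x'" "x' \<noteq> x" using nbr_avoiding[OF adj_verts2[OF y] deg', of x] by auto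
  obtain y' where y': "adj x y'" "y' \<noteq> y" using nbr_avoiding[OF x(1) deg', of y] by auto
  have not: "\<not> adj x' y'" "\<not> adj y' x'"
    using girth6_unique_common_nbr[of x y x' y'] x' y y' adj_sym by auto
  have V: "x' \<in> V" "y' \<in> V" "col x' = c" "col y' = (\<not> c)"
    using adj_verts2 x' y' adj_col[OF y] adj_col[OF x'(1)] adj_col[OF y'(1)] x(2) by auto
  have "deg c \<le> deg (\<not> c)" "deg (\<not> c) \<le> deg c"
    using girth6_deg_le[OF V(1,2) _ not(1)] girth6_deg_le[OF V(2,1) _ not(2)] V(3,4) by auto
  then show ?thesis by (cases "c' = c") auto
qed

lemma girth6_branches_disjoint:
  assumes "adj p z" "adj x p" "adj x p'" "p \<noteq> p'" "z \<noteq> x" shows "\<not> adj p' z"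
  using girth6_unique_common_nbr[of x p z p'] assms adj_sym by blast

lemma girth6_triangle:
  assumes deg: "\<And>c. deg c \<ge> 3"
  obtains x y\<^sub>1 y\<^sub>2 y\<^sub>3 x\<^sub>1 x\<^sub>2 y x\<^sub>3 where
    "adj x y\<^sub>1" "adj x y\<^sub>2" "adj x y\<^sub>3" "distinct [y\<^sub>1, y\<^sub>2, y\<^sub>3]"
    "adj y\<^sub>1 x\<^sub>1" "adj y\<^sub>2 x\<^sub>2" "x\<^sub>1 \<noteq> x" "x\<^sub>2 \<noteq> x"
    "adj y x\<^sub>1" "adj y x\<^sub>2" "\<not> adj y x" "adj y x\<^sub>3" "adj y\<^sub>3 x\<^sub>3"
proof -
  have deg': "length [p, q] < deg c" "length [p] < deg c" for p q :: 'a and c using deg[of c] by simp_all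
  obtain x where x: "x \<in> V" using colour_vertex by blast
  obtain y\<^sub>1 where y\<^sub>1: "adj x y\<^sub>1" by (rule has_nbr[OF x])
  obtain y\<^sub>2 where y\<^sub>2: "adj x y\<^sub>2" "y\<^sub>2 \<noteq> y\<^sub>1" using nbr_avoiding[OF x deg'(2), of y\<^sub>1] by auto
  obtain y\<^sub>3 where y\<^sub>3: "adj x y\<^sub>3" "y\<^sub>3 \<noteq> y\<^sub>1" "y\<^sub>3 \<noteq> y\<^sub>2" using nbr_avoiding[OF x deg'(1), of y\<^sub>1 y\<^sub>2] by auto
  obtain x\<^sub>1 where x\<^sub>1: "adj y\<^sub>1 x\<^sub>1" "x\<^sub>1 \<noteq> x" using nbr_avoiding[OF adj_verts2[OF y\<^sub>1] deg'(2), of x] by auto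
  obtain x\<^sub>2 where x\<^sub>2: "adj y\<^sub>2 x\<^sub>2" "x\<^sub>2 \<noteq> x" using nbr_avoiding[OF adj_verts2[OF y\<^sub>2(1)] deg'(2), of x] by auto
  have "x\<^sub>1 \<noteq> x\<^sub>2" using girth6_branches_disjoint[OF x\<^sub>1(1) y\<^sub>1 y\<^sub>2(1)] y\<^sub>2(2) x\<^sub>1(2) x\<^sub>2(1) by auto
  have col: "col x\<^sub>1 = col x" "col x\<^sub>2 = col x"
    using same_col_if_common_nbr adj_sym y\<^sub>1 y\<^sub>2(1) x\<^sub>1(1) x\<^sub>2(1) by metis+
  obtain y where y: "adj x\<^sub>1 y" "adj y x\<^sub>2"
    using girth6_common_nbr[of x\<^sub>1 x\<^sub>2] adj_verts2[OF x\<^sub>1(1)] adj_verts2[OF x\<^sub>2(1)] col \<open>x\<^sub>1 \<noteq> x\<^sub>2\<close> by auto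
  have yx: "\<not> adj y x"
  proof
    assume "adj y x"
    then have "y = y\<^sub>1" "y = y\<^sub>2"
      using girth6_unique_common_nbr[of x y x\<^sub>1 y\<^sub>1] girth6_unique_common_nbr[of x y x\<^sub>2 y\<^sub>2]
        y x\<^sub>1 x\<^sub>2 y\<^sub>1 y\<^sub>2(1) adj_sym by blast+
    then show False using y\<^sub>2(2) by simp
  qed
  then have "y \<noteq> y\<^sub>3" using y\<^sub>3(1) adj_sym by blast
  moreover have "col y = col y\<^sub>3" using adj_col[OF y(1)] adj_col[OF y\<^sub>3(1)] col(1) by auto
  ultimately obtain x\<^sub>3 where "adj y x\<^sub>3" "adj x\<^sub>3 y\<^sub>3"
    using girth6_common_nbr adj_verts2[OF y(1)] adj_verts2[OF y\<^sub>3(1)] by blast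
  then show ?thesis using that[OF y\<^sub>1 y\<^sub>2(1) y\<^sub>3(1) _ x\<^sub>1(1) x\<^sub>2(1) x\<^sub>1(2) x\<^sub>2(2)]
      y yx y\<^sub>2(2) y\<^sub>3(2,3) adj_sym by auto
qed

lemma girth6_deg_less_3:
  assumes deg2: "\<And>c. deg c \<ge> 2" shows "deg c < 3"
proof (rule ccontr)
  assume "\<not> deg c < 3"
  then have deg: "deg c' \<ge> 3" for c' using girth6_deg_eq[OF deg2, of c' c] by simp
  obtain x y\<^sub>1 y\<^sub>2 y\<^sub>3 x\<^sub>1 x\<^sub>2 y x\<^sub>3 where
    y: "adj x y\<^sub>1" "adj x y\<^sub>2" "adj x y\<^sub>3" "distinct [y\<^sub>1, y\<^sub>2, y\<^sub>3]" and
    x\<^sub>1: "adj y\<^sub>1 x\<^sub>1" "x\<^sub>1 \<noteq> x" and x\<^sub>2: "adj y\<^sub>2 x\<^sub>2" "x\<^sub>2 \<noteq> x" and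
    yx: "adj y x\<^sub>1" "adj y x\<^sub>2" "\<not> adj y x" and x\<^sub>3: "adj y x\<^sub>3" "adj y\<^sub>3 x\<^sub>3"
    by (rule girth6_triangle[OF deg])
  have "length [x, x\<^sub>3] < deg (col y\<^sub>3)" using deg[of "col y\<^sub>3"] by simp
  then obtain x\<^sub>3' where x\<^sub>3': "adj y\<^sub>3 x\<^sub>3'" "x\<^sub>3' \<noteq> x" "x\<^sub>3' \<noteq> x\<^sub>3"
    using nbr_avoiding[of y\<^sub>3 "[x, x\<^sub>3]"] adj_verts[OF x\<^sub>3(2)] by auto
  have "x\<^sub>3 \<noteq> x" using yx(3) x\<^sub>3(1) by blast
  have "x\<^sub>1 \<noteq> x\<^sub>2" using girth6_branches_disjoint[OF x\<^sub>1(1) y(1,2)] y(4) x\<^sub>1(2) x\<^sub>2(1) by auto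
  let ?Z = "{x\<^sub>2, x\<^sub>1, y\<^sub>3, y\<^sub>2, y\<^sub>1, x}"
  have Z: "?Z \<subseteq> V" using y x\<^sub>1 x\<^sub>2 adj_verts adj_verts2 by blast
  have col: "col x\<^sub>1 = col x" "col x\<^sub>2 = col x" "col x\<^sub>3 = col x" "col x\<^sub>3' = col x"
    using same_col_if_common_nbr adj_sym y x\<^sub>1(1) x\<^sub>2(1) x\<^sub>3(2) x\<^sub>3'(1) by metis+
  have cols: "col y\<^sub>1 \<noteq> col x" "col y\<^sub>2 \<noteq> col x" "col y\<^sub>3 \<noteq> col x" using y adj_col by blast+
  have x\<^sub>3_not: "z \<notin> ?Z" "\<not> adj y\<^sub>1 z" "\<not> adj y\<^sub>2 z" if "adj y\<^sub>3 z" "z \<noteq> x" for z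
    using girth6_branches_disjoint[OF that(1) y(3,1)] girth6_branches_disjoint[OF that(1) y(3,2)]
      that(2) y(4) x\<^sub>1(1) x\<^sub>2(1)
      adj_irrefl that(1) same_col_if_common_nbr[OF adj_sym[OF that(1)] y(3)] cols by auto
  obtain g where g: "aut g" "\<And>z. z \<in> ?Z \<Longrightarrow> g z = z" "g x\<^sub>3 = x\<^sub>3'"
  proof (rule aut_fixing_swap)
    show "connected_on (ugraph G) ?Z"
      by (intro connected_on_insert[OF sym_ugraph] connected_on_singleton)
        (use y x\<^sub>1 x\<^sub>2 in \<open>auto simp: ugraph_def uadj_commute[of G y\<^sub>1 x] uadj_commute[of G y\<^sub>2 x]
           uadj_commute[of G y\<^sub>3 x]\<close>)
    show "x\<^sub>3 \<in> V" "x\<^sub>3' \<in> V" using adj_verts2 x\<^sub>3(2) x\<^sub>3'(1) by blast+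
    show "x\<^sub>3 \<notin> ?Z" "x\<^sub>3' \<notin> ?Z" using x\<^sub>3_not(1) x\<^sub>3(2) \<open>x\<^sub>3 \<noteq> x\<close> x\<^sub>3'(1,2) by blast+
    show "\<exists>z\<in>?Z. adj z x\<^sub>3" using x\<^sub>3(2) by blast
    fix z assume "z \<in> ?Z"
    moreover have "\<not> adj z x\<^sub>3 \<and> \<not> adj z x\<^sub>3'" if "col z = col x" using that col adj_col by metis
    ultimately show "adj z x\<^sub>3 \<longleftrightarrow> adj z x\<^sub>3'"
      using x\<^sub>3_not(2,3) x\<^sub>3(2) \<open>x\<^sub>3 \<noteq> x\<close> x\<^sub>3'(1,2) col by blast
  qed (use Z col in simp_all)
  have "adj (g y) x\<^sub>1" "adj (g y) x\<^sub>2" using aut_adj[OF g(1) yx(1)] aut_adj[OF g(1) yx(2)] g(2) by auto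
  then have "g y = y" using girth6_unique_common_nbr[of x\<^sub>1 "g y" x\<^sub>2 y] yx \<open>x\<^sub>1 \<noteq> x\<^sub>2\<close> adj_sym by blast
  then have "adj y x\<^sub>3'" using aut_adj[OF g(1) x\<^sub>3(1)] g(3) by simp
  moreover have "y \<noteq> y\<^sub>3" using y(3) yx(3) adj_sym by blast
  ultimately show False using girth6_unique_common_nbr[of y x\<^sub>3 y\<^sub>3 x\<^sub>3'] x\<^sub>3 x\<^sub>3' by blast
qed

end

end

section \<open>Homogeneous bipartite graphs: codegrees\<close>

lemma bij_betw_moving_subset:
  assumes "finite A" "S \<subseteq> A" "T \<subseteq> A" "card S = card T"
  obtains h where "bij_betw h A A" "h ` S = T"
proof -
  have fin: "finite S" "finite T" using assms finite_subset by blast+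
  then have "card (A - S) = card (A - T)" using assms by (simp add: card_Diff_subset)
  then obtain h k where h: "bij_betw h S T" and k: "bij_betw k (A - S) (A - T)"
    using finite_same_card_bij[OF fin assms(4)] finite_same_card_bij[of "A - S" "A - T"] assms(1) by blast
  let ?f = "\<lambda>v. if v \<in> S then h v else k v"
  have f: "bij_betw ?f S T" using h by (simp cong: bij_betw_cong)
  moreover have "bij_betw ?f (A - S) (A - T)" using k by (subst bij_betw_cong[of _ _ k]) auto
  ultimately have "bij_betw ?f (S \<union> (A - S)) (T \<union> (A - T))" by (rule bij_betw_combine) blast
  then have "bij_betw ?f A A" using assms(2,3) by (simp add: Un_absorb1)
  then show ?thesis using that bij_betw_imp_surj_on[OF f] by blast
qed

context homogeneous_bipartite
begin

definition has_codegree :: "bool \<Rightarrow> nat \<Rightarrow> bool" where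
  "has_codegree c k \<longleftrightarrow>
     (\<forall>x x' y. adj x y \<longrightarrow> adj x' y \<longrightarrow> x \<noteq> x' \<longrightarrow> col x = c \<longrightarrow> card (N x \<inter> N x') = k)"

lemma has_codegreeD:
  "has_codegree c k \<Longrightarrow> adj x y \<Longrightarrow> adj x' y \<Longrightarrow> x \<noteq> x' \<Longrightarrow> col x = c \<Longrightarrow> card (N x \<inter> N x') = k"
  unfolding has_codegree_def by blast

lemma has_codegree_card:
  assumes x: "adj x y" "adj x' y" "x \<noteq> x'"
  shows "has_codegree (col x) (card (N x \<inter> N x'))"
  unfolding has_codegree_def
proof (intro allI impI)
  fix z z' w assume z: "adj z w" "adj z' w" "z \<noteq> z'" "col z = col x"
  have indep: "\<not> adj a b" if "adj a y'" "adj b y'" for a b y'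
    using same_col_if_common_nbr[OF that] adj_col by blast
  have not_adj: "\<not> adj x x'" "\<not> adj x' x" "\<not> adj z z'" "\<not> adj z' z" using indep x(1,2) z(1,2) by blast+
  obtain g where "aut g" "map g [x, y, x'] = [z, w, z']"
  proof (rule aut_of_induced_paths)
    show "distinct [x, y, x']" "distinct [z, w, z']" using x z adj_irrefl by auto
    show "successively adj [x, y, x']" "successively adj [z, w, z']" using x z adj_sym by auto
    fix i j assume "i < length [x, y, x']" "j < length [x, y, x']"
    then show "adj ([x, y, x'] ! i) ([x, y, x'] ! j) \<longleftrightarrow> adj ([z, w, z'] ! i) ([z, w, z'] ! j)"
      using x(1,2) z(1,2) not_adj adj_irrefl adj_sym[OF x(1)] adj_sym[OF x(2)] adj_sym[OF z(1)] adj_sym[OF z(2)]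
      by (auto simp: less_Suc_eq numeral_2_eq_2)
  qed (use z(4) in auto)
  then have g: "aut g" "g x = z" "g x' = z'" by auto
  have V: "x \<in> V" "x' \<in> V" using x adj_verts by blast+
  have "N z \<inter> N z' = g ` (N x \<inter> N x')"
    using aut_Int[OF g(1) N_subset N_subset] aut_N[OF g(1)] V g(2,3) by simp
  then show "card (N z \<inter> N z') = card (N x \<inter> N x')"
    using aut_card[OF g(1)] N_subset by (metis inf.coboundedI1)
qed

lemma aut_nbrs_minus:
  assumes "aut g" "x \<in> V" "y \<in> V" "g x = x" "g y = y"
  shows "g ` (N x - {y}) = N x - {y}"
  using inj_on_image_set_diff[OF rel_aut_inj[OF assms(1)], of "N x" "{y}"] N_subset aut_N[OF assms(1,2)] assms
  by auto

text \<open>All \<open>k\<close>-subsets of \<open>N x - {y}\<close> occur as traces of neighbourhoods, and any two of these meet in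
  equally many points; this forces \<open>k\<close> to be 1 or one less than the size of \<open>N x - {y}\<close>.\<close>

lemma all_traces_occur:
  assumes xy: "adj x y" and x\<^sub>0: "adj y x\<^sub>0" "x\<^sub>0 \<noteq> x"
    and T: "T \<subseteq> N x - {y}" "card T = card (N x\<^sub>0 \<inter> (N x - {y}))"
  obtains x' where "adj y x'" "x' \<noteq> x" "N x' \<inter> (N x - {y}) = T"
proof -
  have V: "x \<in> V" "y \<in> V" "x\<^sub>0 \<in> V" using xy x\<^sub>0 adj_verts adj_verts2 by blast+
  let ?A = "N x - {y}"
  obtain h where h: "bij_betw h ?A ?A" "h ` (N x\<^sub>0 \<inter> ?A) = T"
    using bij_betw_moving_subset[of ?A "N x\<^sub>0 \<inter> ?A" T] finite_N[OF V(1)] T by auto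
  have hA: "h v \<in> ?A" if "v \<in> ?A" for v using bij_betwE[OF h(1)] that by blast
  have inj: "h u = h v \<longleftrightarrow> u = v" if "u \<in> ?A" "v \<in> ?A" for u v
    using inj_on_eq_iff[OF bij_betw_imp_inj_on[OF h(1)] that] .
  have "inj_on (h(y := y)) (N x)"
  proof (rule inj_onI)
    fix u v assume "u \<in> N x" "v \<in> N x" "(h(y := y)) u = (h(y := y)) v"
    then show "u = v" using hA[of u] hA[of v] inj[of u v] by (cases "u = y"; cases "v = y") auto
  qed
  moreover have "(h(y := y)) ` N x \<subseteq> N x" using hA by auto
  ultimately obtain g where g: "aut g" "g x = x" "\<And>s. s \<in> N x \<Longrightarrow> g s = (h(y := y)) s"
    by (rule aut_permuting_nbrs[OF V(1) order_refl]) blast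
  have gy: "g y = y" using g(3) xy by simp
  have "T = g ` (N x\<^sub>0 \<inter> ?A)" unfolding h(2)[symmetric] using g(3) by (intro image_cong) auto
  also have "\<dots> = g ` N x\<^sub>0 \<inter> g ` ?A" using N_subset by (intro aut_Int[OF g(1)]) auto
  also have "\<dots> = N (g x\<^sub>0) \<inter> ?A" using aut_N[OF g(1) V(3)] aut_nbrs_minus[OF g(1) V(1,2) g(2) gy] by simp
  finally have "N (g x\<^sub>0) \<inter> ?A = T" by simp
  moreover have "adj y (g x\<^sub>0)" using aut_adj[OF g(1) x\<^sub>0(1)] gy by simp
  moreover have "g x\<^sub>0 \<noteq> x" using aut_eq_iff[OF g(1) V(3,1)] g(2) x\<^sub>0(2) by simp
  ultimately show ?thesis using that by blast
qed

lemma card_trace_Int: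
  assumes xy: "adj x y" and x\<^sub>1: "adj y x\<^sub>1" "x\<^sub>1 \<noteq> x" "adj y x\<^sub>2" "x\<^sub>2 \<noteq> x" "x\<^sub>1 \<noteq> x\<^sub>2"
    and x\<^sub>3: "adj y x\<^sub>3" "x\<^sub>3 \<noteq> x" "adj y x\<^sub>4" "x\<^sub>4 \<noteq> x" "x\<^sub>3 \<noteq> x\<^sub>4"
  shows "card (N x\<^sub>1 \<inter> N x\<^sub>2 \<inter> (N x - {y})) = card (N x\<^sub>3 \<inter> N x\<^sub>4 \<inter> (N x - {y}))"
proof -
  have V: "x \<in> V" "y \<in> V" "x\<^sub>1 \<in> V" "x\<^sub>2 \<in> V" using xy x\<^sub>1 adj_verts adj_verts2 by blast+
  obtain g where g: "aut g" "g y = y" "\<And>s. s \<in> {x, x\<^sub>1, x\<^sub>2} \<Longrightarrow> g s = (id(x\<^sub>1 := x\<^sub>3, x\<^sub>2 := x\<^sub>4)) s"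
  proof (rule aut_permuting_nbrs[OF V(2), of "{x, x\<^sub>1, x\<^sub>2}" "id(x\<^sub>1 := x\<^sub>3, x\<^sub>2 := x\<^sub>4)"])
    show "inj_on (id(x\<^sub>1 := x\<^sub>3, x\<^sub>2 := x\<^sub>4)) {x, x\<^sub>1, x\<^sub>2}" using x\<^sub>1 x\<^sub>3 by (auto simp: inj_on_def)
  qed (use adj_sym[OF xy] x\<^sub>1 x\<^sub>3 in auto)
  then have gx: "g x = x" "g x\<^sub>1 = x\<^sub>3" "g x\<^sub>2 = x\<^sub>4" using x\<^sub>1 by auto
  let ?A = "N x - {y}"
  have sub: "?A \<subseteq> V" "N x\<^sub>1 \<inter> N x\<^sub>2 \<subseteq> V" using N_subset by auto
  have "g ` (N x\<^sub>1 \<inter> N x\<^sub>2 \<inter> ?A) = g ` N x\<^sub>1 \<inter> g ` N x\<^sub>2 \<inter> g ` ?A"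
    using aut_Int[OF g(1) sub(2,1)] aut_Int[OF g(1) N_subset N_subset] by simp
  also have "\<dots> = N x\<^sub>3 \<inter> N x\<^sub>4 \<inter> ?A"
    using aut_N[OF g(1)] V aut_nbrs_minus[OF g(1) V(1,2) gx(1) g(2)] gx by simp
  finally show ?thesis using aut_card[OF g(1), of "N x\<^sub>1 \<inter> N x\<^sub>2 \<inter> ?A"] sub(2) by (metis inf.coboundedI1)
qed

lemma card_trace:
  assumes k: "has_codegree c (Suc k)" and xy: "adj x y" "col x = c" and x': "adj y x'" "x' \<noteq> x"
  shows "card (N x' \<inter> (N x - {y})) = k"
proof -
  have "card (N x \<inter> N x') = Suc k" using has_codegreeD[OF k xy(1) adj_sym[OF x'(1)]] x' xy by auto
  moreover have "N x \<inter> N x' = insert y (N x' \<inter> (N x - {y}))" using xy x' adj_sym by auto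
  moreover have "finite (N x' \<inter> (N x - {y}))" using finite_N[OF adj_verts[OF xy(1)]] by simp
  ultimately show ?thesis by simp
qed

lemma traces_with_smaller_Int:
  assumes k: "has_codegree c (Suc k)" "deg (\<not> c) \<ge> 2" and xy: "adj x y" "col x = c"
    and j: "1 \<le> j" "j \<le> k" "j + Suc k \<le> deg c"
  obtains x\<^sub>1 x\<^sub>2 where "adj y x\<^sub>1" "x\<^sub>1 \<noteq> x" "adj y x\<^sub>2" "x\<^sub>2 \<noteq> x" "x\<^sub>1 \<noteq> x\<^sub>2"
    "card (N x\<^sub>1 \<inter> N x\<^sub>2 \<inter> (N x - {y})) = k - j"
proof -
  have V: "x \<in> V" "y \<in> V" using xy adj_verts adj_verts2 by blast+
  let ?A = "N x - {y}"
  have A: "finite ?A" "card ?A = deg c - 1"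
    using card_N[OF V(1)] finite_N[OF V(1)] xy by (simp_all add: card_Diff_singleton)
  have "length [x] < deg (col y)" using k(2) adj_col[OF xy(1)] xy(2) by (cases "col y") auto
  then obtain x\<^sub>1 where x\<^sub>1: "adj y x\<^sub>1" "x\<^sub>1 \<noteq> x" using nbr_avoiding[OF V(2), of "[x]"] by auto
  let ?T = "N x\<^sub>1 \<inter> ?A"
  have T: "card ?T = k" "finite ?T" using card_trace[OF k(1) xy x\<^sub>1] A(1) by simp_all
  obtain S where S: "S \<subseteq> ?T" "card S = j" using T(1) j(2) by (meson obtain_subset_with_card_n)
  have "card (?A - ?T) = deg c - 1 - k" using T A by (subst card_Diff_subset) auto
  then have "j \<le> card (?A - ?T)" using j(3) by simp
  then obtain R where R: "R \<subseteq> ?A - ?T" "card R = j" by (meson obtain_subset_with_card_n)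
  have fin: "finite S" "finite R" using S(1) R(1) A(1) finite_subset by blast+
  have card_diff: "card (?T - S) = k - j" using S T fin by (simp add: card_Diff_subset)
  have "card (?T - S \<union> R) = card (?T - S) + card R"
    using T(2) fin R(1) by (intro card_Un_disjoint) auto
  then have "card (?T - S \<union> R) = card ?T" using card_diff R(2) T(1) j(2) by simp
  moreover have "?T - S \<union> R \<subseteq> ?A" using R(1) by blast
  ultimately obtain x\<^sub>2 where x\<^sub>2: "adj y x\<^sub>2" "x\<^sub>2 \<noteq> x" "N x\<^sub>2 \<inter> ?A = ?T - S \<union> R"
    using all_traces_occur[OF xy(1) x\<^sub>1] by metis
  have "R \<noteq> {}" using R(2) j(1) by auto
  then have "x\<^sub>1 \<noteq> x\<^sub>2" using R(1) x\<^sub>2(3) by auto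
  moreover have "N x\<^sub>1 \<inter> N x\<^sub>2 \<inter> ?A = ?T - S" using x\<^sub>2(3) R(1) by blast
  ultimately show ?thesis using that x\<^sub>1 x\<^sub>2(1,2) card_diff by simp
qed

lemma trace_injective:
  assumes k: "has_codegree c (Suc k)" "1 \<le> k" "Suc k < deg c" "deg (\<not> c) \<ge> 2"
    and xy: "adj x y" "col x = c" and z: "adj y z\<^sub>1" "z\<^sub>1 \<noteq> x" "adj y z\<^sub>2" "z\<^sub>2 \<noteq> x"
    and eq: "N z\<^sub>1 \<inter> (N x - {y}) = N z\<^sub>2 \<inter> (N x - {y})"
  shows "z\<^sub>1 = z\<^sub>2"
proof (rule ccontr)
  assume ne: "z\<^sub>1 \<noteq> z\<^sub>2"
  have "1 + Suc k \<le> deg c" using k(3) by simp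
  then obtain x\<^sub>1 x\<^sub>2 where x: "adj y x\<^sub>1" "x\<^sub>1 \<noteq> x" "adj y x\<^sub>2" "x\<^sub>2 \<noteq> x" "x\<^sub>1 \<noteq> x\<^sub>2"
    and "card (N x\<^sub>1 \<inter> N x\<^sub>2 \<inter> (N x - {y})) = k - 1"
    by (rule traces_with_smaller_Int[OF k(1,4) xy _ k(2), OF order_refl])
  moreover have "N z\<^sub>1 \<inter> N z\<^sub>2 \<inter> (N x - {y}) = N z\<^sub>1 \<inter> (N x - {y})" using eq by auto
  ultimately show False
    using card_trace_Int[OF xy(1) x z ne] card_trace[OF k(1) xy z(1,2)] k(2) by simp
qed

lemma codegree_cases:
  assumes k: "has_codegree c (Suc k)" "1 \<le> k" "Suc k < deg c" "deg (\<not> c) \<ge> 2"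
  shows "k = 1 \<or> Suc (Suc k) = deg c"
proof (rule ccontr)
  assume "\<not> ?thesis"
  then have k_ge_2: "2 \<le> k" "2 + Suc k \<le> deg c" "1 + Suc k \<le> deg c" using k(2,3) by linarith+
  obtain x where x: "x \<in> V" "col x = c" by (rule colour_vertex)
  obtain y where y: "adj x y" by (rule has_nbr[OF x(1)])
  obtain x\<^sub>1 x\<^sub>2 where x\<^sub>1: "adj y x\<^sub>1" "x\<^sub>1 \<noteq> x" "adj y x\<^sub>2" "x\<^sub>2 \<noteq> x" "x\<^sub>1 \<noteq> x\<^sub>2"
    and "card (N x\<^sub>1 \<inter> N x\<^sub>2 \<inter> (N x - {y})) = k - 1"
    by (rule traces_with_smaller_Int[OF k(1,4) y x(2) _ k(2) k_ge_2(3), OF order_refl])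
  moreover obtain x\<^sub>3 x\<^sub>4 where x\<^sub>3: "adj y x\<^sub>3" "x\<^sub>3 \<noteq> x" "adj y x\<^sub>4" "x\<^sub>4 \<noteq> x" "x\<^sub>3 \<noteq> x\<^sub>4"
    and "card (N x\<^sub>3 \<inter> N x\<^sub>4 \<inter> (N x - {y})) = k - 2"
    by (rule traces_with_smaller_Int[OF k(1,4) y x(2) _ k_ge_2(1,2)]) simp_all
  ultimately show False using card_trace_Int[OF y x\<^sub>1 x\<^sub>3] k_ge_2(1) by simp
qed

lemma listed_if_full_codegree:
  assumes "has_codegree c (deg c)" shows "listed_graph G"
proof (rule listed_if_twins)
  fix x x' y assume xy: "adj x y" "adj x' y" "col x = c"
  show "N x = N x'"
  proof (cases "x = x'")
    case False
    then have Int: "card (N x \<inter> N x') = deg c" using has_codegreeD[OF assms xy(1,2)] xy(3) by simp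
    have V: "x \<in> V" "x' \<in> V" using xy adj_verts by auto
    have "card (N x) = deg c" "card (N x') = deg c"
      using card_N V same_col_if_common_nbr[OF xy(1,2)] xy(3) by simp_all
    then have "N x \<inter> N x' = N x" "N x \<inter> N x' = N x'"
      using Int card_subset_eq[OF finite_N[OF V(1)]] card_subset_eq[OF finite_N[OF V(2)]] by auto
    then show ?thesis by simp
  qed simp
qed

lemma codegree_2_pair_trace:
  assumes codeg: "\<And>c. has_codegree c 2" and pq: "adj x p" "adj x q" "p \<noteq> q"
  obtains z where "z \<noteq> x" "N x \<inter> N z = {p, q}"
proof -
  have "card (N p \<inter> N q) = 2"
    using has_codegreeD[OF codeg adj_sym[OF pq(1)] adj_sym[OF pq(2)] pq(3)] by blast
  moreover have "x \<in> N p \<inter> N q" using pq adj_sym by simp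
  ultimately obtain z where z: "z \<in> N p \<inter> N q" "z \<noteq> x" by (metis card_2_iff')
  then have zp: "adj z p" "adj z q" using adj_sym by auto
  have card: "card (N x \<inter> N z) = 2" using has_codegreeD[OF codeg pq(1) zp(1)] z(2) by auto
  then have "finite (N x \<inter> N z)" by (metis card.infinite zero_neq_numeral)
  then have "{p, q} = N x \<inter> N z" by (rule card_subset_eq) (use pq zp card in auto)
  then show ?thesis using that z(2) by blast
qed

lemma four_nbrs:
  assumes x: "x \<in> V" "4 \<le> deg (col x)"
  obtains a b c d where "adj x a" "adj x b" "adj x c" "adj x d" "distinct [a, b, c, d]"
proof -
  have avoid: "\<exists>v. adj x v \<and> v \<notin> set us" if "length us < 4" for us
    using nbr_avoiding[OF x(1), of us] that x(2) by (metis order_less_le_trans)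
  obtain a where a: "adj x a" using avoid[of "[]"] by auto
  obtain b where b: "adj x b" "b \<noteq> a" using avoid[of "[a]"] by auto
  obtain c where c: "adj x c" "c \<noteq> a" "c \<noteq> b" using avoid[of "[a, b]"] by auto
  obtain d where "adj x d" "d \<noteq> a" "d \<noteq> b" "d \<noteq> c" using avoid[of "[a, b, c]"] by auto
  then show ?thesis using that a b c by simp
qed

lemma codegree_2_deg_less_4:
  assumes codeg: "\<And>c. has_codegree c 2" shows "deg c < 4"
proof (rule ccontr)
  assume deg: "\<not> deg c < 4"
  obtain x where x: "x \<in> V" "col x = c" by (rule colour_vertex)
  have "4 \<le> deg (col x)" using deg x(2) by simp
  then obtain y\<^sub>1 y\<^sub>2 y\<^sub>3 y\<^sub>4 where y: "adj x y\<^sub>1" "adj x y\<^sub>2" "adj x y\<^sub>3" "adj x y\<^sub>4"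
    and dist: "distinct [y\<^sub>1, y\<^sub>2, y\<^sub>3, y\<^sub>4]"
    by (rule four_nbrs[OF x(1)])
  obtain a where a: "a \<noteq> x" "N x \<inter> N a = {y\<^sub>1, y\<^sub>3}"
    by (rule codegree_2_pair_trace[OF codeg y(1,3)]) (use dist in auto)
  obtain b where b: "b \<noteq> x" "N x \<inter> N b = {y\<^sub>2, y\<^sub>3}"
    by (rule codegree_2_pair_trace[OF codeg y(2,3)]) (use dist in auto)
  obtain d where d: "d \<noteq> x" "N x \<inter> N d = {y\<^sub>2, y\<^sub>4}"
    by (rule codegree_2_pair_trace[OF codeg y(2,4)]) (use dist in auto)
  have adj_iff: "adj u w \<longleftrightarrow> w \<in> T" if "N x \<inter> N u = T" "adj x w" for u w T
    using that by auto
  have adj_a: "adj a y\<^sub>1" "adj a y\<^sub>3" "\<not> adj a y\<^sub>2"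
    using adj_iff[OF a(2)] y dist by auto
  have adj_b: "adj b y\<^sub>2" "adj b y\<^sub>3" "\<not> adj b y\<^sub>1"
    using adj_iff[OF b(2)] y dist by auto
  have adj_d: "adj d y\<^sub>2" "\<not> adj d y\<^sub>1" "\<not> adj d y\<^sub>3"
    using adj_iff[OF d(2)] y dist by auto
  have cols: "col a = c" "col b = c" "col d = c" "col y\<^sub>1 \<noteq> c" "col y\<^sub>2 \<noteq> c"
    using same_col_if_common_nbr[OF _ y(1)] same_col_if_common_nbr[OF _ y(2)] adj_a adj_b adj_d
      adj_col[OF y(1)] adj_col[OF y(2)] x(2) by auto
  let ?Z = "{a, y\<^sub>2, y\<^sub>1, x}"
  obtain g where g: "aut g" "\<And>z. z \<in> ?Z \<Longrightarrow> g z = z" "g b = d"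
  proof (rule aut_fixing_swap)
    show "connected_on (ugraph G) ?Z"
      by (intro connected_on_insert[OF sym_ugraph] connected_on_singleton)
        (use y(1,2) adj_sym[OF adj_a(1)] in \<open>auto simp: ugraph_def\<close>)
    show "?Z \<subseteq> V" "b \<in> V" "d \<in> V" using adj_a adj_b adj_d adj_verts adj_verts2 x(1) by blast+
    show "b \<notin> ?Z" "d \<notin> ?Z" using a b d adj_a adj_b adj_d cols by auto
    show "\<exists>z\<in>?Z. adj z b" using adj_sym[OF adj_b(1)] by blast
    fix z assume "z \<in> ?Z"
    moreover have "\<not> adj z b \<and> \<not> adj z d" if "col z = c" using that cols(2,3) adj_col by metis
    ultimately show "adj z b \<longleftrightarrow> adj z d"
      using adj_b adj_d x(2) cols(1) by (auto simp: uadj_commute[of G _ b] uadj_commute[of G _ d])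
  qed (use cols in simp_all)
  have "adj x (g y\<^sub>3)" "adj a (g y\<^sub>3)" "adj d (g y\<^sub>3)"
    using aut_adj[OF g(1) y(3)] aut_adj[OF g(1) adj_a(2)] aut_adj[OF g(1) adj_b(2)] g(2,3) by auto
  then have "g y\<^sub>3 \<in> {y\<^sub>1, y\<^sub>3}" "g y\<^sub>3 \<in> {y\<^sub>2, y\<^sub>4}" using adj_iff[OF a(2)] adj_iff[OF d(2)] by blast+
  then show False using dist by auto
qed

end

locale near_twins = homogeneous_bipartite +
  fixes k :: nat and x :: 'a
  assumes codegree: "has_codegree (col x) (Suc k)" and k_pos: "1 \<le> k"
    and deg_col: "deg (col x) = Suc (Suc k)" and deg_other: "2 \<le> deg (\<not> col x)"
    and x: "x \<in> V"
begin

lemma card_Nx: "card (N x) = Suc (Suc k)" and finite_Nx: "finite (N x)"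
  using card_N[OF x] finite_N[OF x] deg_col by auto

lemma other_nbr: obtains w where "adj x w" "w \<noteq> p" "w \<noteq> q"
  using nbr_avoiding[OF x, of "[p, q]"] deg_col k_pos by auto

lemma nbr_col: "adj x y \<Longrightarrow> col y = (\<not> col x)"
  using adj_col by blast

lemma near_twin_exists:
  assumes y: "adj x y" shows "\<exists>x'. x' \<noteq> x \<and> N x' \<inter> N x = N x - {y}"
proof -
  obtain w where w: "adj x w" "w \<noteq> y" by (rule other_nbr)
  have "length [x] < deg (col w)" using deg_other nbr_col[OF w(1)] by simp
  then obtain x\<^sub>0 where x\<^sub>0: "adj w x\<^sub>0" "x\<^sub>0 \<noteq> x"
    using nbr_avoiding[OF adj_verts2[OF w(1)], of "[x]"] by auto
  have "card (N x - {w} - {y}) = k" using card_Nx finite_Nx w y by simp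
  then obtain x' where x': "adj w x'" "x' \<noteq> x" "N x' \<inter> (N x - {w}) = N x - {w} - {y}"
    using all_traces_occur[OF w(1) x\<^sub>0, of "N x - {w} - {y}"] card_trace[OF codegree w(1) refl x\<^sub>0] by auto
  have "w \<in> N x'" "w \<in> N x" using adj_sym[OF x'(1)] w(1) by simp_all
  then have "N x' \<inter> N x = N x - {y}" using w(2) x'(3) by blast
  then show ?thesis using x'(2) by blast
qed

definition near_twin :: "'a \<Rightarrow> 'a" where
  "near_twin y = (SOME x'. x' \<noteq> x \<and> N x' \<inter> N x = N x - {y})"

lemma near_twin:
  assumes "adj x y" shows "near_twin y \<noteq> x" "N (near_twin y) \<inter> N x = N x - {y}"
  using someI_ex[OF near_twin_exists[OF assms]] by (auto simp: near_twin_def)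

lemma near_twin_adj: "adj x y \<Longrightarrow> adj x w \<Longrightarrow> adj (near_twin y) w \<longleftrightarrow> w \<noteq> y"
  using near_twin(2)[of y] in_N by blast

lemma near_twin_unique:
  assumes y: "adj x y" and x': "x' \<noteq> x" "N x' \<inter> N x = N x - {y}"
  shows "x' = near_twin y"
proof -
  obtain w where w: "adj x w" "w \<noteq> y" by (rule other_nbr)
  then have "w \<in> N x' \<inter> N x" using x'(2) by simp
  then have "adj w x'" using adj_sym by simp
  moreover have "adj w (near_twin y)" using near_twin_adj[OF y w(1)] w(2) adj_sym by blast
  moreover have "N x' \<inter> (N x - {w}) = N (near_twin y) \<inter> (N x - {w})" using x'(2) near_twin(2)[OF y] by blast
  ultimately show ?thesis
    using trace_injective[OF codegree k_pos _ deg_other w(1) refl] deg_col x'(1) near_twin(1)[OF y] by simp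
qed

lemma near_twin_vertex:
  assumes y: "adj x y" shows "near_twin y \<in> V" "col (near_twin y) = col x"
proof -
  obtain w where w: "adj x w" "w \<noteq> y" by (rule other_nbr)
  then have adj: "adj (near_twin y) w" using near_twin_adj y by blast
  then show "near_twin y \<in> V" by (rule adj_verts)
  show "col (near_twin y) = col x" by (rule same_col_if_common_nbr[OF adj w(1)])
qed

lemma near_twin_inj: "inj_on near_twin (N x)"
proof (rule inj_onI)
  fix y w assume yw: "y \<in> N x" "w \<in> N x" "near_twin y = near_twin w"
  then have "adj x y" "adj x w" by simp_all
  then show "y = w" using near_twin_adj[of y w] near_twin_adj[of w w] yw(3) by metis
qed

lemma distance_2_near_twin:
  assumes "adj x w" "adj w x'" "x' \<noteq> x" obtains y where "adj x y" "x' = near_twin y"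
proof -
  have "card (N x \<inter> N x') = Suc k" using has_codegreeD[OF codegree assms(1) adj_sym[OF assms(2)]] assms(3) by auto
  then have "card (N x - N x') = 1"
    using card_Nx finite_Nx card_Diff_subset_Int[of "N x" "N x'"] by simp
  then obtain y where y: "N x - N x' = {y}" by (metis card_1_singletonE)
  then have "N x' \<inter> N x = N x - {y}" "adj x y" by auto
  then show ?thesis using that near_twin_unique assms(3) by blast
qed

lemma N_nbr:
  assumes y: "adj x y" shows "N y = insert x (near_twin ` (N x - {y}))"
proof (intro set_eqI iffI)
  fix x' assume x': "x' \<in> N y"
  show "x' \<in> insert x (near_twin ` (N x - {y}))"
  proof (cases "x' = x")
    case False
    obtain w where w: "adj x w" "x' = near_twin w"
      by (rule distance_2_near_twin[OF y _ False]) (use x' in simp)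
    then have "y \<noteq> w" using near_twin_adj[OF w(1) y] x' adj_sym by auto
    then show ?thesis using w by auto
  qed simp
next
  fix x' assume "x' \<in> insert x (near_twin ` (N x - {y}))"
  then consider "x' = x" | w where "x' = near_twin w" "w \<in> N x - {y}" by blast
  then show "x' \<in> N y"
  proof cases
    case 1
    then show ?thesis using adj_sym[OF y] by simp
  next
    case 2
    then show ?thesis using near_twin_adj[of w y] y adj_sym by auto
  qed
qed

lemma card_N_near_twin_minus:
  assumes y: "adj x y" shows "card (N (near_twin y) - N x) = 1"
proof -
  have "card (N (near_twin y)) = Suc (Suc k)" "finite (N (near_twin y))"
    using card_N finite_N near_twin_vertex[OF y] deg_col by auto
  moreover have "card (N (near_twin y) \<inter> N x) = Suc k"
    using near_twin(2)[OF y] card_Nx finite_Nx y by simp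
  ultimately show ?thesis by (simp add: card_Diff_subset_Int)
qed

lemma near_twins_common_outer_nbr:
  assumes y: "adj x y" "adj x y'" shows "N (near_twin y) - N x = N (near_twin y') - N x"
proof (cases "y = y'")
  case False
  let ?M = "N (near_twin y) \<inter> N (near_twin y')"
  obtain w where w: "adj x w" "w \<noteq> y" "w \<noteq> y'" by (rule other_nbr)
  have "near_twin y \<noteq> near_twin y'" using near_twin_inj y False by (auto dest: inj_onD)
  moreover have "adj (near_twin y) w" "adj (near_twin y') w" using near_twin_adj y w by blast+
  moreover have "has_codegree (col (near_twin y)) (Suc k)" using codegree near_twin_vertex(2)[OF y(1)] by simp
  ultimately have "card ?M = Suc k" using has_codegreeD by blast
  moreover have "?M \<inter> N x = N x - {y} - {y'}" using near_twin(2)[OF y(1)] near_twin(2)[OF y(2)] by blast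
  then have "card (?M \<inter> N x) = k" using card_Nx finite_Nx y False by simp
  ultimately have "?M \<inter> N x \<noteq> ?M" by auto
  then obtain v where "v \<in> ?M" "v \<notin> N x" by blast
  then have v: "v \<in> N (near_twin y) - N x" "v \<in> N (near_twin y') - N x" by blast+
  have "N (near_twin y) - N x = {v}" "N (near_twin y') - N x = {v}"
    using card_N_near_twin_minus[OF y(1)] card_N_near_twin_minus[OF y(2)] v by (metis card_1_singletonE singletonD)+
  then show ?thesis by simp
qed simp

definition antipode :: 'a where
  "antipode = (SOME z. \<forall>y. adj x y \<longrightarrow> N (near_twin y) - N x = {z})"

lemma N_near_twin_minus:
  assumes "adj x y" shows "N (near_twin y) - N x = {antipode}"
proof -
  obtain z where "N (near_twin y) - N x = {z}"
    using card_N_near_twin_minus[OF assms] by (metis card_1_singletonE)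
  then have "\<exists>z. \<forall>y. adj x y \<longrightarrow> N (near_twin y) - N x = {z}"
    using near_twins_common_outer_nbr[OF assms] by metis
  then have "\<forall>y. adj x y \<longrightarrow> N (near_twin y) - N x = {antipode}" unfolding antipode_def by (rule someI_ex)
  then show ?thesis using assms by blast
qed

lemma N_near_twin: "adj x y \<Longrightarrow> N (near_twin y) = insert antipode (N x - {y})"
  using N_near_twin_minus[of y] near_twin(2)[of y] by blast

lemma antipode: "\<not> adj x antipode" "antipode \<in> V" "col antipode = (\<not> col x)"
proof -
  obtain y where y: "adj x y" by (rule has_nbr[OF x])
  have "antipode \<in> N (near_twin y) - N x" using N_near_twin_minus[OF y] by simp
  then have "adj (near_twin y) antipode" "\<not> adj x antipode" by auto
  then show "\<not> adj x antipode" "antipode \<in> V" "col antipode = (\<not> col x)"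
    using adj_verts2 adj_col near_twin_vertex(2)[OF y] by auto
qed

lemma N_antipode: "N antipode = near_twin ` N x"
proof (rule card_subset_eq[symmetric])
  show "finite (N antipode)" by (rule finite_N[OF antipode(2)])
  show "near_twin ` N x \<subseteq> N antipode"
  proof
    fix v assume "v \<in> near_twin ` N x"
    then obtain y where y: "v = near_twin y" "adj x y" by auto
    then have "antipode \<in> N (near_twin y)" using N_near_twin by blast
    then show "v \<in> N antipode" using y(1) adj_sym by simp
  qed
  obtain y where y: "adj x y" by (rule has_nbr[OF x])
  have "x \<notin> near_twin ` (N x - {y})" using near_twin(1) by force
  moreover have "card (near_twin ` (N x - {y})) = Suc k"
    using card_image[OF inj_on_subset[OF near_twin_inj]] card_Nx finite_Nx y by simp
  ultimately have "card (N y) = Suc (Suc k)" using N_nbr[OF y] finite_Nx by simp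
  moreover have "card (N y) = card (N antipode)"
    using card_N[OF adj_verts2[OF y]] card_N[OF antipode(2)] nbr_col[OF y] antipode(3) by simp
  ultimately show "card (near_twin ` N x) = card (N antipode)"
    using card_image[OF near_twin_inj] card_Nx by simp
qed

lemma verts_subset: "V \<subseteq> insert x (near_twin ` N x) \<union> insert antipode (N x)"
proof
  fix v assume "v \<in> V"
  let ?P = "\<lambda>v. v \<in> insert x (near_twin ` N x) \<union> insert antipode (N x)"
  show "?P v"
  proof (rule graph_induct[where P = ?P, OF x _ _ \<open>v \<in> V\<close>])
    fix u v assume u: "?P u" and uv: "adj u v"
    have v: "v \<in> N u" using uv by simp
    from u consider "u = x" | y where "adj x y" "u = near_twin y" | "u = antipode" | "adj x u" by auto
    then show "?P v" using v N_near_twin N_antipode N_nbr by cases blast+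
  qed simp
qed

lemma colour_classes:
  "{v \<in> V. col v = col x} = insert x (near_twin ` N x)" "{v \<in> V. col v \<noteq> col x} = insert antipode (N x)"
proof -
  have "insert x (near_twin ` N x) \<subseteq> {v \<in> V. col v = col x}" using x near_twin_vertex by auto
  moreover have "insert antipode (N x) \<subseteq> {v \<in> V. col v \<noteq> col x}"
    using antipode(2,3) nbr_col adj_verts2 by auto
  ultimately show "{v \<in> V. col v = col x} = insert x (near_twin ` N x)"
    "{v \<in> V. col v \<noteq> col x} = insert antipode (N x)"
    using verts_subset by blast+
qed

definition non_nbr :: "'a \<Rightarrow> 'a" where
  "non_nbr v = (if v = x then antipode else inv_into (N x) near_twin v)"

lemma non_nbr_near_twin: "adj x y \<Longrightarrow> non_nbr (near_twin y) = y"
  using near_twin(1)[of y] inv_into_f_f[OF near_twin_inj, of y] by (simp add: non_nbr_def)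

lemma adj_iff_non_nbr:
  assumes u: "u \<in> insert x (near_twin ` N x)" and w: "w \<in> insert antipode (N x)"
  shows "adj u w \<longleftrightarrow> w \<noteq> non_nbr u"
proof (cases "u = x")
  case True
  then show ?thesis using w antipode(1) by (auto simp: non_nbr_def)
next
  case False
  then obtain y where y: "u = near_twin y" "adj x y" using u by auto
  have "adj u w \<longleftrightarrow> w \<in> insert antipode (N x - {y})" unfolding y(1) N_near_twin[OF y(2), symmetric] by simp
  also have "\<dots> \<longleftrightarrow> w \<noteq> y" using w y(2) antipode(1) by auto
  finally show ?thesis using non_nbr_near_twin[OF y(2)] y(1) by simp
qed

lemma non_nbr_bij: "bij_betw non_nbr (insert x (near_twin ` N x)) (insert antipode (N x))"
proof (rule bij_betw_imageI)
  have "non_nbr ` near_twin ` N x = N x" using non_nbr_near_twin by (force simp: image_image)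
  moreover have "non_nbr x = antipode" by (simp add: non_nbr_def)
  ultimately show "non_nbr ` insert x (near_twin ` N x) = insert antipode (N x)" by (simp only: image_insert)
  have "u = x \<and> non_nbr u = antipode \<or> adj x (non_nbr u) \<and> u = near_twin (non_nbr u)"
    if "u \<in> insert x (near_twin ` N x)" for u
    using that non_nbr_near_twin by (auto simp: non_nbr_def[of x])
  then show "inj_on non_nbr (insert x (near_twin ` N x))"
    using antipode(1) by (intro inj_onI) metis
qed

lemma listed: "listed_graph G"
proof (rule listed_if_complete_minus_matching[where c = "col x" and \<eta> = non_nbr])
  show "finite V" by (rule finite_subset[OF verts_subset]) (simp add: finite_Nx)
  show "bij_betw non_nbr {z \<in> V. col z = col x} {z \<in> V. col z \<noteq> col x}"
    unfolding colour_classes by (rule non_nbr_bij)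
  fix z w assume "z \<in> V" "w \<in> V" "col z = col x" "col w \<noteq> col x"
  then show "adj z w \<longleftrightarrow> w \<noteq> non_nbr z"
    using colour_classes by (intro adj_iff_non_nbr) blast+
qed

end

context homogeneous_bipartite
begin

lemma four_cycle_codegree:
  assumes "is_cycle G [p, q, r, s]"
  obtains k where "has_codegree c (Suc k)" "1 \<le> k" "Suc k \<le> deg c"
proof -
  have codegree: "\<exists>k. has_codegree (col u) (Suc k) \<and> 1 \<le> k \<and> Suc k \<le> deg (col u)"
    if uv: "adj u a" "adj v a" "adj u b" "adj v b" "a \<noteq> b" "u \<noteq> v" for u v a b
  proof -
    have fin: "finite (N u)" "card (N u) = deg (col u)"
      using finite_N card_N adj_verts[OF uv(1)] by blast+
    then have "card {a, b} \<le> card (N u \<inter> N v)" using uv by (intro card_mono) auto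
    then have "2 \<le> card (N u \<inter> N v)" using uv(5) by simp
    moreover have "card (N u \<inter> N v) \<le> deg (col u)" using fin card_mono[of "N u" "N u \<inter> N v"] by simp
    moreover have "has_codegree (col u) (card (N u \<inter> N v))" by (rule has_codegree_card[OF uv(1,2,6)])
    ultimately show ?thesis by (intro exI[of _ "card (N u \<inter> N v) - 1"]) auto
  qed
  have adj: "adj p q" "adj q r" "adj r s" "adj s p" "p \<noteq> r" "q \<noteq> s" using assms by (auto simp: is_cycle_def)
  note sym = adj(1-4)[THEN adj_sym]
  have "\<exists>k. has_codegree c (Suc k) \<and> 1 \<le> k \<and> Suc k \<le> deg c"
  proof (cases "c = col p")
    case True
    then show ?thesis using codegree[of p q r s] adj sym by simp
  next
    case False
    then have "c = col q" using adj_col[OF adj(1)] by auto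
    then show ?thesis using codegree[of q r s p] adj sym by simp
  qed
  then show ?thesis using that by blast
qed

lemma listed_if_four_cycle:
  assumes deg: "\<And>c. deg c \<ge> 2" and c: "deg c \<ge> 3" and cyc: "is_cycle G [p, q, r, s]"
  shows "listed_graph G"
proof -
  have "\<exists>k. has_codegree c (Suc k) \<and> 1 \<le> k \<and> Suc k \<le> deg c" for c
    using four_cycle_codegree[OF cyc, of c] by blast
  then obtain k where k: "\<And>c. has_codegree c (Suc (k c))" "\<And>c. 1 \<le> k c" "\<And>c. Suc (k c) \<le> deg c" by metis
  consider c where "Suc (k c) = deg c" | c where "Suc (Suc (k c)) = deg c" | "\<And>c. Suc (Suc (k c)) < deg c"
    using k(3) by (metis Suc_leI le_neq_implies_less)
  then show ?thesis
  proof cases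
    case (1 c)
    then show ?thesis using listed_if_full_codegree k(1)[of c] by simp
  next
    case (2 c)
    obtain x where x: "x \<in> V" "col x = c" by (rule colour_vertex)
    interpret near_twins G col deg "k c" x
    proof
      show "has_codegree (col x) (Suc (k c))" "1 \<le> k c" using k(1,2)[of c] x(2) by auto
      show "deg (col x) = Suc (Suc (k c))" using 2 x(2) by simp
      show "2 \<le> deg (\<not> col x)" by (rule deg)
      show "x \<in> V" by (rule x(1))
    qed
    show ?thesis by (rule listed)
  next
    case 3
    then have "k c = 1" for c
      using codegree_cases[OF k(1,2) _ deg, of c] by (metis Suc_lessD less_irrefl)
    then have "\<And>c. has_codegree c 2" "4 \<le> deg True"
      using k(1) 3[of True] by (simp_all add: numeral_2_eq_2)
    then show ?thesis using codegree_2_deg_less_4[of True] by simp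
  qed
qed

theorem homogeneous_bipartite_listed: "listed_graph G"
proof (cases "uacyclic G \<or> (\<exists>c. deg c = 1)")
  case True
  then show ?thesis using listed_if_acyclic listed_if_deg_1 by blast
next
  case False
  then have deg: "deg c \<ge> 2" for c using deg_pos[of c] by (metis Suc_1 Suc_leI le_neq_implies_less)
  obtain zs where zs: "is_cycle G zs" "length zs = girth"
    using False uacyclic_iff[OF ugraph_verts] girth_cycle by blast
  show ?thesis
  proof (cases "\<forall>c. deg c = 2")
    case True
    then show ?thesis using listed_if_cycle[OF zs(1)] by blast
  next
    case False
    then obtain c where c: "deg c \<ge> 3"
      using deg by (metis le_antisym not_less_eq_eq numeral_2_eq_2 numeral_3_eq_3)
    then have "\<not> girth > 4"
      using girth_at_most_6[OF zs c] girth6_deg_less_3[OF zs _ deg] by (meson linorder_not_le)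
    then have "length zs = Suc (Suc (Suc (Suc 0)))" using cycle_even_length(2)[OF zs(1)] zs(2) by simp
    then obtain p q r s where "zs = [p, q, r, s]" unfolding length_Suc_conv length_0_conv by blast
    then show ?thesis using listed_if_four_cycle[OF deg c] zs(1) by blast
  qed
qed

end

section \<open>One-point extensions\<close>

definition connected_embedding :: "'a dg \<Rightarrow> 'a set \<Rightarrow> ('a \<Rightarrow> 'a) \<Rightarrow> bool" where
  "connected_embedding D S f \<longleftrightarrow> S \<subseteq> verts D \<and> connected_on (ugraph D) S \<and> inj_on f S \<and> f ` S \<subseteq> verts D
     \<and> (\<forall>x\<in>S. \<forall>y\<in>S. (f x, f y) \<in> arcs D \<longleftrightarrow> (x, y) \<in> arcs D)"

text \<open>The set \<open>S\<close> is not required to be finite, so that Zorn's lemma applies.\<close>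

definition one_point_extendable :: "'a dg \<Rightarrow> bool" where
  "one_point_extendable D \<longleftrightarrow> (\<forall>S f v. connected_embedding D S f \<longrightarrow> v \<in> verts D - S \<longrightarrow> (\<exists>s\<in>S. uadj D s v)
     \<longrightarrow> (\<exists>w\<in>verts D - f ` S. \<forall>u\<in>S. ((f u, w) \<in> arcs D \<longleftrightarrow> (u, v) \<in> arcs D)
       \<and> ((w, f u) \<in> arcs D \<longleftrightarrow> (v, u) \<in> arcs D)))"

lemma connected_embedding_uadj:
  "connected_embedding D S f \<Longrightarrow> x \<in> S \<Longrightarrow> y \<in> S \<Longrightarrow> uadj D (f x) (f y) \<longleftrightarrow> uadj D x y"
  by (simp add: connected_embedding_def uadj_def)

lemma connected_embedding_connected_image:
  assumes "connected_embedding D S f" shows "connected_on (ugraph D) (f ` S)"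
proof (rule connected_on_image)
  show "connected_on (ugraph D) S" using assms by (simp add: connected_embedding_def)
qed (use connected_embedding_uadj[OF assms] in \<open>simp add: ugraph_def\<close>)

lemma connected_embedding_inv_into:
  assumes "connected_embedding D S f" shows "connected_embedding D (f ` S) (inv_into S f)"
  using assms connected_embedding_connected_image[OF assms]
  by (auto simp: connected_embedding_def inj_on_inv_into)

lemma connected_embedding_insert:
  assumes wf: "wf_digraph D" and f: "connected_embedding D S f" and v: "v \<in> verts D - S" "\<exists>s\<in>S. uadj D s v"
    and w: "w \<in> verts D - f ` S"
      "\<forall>u\<in>S. ((f u, w) \<in> arcs D \<longleftrightarrow> (u, v) \<in> arcs D) \<and> ((w, f u) \<in> arcs D \<longleftrightarrow> (v, u) \<in> arcs D)"
  shows "connected_embedding D (insert v S) (f(v := w))"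
proof -
  have "connected_on (ugraph D) (insert v S)"
    using f v(2) by (intro connected_on_insert[OF sym_ugraph]) (auto simp: connected_embedding_def ugraph_def)
  moreover have "inj_on (f(v := w)) (insert v S)"
    using f v(1) w(1) by (auto simp: connected_embedding_def inj_on_def)
  moreover have "(z, z) \<notin> arcs D" for z using wf by (simp add: wf_digraph_def)
  ultimately show ?thesis using f v(1) w by (auto simp: connected_embedding_def)
qed

definition partial_iso :: "'a dg \<Rightarrow> ('a \<times> 'a) set \<Rightarrow> bool" where
  "partial_iso D F \<longleftrightarrow> F \<subseteq> verts D \<times> verts D \<and> connected_on (ugraph D) (Domain F) \<and>
     (\<forall>x y x' y'. (x, y) \<in> F \<longrightarrow> (x', y') \<in> F \<longrightarrow> (x = x' \<longleftrightarrow> y = y') \<and> ((x, x') \<in> arcs D \<longleftrightarrow> (y, y') \<in> arcs D))"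

lemma partial_iso_graph_iff: "partial_iso D ((\<lambda>x. (x, f x)) ` S) \<longleftrightarrow> connected_embedding D S f"
proof -
  let ?F = "(\<lambda>x. (x, f x)) ` S"
  have "Domain ?F = S" "?F \<subseteq> verts D \<times> verts D \<longleftrightarrow> S \<subseteq> verts D \<and> f ` S \<subseteq> verts D" by force+
  moreover have "(\<forall>x y x' y'. (x, y) \<in> ?F \<longrightarrow> (x', y') \<in> ?F \<longrightarrow> (x = x' \<longleftrightarrow> y = y') \<and> ((x, x') \<in> arcs D \<longleftrightarrow> (y, y') \<in> arcs D))
      \<longleftrightarrow> inj_on f S \<and> (\<forall>x\<in>S. \<forall>y\<in>S. (f x, f y) \<in> arcs D \<longleftrightarrow> (x, y) \<in> arcs D)"
    unfolding inj_on_def by fast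
  ultimately show ?thesis by (simp add: partial_iso_def connected_embedding_def conj_ac)
qed

lemma partial_isoE:
  assumes "partial_iso D F"
  obtains S f where "F = (\<lambda>x. (x, f x)) ` S" "Domain F = S" "connected_embedding D S f"
proof -
  have "\<forall>x\<in>Domain F. \<exists>y. (x, y) \<in> F" by blast
  then obtain f where f: "\<forall>x\<in>Domain F. (x, f x) \<in> F" by metis
  moreover have "y = f x" if "(x, y) \<in> F" for x y
    using assms f that unfolding partial_iso_def by blast
  ultimately have F: "F = (\<lambda>x. (x, f x)) ` Domain F" by force
  then have "connected_embedding D (Domain F) f" using assms partial_iso_graph_iff by metis
  then show ?thesis using that F by blast
qed

lemma partial_iso_converse:
  assumes "partial_iso D F" shows "partial_iso D (F\<inverse>)"
proof -
  obtain S f where F: "F = (\<lambda>x. (x, f x)) ` S" and emb: "connected_embedding D S f"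
    by (rule partial_isoE[OF assms])
  have "F\<inverse> = (\<lambda>x. (f x, x)) ` S" unfolding F by auto
  also have "\<dots> = (\<lambda>y. (y, inv_into S f y)) ` f ` S"
    using emb unfolding image_image by (intro image_cong) (auto simp: connected_embedding_def)
  finally show ?thesis
    using connected_embedding_inv_into[OF emb] by (simp only: partial_iso_graph_iff)
qed

lemma partial_iso_extend:
  assumes wf: "wf_digraph D" and conn: "uconnected D" and ext: "one_point_extendable D"
    and iso: "partial_iso D F" "F \<noteq> {}" and dom: "Domain F \<noteq> verts D"
  obtains v w where "v \<notin> Domain F" "partial_iso D (insert (v, w) F)"
proof -
  obtain S f where F: "F = (\<lambda>x. (x, f x)) ` S" "Domain F = S" and emb: "connected_embedding D S f"
    by (rule partial_isoE[OF iso(1)])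
  have S: "S \<subseteq> verts D" using emb by (simp add: connected_embedding_def)
  then obtain x y where x: "x \<in> S" and y: "y \<in> verts D - S" using iso(2) dom F by blast
  have "(x, y) \<in> (ugraph D)\<^sup>*"
    using conn x y S by (intro connected_on_rtrancl[of _ "verts D"]) (auto simp: uconnected_iff)
  then obtain s v where sv: "(s, v) \<in> ugraph D" "s \<in> S" "v \<notin> S" by (rule rtrancl_exits) (use x y in auto)
  then have v: "v \<in> verts D - S" "\<exists>s\<in>S. uadj D s v"
    using uadj_in_verts[OF wf] by (auto simp: ugraph_def)
  then obtain w where w: "w \<in> verts D - f ` S"
    "\<forall>u\<in>S. ((f u, w) \<in> arcs D \<longleftrightarrow> (u, v) \<in> arcs D) \<and> ((w, f u) \<in> arcs D \<longleftrightarrow> (v, u) \<in> arcs D)"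
    using ext emb unfolding one_point_extendable_def by blast
  have "insert (v, w) F = (\<lambda>x. (x, (f(v := w)) x)) ` insert v S"
    using sv(3) unfolding F(1) by auto
  then have "partial_iso D (insert (v, w) F)"
    using connected_embedding_insert[OF wf emb v w] by (simp only: partial_iso_graph_iff)
  then show ?thesis using that sv(3) F(2) by blast
qed

lemma partial_iso_Union_chain:
  assumes iso: "\<And>F. F \<in> \<C> \<Longrightarrow> partial_iso D F" and chain: "\<And>F F'. F \<in> \<C> \<Longrightarrow> F' \<in> \<C> \<Longrightarrow> F \<subseteq> F' \<or> F' \<subseteq> F"
  shows "partial_iso D (\<Union>\<C>)"
proof -
  have common: "\<exists>F\<in>\<C>. e \<in> F \<and> e' \<in> F" if "e \<in> \<Union>\<C>" "e' \<in> \<Union>\<C>" for e e'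
    using that chain by (meson UnionE subsetD)
  have "connected_on (ugraph D) (Domain (\<Union>\<C>))"
    unfolding connected_on_def
  proof (intro ballI)
    fix x x' assume "x \<in> Domain (\<Union>\<C>)" "x' \<in> Domain (\<Union>\<C>)"
    then obtain F where F: "F \<in> \<C>" "x \<in> Domain F" "x' \<in> Domain F" using common by (meson DomainE DomainI)
    then have "(x, x') \<in> (ugraph D \<inter> Domain F \<times> Domain F)\<^sup>*"
      using iso by (simp add: partial_iso_def connected_on_def)
    moreover have "(ugraph D \<inter> Domain F \<times> Domain F)\<^sup>* \<subseteq> (ugraph D \<inter> Domain (\<Union>\<C>) \<times> Domain (\<Union>\<C>))\<^sup>*"
      by (rule rtrancl_mono) (use F(1) in blast)
    ultimately show "(x, x') \<in> (ugraph D \<inter> Domain (\<Union>\<C>) \<times> Domain (\<Union>\<C>))\<^sup>*" by (rule subsetD[rotated])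
  qed
  moreover have "\<Union>\<C> \<subseteq> verts D \<times> verts D" using iso unfolding partial_iso_def by blast
  moreover have "(x = x' \<longleftrightarrow> y = y') \<and> ((x, x') \<in> arcs D \<longleftrightarrow> (y, y') \<in> arcs D)"
    if xy: "(x, y) \<in> \<Union>\<C>" "(x', y') \<in> \<Union>\<C>" for x y x' y'
  proof -
    obtain F where "F \<in> \<C>" "(x, y) \<in> F" "(x', y') \<in> F" using common[OF xy] by blast
    then show ?thesis using iso unfolding partial_iso_def by blast
  qed
  ultimately show ?thesis unfolding partial_iso_def by blast
qed

lemma maximal_partial_iso:
  assumes "partial_iso D F\<^sub>0"
  obtains M where "partial_iso D M" "F\<^sub>0 \<subseteq> M" "\<And>F. partial_iso D F \<Longrightarrow> M \<subseteq> F \<Longrightarrow> F = M"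
proof -
  let ?P = "{F. partial_iso D F \<and> F\<^sub>0 \<subseteq> F}"
  have "\<exists>M\<in>?P. \<forall>F\<in>?P. M \<subseteq> F \<longrightarrow> F = M"
  proof (rule subset_Zorn_nonempty)
    fix \<C> assume C: "\<C> \<noteq> {}" "subset.chain ?P \<C>"
    then have "partial_iso D (\<Union>\<C>)" by (intro partial_iso_Union_chain) (auto simp: subset_chain_def)
    moreover have "F\<^sub>0 \<subseteq> \<Union>\<C>" using C unfolding subset_chain_def by blast
    ultimately show "\<Union>\<C> \<in> ?P" by simp
  qed (use assms in blast)
  then obtain M where "partial_iso D M" "F\<^sub>0 \<subseteq> M" "\<forall>F\<in>?P. M \<subseteq> F \<longrightarrow> F = M" by blast
  then show ?thesis using that[of M] by (metis (mono_tags) mem_Collect_eq order_trans)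
qed

theorem one_point_extendable_homogeneous:
  assumes wf: "wf_digraph D" and conn: "uconnected D" and ext: "one_point_extendable D"
  shows "connected_homogeneous D"
  unfolding connected_homogeneous_def
proof (intro allI impI)
  fix A B f assume "A \<subseteq> verts D \<and> B \<subseteq> verts D \<and> finite A \<and> finite B
        \<and> uconnected (induced D A) \<and> uconnected (induced D B) \<and> dg_iso f (induced D A) (induced D B)"
  then have "connected_embedding D A f" and A: "A \<noteq> {}"
    by (auto simp: uconnected_induced_iff dg_iso_def arcs_induced connected_embedding_def bij_betw_def)
  then have "partial_iso D ((\<lambda>x. (x, f x)) ` A)" by (simp add: partial_iso_graph_iff)
  then obtain M where M: "partial_iso D M" "(\<lambda>x. (x, f x)) ` A \<subseteq> M"
    and max: "\<And>F. partial_iso D F \<Longrightarrow> M \<subseteq> F \<Longrightarrow> F = M" by (rule maximal_partial_iso) blast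
  have ne: "M \<noteq> {}" "M\<inverse> \<noteq> {}" using M(2) A by auto
  have dom: "Domain M = verts D"
  proof (rule ccontr)
    assume "Domain M \<noteq> verts D"
    then obtain v w where "v \<notin> Domain M" "partial_iso D (insert (v, w) M)"
      by (rule partial_iso_extend[OF wf conn ext M(1) ne(1)])
    then show False using max[of "insert (v, w) M"] by blast
  qed
  have rng: "Domain (M\<inverse>) = verts D"
  proof (rule ccontr)
    assume "Domain (M\<inverse>) \<noteq> verts D"
    then obtain v w where vw: "v \<notin> Domain (M\<inverse>)" "partial_iso D (insert (v, w) (M\<inverse>))"
      by (rule partial_iso_extend[OF wf conn ext partial_iso_converse[OF M(1)] ne(2)])
    have "partial_iso D ((insert (v, w) (M\<inverse>))\<inverse>)" by (rule partial_iso_converse[OF vw(2)])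
    moreover have "(insert (v, w) (M\<inverse>))\<inverse> = insert (w, v) M" by auto
    ultimately show False using max[of "insert (w, v) M"] vw(1) by auto
  qed
  obtain S g where S: "M = (\<lambda>x. (x, g x)) ` S" "Domain M = S" and emb: "connected_embedding D S g"
    by (rule partial_isoE[OF M(1)])
  have M_eq: "M = (\<lambda>x. (x, g x)) ` verts D" using S dom by simp
  have "connected_embedding D (verts D) g" using emb S(2) dom by simp
  moreover have "g ` verts D = verts D" using rng unfolding M_eq by force
  ultimately have "automorphism g D"
    by (auto simp: automorphism_def dg_iso_def bij_betw_def connected_embedding_def)
  moreover have "\<forall>x\<in>A. g x = f x" using M(2) unfolding M_eq by auto
  ultimately show "\<exists>g. automorphism g D \<and> (\<forall>x\<in>A. g x = f x)" by blast
qed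

section \<open>One-point extensions in the listed bipartite graphs\<close>

definition coloured_embedding :: "'b dg \<Rightarrow> 'b set \<Rightarrow> 'b set \<Rightarrow> ('b \<Rightarrow> 'b) \<Rightarrow> bool" where
  "coloured_embedding B X W f \<longleftrightarrow> W \<subseteq> verts B \<and> connected_on (ugraph B) W \<and> inj_on f W \<and> f ` W \<subseteq> verts B
     \<and> (\<forall>u\<in>W. f u \<in> X \<longleftrightarrow> u \<in> X) \<and> (\<forall>u\<in>W. \<forall>u'\<in>W. uadj B (f u) (f u') \<longleftrightarrow> uadj B u u')"

definition coloured_one_point_extendable :: "'b dg \<Rightarrow> 'b set \<Rightarrow> bool" where
  "coloured_one_point_extendable B X \<longleftrightarrow>
     (\<forall>W f v. coloured_embedding B X W f \<longrightarrow> v \<in> verts B - W \<longrightarrow> (\<exists>s\<in>W. uadj B s v)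
       \<longrightarrow> (\<exists>w\<in>verts B - f ` W. (w \<in> X \<longleftrightarrow> v \<in> X) \<and> (\<forall>u\<in>W. uadj B (f u) w \<longleftrightarrow> uadj B u v)))"

lemma image_misses_element:
  assumes fin: "finite C" and card: "card C \<le> card C'" and v: "v \<in> C - W"
    and preimage: "\<And>u. u \<in> W \<Longrightarrow> f u \<in> C' \<Longrightarrow> u \<in> C"
  obtains w where "w \<in> C'" "w \<notin> f ` W"
proof -
  have "card (f ` (C \<inter> W)) \<le> card (C \<inter> W)" using fin by (intro card_image_le) simp
  also have "\<dots> < card C" using fin v by (intro psubset_card_mono) auto
  finally have "card (f ` (C \<inter> W)) < card C'" using card by simp
  moreover have "finite (f ` (C \<inter> W))" using fin by simp
  ultimately have "\<not> C' \<subseteq> f ` (C \<inter> W)" using card_mono linorder_not_le by metis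
  then show ?thesis using that preimage by blast
qed

locale connected_bipartite =
  fixes B :: "'b dg" and X Y :: "'b set"
  assumes bip: "bipartite_parts B X Y" and conn: "uconnected B"
begin

lemma arcs_parts: "(x, y) \<in> arcs B \<Longrightarrow> x \<in> X \<and> y \<in> Y"
  using bip by (auto simp: bipartite_parts_def)

lemma parts: "X \<inter> Y = {}" "X \<union> Y = verts B"
  using bip by (auto simp: bipartite_parts_def)

lemma uadj_parts: "uadj B x y \<Longrightarrow> x \<in> X \<longleftrightarrow> y \<notin> X"
  using arcs_parts parts unfolding uadj_def by blast

lemma uadj_verts: "uadj B x y \<Longrightarrow> x \<in> verts B \<and> y \<in> verts B"
  using arcs_parts parts unfolding uadj_def by blast

lemma ugraph_verts: "ugraph B \<subseteq> verts B \<times> verts B"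
  using uadj_verts by (auto simp: ugraph_def)

lemma joined: "x \<in> verts B \<Longrightarrow> y \<in> verts B \<Longrightarrow> (x, y) \<in> (ugraph B)\<^sup>*"
  using conn by (intro connected_on_rtrancl[of _ "verts B"]) (auto simp: uconnected_iff)

lemma colours_agree:
  fixes c :: "'b \<Rightarrow> bool"
  assumes c: "\<And>x y. uadj B x y \<Longrightarrow> c x \<noteq> c y" and xy: "x \<in> verts B" "y \<in> verts B"
  shows "c x = c y \<longleftrightarrow> (x \<in> X \<longleftrightarrow> y \<in> X)"
  using joined[OF xy]
proof (induction rule: rtrancl_induct)
  case (step u v)
  then have "uadj B u v" by (simp add: ugraph_def)
  from c[OF this] uadj_parts[OF this] show ?case using step.IH by blast
qed simp

lemma coloured_embedding_connected_image:
  assumes "coloured_embedding B X W f" shows "connected_on (ugraph B) (f ` W)"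
  by (rule connected_on_image[of "ugraph B"]) (use assms in \<open>auto simp: coloured_embedding_def ugraph_def\<close>)

lemma extendable_if_complete:
  assumes fin: "finite (verts B)"
    and adj: "\<And>x y. x \<in> verts B \<Longrightarrow> y \<in> verts B \<Longrightarrow> uadj B x y \<longleftrightarrow> (x \<in> X \<longleftrightarrow> y \<notin> X)"
  shows "coloured_one_point_extendable B X"
  unfolding coloured_one_point_extendable_def
proof (intro allI impI)
  fix W f v assume f: "coloured_embedding B X W f" and v: "v \<in> verts B - W"
  let ?C = "{u \<in> verts B. u \<in> X \<longleftrightarrow> v \<in> X}"
  obtain w where w: "w \<in> ?C" "w \<notin> f ` W"
    by (rule image_misses_element[of ?C ?C v W f]) (use fin v f in \<open>auto simp: coloured_embedding_def\<close>)
  moreover have "uadj B (f u) w \<longleftrightarrow> uadj B u v" if "u \<in> W" for u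
    using adj[of "f u" w] adj[of u v] f that v w(1) by (auto simp: coloured_embedding_def)
  ultimately show "\<exists>w\<in>verts B - f ` W. (w \<in> X \<longleftrightarrow> v \<in> X) \<and> (\<forall>u\<in>W. uadj B (f u) w \<longleftrightarrow> uadj B u v)"
    by blast
qed

end

locale complete_minus_matching = connected_bipartite +
  fixes mate :: "'b \<Rightarrow> 'b"
  assumes fin: "finite (verts B)"
    and mate_verts: "x \<in> verts B \<Longrightarrow> mate x \<in> verts B"
    and mate_mate: "x \<in> verts B \<Longrightarrow> mate (mate x) = x"
    and mate_part: "x \<in> verts B \<Longrightarrow> mate x \<in> X \<longleftrightarrow> x \<notin> X"
    and uadj_iff: "x \<in> verts B \<Longrightarrow> y \<in> verts B \<Longrightarrow> uadj B x y \<longleftrightarrow> (x \<in> X \<longleftrightarrow> y \<notin> X) \<and> y \<noteq> mate x"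
begin

lemma mate_eq_iff: "x \<in> verts B \<Longrightarrow> y \<in> verts B \<Longrightarrow> x = mate y \<longleftrightarrow> mate x = y"
  using mate_mate by metis

lemma coloured_embedding_mate:
  assumes f: "coloured_embedding B X W f" and u: "u \<in> W" "mate u \<in> W"
  shows "f (mate u) = mate (f u)"
proof -
  have V: "u \<in> verts B" "mate u \<in> verts B" "f u \<in> verts B" "f (mate u) \<in> verts B"
    using f u by (auto simp: coloured_embedding_def)
  have "\<not> uadj B (f u) (f (mate u))"
    using f u uadj_iff[OF V(1,2)] by (simp add: coloured_embedding_def)
  then show ?thesis
    using uadj_iff[OF V(3,4)] mate_part[OF V(1)] f u by (simp add: coloured_embedding_def)
qed

lemma mate_image_new:
  assumes f: "coloured_embedding B X W f" and v: "v \<in> verts B" "v \<notin> W" "mate v \<in> W"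
  shows "mate (f (mate v)) \<notin> f ` W"
proof
  assume "mate (f (mate v)) \<in> f ` W"
  then obtain u where u: "u \<in> W" "f u = mate (f (mate v))" by auto
  have V: "u \<in> verts B" "f u \<in> verts B" "f u \<in> X \<longleftrightarrow> u \<in> X"
    "f (mate v) \<in> verts B" "f (mate v) \<in> X \<longleftrightarrow> v \<notin> X"
    using f u(1) v mate_part[OF v(1)] by (auto simp: coloured_embedding_def)
  have "\<not> uadj B (f u) (f (mate v))" using uadj_iff[OF V(2,4)] mate_eq_iff[OF V(2,4)] u(2) by simp
  then have "\<not> uadj B u (mate v)" using f u(1) v(3) by (simp add: coloured_embedding_def)
  moreover have "u \<in> X \<longleftrightarrow> mate v \<notin> X" using V(3,5) u(2) mate_part[OF V(4)] mate_part[OF v(1)] by simp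
  ultimately have "mate v = mate u" using uadj_iff[OF V(1) mate_verts[OF v(1)]] by simp
  then show False using mate_mate V(1) v u(1) by metis
qed

text \<open>The embedding determines the images of the mates; extended to them it still misses \<open>v\<close>, so
  some vertex is neither an image nor the mate of one.\<close>

lemma image_and_mates_miss_vertex:
  assumes f: "coloured_embedding B X W f" and v: "v \<in> verts B" "v \<notin> W" "mate v \<notin> W"
  obtains w where "w \<in> verts B" "w \<in> X \<longleftrightarrow> v \<in> X" "w \<notin> f ` W" "mate w \<notin> f ` W"
proof -
  let ?C = "{u \<in> verts B. u \<in> X \<longleftrightarrow> v \<in> X}"
  define h where "h u = (if u \<in> W then f u else mate (f (mate u)))" for u
  have W: "u \<in> verts B" "f u \<in> verts B" "f u \<in> X \<longleftrightarrow> u \<in> X" if "u \<in> W" for u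
    using f that by (auto simp: coloured_embedding_def)
  have h_mate: "h (mate u) = mate (f u)" if "u \<in> W" for u
    using coloured_embedding_mate[OF f that] mate_mate[OF W(1)[OF that]] by (simp add: h_def)
  obtain w where w: "w \<in> ?C" "w \<notin> h ` (W \<union> mate ` W)"
  proof (rule image_misses_element[of ?C ?C v "W \<union> mate ` W" h])
    show "v \<in> ?C - (W \<union> mate ` W)" using v mate_mate W(1) by auto
    fix u assume "u \<in> W \<union> mate ` W" "h u \<in> ?C"
    then consider "u \<in> W" "f u \<in> X \<longleftrightarrow> v \<in> X" | u' where "u' \<in> W" "u = mate u'" "mate (f u') \<in> X \<longleftrightarrow> v \<in> X"
      using h_mate by (auto simp: h_def)
    then show "u \<in> ?C"
      by cases (use W mate_part mate_verts in auto)
  qed (use fin in simp_all)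
  have "w \<noteq> f u" "mate w \<noteq> f u" if "u \<in> W" for u
  proof -
    show "w \<noteq> f u" using w(2) that by (auto simp: h_def)
    have "w \<noteq> h (mate u)" using w(2) that by blast
    then show "mate w \<noteq> f u" using h_mate[OF that] mate_mate w(1) by force
  qed
  then show ?thesis using that w(1) by blast
qed

lemma extendable: "coloured_one_point_extendable B X"
  unfolding coloured_one_point_extendable_def
proof (intro allI impI)
  fix W f v assume f: "coloured_embedding B X W f" and "v \<in> verts B - W"
  then have v: "v \<in> verts B" "v \<notin> W" by auto
  have W: "u \<in> verts B" "f u \<in> verts B" "f u \<in> X \<longleftrightarrow> u \<in> X" if "u \<in> W" for u
    using f that by (auto simp: coloured_embedding_def)
  have "\<exists>w\<in>verts B - f ` W. (w \<in> X \<longleftrightarrow> v \<in> X) \<and> (\<forall>u\<in>W. mate w = f u \<longleftrightarrow> u = mate v)"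
  proof (cases "mate v \<in> W")
    case True
    let ?w = "mate (f (mate v))"
    have w: "?w \<in> verts B" "?w \<in> X \<longleftrightarrow> v \<in> X" "mate ?w = f (mate v)"
      using W[OF True] mate_verts mate_part mate_mate v(1) by auto
    have mates: "mate ?w = f u \<longleftrightarrow> u = mate v" if "u \<in> W" for u
      using f True that w(3) unfolding coloured_embedding_def by (metis inj_onD)
    show ?thesis
    proof (rule bexI[of _ ?w])
      show "(?w \<in> X \<longleftrightarrow> v \<in> X) \<and> (\<forall>u\<in>W. mate ?w = f u \<longleftrightarrow> u = mate v)"
        by (intro conjI ballI mates w(2))
      show "?w \<in> verts B - f ` W" using w(1) mate_image_new[OF f v True] by blast
    qed
  next
    case False
    then obtain w where w: "w \<in> verts B" "w \<in> X \<longleftrightarrow> v \<in> X" "w \<notin> f ` W" "mate w \<notin> f ` W"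
      by (rule image_and_mates_miss_vertex[OF f v])
    have "mate w = f u \<longleftrightarrow> u = mate v" if "u \<in> W" for u using w(4) False that by auto
    then show ?thesis using w(1-3) by blast
  qed
  then obtain w where w: "w \<in> verts B - f ` W" "w \<in> X \<longleftrightarrow> v \<in> X" "\<And>u. u \<in> W \<Longrightarrow> mate w = f u \<longleftrightarrow> u = mate v" by blast
  have "uadj B (f u) w \<longleftrightarrow> uadj B u v" if u: "u \<in> W" for u
  proof -
    have "w = mate (f u) \<longleftrightarrow> v = mate u"
      using mate_eq_iff[of w "f u"] mate_eq_iff[of v u] W[OF u] v(1) w(1) w(3)[OF u] by auto
    then show ?thesis using uadj_iff[of "f u" w] uadj_iff[of u v] W[OF u] v(1) w(1,2) by simp
  qed
  then show "\<exists>w\<in>verts B - f ` W. (w \<in> X \<longleftrightarrow> v \<in> X) \<and> (\<forall>u\<in>W. uadj B (f u) w \<longleftrightarrow> uadj B u v)"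
    using w(1,2) by blast
qed

end

text \<open>Trees, where the last hypothesis is void, and cycles.\<close>

locale two_nbrs_fill = connected_bipartite +
  assumes fin: "x \<in> verts B \<Longrightarrow> finite {y. uadj B x y}"
    and deg: "x \<in> verts B \<Longrightarrow> y \<in> verts B \<Longrightarrow> (x \<in> X \<longleftrightarrow> y \<in> X) \<Longrightarrow> card {z. uadj B x z} = card {z. uadj B y z}"
    and fill: "connected_on (ugraph B) W \<Longrightarrow> W \<subseteq> verts B \<Longrightarrow> v \<notin> W \<Longrightarrow> s \<in> W \<Longrightarrow> u \<in> W \<Longrightarrow> s \<noteq> u
      \<Longrightarrow> uadj B s v \<Longrightarrow> uadj B u v \<Longrightarrow> finite (verts B) \<and> W = verts B - {v}"
begin

lemma new_nbr_of_image:
  assumes f: "coloured_embedding B X W f" and u: "u \<in> W" "uadj B u v" "v \<notin> W"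
  obtains w where "uadj B (f u) w" "w \<notin> f ` W"
proof -
  have V: "u \<in> verts B" "f u \<in> verts B" "f u \<in> X \<longleftrightarrow> u \<in> X"
    and adj: "\<And>u'. u' \<in> W \<Longrightarrow> uadj B (f u) (f u') \<longleftrightarrow> uadj B u u'"
    using f u(1) by (auto simp: coloured_embedding_def)
  obtain w where "w \<in> {z. uadj B (f u) z}" "w \<notin> f ` W"
  proof (rule image_misses_element)
    show "finite {z. uadj B u z}" by (rule fin[OF V(1)])
    show "card {z. uadj B u z} \<le> card {z. uadj B (f u) z}" using deg[OF V(1,2)] V(3) by simp
    show "v \<in> {z. uadj B u z} - W" using u by simp
  qed (use adj in blast)
  then show ?thesis using that by blast
qed

lemma new_nbr_adjacent:
  assumes f: "coloured_embedding B X W f" and v: "v \<notin> W" and s: "s \<in> W" "uadj B s v"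
    and w: "uadj B (f s) w" "w \<notin> f ` W" and u: "u \<in> W" "u \<noteq> s" "uadj B u v"
  shows "uadj B (f u) w"
proof -
  have emb: "W \<subseteq> verts B" "connected_on (ugraph B) W" "inj_on f W" "f ` W \<subseteq> verts B"
    using f by (auto simp: coloured_embedding_def)
  have W: "finite (verts B)" "W = verts B - {v}"
    using fill[OF emb(2,1) v s(1) u(1) _ s(2) u(3)] u(2) by auto
  have "v \<in> verts B" "w \<in> verts B" using uadj_verts s(2) w(1) by blast+
  then have "card (verts B - {w}) = card (f ` W)" using W card_image[OF emb(3)] by simp
  moreover have "f ` W \<subseteq> verts B - {w}" using emb(4) w(2) by blast
  ultimately have "f ` W = verts B - {w}" using W(1) by (intro card_subset_eq) auto
  moreover obtain w' where "uadj B (f u) w'" "w' \<notin> f ` W" by (rule new_nbr_of_image[OF f u(1,3) v])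
  ultimately show ?thesis using uadj_verts by blast
qed

lemma new_nbr_not_adjacent:
  assumes f: "coloured_embedding B X W f" and v: "v \<notin> W" and s: "s \<in> W" "uadj B s v"
    and w: "uadj B (f s) w" "w \<notin> f ` W" and u: "u \<in> W" "u \<noteq> s" "\<not> uadj B u v"
  shows "\<not> uadj B (f u) w"
proof
  assume a: "uadj B (f u) w"
  have emb: "W \<subseteq> verts B" "inj_on f W" "f ` W \<subseteq> verts B" "u \<in> verts B" "f u \<in> verts B" "f u \<in> X \<longleftrightarrow> u \<in> X"
    and adj: "\<And>u'. u' \<in> W \<Longrightarrow> uadj B (f u) (f u') \<longleftrightarrow> uadj B u u'"
    using f u(1) by (auto simp: coloured_embedding_def)
  have V: "v \<in> verts B" "w \<in> verts B" using uadj_verts s(2) w(1) by blast+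
  have "f s \<noteq> f u" using emb(2) s(1) u by (auto dest: inj_onD)
  then have W: "finite (verts B)" "f ` W = verts B - {w}"
    using fill[OF coloured_embedding_connected_image[OF f] emb(3) w(2) _ _ _ w(1) a] s(1) u(1) by auto
  then have "card W = card (verts B - {v})" using card_image[OF emb(2)] V by simp
  then have "W = verts B - {v}" using emb(1) v W(1) by (intro card_subset_eq) auto
  then have nbrs: "{z. uadj B u z} \<subseteq> W" using u(3) uadj_verts by blast
  then have "card {z. uadj B u z} = card (f ` {z. uadj B u z})"
    using inj_on_subset[OF emb(2)] by (simp add: card_image)
  also have "\<dots> < card {z. uadj B (f u) z}"
    by (rule psubset_card_mono[OF fin[OF emb(5)]]) (use nbrs adj a w(2) in blast)
  finally show False using deg[OF emb(4,5)] emb(6) by simp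
qed

lemma extendable: "coloured_one_point_extendable B X"
  unfolding coloured_one_point_extendable_def
proof (intro allI impI)
  fix W f v assume f: "coloured_embedding B X W f" and "v \<in> verts B - W" and "\<exists>s\<in>W. uadj B s v"
  then obtain s where v: "v \<notin> W" and s: "s \<in> W" "uadj B s v" by blast
  obtain w where w: "uadj B (f s) w" "w \<notin> f ` W" by (rule new_nbr_of_image[OF f s v])
  have "uadj B (f u) w \<longleftrightarrow> uadj B u v" if "u \<in> W" for u
    using new_nbr_adjacent[OF f v s w that] new_nbr_not_adjacent[OF f v s w that] s(2) w(1) by blast
  moreover have "f s \<in> X \<longleftrightarrow> s \<in> X" using f s(1) by (simp add: coloured_embedding_def)
  then have "w \<in> X \<longleftrightarrow> v \<in> X" using uadj_parts[OF w(1)] uadj_parts[OF s(2)] by blast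
  ultimately show "\<exists>w\<in>verts B - f ` W. (w \<in> X \<longleftrightarrow> v \<in> X) \<and> (\<forall>u\<in>W. uadj B (f u) w \<longleftrightarrow> uadj B u v)"
    using w uadj_verts by blast
qed

end

lemma cycle_graph_degree:
  assumes "3 \<le> m" "i < m" shows "card {j. uadj (cycle_graph m) i j} = 2"
proof -
  have "{j. uadj (cycle_graph m) i j} = {Suc i mod m, if i = 0 then m - 1 else i - 1}"
    using assms by (auto simp: uadj_def cycle_graph_def mod_Suc split: if_splits)
  moreover have "Suc i mod m \<noteq> (if i = 0 then m - 1 else i - 1)"
    using assms by (auto simp: mod_Suc)
  ultimately show ?thesis by simp
qed

context connected_bipartite
begin

lemma extendable_if_K_bip:
  assumes "u_isomorphic B (K_bip m n)" shows "coloured_one_point_extendable B X" "finite (verts B)"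
proof -
  obtain h where h: "bij_betw h (verts B) (verts (K_bip m n))"
    "\<And>x y. x \<in> verts B \<Longrightarrow> y \<in> verts B \<Longrightarrow> uadj B x y \<longleftrightarrow> uadj (K_bip m n) (h x) (h y)"
    using assms unfolding u_isomorphic_def by blast
  have "verts (K_bip m n) = Pair False ` {..<m} \<union> Pair True ` {..<n}" by (auto simp: K_bip_def)
  then show fin: "finite (verts B)" using bij_betw_finite[OF h(1)] by simp
  have adj: "uadj B x y \<longleftrightarrow> fst (h x) \<noteq> fst (h y)" if xy: "x \<in> verts B" "y \<in> verts B" for x y
  proof -
    have "h x \<in> verts (K_bip m n)" "h y \<in> verts (K_bip m n)" using bij_betwE[OF h(1)] xy by auto
    then show ?thesis unfolding h(2)[OF xy] by (auto simp: K_bip_def uadj_def)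
  qed
  then have "fst (h x) = fst (h y) \<longleftrightarrow> (x \<in> X \<longleftrightarrow> y \<in> X)" if "x \<in> verts B" "y \<in> verts B" for x y
    using colours_agree[OF _ that, of "\<lambda>x. fst (h x)"] uadj_verts by blast
  then show "coloured_one_point_extendable B X"
    using adj by (intro extendable_if_complete[OF fin]) blast
qed

lemma extendable_if_CP:
  assumes "u_isomorphic B (CP_graph n)" shows "coloured_one_point_extendable B X" "finite (verts B)"
proof -
  obtain h where h: "bij_betw h (verts B) (verts (CP_graph n))"
    "\<And>x y. x \<in> verts B \<Longrightarrow> y \<in> verts B \<Longrightarrow> uadj B x y \<longleftrightarrow> uadj (CP_graph n) (h x) (h y)"
    using assms unfolding u_isomorphic_def by blast
  have CP: "verts (CP_graph n) = UNIV \<times> {..<n}" by (auto simp: CP_graph_def)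
  show fin: "finite (verts B)" using bij_betw_finite[OF h(1)] by (simp add: CP)
  have h_verts: "snd (h x) < n" if "x \<in> verts B" for x
    using bij_betwE[OF h(1)] that by (auto simp: CP mem_Times_iff)
  have adj: "uadj B x y \<longleftrightarrow> fst (h x) \<noteq> fst (h y) \<and> snd (h x) \<noteq> snd (h y)" if xy: "x \<in> verts B" "y \<in> verts B" for x y
    using h_verts[OF xy(1)] h_verts[OF xy(2)] unfolding h(2)[OF xy]
    by (cases "h x"; cases "h y") (auto simp: CP_graph_def uadj_def)
  then have part: "fst (h x) = fst (h y) \<longleftrightarrow> (x \<in> X \<longleftrightarrow> y \<in> X)" if "x \<in> verts B" "y \<in> verts B" for x y
    using colours_agree[OF _ that, of "\<lambda>x. fst (h x)"] uadj_verts by blast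
  define mate where "mate x = inv_into (verts B) h (\<not> fst (h x), snd (h x))" for x
  have mate: "mate x \<in> verts B" "h (mate x) = (\<not> fst (h x), snd (h x))" if "x \<in> verts B" for x
  proof -
    have "(\<not> fst (h x), snd (h x)) \<in> h ` verts B"
      using h(1) h_verts[OF that] by (simp add: bij_betw_def CP)
    then show "mate x \<in> verts B" "h (mate x) = (\<not> fst (h x), snd (h x))"
      unfolding mate_def by (simp_all add: inv_into_into f_inv_into_f)
  qed
  have h_inj: "x = y \<longleftrightarrow> h x = h y" if "x \<in> verts B" "y \<in> verts B" for x y
    using inj_on_eq_iff[OF bij_betw_imp_inj_on[OF h(1)] that] by simp
  interpret complete_minus_matching B X Y mate
  proof
    fix x y assume x: "x \<in> verts B" and y: "y \<in> verts B"
    show "uadj B x y \<longleftrightarrow> (x \<in> X \<longleftrightarrow> y \<notin> X) \<and> y \<noteq> mate x"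
      using adj[OF x y] part[OF x y] h_inj[OF y mate(1)[OF x]] mate(2)[OF x] by (auto simp: prod_eq_iff)
  next
    fix x assume x: "x \<in> verts B"
    show "mate x \<in> verts B" by (rule mate(1)[OF x])
    show "mate (mate x) = x" using h_inj[OF mate(1)[OF mate(1)[OF x]] x]
        mate(2)[OF mate(1)[OF x]] mate(2)[OF x] by simp
    show "mate x \<in> X \<longleftrightarrow> x \<notin> X" using part[OF mate(1)[OF x] x] mate(2)[OF x] by simp
  qed (rule fin)
  show "coloured_one_point_extendable B X" by (rule extendable)
qed

lemma two_nbrs_fill_if_2_regular:
  assumes deg: "\<forall>x\<in>verts B. card {y. uadj B x y} = 2"
    and W: "connected_on (ugraph B) W" "W \<subseteq> verts B" "v \<notin> W" "s \<in> W" "u \<in> W" "s \<noteq> u" "uadj B s v" "uadj B u v"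
  shows "W = verts B - {v}"
proof -
  have "(s, u) \<in> (ugraph B \<inter> W \<times> W)\<^sup>*" using W(1,4,5) by (simp add: connected_on_def)
  then obtain xs where xs: "is_cycle B (xs @ [v])" "set xs \<subseteq> W"
    using is_cycle_through[OF _ W(4,6,3,7,8)] by metis
  let ?S = "set (xs @ [v])"
  have closed: "y \<in> ?S" if x: "x \<in> ?S" and xy: "uadj B x y" for x y
  proof -
    obtain a b where ab: "a \<in> ?S" "b \<in> ?S" "a \<noteq> b" "uadj B x a" "uadj B x b"
      by (rule is_cycle_two_nbrs[OF xs(1) x])
    have "card {y. uadj B x y} = 2" using deg xy uadj_verts by blast
    moreover from this have "finite {y. uadj B x y}" by (metis card.infinite zero_neq_numeral)
    ultimately have "{a, b} = {y. uadj B x y}" using ab by (intro card_subset_eq) auto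
    then have "y \<in> {a, b}" using xy by simp
    then show ?thesis using ab(1,2) by blast
  qed
  have "x \<in> ?S" if "x \<in> verts B" for x
  proof -
    have "v \<in> verts B" using uadj_verts[OF W(7)] by blast
    then have "(v, x) \<in> (ugraph B)\<^sup>*" using joined that by blast
    then show ?thesis by (rule rtrancl_closed) (use closed in \<open>auto simp: ugraph_def\<close>)
  qed
  then show ?thesis using xs(2) W(2,3) by auto
qed

lemma u_isomorphic_card_nbrs:
  assumes h: "bij_betw h (verts B) (verts H)"
      "\<forall>x\<in>verts B. \<forall>y\<in>verts B. uadj B x y \<longleftrightarrow> uadj H (h x) (h y)"
    and H: "ugraph H \<subseteq> verts H \<times> verts H" and x: "x \<in> verts B"
  shows "card {y. uadj B x y} = card {z. uadj H (h x) z}"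
proof (rule bij_betw_same_card)
  have "inj_on h {y. uadj B x y}"
    by (rule inj_on_subset[OF bij_betw_imp_inj_on[OF h(1)]]) (use uadj_verts in blast)
  moreover have "h ` {y. uadj B x y} = {z. uadj H (h x) z}"
  proof (intro set_eqI iffI)
    fix z assume z: "z \<in> {z. uadj H (h x) z}"
    then have "z \<in> h ` verts B" using H h(1) by (auto simp: ugraph_def bij_betw_def)
    then show "z \<in> h ` {y. uadj B x y}" using z h(2) x by auto
  qed (use h(2) x uadj_verts in blast)
  ultimately show "bij_betw h {y. uadj B x y} {z. uadj H (h x) z}" by (rule bij_betw_imageI)
qed

lemma extendable_if_cycle:
  assumes "u_isomorphic B (cycle_graph m)" "3 \<le> m"
  shows "coloured_one_point_extendable B X" "finite (verts B)"
proof -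
  obtain h where h: "bij_betw h (verts B) (verts (cycle_graph m))"
    "\<forall>x\<in>verts B. \<forall>y\<in>verts B. uadj B x y \<longleftrightarrow> uadj (cycle_graph m) (h x) (h y)"
    using assms(1) unfolding u_isomorphic_def by blast
  have C: "verts (cycle_graph m) = {..<m}" by (simp add: cycle_graph_def)
  have "ugraph (cycle_graph m) \<subseteq> verts (cycle_graph m) \<times> verts (cycle_graph m)"
    using assms(2) by (auto simp: C ugraph_def uadj_def cycle_graph_def)
  note deg_eq = u_isomorphic_card_nbrs[OF h this]
  show fin: "finite (verts B)" using bij_betw_finite[OF h(1)] by (simp add: C)
  have deg: "\<forall>x\<in>verts B. card {y. uadj B x y} = 2"
    using deg_eq cycle_graph_degree[OF assms(2)] bij_betwE[OF h(1)] by (simp add: C)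
  interpret two_nbrs_fill B X Y
  proof
    show "finite {y. uadj B x y}" for x by (rule finite_subset[OF _ fin]) (use uadj_verts in blast)
  qed (use deg in simp, use fin two_nbrs_fill_if_2_regular[OF deg] in blast)
  show "coloured_one_point_extendable B X" by (rule extendable)
qed

lemma extendable_if_T_ab:
  assumes T: "is_T_ab B a b"
  shows "coloured_one_point_extendable B X" "x \<in> verts B \<Longrightarrow> finite {y. uadj B x y}"
proof -
  obtain X' Y' where T_parts: "X' \<inter> Y' = {}" "X' \<union> Y' = verts B"
      "\<forall>x\<in>verts B. \<forall>y\<in>verts B. uadj B x y \<longrightarrow> (x \<in> X' \<longleftrightarrow> y \<in> Y')"
    and T_deg: "\<forall>x\<in>X'. finite {w. uadj B x w} \<and> card {w. uadj B x w} = a"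
      "\<forall>y\<in>Y'. finite {w. uadj B y w} \<and> card {w. uadj B y w} = b"
    using T unfolding is_T_ab_def by blast
  show fin: "finite {y. uadj B x y}" if "x \<in> verts B" for x using T_parts(2) T_deg that by blast
  have deg: "card {w. uadj B x w} = card {w. uadj B y w}" if xy: "x \<in> verts B" "y \<in> verts B" "x \<in> X \<longleftrightarrow> y \<in> X" for x y
  proof -
    have "(x \<in> X') = (y \<in> X') \<longleftrightarrow> (x \<in> X \<longleftrightarrow> y \<in> X)"
      by (rule colours_agree[OF _ xy(1,2)]) (use T_parts uadj_verts in blast)
    then show ?thesis using xy T_parts(2) T_deg by (metis UnE)
  qed
  interpret two_nbrs_fill B X Y
  proof (unfold_locales, rule fin, assumption, rule deg, assumption+)
    fix W v s u assume W: "connected_on (ugraph B) W" "v \<notin> W" "s \<in> W" "u \<in> W" "s \<noteq> u" "uadj B s v" "uadj B u v"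
    have "(s, u) \<in> (ugraph B \<inter> W \<times> W)\<^sup>*" using W(1,3,4) by (simp add: connected_on_def)
    then obtain xs where "is_cycle B xs" using is_cycle_through[OF _ W(3,5,2,6,7)] by metis
    then show "finite (verts B) \<and> W = verts B - {v}"
      using T uacyclic_iff[OF ugraph_verts] by (auto simp: is_T_ab_def is_tree_def)
  qed
  show "coloured_one_point_extendable B X" by (rule extendable)
qed

theorem listed_extendable:
  assumes "listed_graph B"
  shows "coloured_one_point_extendable B X" "x \<in> verts B \<Longrightarrow> finite {y. uadj B x y}"
proof -
  have fin: "finite {y. uadj B x y}" if "finite (verts B)" for x
    by (rule finite_subset[OF _ that]) (use uadj_verts in blast)
  consider m where "m \<ge> 4" "u_isomorphic B (cycle_graph m)" | m n where "u_isomorphic B (K_bip m n)"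
    | n where "u_isomorphic B (CP_graph n)" | a b where "is_T_ab B a b"
    using assms unfolding listed_graph_def by blast
  then have "coloured_one_point_extendable B X \<and> (\<forall>x\<in>verts B. finite {y. uadj B x y})"
  proof cases
    case (1 m)
    then show ?thesis using extendable_if_cycle[of m] fin by auto
  next
    case 2
    then show ?thesis using extendable_if_K_bip fin by blast
  next
    case 3
    then show ?thesis using extendable_if_CP fin by blast
  next
    case 4
    then show ?thesis using extendable_if_T_ab by blast
  qed
  then show "coloured_one_point_extendable B X" "x \<in> verts B \<Longrightarrow> finite {y. uadj B x y}" by blast+
qed

end

section \<open>The digraphs DL\<close>

locale diestel_leader = connected_bipartite B X Y for B :: "'b dg" and X Y +
  fixes T :: "'t dg" and \<phi> \<psi> :: "'t \<Rightarrow> 't \<Rightarrow> 'b"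
  assumes data: "DL_data X Y T \<phi> \<psi>" and arcs_nonempty: "arcs B \<noteq> {}"
    and extendable: "coloured_one_point_extendable B X"
    and finite_nbrs: "x \<in> verts B \<Longrightarrow> finite {y. uadj B x y}"
begin

abbreviation D :: "('t \<times> 't) dg" where "D \<equiv> DL B T \<phi> \<psi>"

definition block :: "'t \<Rightarrow> ('t \<times> 't) set" where
  "block t = {e \<in> arcs T. fst e = t \<or> snd e = t}"

definition label :: "'t \<Rightarrow> 't \<times> 't \<Rightarrow> 'b" where
  "label t e = (if snd e = t then \<phi> t (fst e) else \<psi> t (snd e))"

definition unlabel :: "'t \<Rightarrow> 'b \<Rightarrow> 't \<times> 't" where
  "unlabel t = inv_into (block t) (label t)"

lemma wfT: "wf_digraph T" and T_connected: "uconnected T" and T_acyclic: "\<nexists>xs. is_cycle T xs"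
  and \<phi>_bij: "t \<in> verts T \<Longrightarrow> bij_betw (\<phi> t) (in_nbrs T t) X"
  and \<psi>_bij: "t \<in> verts T \<Longrightarrow> bij_betw (\<psi> t) (out_nbrs T t) Y"
  using data uacyclic_iff[OF ugraph_sub] by (auto simp: DL_data_def is_tree_def)

lemma T_irrefl: "(a, a) \<notin> arcs T" and T_antisym: "(a, b) \<in> arcs T \<Longrightarrow> (b, a) \<notin> arcs T"
  using wfT by (auto simp: wf_digraph_def)

lemma T_arc_ends_distinct: "e \<in> arcs T \<Longrightarrow> fst e \<noteq> snd e"
  using T_irrefl by (metis prod.collapse)

lemma T_verts: "e \<in> arcs T \<Longrightarrow> fst e \<in> verts T \<and> snd e \<in> verts T"
  using arcs_in_verts[OF wfT] by (metis prod.collapse)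

lemma verts_D [simp]: "verts D = arcs T"
  by (simp add: DL_def)

lemma arcs_D:
  "(e, e') \<in> arcs D \<longleftrightarrow> e \<in> arcs T \<and> e' \<in> arcs T \<and> snd e = fst e' \<and> (label (snd e) e, label (snd e) e') \<in> arcs B"
proof -
  obtain a b c d where e: "e = (a, b)" "e' = (c, d)" by (cases e, cases e')
  have "(b, d) \<in> arcs T \<Longrightarrow> d \<noteq> b" using T_irrefl by blast
  then show ?thesis unfolding e by (auto simp: DL_def label_def)
qed

lemma label_bij: assumes t: "t \<in> verts T" shows "bij_betw (label t) (block t) (verts B)"
proof -
  let ?In = "{e \<in> arcs T. snd e = t}" and ?Out = "{e \<in> arcs T. fst e = t}"
  have "bij_betw fst ?In (in_nbrs T t)"
    by (rule bij_betw_byWitness[where f' = "\<lambda>a. (a, t)"]) (auto simp: in_nbrs_def)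
  then have "bij_betw (\<phi> t \<circ> fst) ?In X" by (rule bij_betw_trans[OF _ \<phi>_bij[OF t]])
  then have In: "bij_betw (label t) ?In X"
    by (rule bij_betw_cong[THEN iffD1, rotated]) (simp add: label_def)
  have "bij_betw snd ?Out (out_nbrs T t)"
    by (rule bij_betw_byWitness[where f' = "\<lambda>b. (t, b)"]) (auto simp: out_nbrs_def)
  then have "bij_betw (\<psi> t \<circ> snd) ?Out Y" by (rule bij_betw_trans[OF _ \<psi>_bij[OF t]])
  then have Out: "bij_betw (label t) ?Out Y"
    by (rule bij_betw_cong[THEN iffD1, rotated]) (auto simp: label_def dest: T_arc_ends_distinct)
  have "block t = ?In \<union> ?Out" by (auto simp: block_def)
  then show ?thesis using bij_betw_combine[OF In Out parts(1)] parts(2) by simp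
qed

lemma label_inj: "t \<in> verts T \<Longrightarrow> e \<in> block t \<Longrightarrow> e' \<in> block t \<Longrightarrow> label t e = label t e' \<longleftrightarrow> e = e'"
  using inj_on_eq_iff[OF bij_betw_imp_inj_on[OF label_bij]] by metis

lemma label_verts: "t \<in> verts T \<Longrightarrow> e \<in> block t \<Longrightarrow> label t e \<in> verts B"
  using bij_betwE[OF label_bij] by blast

lemma unlabel: "t \<in> verts T \<Longrightarrow> x \<in> verts B \<Longrightarrow> unlabel t x \<in> block t"
  and label_unlabel: "t \<in> verts T \<Longrightarrow> x \<in> verts B \<Longrightarrow> label t (unlabel t x) = x"
  using label_bij[of t] by (auto simp: unlabel_def bij_betw_def inv_into_into f_inv_into_f)

lemma unlabel_label: "t \<in> verts T \<Longrightarrow> e \<in> block t \<Longrightarrow> unlabel t (label t e) = e"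
  using label_bij[of t] by (simp add: unlabel_def bij_betw_inv_into_left)

lemma block_verts: "e \<in> block t \<Longrightarrow> t \<in> verts T"
  using T_verts unfolding block_def by blast

lemma label_part:
  assumes e: "e \<in> block t" shows "label t e \<in> X \<longleftrightarrow> snd e = t"
proof (cases "snd e = t")
  case True
  then have "fst e \<in> in_nbrs T t" using e by (auto simp: block_def in_nbrs_def)
  then show ?thesis using True bij_betwE[OF \<phi>_bij[OF block_verts[OF e]]] by (simp add: label_def)
next
  case False
  then have "snd e \<in> out_nbrs T t" using e by (auto simp: block_def out_nbrs_def)
  then have "label t e \<in> Y" using False bij_betwE[OF \<psi>_bij[OF block_verts[OF e]]] by (simp add: label_def)
  then show ?thesis using False parts(1) by blast
qed

lemma block_arc_ends:
  assumes "e \<in> block t" "e' \<in> block t" "(e, e') \<in> arcs D" shows "snd e = t" "fst e' = t"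
proof -
  have e: "e \<in> arcs T" "e' \<in> arcs T" "snd e = fst e'" using assms(3) arcs_D by blast+
  have "snd e = t"
  proof (rule ccontr)
    assume "snd e \<noteq> t"
    then have "fst e = t" "snd e' = t" using assms e by (auto simp: block_def)
    then have "e = (t, snd e)" "e' = (snd e, t)" using e by (metis prod.collapse)+
    then show False using e T_antisym by metis
  qed
  then show "snd e = t" "fst e' = t" using e by simp_all
qed

lemma block_arcs:
  assumes "e \<in> block t" "e' \<in> block t" shows "(e, e') \<in> arcs D \<longleftrightarrow> (label t e, label t e') \<in> arcs B"
proof
  assume "(e, e') \<in> arcs D"
  then show "(label t e, label t e') \<in> arcs B" using block_arc_ends[OF assms] arcs_D by metis
next
  assume b: "(label t e, label t e') \<in> arcs B"
  then have "label t e \<in> X" "label t e' \<notin> X" using arcs_parts parts(1) by blast+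
  then have "snd e = t" "snd e' \<noteq> t" using label_part assms by blast+
  moreover have "e \<in> arcs T" "e' \<in> arcs T" "fst e' = t" using assms calculation by (auto simp: block_def)
  ultimately show "(e, e') \<in> arcs D" using b arcs_D by simp
qed

lemma block_uadj: "e \<in> block t \<Longrightarrow> e' \<in> block t \<Longrightarrow> uadj D e e' \<longleftrightarrow> uadj B (label t e) (label t e')"
  using block_arcs by (simp add: uadj_def)

lemma block_arc_iff:
  "e \<in> block t \<Longrightarrow> e' \<in> block t \<Longrightarrow> (e, e') \<in> arcs D \<longleftrightarrow> uadj D e e' \<and> label t e \<in> X"
  using block_arcs[of e t e'] block_arcs[of e' t e] arcs_parts parts(1) unfolding uadj_def by blast

lemma arc_block: "(e, e') \<in> arcs D \<Longrightarrow> e \<in> block (snd e) \<and> e' \<in> block (snd e)"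
  using arcs_D by (auto simp: block_def)

lemma uadj_block: assumes "uadj D e e'" obtains t where "e \<in> block t" "e' \<in> block t"
  using assms arc_block unfolding uadj_def by blast

lemma wf_D: "wf_digraph D"
  unfolding wf_digraph_def
proof (intro conjI allI impI)
  show "arcs D \<subseteq> verts D \<times> verts D" using arcs_D by auto
  show "(e, e) \<notin> arcs D" for e using arcs_D T_arc_ends_distinct by metis
  fix e e' assume "(e, e') \<in> arcs D"
  show "(e', e) \<notin> arcs D"
  proof
    assume "(e', e) \<in> arcs D"
    then have "(fst e, snd e) \<in> arcs T" "(snd e, fst e) \<in> arcs T"
      using \<open>(e, e') \<in> arcs D\<close> arcs_D by (metis prod.collapse)+
    then show False using T_antisym by blast
  qed
qed

lemma triangle_free_D: "triangle_free D"
  unfolding triangle_free_def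
proof
  assume "\<exists>x\<in>verts D. \<exists>y\<in>verts D. \<exists>z\<in>verts D. uadj D x y \<and> uadj D y z \<and> uadj D x z"
  then obtain x y z where xyz: "x \<in> arcs T" "y \<in> arcs T" "z \<in> arcs T" "uadj D x y" "uadj D y z" "uadj D x z"
    by auto
  have consecutive: "snd e = fst e' \<or> snd e' = fst e" if "uadj D e e'" for e e'
    using that arcs_D unfolding uadj_def by blast
  have no_triangle: False if abc: "(a, b) \<in> arcs T" "(b, c) \<in> arcs T" "(c, a) \<in> arcs T" for a b c
  proof -
    have "is_cycle T [a, b, c]" using abc T_irrefl by (auto simp: is_cycle_def uadj_def)
    then show False using T_acyclic by blast
  qed
  obtain x\<^sub>1 x\<^sub>2 y\<^sub>1 y\<^sub>2 z\<^sub>1 z\<^sub>2 where e: "x = (x\<^sub>1, x\<^sub>2)" "y = (y\<^sub>1, y\<^sub>2)" "z = (z\<^sub>1, z\<^sub>2)"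
    by (cases x, cases y, cases z)
  have "x\<^sub>2 = y\<^sub>1 \<or> y\<^sub>2 = x\<^sub>1" "y\<^sub>2 = z\<^sub>1 \<or> z\<^sub>2 = y\<^sub>1" "x\<^sub>2 = z\<^sub>1 \<or> z\<^sub>2 = x\<^sub>1"
    using consecutive[OF xyz(4)] consecutive[OF xyz(5)] consecutive[OF xyz(6)] e by auto
  moreover have "x\<^sub>1 \<noteq> x\<^sub>2" "y\<^sub>1 \<noteq> y\<^sub>2" "z\<^sub>1 \<noteq> z\<^sub>2"
    using xyz(1-3)[THEN T_arc_ends_distinct] e by simp_all
  ultimately show False
    using no_triangle[of x\<^sub>1 x\<^sub>2 y\<^sub>2] no_triangle[of x\<^sub>1 x\<^sub>2 z\<^sub>2] no_triangle[of y\<^sub>1 y\<^sub>2 x\<^sub>2]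
      no_triangle[of y\<^sub>1 y\<^sub>2 z\<^sub>2] xyz(1-3) e by auto
qed

lemma finite_block_nbrs:
  assumes "e \<in> block t" shows "finite {e' \<in> block t. uadj D e e'}"
proof (rule finite_imageD[of "label t"])
  have t: "t \<in> verts T" by (rule block_verts[OF assms])
  have "label t ` {e' \<in> block t. uadj D e e'} \<subseteq> {y. uadj B (label t e) y}" using block_uadj[OF assms] by blast
  then show "finite (label t ` {e' \<in> block t. uadj D e e'})"
    using finite_nbrs[OF label_verts[OF t assms]] finite_subset by blast
  show "inj_on (label t) {e' \<in> block t. uadj D e e'}"
    using label_inj[OF t] by (auto intro: inj_onI)
qed

lemma locally_finite_D: "locally_finite D"
  unfolding locally_finite_def
proof
  fix e assume "e \<in> verts D"
  then have e: "e \<in> block (fst e)" "e \<in> block (snd e)" by (auto simp: block_def)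
  have "out_nbrs D e \<subseteq> {e' \<in> block (snd e). uadj D e e'}"
    using arc_block unfolding out_nbrs_def uadj_def by blast
  moreover have "in_nbrs D e \<subseteq> {e' \<in> block (fst e). uadj D e e'}"
    using arc_block arcs_D by (fastforce simp: in_nbrs_def uadj_def)
  ultimately show "finite (out_nbrs D e) \<and> finite (in_nbrs D e)"
    using finite_block_nbrs[OF e(2)] finite_block_nbrs[OF e(1)] finite_subset by blast
qed

lemma block_joined:
  assumes e: "e \<in> block t" "e' \<in> block t" shows "(e, e') \<in> (ugraph D)\<^sup>*"
proof -
  have t: "t \<in> verts T" by (rule block_verts[OF e(1)])
  have "(label t e, label t e') \<in> (ugraph B)\<^sup>*" using joined label_verts t e by blast
  then have "(unlabel t (label t e), unlabel t (label t e')) \<in> (ugraph D)\<^sup>*"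
  proof (rule rtrancl_map)
    fix x y assume "(x, y) \<in> ugraph B"
    then have xy: "uadj B x y" "x \<in> verts B" "y \<in> verts B" using uadj_verts by (auto simp: ugraph_def)
    then show "(unlabel t x, unlabel t y) \<in> ugraph D"
      using block_uadj[OF unlabel unlabel, OF t _ t] label_unlabel[OF t] by (simp add: ugraph_def)
  qed
  then show ?thesis using unlabel_label t e by simp
qed

lemma uconnected_D: "uconnected D"
proof -
  obtain x y where "(x, y) \<in> arcs B" using arcs_nonempty by auto
  then have x: "x \<in> verts B" using arcs_parts parts by blast
  obtain t\<^sub>0 where t\<^sub>0: "t\<^sub>0 \<in> verts T" using T_connected by (auto simp: uconnected_def)
  let ?e\<^sub>0 = "unlabel t\<^sub>0 x"
  have e\<^sub>0: "?e\<^sub>0 \<in> block t\<^sub>0" by (rule unlabel[OF t\<^sub>0 x])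
  have reach: "\<forall>e\<in>block t. (?e\<^sub>0, e) \<in> (ugraph D)\<^sup>*" if "t \<in> verts T" for t
  proof -
    have "(t\<^sub>0, t) \<in> (ugraph T)\<^sup>*" using T_connected t\<^sub>0 that
      by (intro connected_on_rtrancl[of _ "verts T"]) (auto simp: uconnected_iff)
    then show ?thesis
    proof (induction rule: rtrancl_induct)
      case base
      show ?case using block_joined[OF e\<^sub>0] by blast
    next
      case (step u v)
      then have "\<exists>e. e \<in> block u \<and> e \<in> block v" unfolding ugraph_def uadj_def block_def by force
      then obtain e where e: "e \<in> block u" "e \<in> block v" by blast
      then show ?case using step.IH block_joined by (meson rtrancl_trans)
    qed
  qed
  have "connected_on (ugraph D) (verts D)"
  proof (rule connected_on_from[OF sym_ugraph])
    show "?e\<^sub>0 \<in> verts D" using e\<^sub>0 by (simp add: block_def)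
    fix e assume "e \<in> verts D"
    then have "e \<in> block (fst e)" by (simp add: block_def)
    then have "(?e\<^sub>0, e) \<in> (ugraph D)\<^sup>*" using reach block_verts by blast
    moreover have "ugraph D \<inter> verts D \<times> verts D = ugraph D" using ugraph_sub[OF wf_D] by blast
    ultimately show "(?e\<^sub>0, e) \<in> (ugraph D \<inter> verts D \<times> verts D)\<^sup>*" by (simp only:)
  qed
  then show ?thesis using e\<^sub>0 by (auto simp: uconnected_iff block_def)
qed

definition edges_avoiding :: "'t \<Rightarrow> ('t \<times> 't) set" where
  "edges_avoiding t = ugraph T \<inter> (- {t}) \<times> (- {t})"

definition towards :: "'t \<Rightarrow> 't \<Rightarrow> 't" where
  "towards t a = (SOME n. uadj T t n \<and> (n, a) \<in> (edges_avoiding t)\<^sup>*)"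

lemma sym_edges_avoiding: "sym (edges_avoiding t)"
  using sym_ugraph[of T] by (auto simp: edges_avoiding_def sym_def)

lemma towards_unique:
  assumes "uadj T t n" "uadj T t n'" "(n, n') \<in> (edges_avoiding t)\<^sup>*" shows "n = n'"
proof (rule ccontr)
  assume "n \<noteq> n'"
  moreover have "n \<in> - {t}" using assms(1) T_irrefl by (auto simp: uadj_def)
  ultimately obtain xs where "is_cycle T (xs @ [t])"
    using is_cycle_through[OF assms(3)[unfolded edges_avoiding_def]] assms(1,2) uadj_commute
    by (metis Compl_iff singletonI)
  then show False using T_acyclic by blast
qed

lemma towards_exists:
  assumes "t \<in> verts T" "a \<in> verts T" "a \<noteq> t"
  shows "\<exists>n. uadj T t n \<and> (n, a) \<in> (edges_avoiding t)\<^sup>*"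
proof -
  have "connected_on (ugraph T) (verts T)" using T_connected by (simp add: uconnected_iff)
  then have "(a, t) \<in> (ugraph T)\<^sup>*" using assms(2,1) by (rule connected_on_rtrancl)
  then show ?thesis
    using assms(3)
  proof (induction rule: converse_rtrancl_induct)
    case (step a b)
    show ?case
    proof (cases "b = t")
      case True
      then show ?thesis using step.hyps(1) by (auto simp: ugraph_def uadj_commute[of T a])
    next
      case False
      then have "(b, a) \<in> edges_avoiding t"
        using step.hyps(1) step.prems by (auto simp: edges_avoiding_def ugraph_def uadj_commute[of T a])
      then show ?thesis using step.IH[OF False] by (meson rtrancl.rtrancl_into_rtrancl)
    qed
  qed simp
qed

lemma towards:
  assumes "t \<in> verts T" "a \<in> verts T" "a \<noteq> t"
  shows "uadj T t (towards t a)" "(towards t a, a) \<in> (edges_avoiding t)\<^sup>*"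
  using someI_ex[OF towards_exists[OF assms]] by (auto simp: towards_def)

lemma towards_nbr: assumes "uadj T t n" shows "towards t n = n"
proof -
  have "t \<in> verts T" "n \<in> verts T" "n \<noteq> t"
    using uadj_in_verts[OF wfT assms] assms T_irrefl by (auto simp: uadj_def)
  from towards[OF this] show ?thesis using assms towards_unique by blast
qed

lemma towards_adj:
  assumes t: "t \<in> verts T" and ab: "uadj T a b" "a \<noteq> t" "b \<noteq> t" shows "towards t a = towards t b"
proof (rule towards_unique[of t])
  have V: "a \<in> verts T" "b \<in> verts T" using uadj_in_verts[OF wfT ab(1)] by auto
  note a = towards[OF t V(1) ab(2)] and b = towards[OF t V(2) ab(3)]
  show "uadj T t (towards t a)" "uadj T t (towards t b)" by (rule a(1), rule b(1))
  have "(a, b) \<in> edges_avoiding t" using ab by (simp add: edges_avoiding_def ugraph_def)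
  then have "(towards t a, b) \<in> (edges_avoiding t)\<^sup>*" using a(2) by (rule rtrancl_into_rtrancl[rotated])
  moreover have "(b, towards t b) \<in> (edges_avoiding t)\<^sup>*"
    using b(2) by (rule symD[OF sym_rtrancl[OF sym_edges_avoiding]])
  ultimately show "(towards t a, towards t b) \<in> (edges_avoiding t)\<^sup>*" by (rule rtrancl_trans)
qed

text \<open>The retraction onto the block of \<open>t\<close>: the arc at \<open>t\<close> on the way from \<open>t\<close> to \<open>e\<close>.\<close>

definition proj :: "'t \<Rightarrow> 't \<times> 't \<Rightarrow> 't \<times> 't" where
  "proj t e = (let n = towards t (if fst e \<noteq> t then fst e else snd e)
     in if (t, n) \<in> arcs T then (t, n) else (n, t))"

lemma proj_block: assumes "e \<in> block t" shows "proj t e = e"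
proof -
  obtain a b where e: "e = (a, b)" "(a, b) \<in> arcs T" "a = t \<or> b = t" using assms by (cases e) (auto simp: block_def)
  have "towards t a = a" if "b = t" using towards_nbr e(2) that by (simp add: uadj_def)
  moreover have "towards t b = b" if "a = t" using towards_nbr e(2) that by (simp add: uadj_def)
  ultimately show ?thesis using e T_irrefl T_antisym by (auto simp: proj_def)
qed

lemma proj_arc:
  assumes t: "t \<in> verts T" and e: "(e, e') \<in> arcs D" and n: "\<not> (e \<in> block t \<and> e' \<in> block t)"
  shows "proj t e = proj t e'"
proof -
  obtain a b c d where ab: "e = (a, b)" "e' = (c, d)" by (cases e, cases e')
  have T: "(a, b) \<in> arcs T" "(c, d) \<in> arcs T" "b = c" using e ab by (auto simp: arcs_D)
  have bt: "b \<noteq> t" using n T ab by (auto simp: block_def)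
  have "towards t (if a \<noteq> t then a else b) = towards t b"
    using towards_adj[OF t, of a b] bt T by (auto simp: uadj_def)
  then have "proj t e = (if (t, towards t b) \<in> arcs T then (t, towards t b) else (towards t b, t))"
    unfolding proj_def ab Let_def fst_conv snd_conv by (simp only:)
  also have "\<dots> = proj t e'"
    unfolding proj_def ab using bt T(3) by (simp add: Let_def)
  finally show ?thesis .
qed

lemma proj_uadj:
  assumes "t \<in> verts T" "uadj D e e'" "\<not> (e \<in> block t \<and> e' \<in> block t)" shows "proj t e = proj t e'"
  using assms proj_arc[of t e e'] proj_arc[of t e' e] unfolding uadj_def by metis

lemma connected_proj:
  assumes S: "connected_on (ugraph D) S" and s: "s \<in> S" "s \<in> block t" and e: "e \<in> S"
  shows "proj t e \<in> S \<inter> block t \<and> (s, proj t e) \<in> (ugraph D \<inter> (S \<inter> block t) \<times> (S \<inter> block t))\<^sup>*"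
proof -
  have t: "t \<in> verts T" by (rule block_verts[OF s(2)])
  have "(s, e) \<in> (ugraph D \<inter> S \<times> S)\<^sup>*" using S s e unfolding connected_on_def by blast
  then show ?thesis
  proof (induction rule: rtrancl_induct)
    case base
    show ?case using proj_block[OF s(2)] s by simp
  next
    case (step p q)
    have pq: "uadj D p q" "p \<in> S" "q \<in> S" using step.hyps(2) by (auto simp: ugraph_def)
    show ?case
    proof (cases "p \<in> block t \<and> q \<in> block t")
      case True
      then have proj: "proj t p = p" "proj t q = q" using proj_block by blast+
      have "(p, q) \<in> ugraph D \<inter> (S \<inter> block t) \<times> (S \<inter> block t)" using True pq by (simp add: ugraph_def)
      then show ?thesis using step.IH True pq unfolding proj by (meson IntI rtrancl.rtrancl_into_rtrancl)
    next
      case False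
      then show ?thesis using step.IH proj_uadj[OF t pq(1)] by metis
    qed
  qed
qed

lemma connected_block_Int:
  assumes "connected_on (ugraph D) S" shows "connected_on (ugraph D) (S \<inter> block t)"
  unfolding connected_on_def
proof (intro ballI)
  fix s e assume "s \<in> S \<inter> block t" "e \<in> S \<inter> block t"
  then show "(s, e) \<in> (ugraph D \<inter> (S \<inter> block t) \<times> (S \<inter> block t))\<^sup>*"
    using connected_proj[OF assms, of s t e] proj_block[of e t] by simp
qed

lemma outside_not_adjacent:
  assumes S: "connected_on (ugraph D) S" and s: "s \<in> S" "s \<in> block t"
    and v: "v \<notin> S" "v \<in> block t" and u: "u \<in> S" "u \<notin> block t"
  shows "\<not> uadj D u v"
proof
  assume "uadj D u v"
  then have "proj t u = v" using proj_uadj[OF block_verts[OF s(2)]] proj_block[OF v(2)] u(2) by metis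
  then show False using connected_proj[OF S s u(1)] v(1) by simp
qed

end

locale embedding_at_block = diestel_leader B X Y T \<phi> \<psi>
  for B :: "'b dg" and X Y and T :: "'t dg" and \<phi> \<psi> +
  fixes S :: "('t \<times> 't) set" and f :: "'t \<times> 't \<Rightarrow> 't \<times> 't" and s :: "'t \<times> 't" and t :: 't
  assumes embedding: "connected_embedding D S f" and s: "s \<in> S" "s \<in> block t"
begin

definition image_vertex :: 't where
  "image_vertex = (if snd s = t then snd (f s) else fst (f s))"

lemma S_connected: "connected_on (ugraph D) S"
  and f_arcs: "x \<in> S \<Longrightarrow> y \<in> S \<Longrightarrow> (f x, f y) \<in> arcs D \<longleftrightarrow> (x, y) \<in> arcs D"
  and f_inj: "inj_on f S"
  and f_in_T: "e \<in> S \<Longrightarrow> f e \<in> arcs T"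
  and S_in_T: "e \<in> S \<Longrightarrow> e \<in> arcs T"
  using embedding by (auto simp: connected_embedding_def)

lemma t_vertex: "t \<in> verts T"
  by (rule block_verts[OF s(2)])

lemma image_role:
  assumes e: "e \<in> S" "e \<in> block t"
  shows "if snd e = t then snd (f e) = image_vertex else fst (f e) = image_vertex"
proof -
  let ?W = "S \<inter> block t"
  have "(s, e) \<in> (ugraph D \<inter> ?W \<times> ?W)\<^sup>*"
    using connected_block_Int[OF S_connected] s e unfolding connected_on_def by blast
  then show ?thesis
  proof (induction rule: rtrancl_induct)
    case base
    then show ?case by (simp add: image_vertex_def)
  next
    case (step p q)
    have pq: "p \<in> ?W" "q \<in> ?W" "(p, q) \<in> arcs D \<or> (q, p) \<in> arcs D"
      using step.hyps(2) by (auto simp: ugraph_def uadj_def)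
    have across: "snd x = t" "snd y \<noteq> t" "snd (f x) = fst (f y)"
      if xy: "(x, y) \<in> arcs D" "x \<in> ?W" "y \<in> ?W" for x y
    proof -
      have "fst y = t" using block_arc_ends[OF _ _ xy(1)] xy(2,3) by blast
      then show "snd y \<noteq> t" using T_arc_ends_distinct[OF S_in_T, of y] xy(3) by auto
      show "snd x = t" using block_arc_ends[OF _ _ xy(1)] xy(2,3) by blast
      show "snd (f x) = fst (f y)" using f_arcs[of x y] xy arcs_D by blast
    qed
    from pq(3) show ?case
      using step.IH across[of p q] across[of q p] pq(1,2) by auto
  qed
qed

lemma image_in_block: "e \<in> S \<Longrightarrow> e \<in> block t \<Longrightarrow> f e \<in> block image_vertex"
  using image_role[of e] f_in_T[of e] by (auto simp: block_def split: if_splits)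

lemma snd_image_iff: "e \<in> S \<Longrightarrow> e \<in> block t \<Longrightarrow> snd (f e) = image_vertex \<longleftrightarrow> snd e = t"
  using image_role[of e] T_arc_ends_distinct[OF f_in_T, of e] by (auto split: if_splits)

lemma label_image_part: "e \<in> S \<Longrightarrow> e \<in> block t \<Longrightarrow> label image_vertex (f e) \<in> X \<longleftrightarrow> label t e \<in> X"
  using label_part[OF image_in_block] label_part[of e t] snd_image_iff by blast

lemma image_vertex_verts: "image_vertex \<in> verts T"
  by (rule block_verts[OF image_in_block[OF s]])

lemma image_block_iff:
  assumes u: "u \<in> S" shows "f u \<in> block image_vertex \<longleftrightarrow> u \<in> block t"
proof
  assume fu: "f u \<in> block image_vertex"
  interpret inverse: embedding_at_block B X Y T \<phi> \<psi> "f ` S" "inv_into S f" "f s" image_vertex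
  proof
    show "connected_embedding D (f ` S) (inv_into S f)" by (rule connected_embedding_inv_into[OF embedding])
    show "f s \<in> f ` S" "f s \<in> block image_vertex" using s image_in_block[OF s] by blast+
  qed
  have inv: "inv_into S f (f x) = x" if "x \<in> S" for x using f_inj that by simp
  have "inverse.image_vertex = t"
    using snd_image_iff[OF s] s inv[OF s(1)] by (auto simp: inverse.image_vertex_def block_def)
  then show "u \<in> block t" using inverse.image_in_block[OF _ fu] u inv[OF u] by simp
qed (rule image_in_block[OF u])

definition label_map :: "'b \<Rightarrow> 'b" where
  "label_map x = label image_vertex (f (unlabel t x))"

lemma label_map: "e \<in> block t \<Longrightarrow> label_map (label t e) = label image_vertex (f e)"
  by (simp add: label_map_def unlabel_label[OF t_vertex])

lemma label_map_uadj:
  assumes "e \<in> S \<inter> block t" "e' \<in> S \<inter> block t"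
  shows "uadj B (label_map (label t e)) (label_map (label t e')) \<longleftrightarrow> uadj B (label t e) (label t e')"
proof -
  have "uadj B (label image_vertex (f e)) (label image_vertex (f e')) \<longleftrightarrow> uadj D (f e) (f e')"
    using block_uadj[OF image_in_block image_in_block] assms by blast
  also have "\<dots> \<longleftrightarrow> uadj D e e'" using connected_embedding_uadj[OF embedding] assms by blast
  also have "\<dots> \<longleftrightarrow> uadj B (label t e) (label t e')" using block_uadj assms by blast
  finally show ?thesis using label_map assms by simp
qed

lemma coloured_embedding_label_map:
  "coloured_embedding B X (label t ` (S \<inter> block t)) label_map"
  unfolding coloured_embedding_def
proof (intro conjI)
  let ?W = "S \<inter> block t"
  show "label t ` ?W \<subseteq> verts B" using label_verts[OF t_vertex] by blast
  show "connected_on (ugraph B) (label t ` ?W)"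
    by (rule connected_on_image[OF connected_block_Int[OF S_connected]]) (use block_uadj in \<open>auto simp: ugraph_def\<close>)
  show "inj_on label_map (label t ` ?W)"
  proof (rule inj_onI, elim imageE, hypsubst)
    fix x y assume xy: "x \<in> ?W" "y \<in> ?W" "label_map (label t x) = label_map (label t y)"
    then have "f x = f y"
      using label_map label_inj[OF image_vertex_verts image_in_block image_in_block] by simp
    then show "label t x = label t y" using inj_onD[OF f_inj] xy by blast
  qed
  show "label_map ` label t ` ?W \<subseteq> verts B"
    using label_map label_verts[OF image_vertex_verts image_in_block] by auto
  show "\<forall>u\<in>label t ` ?W. label_map u \<in> X \<longleftrightarrow> u \<in> X" using label_map label_image_part by auto
  show "\<forall>u\<in>label t ` ?W. \<forall>u'\<in>label t ` ?W. uadj B (label_map u) (label_map u') \<longleftrightarrow> uadj B u u'"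
    using label_map_uadj by blast
qed

lemma extension_in_block:
  assumes v: "v \<notin> S" "v \<in> block t" "uadj D s v"
  obtains w where "w \<in> block image_vertex" "w \<notin> f ` S" "label image_vertex w \<in> X \<longleftrightarrow> label t v \<in> X"
    "\<And>u. u \<in> S \<inter> block t \<Longrightarrow> uadj D (f u) w \<longleftrightarrow> uadj D u v"
proof -
  let ?W = "S \<inter> block t"
  have "label t v \<notin> label t ` ?W"
    using label_inj[OF t_vertex v(2)] v(1) by blast
  then have "label t v \<in> verts B - label t ` ?W" using label_verts[OF t_vertex v(2)] by blast
  moreover have "\<exists>x\<in>label t ` ?W. uadj B x (label t v)" using block_uadj[OF s(2) v(2)] s v(3) by blast
  ultimately obtain x where x: "x \<in> verts B" "x \<notin> label_map ` label t ` ?W" "x \<in> X \<longleftrightarrow> label t v \<in> X"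
      "\<forall>u\<in>label t ` ?W. uadj B (label_map u) x \<longleftrightarrow> uadj B u (label t v)"
    using extendable coloured_embedding_label_map unfolding coloured_one_point_extendable_def by blast
  let ?w = "unlabel image_vertex x"
  have w: "?w \<in> block image_vertex" "label image_vertex ?w = x"
    using unlabel label_unlabel image_vertex_verts x(1) by blast+
  have "?w \<notin> f ` S"
  proof
    assume "?w \<in> f ` S"
    then obtain u where u: "?w = f u" "u \<in> S" by (rule imageE)
    then have "u \<in> ?W" using image_block_iff w(1) by simp
    moreover have "label_map (label t u) = x" using label_map[of u] u(1) w(2) \<open>u \<in> ?W\<close> by simp
    ultimately show False using x(2) by blast
  qed
  moreover have "uadj D (f u) ?w \<longleftrightarrow> uadj D u v" if u: "u \<in> ?W" for u
  proof -
    have "uadj D (f u) ?w \<longleftrightarrow> uadj B (label_map (label t u)) x"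
      using block_uadj[OF image_in_block w(1)] w(2) label_map u by simp
    also have "\<dots> \<longleftrightarrow> uadj D u v" using x(4) block_uadj[OF _ v(2)] u by blast
    finally show ?thesis .
  qed
  ultimately show ?thesis using that w x(3) by simp
qed

lemma extension:
  assumes v: "v \<notin> S" "v \<in> block t" "uadj D s v"
  obtains w where "w \<in> arcs T - f ` S"
    "\<forall>u\<in>S. ((f u, w) \<in> arcs D \<longleftrightarrow> (u, v) \<in> arcs D) \<and> ((w, f u) \<in> arcs D \<longleftrightarrow> (v, u) \<in> arcs D)"
proof -
  obtain w where w: "w \<in> block image_vertex" "w \<notin> f ` S" "label image_vertex w \<in> X \<longleftrightarrow> label t v \<in> X"
    and adj: "\<And>u. u \<in> S \<inter> block t \<Longrightarrow> uadj D (f u) w \<longleftrightarrow> uadj D u v"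
    by (rule extension_in_block[OF v]) blast
  have "((f u, w) \<in> arcs D \<longleftrightarrow> (u, v) \<in> arcs D) \<and> ((w, f u) \<in> arcs D \<longleftrightarrow> (v, u) \<in> arcs D)" if u: "u \<in> S" for u
  proof (cases "u \<in> block t")
    case True
    then have "(f u, w) \<in> arcs D \<longleftrightarrow> (u, v) \<in> arcs D"
      using block_arc_iff[OF image_in_block[OF u True] w(1)] block_arc_iff[OF True v(2)]
        adj[of u] label_image_part[OF u True] u by simp
    moreover have "(w, f u) \<in> arcs D \<longleftrightarrow> (v, u) \<in> arcs D"
      using block_arc_iff[OF w(1) image_in_block[OF u True]] block_arc_iff[OF v(2) True]
        adj[of u] w(3) True u by (simp add: uadj_commute[of D w] uadj_commute[of D v])
    ultimately show ?thesis by blast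
  next
    case False
    then have "\<not> uadj D u v" using outside_not_adjacent[OF S_connected s v(1,2) u] by blast
    moreover have "\<not> uadj D (f u) w"
      using outside_not_adjacent[OF connected_embedding_connected_image[OF embedding] _ image_in_block[OF s] w(2,1)]
        image_block_iff[OF u] False s(1) u by blast
    ultimately show ?thesis unfolding uadj_def by blast
  qed
  then show ?thesis using that[of w] w(1,2) by (simp add: block_def)
qed

end

context diestel_leader
begin

lemma one_point_extendable_D: "one_point_extendable D"
  unfolding one_point_extendable_def
proof (intro allI impI)
  fix S f v assume f: "connected_embedding D S f" and v: "v \<in> verts D - S" and "\<exists>s\<in>S. uadj D s v"
  then obtain s where "s \<in> S" and sv: "uadj D s v" by blast
  obtain t where t: "s \<in> block t" "v \<in> block t" by (rule uadj_block[OF sv])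
  interpret embedding_at_block B X Y T \<phi> \<psi> S f s t
    by unfold_locales (rule f, rule \<open>s \<in> S\<close>, rule t(1))
  show "\<exists>w\<in>verts D - f ` S. \<forall>u\<in>S. ((f u, w) \<in> arcs D \<longleftrightarrow> (u, v) \<in> arcs D)
      \<and> ((w, f u) \<in> arcs D \<longleftrightarrow> (v, u) \<in> arcs D)"
    using extension[OF _ t(2) sv] v verts_D by (metis DiffD2)
qed

theorem connected_homogeneous_D: "connected_homogeneous D"
  by (rule one_point_extendable_homogeneous[OF wf_D uconnected_D one_point_extendable_D])

end

section \<open>Reachability classes as homogeneous bipartite graphs\<close>

lemma uconnected_class:
  assumes wf: "wf_digraph D" and e: "e \<in> arcs D" shows "uconnected (Delta_of (A_class D e))"
proof -
  let ?G = "Delta_of (A_class D e)"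
  have edge: "(fst f, snd f) \<in> ugraph ?G" "(snd f, fst f) \<in> ugraph ?G" if "f \<in> A_class D e" for f
    using that by (cases f; simp add: ugraph_def uadj_def Delta_of_def)+
  have eC: "e \<in> A_class D e" using A_class_iff[OF wf e] by simp
  have reach: "(fst e, fst f) \<in> (ugraph ?G)\<^sup>* \<and> (fst e, snd f) \<in> (ugraph ?G)\<^sup>*"
    if "(e, f) \<in> (share_end D)\<^sup>*" for f
    using that
  proof (induction rule: rtrancl_induct)
    case base
    show ?case using edge[OF eC] by blast
  next
    case (step f f')
    have "f' \<in> A_class D e" using step.hyps A_class_iff[OF wf e] by (meson rtrancl.rtrancl_into_rtrancl)
    moreover have "fst f = fst f' \<or> snd f = snd f'" using step.hyps(2) by (simp add: share_end_def)
    ultimately show ?case using step.IH edge by (metis rtrancl.rtrancl_into_rtrancl)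
  qed
  have "connected_on (ugraph ?G) (verts ?G)"
  proof (rule connected_on_from[OF sym_ugraph])
    show "fst e \<in> verts ?G" using eC by (simp add: Delta_of_def)
    fix v assume "v \<in> verts ?G"
    then obtain f where "f \<in> A_class D e" "v = fst f \<or> v = snd f" by (auto simp: Delta_of_def)
    then have "(fst e, v) \<in> (ugraph ?G)\<^sup>*" using reach A_class_iff[OF wf e] by blast
    moreover have "ugraph ?G \<inter> verts ?G \<times> verts ?G = ugraph ?G"
      by (force simp: ugraph_def uadj_def Delta_of_def)
    ultimately show "(fst e, v) \<in> (ugraph ?G \<inter> verts ?G \<times> verts ?G)\<^sup>*" by (simp only:)
  qed
  then show ?thesis using eC by (auto simp: uconnected_iff Delta_of_def)
qed

lemma share_end_aut:
  assumes wf: "wf_digraph D" and g: "automorphism g D" and s: "(f, f') \<in> (share_end D)\<^sup>*"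
  shows "(map_prod g g f, map_prod g g f') \<in> (share_end D)\<^sup>*"
proof (rule rtrancl_map[OF s])
  fix f f' assume "(f, f') \<in> share_end D"
  then show "(map_prod g g f, map_prod g g f') \<in> share_end D"
    using automorphism_arcs[OF g] arcs_in_verts[OF wf] by (cases f; cases f') (auto simp: share_end_def)
qed

context cut_homogeneous
begin

lemma finite_out_nbrs: "x \<in> verts D \<Longrightarrow> finite (out_nbrs D x)"
  and finite_in_nbrs: "x \<in> verts D \<Longrightarrow> finite (in_nbrs D x)"
  using lf by (simp_all add: locally_finite_def)

lemma card_out_nbrs:
  assumes "x \<in> verts D" "y \<in> verts D" shows "card (out_nbrs D x) = card (out_nbrs D y)"
proof -
  obtain g where g: "automorphism g D" "g x = y" using vertex_transitive assms by blast
  have "inj_on g (out_nbrs D x)"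
    using automorphism_bij[OF g(1)] inj_on_subset[OF _ out_nbrs_verts] unfolding bij_betw_def by blast
  then show ?thesis using automorphism_out_nbrs[OF wf g(1) assms(1)] g(2) card_image by metis
qed

end

context cut_homogeneous
begin

interpretation reversed: cut_homogeneous "rev_dg D" E by (rule rev_cut_homogeneous)

lemma card_in_nbrs:
  assumes "x \<in> verts D" "y \<in> verts D" shows "card (in_nbrs D x) = card (in_nbrs D y)"
proof -
  have "out_nbrs (rev_dg D) z = in_nbrs D z" for z by (simp add: out_nbrs_def in_nbrs_def)
  then show ?thesis using reversed.card_out_nbrs[of x y] assms by simp
qed

end

locale reachability_class = cut_homogeneous D E for D :: "'a dg" and E +
  fixes e :: "'a \<times> 'a"
  assumes e: "e \<in> arcs D"
begin

abbreviation C :: "('a \<times> 'a) set" where "C \<equiv> A_class D e"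

abbreviation \<Delta> :: "'a dg" where "\<Delta> \<equiv> Delta_of C"

definition source :: "'a \<Rightarrow> bool" where
  "source v \<longleftrightarrow> v \<in> fst ` C"

definition part_deg :: "bool \<Rightarrow> nat" where
  "part_deg c = (if c then card (out_nbrs D (fst e)) else card (in_nbrs D (fst e)))"

lemma uadj_\<Delta>: "uadj \<Delta> u v \<longleftrightarrow> (u, v) \<in> C \<or> (v, u) \<in> C"
  by (simp add: uadj_def Delta_of_def)

lemma arc_sides:
  assumes "(u, v) \<in> C" shows "source u" "\<not> source v" "u \<in> verts \<Delta>" "v \<in> verts \<Delta>"
proof -
  show "source u" "u \<in> verts \<Delta>" "v \<in> verts \<Delta>" using assms by (force simp: source_def Delta_of_def)+
  show "\<not> source v" using class_parts_disjoint[OF e] assms by (force simp: source_def)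
qed

lemma \<Delta>_vertexE:
  assumes "v \<in> verts \<Delta>"
  obtains (source) w where "(v, w) \<in> C" "source v" | (sink) w where "(w, v) \<in> C" "\<not> source v"
proof -
  obtain f where f: "f \<in> C" "v = fst f \<or> v = snd f" using assms by (auto simp: Delta_of_def)
  then have "(fst f, snd f) \<in> C" by simp
  then show ?thesis using f(2) that arc_sides by metis
qed

lemma class_arc: "(u, v) \<in> C \<Longrightarrow> (u, v) \<in> arcs D"
  by (rule class_arcs[OF e])

lemma \<Delta>_verts: assumes "v \<in> verts \<Delta>" shows "v \<in> verts D"
  using assms by (cases rule: \<Delta>_vertexE) (auto dest: class_arc arc_verts)

lemma class_closed:
  assumes "f \<in> C" "f' \<in> arcs D" "fst f = fst f' \<or> snd f = snd f'" shows "f' \<in> C"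
proof -
  have "(f, f') \<in> share_end D" using assms class_arcs[OF e] by (auto simp: share_end_def)
  then show ?thesis
    using assms(1) A_class_iff[OF wf e] by (meson rtrancl.rtrancl_into_rtrancl)
qed

lemma class_arc_iff:
  assumes "u \<in> verts \<Delta> \<and> source u \<or> v \<in> verts \<Delta> \<and> \<not> source v" shows "(u, v) \<in> C \<longleftrightarrow> (u, v) \<in> arcs D"
proof
  assume a: "(u, v) \<in> arcs D"
  from assms consider w where "(u, w) \<in> C" | w where "(w, v) \<in> C" by (metis \<Delta>_vertexE)
  then show "(u, v) \<in> C" by cases (use class_closed[OF _ a] in auto)
qed (rule class_arc)

lemma source_nbrs: assumes "x \<in> verts \<Delta>" "source x" shows "{y. uadj \<Delta> x y} = out_nbrs D x"
  using class_arc_iff[of x] arc_sides assms by (auto simp: uadj_\<Delta> out_nbrs_def)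

lemma sink_nbrs: assumes "x \<in> verts \<Delta>" "\<not> source x" shows "{y. uadj \<Delta> x y} = in_nbrs D x"
  using class_arc_iff[of _ x] arc_sides assms by (auto simp: uadj_\<Delta> in_nbrs_def)

lemma fst_e_verts: "fst e \<in> verts D"
  using arcs_in_verts[OF wf] e by (metis prod.collapse)

lemma biregular: "biregular_bipartite \<Delta> source part_deg"
proof
  fix x y assume "uadj \<Delta> x y"
  then show "x \<in> verts \<Delta>" "source x \<noteq> source y" using arc_sides unfolding uadj_\<Delta> by blast+
next
  fix x assume x: "x \<in> verts \<Delta>"
  then have xV: "x \<in> verts D" by (rule \<Delta>_verts)
  show "finite {y. uadj \<Delta> x y}" "card {y. uadj \<Delta> x y} = part_deg (source x)"
    using source_nbrs[OF x] sink_nbrs[OF x] finite_out_nbrs[OF xV] finite_in_nbrs[OF xV]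
      card_out_nbrs[OF xV fst_e_verts] card_in_nbrs[OF xV fst_e_verts] by (cases "source x"; simp add: part_deg_def)+
next
  fix c
  obtain y z where "(fst e, y) \<in> arcs D" "(z, fst e) \<in> arcs D"
    using has_out_nbr[OF fst_e_verts] has_in_nbr[OF fst_e_verts] by metis
  then have "out_nbrs D (fst e) \<noteq> {}" "in_nbrs D (fst e) \<noteq> {}" unfolding out_nbrs_def in_nbrs_def by blast+
  then show "1 \<le> part_deg c"
    using finite_out_nbrs[OF fst_e_verts] finite_in_nbrs[OF fst_e_verts]
    by (simp add: part_deg_def Suc_le_eq card_gt_0_iff)
qed (rule uconnected_class[OF wf e])

lemma class_aut_iff:
  assumes g: "automorphism g D" and f: "f \<in> C" "map_prod g g f \<in> C"
    and V: "u \<in> verts D" "v \<in> verts D"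
  shows "(g u, g v) \<in> C \<longleftrightarrow> (u, v) \<in> C"
proof
  assume "(u, v) \<in> C"
  then have "(map_prod g g f, map_prod g g (u, v)) \<in> (share_end D)\<^sup>*"
    using share_end_aut[OF wf g] class_related[OF e f(1)] by blast
  then show "(g u, g v) \<in> C" using f(2) A_class_iff[OF wf e] by (auto intro: rtrancl_trans)
next
  let ?h = "inv_into (verts D) g"
  have h: "?h (g x) = x" if "x \<in> verts D" for x
    using automorphism_bij[OF g] that by (simp add: bij_betw_inv_into_left)
  have "fst f \<in> verts D" "snd f \<in> verts D" using class_arcs[OF e f(1)] arc_verts by (metis prod.collapse)+
  then have hf: "map_prod ?h ?h (map_prod g g f) = f" using h by (cases f) simp
  assume "(g u, g v) \<in> C"
  then have "(map_prod ?h ?h (map_prod g g f), map_prod ?h ?h (g u, g v)) \<in> (share_end D)\<^sup>*"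
    using share_end_aut[OF wf automorphism_inv[OF g]] class_related[OF e f(2)] by blast
  then show "(u, v) \<in> C" using f(1) A_class_iff[OF wf e] hf h V by (auto intro: rtrancl_trans)
qed

lemma class_aut_restricts:
  assumes g: "automorphism g D" and f: "f \<in> C" "map_prod g g f \<in> C"
  shows "rel_aut (verts \<Delta>) (ugraph \<Delta>) g"
proof -
  note iff = class_aut_iff[OF g f \<Delta>_verts \<Delta>_verts]
  have bij: "inj_on g (verts D)" "g ` verts D = verts D"
    using automorphism_bij[OF g] by (auto simp: bij_betw_def)
  have "g ` verts \<Delta> = verts \<Delta>"
  proof (intro equalityI subsetI)
    fix v assume "v \<in> g ` verts \<Delta>"
    then obtain u where u: "v = g u" "u \<in> verts \<Delta>" by (rule imageE)
    from u(2) show "v \<in> verts \<Delta>"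
      by (cases rule: \<Delta>_vertexE) (use u(1) iff arc_sides(3,4) in blast)+
  next
    fix v assume "v \<in> verts \<Delta>"
    then show "v \<in> g ` verts \<Delta>"
    proof (cases rule: \<Delta>_vertexE)
      case (source w)
      then obtain v' w' where V: "v' \<in> verts D" "w' \<in> verts D" "v = g v'" "w = g w'"
        using class_arc arc_verts bij(2) by (metis imageE)
      then show ?thesis using class_aut_iff[OF g f V(1,2)] source arc_sides(3) by blast
    next
      case (sink w)
      then obtain v' w' where V: "v' \<in> verts D" "w' \<in> verts D" "v = g v'" "w = g w'"
        using class_arc arc_verts bij(2) by (metis imageE)
      then show ?thesis using class_aut_iff[OF g f V(2,1)] sink arc_sides(4) by blast
    qed
  qed
  moreover have "inj_on g (verts \<Delta>)" using inj_on_subset[OF bij(1)] \<Delta>_verts by blast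
  ultimately show ?thesis using iff by (simp add: rel_aut_def bij_betw_def ugraph_def uadj_\<Delta>)
qed

lemma centred_induced:
  assumes centred and V: "u \<in> verts \<Delta>" "v \<in> verts \<Delta>" shows "(u, v) \<in> C \<longleftrightarrow> (u, v) \<in> arcs D"
proof (cases "source u \<or> \<not> source v")
  case True
  then show ?thesis using class_arc_iff V by blast
next
  case False
  then obtain x y where xy: "(x, u) \<in> C" "(v, y) \<in> C" using V by (metis \<Delta>_vertexE)
  have "(u, v) \<notin> arcs D"
    by (rule centred_class_induced[OF \<open>centred\<close> class_related[OF e xy] class_arc[OF xy(1)]])
  then show ?thesis using class_arc by blast
qed

lemma automorphism_fixes_class:
  assumes g: "automorphism g D" and a: "a \<in> verts \<Delta>" "g a \<in> verts \<Delta>" "source (g a) = source a"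
  obtains f where "f \<in> C" "map_prod g g f \<in> C"
  using a(1)
proof (cases rule: \<Delta>_vertexE)
  case (source w)
  have "(g a, g w) \<in> arcs D" using automorphism_arcs[OF g] class_arc[OF source(1)] arc_verts by blast
  then have "(g a, g w) \<in> C" using class_arc_iff a(2,3) source(2) by blast
  then show ?thesis using that[of "(a, w)"] source(1) by simp
next
  case (sink w)
  have "(g w, g a) \<in> arcs D" using automorphism_arcs[OF g] class_arc[OF sink(1)] arc_verts by blast
  then have "(g w, g a) \<in> C" using class_arc_iff a(2,3) sink(2) by blast
  then show ?thesis using that[of "(w, a)"] sink(1) by simp
qed

lemma centred_homogeneous:
  assumes centred shows "homogeneous_bipartite \<Delta> source part_deg"
proof (intro homogeneous_bipartite.intro homogeneous_bipartite_axioms.intro biregular)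
  fix A f assume A: "finite A" "A \<noteq> {}" "A \<subseteq> verts \<Delta>" "connected_on (ugraph \<Delta>) A"
    and f: "inj_on f A" "f ` A \<subseteq> verts \<Delta>" "\<And>x. x \<in> A \<Longrightarrow> source (f x) = source x"
      "\<And>x y. x \<in> A \<Longrightarrow> y \<in> A \<Longrightarrow> uadj \<Delta> (f x) (f y) \<longleftrightarrow> uadj \<Delta> x y"
  have V: "x \<in> verts \<Delta>" "f x \<in> verts \<Delta>" if "x \<in> A" for x using A(3) f(2) that by auto
  have arcs: "(f x, f y) \<in> arcs D \<longleftrightarrow> (x, y) \<in> arcs D" if xy: "x \<in> A" "y \<in> A" for x y
  proof -
    have "(u, v) \<in> C \<longleftrightarrow> uadj \<Delta> u v \<and> source u" for u v using arc_sides by (auto simp: uadj_\<Delta>)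
    then have "(f x, f y) \<in> C \<longleftrightarrow> (x, y) \<in> C" using f(3,4) xy by simp
    then show ?thesis using centred_induced[OF assms] V xy by simp
  qed
  have sub: "ugraph \<Delta> \<subseteq> ugraph D" using class_arc by (auto simp: ugraph_def uadj_\<Delta> uadj_def[of D])
  then have conn: "connected_on (ugraph D) A"
    using connected_on_image[OF A(4), of id "ugraph D"] by auto
  have "connected_on (ugraph D) (f ` A)"
    by (rule connected_on_image[OF A(4)]) (use f(4) sub in \<open>auto simp: ugraph_def\<close>)
  then have "uconnected (induced D A)" "uconnected (induced D (f ` A))"
    using conn A(2) by (simp_all add: uconnected_induced_iff)
  moreover have "dg_iso f (induced D A) (induced D (f ` A))"
    using f(1) arcs by (auto simp: dg_iso_def arcs_induced bij_betw_def)
  moreover have "A \<subseteq> verts D" "f ` A \<subseteq> verts D" using V \<Delta>_verts by blast+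
  ultimately obtain g where g: "automorphism g D" "\<forall>x\<in>A. g x = f x"
    using hom A(1) unfolding connected_homogeneous_def by blast
  obtain a where a: "a \<in> A" using A(2) by blast
  obtain h where "h \<in> C" "map_prod g g h \<in> C"
    by (rule automorphism_fixes_class[OF g(1) V(1)[OF a]]) (use g(2) a V f(3) in auto)
  then show "\<exists>g. rel_aut (verts \<Delta>) (ugraph \<Delta>) g \<and> (\<forall>x\<in>A. g x = f x)"
    using class_aut_restricts[OF g(1)] g(2) by blast
qed

lemma listed: "listed_graph \<Delta>"
proof (cases centred)
  case True
  then show ?thesis by (rule homogeneous_bipartite.homogeneous_bipartite_listed[OF centred_homogeneous])
next
  case False
  have "ugraph \<Delta> \<subseteq> verts \<Delta> \<times> verts \<Delta>" using arc_sides(3,4) by (auto simp: ugraph_def uadj_\<Delta>)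
  moreover have "is_cycle D xs" if "is_cycle \<Delta> xs" for xs
  proof -
    have "uadj D u v" if "uadj \<Delta> u v" for u v using that class_arc unfolding uadj_\<Delta> uadj_def[of D] by blast
    then show ?thesis using that successively_mono[of "uadj \<Delta>" xs "uadj D"] by (auto simp: is_cycle_def)
  qed
  ultimately have "uacyclic \<Delta>"
    using uacyclic_if_not_centred[OF False] uacyclic_iff ugraph_sub[OF wf] by blast
  then show ?thesis by (rule biregular_bipartite.listed_if_acyclic[OF biregular])
qed

end

theorem connected_homogeneous_many_ends:
  assumes "wf_digraph D" "uconnected D" "locally_finite D" "triangle_free D"
    "more_than_one_end D" "connected_homogeneous D"
  shows "highly_arc_transitive D" "\<exists>e\<in>arcs D. \<exists>e'\<in>arcs D. \<not> rel_A D e e'"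
    "e \<in> arcs D \<Longrightarrow> bipartite_dg (Delta_of (A_class D e))"
    "e \<in> arcs D \<Longrightarrow> listed_graph (Delta_of (A_class D e))"
    "more_than_two_ends D \<Longrightarrow> u \<in> verts D \<Longrightarrow> is_tree (induced D (desc D u)) \<and> is_tree (induced D (anc D u))"
proof -
  obtain E where "cut_homogeneous D E" using cut_homogeneous_exists assms by blast
  then interpret cut_homogeneous D E .
  show "highly_arc_transitive D" by (rule cut_highly_arc_transitive)
  show "\<exists>e\<in>arcs D. \<exists>e'\<in>arcs D. \<not> rel_A D e e'" by (rule cut_reachability_not_universal)
  show "bipartite_dg (Delta_of (A_class D e))" if "e \<in> arcs D"
    using cut_class_bipartite_parts[OF that] unfolding bipartite_dg_def by blast
  show "listed_graph (Delta_of (A_class D e))" if "e \<in> arcs D"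
    by (intro reachability_class.listed reachability_class.intro reachability_class_axioms.intro)
      (rule cut_homogeneous_axioms, rule that)
  show "is_tree (induced D (desc D u)) \<and> is_tree (induced D (anc D u))"
    if "more_than_two_ends D" "u \<in> verts D"
    using desc_tree[OF that] anc_tree[OF that] by blast
qed

section \<open>Reachability classes of DL\<close>

context connected_bipartite
begin

lemma has_nbr:
  assumes "arcs B \<noteq> {}" "v \<in> verts B" obtains w where "uadj B v w"
proof -
  obtain x y where xy: "(x, y) \<in> arcs B" using assms(1) by auto
  then have "(v, x) \<in> (ugraph B)\<^sup>*" using joined arcs_parts parts assms(2) by blast
  then show ?thesis
    by (cases rule: converse_rtranclE) (use that xy in \<open>auto simp: ugraph_def uadj_def\<close>)
qed

lemma share_end_universal:
  assumes e: "e \<in> arcs B" "e' \<in> arcs B" shows "(e, e') \<in> (share_end B)\<^sup>*"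
proof -
  have share: "(f, f') \<in> share_end B"
    if "f \<in> arcs B" "f' \<in> arcs B" "v = fst f \<or> v = snd f" "v = fst f' \<or> v = snd f'" for f f' v
  proof -
    have "fst f \<in> X" "snd f \<in> Y" "fst f' \<in> X" "snd f' \<in> Y" using arcs_parts that(1,2) by (metis prod.collapse)+
    then show ?thesis using that parts(1) by (auto simp: share_end_def)
  qed
  have V: "fst f \<in> verts B" if "f \<in> arcs B" for f using arcs_parts parts that by (metis UnI1 prod.collapse)
  have "(fst e, fst e') \<in> (ugraph B)\<^sup>*" by (rule joined[OF V V]) (rule e)+
  then have "\<forall>f\<in>arcs B. fst e' = fst f \<or> fst e' = snd f \<longrightarrow> (e, f) \<in> (share_end B)\<^sup>*"
  proof (induction rule: rtrancl_induct)
    case base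
    then show ?case using share[OF e(1)] by blast
  next
    case (step v w)
    then obtain f where f: "f \<in> arcs B" "v = fst f \<or> v = snd f" "w = fst f \<or> w = snd f"
      by (auto simp: ugraph_def uadj_def)
    then have "(e, f) \<in> (share_end B)\<^sup>*" using step.IH by blast
    then show ?case using share[OF f(1) _ f(3)] by (meson rtrancl.rtrancl_into_rtrancl)
  qed
  then show ?thesis using e(2) by blast
qed

end

context diestel_leader
begin

lemma share_end_same_block:
  assumes "(f, f') \<in> (share_end D)\<^sup>*" "f \<in> arcs D"
  shows "f' \<in> arcs D \<and> snd (fst f') = snd (fst f)"
  using assms
proof (induction rule: rtrancl_induct)
  case (step f' f'')
  then have "f' \<in> arcs D" "f'' \<in> arcs D" "fst f' = fst f'' \<or> snd f' = snd f''" by (auto simp: share_end_def)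
  moreover from this have "snd (fst f') = fst (snd f')" "snd (fst f'') = fst (snd f'')"
    using arcs_D by (metis prod.collapse)+
  ultimately show ?case using step by auto
qed simp

lemma block_arcs_related:
  assumes pq: "(p, q) \<in> arcs D" "p \<in> block t" "q \<in> block t"
    and xy: "(x, y) \<in> arcs D" "x \<in> block t" "y \<in> block t"
  shows "((p, q), (x, y)) \<in> (share_end D)\<^sup>*"
proof -
  have t: "t \<in> verts T" by (rule block_verts[OF pq(2)])
  let ?u = "map_prod (unlabel t) (unlabel t)"
  have lift: "?u f \<in> arcs D" if "f \<in> arcs B" for f
  proof -
    obtain a b where f: "f = (a, b)" by (cases f)
    then have V: "a \<in> verts B" "b \<in> verts B" using arcs_parts parts that by blast+
    show ?thesis
      using block_arcs[OF unlabel[OF t V(1)] unlabel[OF t V(2)]] label_unlabel[OF t] V that f by simp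
  qed
  have "(label t p, label t q) \<in> arcs B" "(label t x, label t y) \<in> arcs B"
    using block_arcs pq xy by blast+
  then have "((label t p, label t q), (label t x, label t y)) \<in> (share_end B)\<^sup>*"
    by (rule share_end_universal)
  then have "(?u (label t p, label t q), ?u (label t x, label t y)) \<in> (share_end D)\<^sup>*"
  proof (rule rtrancl_map)
    fix f f' assume "(f, f') \<in> share_end B"
    then show "(?u f, ?u f') \<in> share_end D" using lift[of f] lift[of f'] by (auto simp: share_end_def)
  qed
  then show ?thesis using unlabel_label[OF t] pq xy by simp
qed

lemma A_class_D:
  assumes "(p, q) \<in> arcs D"
  shows "(x, y) \<in> A_class D (p, q) \<longleftrightarrow> (x, y) \<in> arcs D \<and> x \<in> block (snd p) \<and> y \<in> block (snd p)"
proof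
  assume "(x, y) \<in> A_class D (p, q)"
  then have "((p, q), (x, y)) \<in> (share_end D)\<^sup>*" using A_class_iff[OF wf_D assms] by blast
  then have "(x, y) \<in> arcs D" "snd x = snd p" using share_end_same_block[OF _ assms] by fastforce+
  then show "(x, y) \<in> arcs D \<and> x \<in> block (snd p) \<and> y \<in> block (snd p)" using arc_block by metis
next
  assume "(x, y) \<in> arcs D \<and> x \<in> block (snd p) \<and> y \<in> block (snd p)"
  then show "(x, y) \<in> A_class D (p, q)"
    using block_arcs_related[OF assms] arc_block[OF assms] A_class_iff[OF wf_D assms] by blast
qed

theorem class_isomorphic_B:
  assumes "f \<in> arcs D" shows "u_isomorphic (Delta_of (A_class D f)) B"
proof -
  obtain p q where f: "f = (p, q)" and pq: "(p, q) \<in> arcs D" using assms by (cases f) simp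
  let ?t = "snd p" and ?G = "Delta_of (A_class D f)"
  have t: "?t \<in> verts T" using pq arcs_D T_verts by blast
  note f_class = A_class_D[OF pq, folded f]
  have adj: "uadj ?G x y \<longleftrightarrow> uadj D x y" if "x \<in> block ?t" "y \<in> block ?t" for x y
    using f_class that by (auto simp: uadj_def Delta_of_def)
  have verts: "verts ?G = block ?t"
  proof (intro set_eqI iffI)
    fix v assume "v \<in> verts ?G"
    then show "v \<in> block ?t" using f_class by (auto simp: Delta_of_def)
  next
    fix v assume v: "v \<in> block ?t"
    obtain w where w: "uadj B (label ?t v) w" by (rule has_nbr[OF arcs_nonempty label_verts[OF t v]])
    then have wV: "w \<in> verts B" using uadj_verts by blast
    have "uadj D v (unlabel ?t w)" using block_uadj[OF v unlabel[OF t wV]] label_unlabel[OF t wV] w by simp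
    then have "uadj ?G v (unlabel ?t w)" using adj v unlabel[OF t wV] by blast
    then show "v \<in> verts ?G" by (force simp: uadj_def Delta_of_def)
  qed
  have "bij_betw (label ?t) (verts ?G) (verts B)" using label_bij[OF t] verts by simp
  moreover have "\<forall>x\<in>verts ?G. \<forall>y\<in>verts ?G. uadj ?G x y \<longleftrightarrow> uadj B (label ?t x) (label ?t y)"
    using adj block_uadj verts by blast
  ultimately show ?thesis unfolding u_isomorphic_def by blast
qed

end

lemma u_isomorphic_two_vertices:
  assumes "u_isomorphic B H" "p \<in> verts H" "q \<in> verts H" "p \<noteq> q"
  obtains x y where "x \<in> verts B" "y \<in> verts B" "x \<noteq> y"
proof -
  obtain h where "bij_betw h (verts B) (verts H)" using assms(1) unfolding u_isomorphic_def by blast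
  then have "p \<in> h ` verts B" "q \<in> h ` verts B" using assms(2,3) by (simp_all add: bij_betw_def)
  then show ?thesis using that assms(4) by blast
qed

lemma listed_two_vertices:
  assumes "listed_graph B" obtains x y where "x \<in> verts B" "y \<in> verts B" "x \<noteq> y"
  using assms unfolding listed_graph_def
proof (elim disjE exE conjE)
  fix m :: nat assume m: "m \<ge> 4" and iso: "u_isomorphic B (cycle_graph m)"
  show ?thesis
    by (rule u_isomorphic_two_vertices[OF iso, of 0 1, OF _ _ _ that]) (use m in \<open>simp_all add: cycle_graph_def\<close>)
next
  fix m n :: nat assume mn: "m \<ge> 1" "n \<ge> 1" and iso: "u_isomorphic B (K_bip m n)"
  show ?thesis
    by (rule u_isomorphic_two_vertices[OF iso, of "(False, 0)" "(True, 0)", OF _ _ _ that])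
      (use mn in \<open>simp_all add: K_bip_def\<close>)
next
  fix n :: nat assume n: "n \<ge> 1" and iso: "u_isomorphic B (CP_graph n)"
  show ?thesis
    by (rule u_isomorphic_two_vertices[OF iso, of "(False, 0)" "(True, 0)", OF _ _ _ that])
      (use n in \<open>simp_all add: CP_graph_def\<close>)
next
  fix a b assume "is_T_ab B a b"
  then have inf: "infinite (verts B)" by (simp add: is_T_ab_def)
  then obtain x where x: "x \<in> verts B" by (metis ex_in_conv finite.emptyI)
  have "verts B - {x} \<noteq> {}" using infinite_imp_nonempty[of "verts B - {x}"] inf by simp
  then show ?thesis using that x by blast
qed

lemma listed_diestel_leader:
  assumes B: "bipartite_parts B X Y" "uconnected B" "listed_graph B" and data: "DL_data X Y T \<phi> \<psi>"
  shows "diestel_leader B X Y T \<phi> \<psi>"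
proof -
  interpret connected_bipartite B X Y by unfold_locales (rule B)+
  obtain x y where xy: "x \<in> verts B" "y \<in> verts B" "x \<noteq> y" by (rule listed_two_vertices[OF B(3)])
  have "arcs B \<noteq> {}"
  proof
    assume "arcs B = {}"
    then have "ugraph B = {}" by (simp add: ugraph_def uadj_def)
    then show False using joined[OF xy(1,2)] xy(3) by simp
  qed
  then show ?thesis
    by unfold_locales (rule data, assumption, rule listed_extendable[OF B(3)], rule listed_extendable[OF B(3)])
qed

theorem DL_connected_homogeneous:
  assumes "bipartite_parts B X Y" "uconnected B" "listed_graph B" "DL_data X Y T \<phi> \<psi>"
  shows "wf_digraph (DL B T \<phi> \<psi>)" "uconnected (DL B T \<phi> \<psi>)" "triangle_free (DL B T \<phi> \<psi>)"
    "locally_finite (DL B T \<phi> \<psi>)" "connected_homogeneous (DL B T \<phi> \<psi>)"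
    "e \<in> arcs (DL B T \<phi> \<psi>) \<Longrightarrow> u_isomorphic (Delta_of (A_class (DL B T \<phi> \<psi>) e)) B"
proof -
  interpret diestel_leader B X Y T \<phi> \<psi> by (rule listed_diestel_leader[OF assms])
  show "wf_digraph D" "uconnected D" "triangle_free D" "locally_finite D" "connected_homogeneous D"
    by (rule wf_D uconnected_D triangle_free_D locally_finite_D connected_homogeneous_D)+
  show "e \<in> arcs D \<Longrightarrow> u_isomorphic (Delta_of (A_class D e)) B" by (rule class_isomorphic_B)
qed

theorem theorem4p1:
  shows "(\<forall>D :: 'a dg.
            wf_digraph D \<and> uconnected D \<and> locally_finite D \<and> triangle_free D
            \<and> more_than_one_end D \<and> connected_homogeneous D
          \<longrightarrow>
            highly_arc_transitive D
          \<and> (\<exists>e\<in>arcs D. \<exists>e'\<in>arcs D. \<not> rel_A D e e')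
          \<and> (\<forall>e\<in>arcs D. bipartite_dg (Delta_of (A_class D e)))
          \<and> (\<forall>e\<in>arcs D. listed_graph (Delta_of (A_class D e)))
          \<and> (more_than_two_ends D \<longrightarrow>
               (\<forall>u\<in>verts D. is_tree (induced D (desc D u)) \<and> is_tree (induced D (anc D u)))))
       \<and> (\<forall>(B :: 'b dg) X Y (T :: 't dg) \<phi> \<psi>.
            wf_digraph B \<and> bipartite_parts B X Y \<and> uconnected B \<and> listed_graph B
            \<and> DL_data X Y T \<phi> \<psi>
          \<longrightarrow>
            (let D' = DL B T \<phi> \<psi> in
               wf_digraph D' \<and> uconnected D' \<and> triangle_free D' \<and> locally_finite D'
             \<and> connected_homogeneous D'
             \<and> (\<forall>e\<in>arcs D'. u_isomorphic (Delta_of (A_class D' e)) B)))"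
proof (rule conjI; intro allI impI; elim conjE)
  fix D :: "'a dg"
  assume "wf_digraph D" "uconnected D" "locally_finite D" "triangle_free D"
    "more_than_one_end D" "connected_homogeneous D"
  from connected_homogeneous_many_ends[OF this]
  show "highly_arc_transitive D
      \<and> (\<exists>e\<in>arcs D. \<exists>e'\<in>arcs D. \<not> rel_A D e e')
      \<and> (\<forall>e\<in>arcs D. bipartite_dg (Delta_of (A_class D e)))
      \<and> (\<forall>e\<in>arcs D. listed_graph (Delta_of (A_class D e)))
      \<and> (more_than_two_ends D \<longrightarrow>
           (\<forall>u\<in>verts D. is_tree (induced D (desc D u)) \<and> is_tree (induced D (anc D u))))"
    by blast
next
  fix B :: "'b dg" and X Y and T :: "'t dg" and \<phi> \<psi>
  assume "bipartite_parts B X Y" "uconnected B" "listed_graph B" "DL_data X Y T \<phi> \<psi>"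
  from DL_connected_homogeneous[OF this]
  show "let D' = DL B T \<phi> \<psi> in
      wf_digraph D' \<and> uconnected D' \<and> triangle_free D' \<and> locally_finite D'
      \<and> connected_homogeneous D' \<and> (\<forall>e\<in>arcs D'. u_isomorphic (Delta_of (A_class D' e)) B)"
    unfolding Let_def by blast
qed

end
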